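(* For any $\mu\in(0,1)$ and integer $r\geq 2$ there is a randomized algorithm which, given an $r$-uniform hypergraph $H=(V,E)$ with $n=|V|$, runs in time $|V|^{{\rm poly}(1/\mu)}$ and returns a set $S\subseteq V$ with $|S|=\mu n$ and $|E_H[S]|\geq C\mu^{r-1}\log(1/\mu)\cdot\delta^{(r)}_{\mu|V|}(H)$, where $C>0$ is a constant.
   Context: $E_H[S]$ denotes the set of hyperedges of $H$ contained in $S$ (its size measured in the same normalization as $\delta$, i.e. as the fraction/weight of hyperedges). $\delta^{(r)}_{\mu|V|}(H)$ is the maximum, over $S'\subseteq V$ with $|S'|=\mu|V|$, of the fraction of hyperedges of $H$ contained in $S'$. *)

theory Defs
  imports "HOL-Probability.Probability" "HOL-Computational_Algebra.Polynomial"
begin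

text \<open>
  Model of computation: randomized while-programs on a random access machine.  The memory
  consists of arrays, named by numbers, of unbounded natural numbers.  The only arithmetic is
  addition and truncated subtraction, so unit-cost time is polynomially related to Turing
  machine time (with unit-cost multiplication it would not be).  A program is a finite object
  containing finitely many expressions, so evaluating an expression or a test is one step.
\<close>

type_synonym mem = "nat \<Rightarrow> nat \<Rightarrow> nat"

datatype expr =
    Lit nat
  | Arr nat expr
  | Add expr expr
  | Sub expr expr

fun eval_expr :: "expr \<Rightarrow> mem \<Rightarrow> nat" where
  "eval_expr (Lit k) s = k"
| "eval_expr (Arr a e) s = s a (eval_expr e s)"
| "eval_expr (Add e f) s = eval_expr e s + eval_expr f s"
| "eval_expr (Sub e f) s = eval_expr e s - eval_expr f s"

datatype prog =
    Skip
  | Store nat expr expr   \<comment> \<open>\<open>Store a i e\<close> writes \<open>e\<close> to cell \<open>i\<close> of array \<open>a\<close>\<close>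
  | Flip nat expr         \<comment> \<open>\<open>Flip a i\<close> writes a fair random bit to cell \<open>i\<close> of array \<open>a\<close>\<close>
  | Seq prog prog
  | Cond expr prog prog   \<comment> \<open>a nonzero value counts as true\<close>
  | While expr prog

definition write_cell :: "mem \<Rightarrow> nat \<Rightarrow> nat \<Rightarrow> nat \<Rightarrow> mem" where
  "write_cell s a i v = s(a := (s a)(i := v))"

text \<open>One step of computation.  Configurations with program \<open>Skip\<close> have halted.\<close>

fun step :: "prog \<Rightarrow> mem \<Rightarrow> (prog \<times> mem) pmf" where
  "step Skip s = return_pmf (Skip, s)"
| "step (Store a i e) s = return_pmf (Skip, write_cell s a (eval_expr i s) (eval_expr e s))"
| "step (Flip a i) s =
     map_pmf (\<lambda>b. (Skip, write_cell s a (eval_expr i s) (of_bool b))) (bernoulli_pmf (1/2))"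
| "step (Seq c d) s =
     (if c = Skip then return_pmf (d, s)
      else map_pmf (\<lambda>(c', s'). (Seq c' d, s')) (step c s))"
| "step (Cond e c d) s = return_pmf (if eval_expr e s \<noteq> 0 then c else d, s)"
| "step (While e c) s =
     return_pmf (if eval_expr e s \<noteq> 0 then Seq c (While e c) else Skip, s)"

fun run :: "nat \<Rightarrow> prog \<Rightarrow> mem \<Rightarrow> (prog \<times> mem) pmf" where
  "run 0 P s = return_pmf (P, s)"
| "run (Suc t) P s = bind_pmf (step P s) (\<lambda>(P', s'). run t P' s')"

definition halts_within :: "nat \<Rightarrow> prog \<Rightarrow> mem \<Rightarrow> bool" where
  "halts_within t P s \<longleftrightarrow> (\<forall>(P', s') \<in> set_pmf (run t P s). P' = Skip)"


definition uniform_hypergraph :: "nat \<Rightarrow> 'a set \<Rightarrow> 'a set set \<Rightarrow> bool" where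
  "uniform_hypergraph r V E \<longleftrightarrow> finite V \<and> (\<forall>e\<in>E. e \<subseteq> V \<and> card e = r)"

definition induced_edges :: "'a set set \<Rightarrow> 'a set \<Rightarrow> 'a set set" where
  "induced_edges E S = {e \<in> E. e \<subseteq> S}"

text \<open>If there are no hyperedges at all, the fraction is \<open>0 / 0 = 0\<close>.\<close>

definition edge_fraction :: "'a set set \<Rightarrow> 'a set \<Rightarrow> real" where
  "edge_fraction E S = real (card (induced_edges E S)) / real (card E)"

definition max_edge_fraction :: "real \<Rightarrow> 'a set \<Rightarrow> 'a set set \<Rightarrow> real" where
  "max_edge_fraction k V E = Max (edge_fraction E ` {S. S \<subseteq> V \<and> real (card S) = k})"

text \<open>
  A hypergraph is presented to a program by an enumeration \<open>vs\<close> of its vertices and an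
  enumeration \<open>es\<close> without repetition of its hyperedges, each one given as a list of vertex
  indices.
\<close>

definition presents :: "'a list \<Rightarrow> nat list list \<Rightarrow> 'a set \<Rightarrow> 'a set set \<Rightarrow> bool" where
  "presents vs es V E \<longleftrightarrow>
     distinct vs \<and> set vs = V \<and>
     (\<forall>e\<in>set es. distinct e \<and> set e \<subseteq> {..<length vs}) \<and>
     distinct (map set es) \<and> E = (\<lambda>e. (!) vs ` set e) ` set es"

text \<open>
  Cell 0 of array 0 holds the number of vertices, cell 0 of array 1 the number of hyperedges,
  array 2 the concatenation of all hyperedges; everything else is 0.
\<close>

definition input_mem :: "nat \<Rightarrow> nat list list \<Rightarrow> mem" where
  "input_mem n es = (\<lambda>a i.
     if a = 0 \<and> i = 0 then n
     else if a = 1 \<and> i = 0 then length es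
     else if a = 2 \<and> i < length (concat es) then concat es ! i
     else 0)"

text \<open>The returned vertex set is read off from array 3, viewed as an indicator vector.\<close>

definition output_set :: "'a list \<Rightarrow> mem \<Rightarrow> 'a set" where
  "output_set vs s = {vs ! i | i. i < length vs \<and> s 3 i \<noteq> 0}"

end

theory Submission
 imports Defs "HOL-Real_Asymp.Real_Asymp"
begin

text \<open>
 The algorithm is deterministic. Let \<open>W\<close> count, for each pair of vertices, the hyperedges containing
 it, let \<open>M = \<mu> n\<close> and \<open>L = ln (1 / \<mu>)\<close>, and let \<open>\<kappa>\<close> be the average \<open>W\<close>-degree inside an optimal set
 \<open>S\<close>. It suffices to find a set \<open>T\<close> of about \<open>M\<close> vertices whose \<open>W\<close>-density is of order \<open>L \<kappa> / n\<close>: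
 removing vertices of small degree from the whole vertex set, while keeping \<open>T\<close> and counting only the
 hyperedges that meet \<open>T\<close> in a fixed number of vertices, then yields the required set. The simple
 cases are those where many vertices have degree above \<open>L \<kappa>\<close>, or where \<open>S\<close> is concentrated on a set
 \<open>R\<close> that is already dense or of large degree.

 Otherwise \<open>A = W / d\<close> with \<open>d \<approx> L \<kappa>\<close> is substochastic outside \<open>R\<close>, and \<open>S\<close> has Rayleigh quotient at
 least \<open>\<rho> = 1 / (4 L)\<close>. Apply Gram--Schmidt to the columns of \<open>(I + A)\<^sup>k\<close>, always choosing the longest
 residual. Either few columns capture \<open>S\<close>, and level sets of the projection of \<open>S\<close> and of its image
 are dense, or there are \<open>D \<approx> 1 / \<mu>\<close> orthonormal vectors with Rayleigh quotient at least \<open>\<rho> / 4\<close>. In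
 the second case every vertex gets a vector of \<open>D\<close> coordinates, and including it with probability
 proportional to an exponential of a random sign combination of these coordinates gains the
 factor \<open>L\<close>. In both cases the probabilities depend only on boundedly many threshold sets of vectors
 generated by \<open>D\<close> seed vertices, so that polynomially many candidates suffice, and the method of
 conditional expectations rounds a candidate to a set.
\<close>

section \<open>Deterministic programs and their running time\<close>

text \<open>The gain of \<open>L\<close> is sought in the pair weights alone, so hyperedges never
  enter the linear algebra. All that \<open>S\<close> guarantees there is a vector of small support
  with a large quadratic form. The shift to \<open>I + A\<close> makes the form positive
  semidefinite, so powers of order \<open>ln n / \<rho>\<close> separate Rayleigh quotients that
  differ by a multiple of \<open>\<rho>\<close> by more than a factor \<open>n\<close>, and
  log-convexity of moments replaces the spectral theorem. Pivoting keeps preimages short, hence they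
  can be enumerated by base \<open>n + m\<close> digits; the number of digits, bounded in terms of
  \<open>1 / \<mu>\<close>, dominates the exponent of the running time. Since
  \<open>\<kappa>\<close> is unknown, every integer \<open>d\<close> is tried. Small dense sets are
  absorbed into \<open>R\<close>, which changes the matrix, so the search is repeated until a whole
  pass finds nothing; from the failure of such a pass the analysis derives a contradiction. The
  estimates hold for large \<open>n\<close> only: the finitely many smaller inputs are answered from
  a table built into the program. If \<open>\<mu>\<close> is bounded away from 0, then
  \<open>L\<close> is bounded and averaging alone suffices.\<close>

inductive exec :: "prog => mem => nat => mem => bool" where
 exec_Skip: "exec Skip s 0 s"
| exec_Store: "exec (Store a i e) s 1 (write_cell s a (eval_expr i s) (eval_expr e s))"
| exec_Seq: "exec c s t s' ==> exec d s' u s'' ==> exec (Seq c d) s (t + 1 + u) s''"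
| exec_CondT: "eval_expr e s ~= 0 ==> exec c s t s' ==> exec (Cond e c d) s (1 + t) s'"
| exec_CondF: "eval_expr e s = 0 ==> exec d s t s' ==> exec (Cond e c d) s (1 + t) s'"
| exec_WhileF: "eval_expr e s = 0 ==> exec (While e c) s 1 s"
| exec_WhileT: "eval_expr e s ~= 0 ==> exec c s t s' ==> exec (While e c) s' u s'' ==>
  exec (While e c) s (1 + t + 1 + u) s''"

text \<open>A stack of pending continuations. A step of \<open>Seq\<close> descends into its left
  component, so a program in the middle of a run is a left-nested chain of \<open>Seq\<close>;
  \<open>plug\<close> names that chain.\<close>

fun plug :: "prog => prog list => prog" where
 "plug c [] = c"
| "plug c (d # ds) = plug (Seq c d) ds"

lemma step_plug:
 "c ~= Skip ==> step (plug c ds) s = map_pmf (%(c', s'). (plug c' ds, s')) (step c s)"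
proof (induction c ds rule: plug.induct)
 case (1 c)
 have "(%(c'::prog, s'::mem). (c', s')) = id" by auto
 then show ?case by (simp add: pmf.map_id)
next
 case (2 c d ds)
 then have "step (plug c (d # ds)) s =
   map_pmf (%(c', s'). (plug c' ds, s')) (map_pmf (%(c', s'). (Seq c' d, s')) (step c s))"
  by simp
 then show ?case by (simp add: pmf.map_comp o_def case_prod_beta)
qed

lemma run_plug_step:
 assumes "c ~= Skip" "step c s = return_pmf (c', s')"
 shows "run (Suc u) (plug c ds) s = run u (plug c' ds) s'"
 using assms by (simp add: step_plug bind_return_pmf)

lemma run_plug_Seq: "run (Suc u) (plug Skip (d # ds)) s = run u (plug d ds) s"
 using run_plug_step[of "Seq Skip d" s d s u ds] by simp

text \<open>The induction needs the arbitrary stack \<open>ds\<close> and the surplus time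
  \<open>u\<close>: the premises for \<open>Seq\<close> and \<open>While\<close> are used with a
  longer stack. The times in \<open>exec\<close> are exact; the 1 between the two parts of a
  \<open>Seq\<close> is the step that drops the finished \<open>Skip\<close>.\<close>

lemma exec_run_plug:
 "exec c s t s' ==> run (t + u) (plug c ds) s = run u (plug Skip ds) s'"
proof (induction arbitrary: u ds rule: exec.induct)
 case (exec_Seq c s t s' d v s'')
 have "run (t + 1 + v + u) (plug (Seq c d) ds) s = run (t + Suc (v + u)) (plug c (d # ds)) s"
  by (simp add: algebra_simps)
 also have "... = run (Suc (v + u)) (plug Skip (d # ds)) s'"
  by (rule exec_Seq.IH(1))
 also have "... = run (v + u) (plug d ds) s'"
  by (rule run_plug_Seq)
 finally show ?case by (simp only: exec_Seq.IH(2))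
next
 case (exec_WhileT e s c t s' v s'')
 have "run (1 + t + 1 + v + u) (plug (While e c) ds) s
   = run (Suc (t + Suc (v + u))) (plug (While e c) ds) s"
  by (simp add: algebra_simps)
 also have "... = run (t + Suc (v + u)) (plug (Seq c (While e c)) ds) s"
  using exec_WhileT by (intro run_plug_step) auto
 also have "... = run (t + Suc (v + u)) (plug c (While e c # ds)) s"
  by simp
 also have "... = run (Suc (v + u)) (plug Skip (While e c # ds)) s'"
  by (rule exec_WhileT.IH(1))
 also have "... = run (v + u) (plug (While e c) ds) s'"
  by (rule run_plug_Seq)
 finally show ?case by (simp only: exec_WhileT.IH(2))
next
 case (exec_Store a i e s)
 show ?case using run_plug_step[of "Store a i e" s] by simp
next
 case (exec_CondT e s c t s' d)
 then show ?case using run_plug_step[of "Cond e c d" s c s "t + u" ds] by simp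
next
 case (exec_CondF e s d t s' c)
 then show ?case using run_plug_step[of "Cond e c d" s d s "t + u" ds] by simp
next
 case (exec_WhileF e s c)
 then show ?case using run_plug_step[of "While e c" s Skip s u ds] by simp
qed simp

lemma exec_run: "exec c s t s' ==> run t c s = return_pmf (Skip, s')"
 using exec_run_plug[of c s t s' 0 "[]"] by simp


section \<open>Loop programs\<close>

text \<open>
 The number of iterations of a loop is capped by cell 0 of array 5, which makes the running
 time bound a matter of syntax. A loop keeps its counter and its bound in cells 0 and 1 of an
 array of its own.
\<close>

datatype cmd =
  St nat expr expr
 | Sq cmd cmd
 | If expr cmd cmd
 | For nat expr cmd
 | Nop

abbreviation upd :: "mem => nat => nat => nat => mem" where
 "upd \<equiv> write_cell"

lemma write_cell_apply [simp]:
 "write_cell s a i v b = (if b = a then (s a)(i := v) else s b)"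
 by (simp add: write_cell_def)

abbreviation cell :: "nat => expr" where
 "cell a \<equiv> Arr a (Lit 0)"

fun den :: "cmd => mem => mem" where
 "den (St a i e) s = upd s a (eval_expr i s) (eval_expr e s)"
| "den (Sq c d) s = den d (den c s)"
| "den (If e c d) s = (if eval_expr e s ~= 0 then den c s else den d s)"
| "den (For a e c) s =
   (let N = min (eval_expr e s) (s 5 0)
   in upd (fold (%j s. den c (upd s a 0 j)) [0..<N] (upd s a 1 N)) a 0 N)"
| "den Nop s = s"

fun writes :: "cmd => nat set" where
 "writes (St a i e) = {a}"
| "writes (Sq c d) = writes c \<union> writes d"
| "writes (If e c d) = writes c \<union> writes d"
| "writes (For a e c) = insert a (writes c)"
| "writes Nop = {}"

fun wf_cmd :: "cmd => bool" where
 "wf_cmd (St a i e) = (a ~= 5)"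
| "wf_cmd (Sq c d) = (wf_cmd c & wf_cmd d)"
| "wf_cmd (If e c d) = (wf_cmd c & wf_cmd d)"
| "wf_cmd (For a e c) = (wf_cmd c & a ~= 5 & a ~: writes c)"
| "wf_cmd Nop = True"

text \<open>\<open>Sub e (Sub e (cell 5))\<close> is the minimum of \<open>e\<close> and the cap, by
  truncated subtraction. It is stored before the loop starts, so the body may change the value of
  \<open>e\<close>.\<close>

fun compile :: "cmd => prog" where
 "compile (St a i e) = Store a i e"
| "compile (Sq c d) = Seq (compile c) (compile d)"
| "compile (If e c d) = Cond e (compile c) (compile d)"
| "compile (For a e c) =
   Seq (Store a (Lit 1) (Sub e (Sub e (cell 5))))
    (Seq (Store a (Lit 0) (Lit 0))
     (While (Sub (Arr a (Lit 1)) (cell a)) (Seq (compile c) (Store a (Lit 0) (Add (cell a) (Lit 1))))))"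
| "compile Nop = Skip"

fun weight :: "cmd => nat" where
 "weight (St a i e) = 1"
| "weight (Sq c d) = weight c + weight d + 1"
| "weight (If e c d) = weight c + weight d + 1"
| "weight (For a e c) = weight c + 9"
| "weight Nop = 1"

fun depth :: "cmd => nat" where
 "depth (St a i e) = 0"
| "depth (Sq c d) = max (depth c) (depth d)"
| "depth (If e c d) = max (depth c) (depth d)"
| "depth (For a e c) = Suc (depth c)"
| "depth Nop = 0"

lemma den_frame: "a ~: writes c ==> den c s a = s a"
proof (induction c arbitrary: s)
 case (For b e c)
 have "fold (%j s. den c (upd s b 0 j)) xs s' a = s' a" for xs s'
  using For by (induction xs arbitrary: s') auto
 then show ?case using For by (simp add: Let_def)
qed auto

lemma wf_writes_5: "wf_cmd c ==> 5 ~: writes c"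
 by (induction c) auto

text \<open>Every loop runs at most \<open>s 5 0\<close> times and no well-formed command writes
  array 5, so each nesting level costs one factor \<open>s 5 0 + 1\<close>. The 9 in
  \<open>weight\<close> pays for 4 extra steps per iteration and 5 steps outside the
  iterations.\<close>

lemma exec_compile:
 "wf_cmd c ==> \<exists>t \<le> weight c * (s 5 0 + 1) ^ depth c. exec (compile c) s t (den c s)"
proof (induction c arbitrary: s)
 case (St a i e)
 have "exec (compile (St a i e)) s 1 (den (St a i e) s)"
  using exec_Store[of a i e s] by (simp only: compile.simps den.simps)
 moreover have "1 <= weight (St a i e) * (s 5 0 + 1) ^ depth (St a i e)" by simp
 ultimately show ?case by blast
next
 case Nop
 show ?case by (auto intro: exI[of _ 0] exec_Skip)
next
 case (Sq c d)
 let ?B = "s 5 0 + 1"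
 obtain t where t: "t <= weight c * ?B ^ depth c" "exec (compile c) s t (den c s)"
  using Sq by auto
 have "den c s 5 = s 5" using Sq by (simp add: den_frame wf_writes_5)
 then obtain u where u: "u <= weight d * ?B ^ depth d" "exec (compile d) (den c s) u (den d (den c s))"
  using Sq.IH(2)[of "den c s"] Sq.prems by auto
 let ?m = "max (depth c) (depth d)"
 have "?B ^ depth c <= ?B ^ ?m" "?B ^ depth d <= ?B ^ ?m" "1 <= ?B ^ ?m"
  by (intro power_increasing; simp)+ simp
 then have "t + 1 + u <= weight c * ?B ^ ?m + ?B ^ ?m + weight d * ?B ^ ?m"
  using t(1) u(1) by (intro add_mono) (auto intro: order_trans mult_le_mono2)
 then show ?case using exec_Seq[OF t(2) u(2)] by (auto intro!: exI[of _ "t + 1 + u"] simp: algebra_simps)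
next
 case (If e c d)
 let ?B = "s 5 0 + 1"
 let ?m = "max (depth c) (depth d)"
 obtain t where t: "t <= weight c * ?B ^ depth c" "exec (compile c) s t (den c s)"
  using If by auto
 obtain u where u: "u <= weight d * ?B ^ depth d" "exec (compile d) s u (den d s)"
  using If by auto
 have "?B ^ depth c <= ?B ^ ?m" "?B ^ depth d <= ?B ^ ?m" "1 <= ?B ^ ?m"
  by (intro power_increasing; simp)+ simp
 then have *: "t + 1 <= weight c * ?B ^ ?m + ?B ^ ?m" "u + 1 <= weight d * ?B ^ ?m + ?B ^ ?m"
  using t(1) u(1) mult_le_mono2[of "?B ^ depth c" "?B ^ ?m" "weight c"]
   mult_le_mono2[of "?B ^ depth d" "?B ^ ?m" "weight d"] by linarith+
 show ?case
 proof (cases "eval_expr e s = 0")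
  case True
  then show ?thesis using exec_CondF[OF True u(2), of "compile c"] *
   by (auto intro!: exI[of _ "1 + u"] simp: algebra_simps intro: order_trans[OF *(2)])
 next
  case False
  then show ?thesis using exec_CondT[OF False t(2), of "compile d"] *
   by (auto intro!: exI[of _ "1 + t"] simp: algebra_simps intro: order_trans[OF *(1)])
 qed
next
 case (For a e c)
 let ?N = "min (eval_expr e s) (s 5 0)"
 let ?B = "s 5 0 + 1"
 let ?W = "While (Sub (Arr a (Lit 1)) (cell a)) (Seq (compile c) (Store a (Lit 0) (Add (cell a) (Lit 1))))"
 let ?f = "%j s. den c (upd s a 0 j)"
 let ?T = "weight c * ?B ^ depth c"
 have a: "a ~= 5" "a ~: writes c" "5 ~: writes c" "wf_cmd c"
  using For.prems wf_writes_5 by auto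
 have IH: "\<exists>t \<le> weight c * (s' 5 0 + 1) ^ depth c. exec (compile c) s' t (den c s')" for s'
  by (rule For.IH[OF a(4)])
 \<comment> \<open>The loop is entered at an arbitrary counter value \<open>j\<close>, so that the
   induction can run on the number of remaining iterations.\<close>
 have W: "\<exists>t \<le> (?N - j) * (?T + 4) + 1.
   exec ?W (upd s' a 0 j) t (upd (fold ?f [j..<?N] s') a 0 ?N)"
  if "j <= ?N" "s' a 1 = ?N" "s' 5 0 = s 5 0" for j s'
  using that
 proof (induction "?N - j" arbitrary: j s')
  case 0
  then have "j = ?N" by linarith
  then have "exec ?W (upd s' a 0 j) 1 (upd (fold ?f [j..<?N] s') a 0 ?N)"
   using 0 exec_WhileF[of "Sub (Arr a (Lit 1)) (cell a)" "upd s' a 0 j"] by simp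
  moreover have "1 <= (?N - j) * (?T + 4) + 1" by simp
  ultimately show ?case by blast
 next
  case (Suc x)
  then have j: "j < ?N" by linarith
  let ?s0 = "upd s' a 0 j"
  let ?s1 = "den c ?s0"
  obtain t where t: "t <= ?T" "exec (compile c) ?s0 t ?s1"
   using IH[of ?s0] a(1) Suc.prems(3) by auto
  have s1: "?s1 a = ?s0 a" "?s1 5 = ?s0 5" by (rule den_frame[OF a(2)], rule den_frame[OF a(3)])
  have body: "exec (Seq (compile c) (Store a (Lit 0) (Add (cell a) (Lit 1)))) ?s0 (t + 1 + 1)
    (upd ?s1 a 0 (Suc j))"
   using exec_Seq[OF t(2) exec_Store[of a "Lit 0" "Add (cell a) (Lit 1)" ?s1]] s1
   by simp
  have "x = ?N - Suc j" using Suc.hyps(2) by linarith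
  moreover have "Suc j <= ?N" using j by simp
  moreover have "?s1 a 1 = ?N" "?s1 5 0 = s 5 0" using s1 Suc.prems a by simp_all
  ultimately obtain u where u: "u <= (?N - Suc j) * (?T + 4) + 1"
    "exec ?W (upd ?s1 a 0 (Suc j)) u (upd (fold ?f [Suc j..<?N] ?s1) a 0 ?N)"
   using Suc.hyps(1)[of "Suc j" ?s1] by blast
  have "exec ?W ?s0 (1 + (t + 1 + 1) + 1 + u) (upd (fold ?f [Suc j..<?N] ?s1) a 0 ?N)"
   using j Suc.prems by (intro exec_WhileT[OF _ body u(2)]) auto
  moreover have "fold ?f [j..<?N] s' = fold ?f [Suc j..<?N] ?s1"
   using j by (simp add: upt_conv_Cons)
  moreover have "1 + (t + 1 + 1) + 1 + u <= (?N - j) * (?T + 4) + 1"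
  proof -
   have "?N - j = Suc (?N - Suc j)" using j by linarith
   then have "(?N - j) * (?T + 4) = (?N - Suc j) * (?T + 4) + (?T + 4)"
    by (simp only: mult_Suc add.commute)
   then show ?thesis using t(1) u(1) by linarith
  qed
  ultimately have "exec ?W ?s0 (1 + (t + 1 + 1) + 1 + u) (upd (fold ?f [j..<?N] s') a 0 ?N)"
    "1 + (t + 1 + 1) + 1 + u <= (?N - j) * (?T + 4) + 1" by (simp_all only:)
  then show ?case by blast
 qed
 define s1 where "s1 = upd s a 1 ?N"
 have s1: "s1 a 1 = ?N" "s1 5 0 = s 5 0" using a by (auto simp: s1_def)
 obtain t where t: "t <= ?N * (?T + 4) + 1" "exec ?W (upd s1 a 0 0) t (upd (fold ?f [0..<?N] s1) a 0 ?N)"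
  using W[of 0 s1] s1 by auto
 have min_diff: "x - (x - y) = min x y" for x y :: nat by auto
 have e1: "exec (Store a (Lit 1) (Sub e (Sub e (cell 5)))) s 1 s1"
  using exec_Store[of a "Lit 1" "Sub e (Sub e (cell 5))" s]
  by (simp add: s1_def min_diff)
 have e2: "exec (Store a (Lit 0) (Lit 0)) s1 1 (upd s1 a 0 0)"
  using exec_Store[of a "Lit 0" "Lit 0" s1] by simp
 have "exec (compile (For a e c)) s (1 + 1 + (1 + 1 + t)) (den (For a e c) s)"
  using exec_Seq[OF e1 exec_Seq[OF e2 t(2)]] by (simp add: s1_def Let_def)
 moreover have "1 + 1 + (1 + 1 + t) <= weight (For a e c) * ?B ^ depth (For a e c)"
 proof -
  let ?q = "?B ^ depth c"
  have q: "1 <= ?q" by simp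
  have "?N * (?T + 4) <= s 5 0 * (?T + 4 * ?q)" using q
   by (intro mult_le_mono) auto
  moreover have "5 <= 5 * ?q + ?T" using q by linarith
  ultimately have "?N * (?T + 4) + 5 <= ?B * (?T + 4 * ?q) + 5 * ?q"
   by (simp add: algebra_simps)
  also have "... <= ?B * (?T + 4 * ?q) + ?B * (5 * ?q)" by simp
  also have "... = (weight c + 9) * (?B * ?q)" by (simp only: algebra_simps)
  finally show ?thesis using t(1) by simp
 qed
 ultimately show ?case by blast
qed

text \<open>The counter sits in an array of its own that the body cannot write. \<open>indep\<close>
  asks that the invariant ignore this array, and \<open>step\<close> may assume that everything
  outside \<open>insert a (writes c)\<close> still has its initial contents; so an invariant only
  has to speak of what the body changes.\<close>

lemma For_rule:
 assumes wf: "a ~: writes c" and N: "N = min (eval_expr e s) (s 5 0)"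
  and I0: "I 0 s"
  and step: "\<And>j s'. j < N ==> I j s' ==> s' a 0 = j ==>
   (\<And>b. b ~: insert a (writes c) ==> s' b = s b) ==> I (Suc j) (den c s')"
  and indep: "\<And>j s' x. I j s' ==> I j (s'(a := x))"
 shows "I N (den (For a e c) s)"
proof -
 define F where "F j = fold (%j s. den c (upd s a 0 j)) [0..<j] (upd s a 1 N)" for j
 have F0: "F 0 = upd s a 1 N" by (simp add: F_def)
 have FS: "F (Suc j) = den c (upd (F j) a 0 j)" for j by (simp add: F_def)
 have indep': "I j (upd s' a i v)" if "I j s'" for j s' i v
  unfolding write_cell_def by (rule indep[OF that])
 have "I j (F j) & (\<forall>b. b ~: insert a (writes c) --> F j b = s b)" if "j <= N" for j
  using that
 proof (induction j)
  case 0
  have "I 0 (F 0)" unfolding F0 by (rule indep'[OF I0])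
  moreover have "F 0 b = s b" if "b ~: insert a (writes c)" for b
   using that unfolding F0 by simp
  ultimately show ?case by blast
 next
  case (Suc j)
  then have IH: "I j (F j)" "\<And>b. b ~: insert a (writes c) ==> F j b = s b" "j < N"
   by auto
  have "I (Suc j) (F (Suc j))" unfolding FS
   using IH indep'[OF IH(1)] by (intro step) auto
  moreover have "F (Suc j) b = s b" if "b ~: insert a (writes c)" for b
   using that IH(2) unfolding FS by (simp add: den_frame)
  ultimately show ?case by blast
 qed
 then have "I N (F N)" by blast
 then have "I N (upd (F N) a 0 N)" by (rule indep')
 then show ?thesis using N by (simp add: Let_def F_def)
qed

section \<open>Symmetric substochastic matrices\<close>

locale substochastic =
 fixes U :: "nat set" and A :: "nat => nat => real"
 assumes finU: "finite U"
  and A_nonneg: "0 <= A i k"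
  and A_sym: "A i k = A k i"
  and A_row: "i \<in> U ==> (\<Sum>k\<in>U. A i k) <= 1"
begin

definition ip :: "(nat => real) => (nat => real) => real" where
 "ip x y = (\<Sum>i\<in>U. x i * y i)"

abbreviation nq :: "(nat => real) => real" where
 "nq x \<equiv> ip x x"

definition l1 :: "(nat => real) => real" where
 "l1 x = (\<Sum>i\<in>U. \<bar>x i\<bar>)"

definition ap :: "(nat => real) => nat => real" where
 "ap x i = (if i \<in> U then \<Sum>k\<in>U. A i k * x k else 0)"

definition B :: "(nat => real) => nat => real" where
 "B x = (%i. x i + ap x i)"

lemma ip_sym: "ip x y = ip y x"
 by (simp add: ip_def mult.commute)

lemma ip_add_right: "ip x (%i. y i + z i) = ip x y + ip x z"
 by (simp add: ip_def distrib_left sum.distrib)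

lemma ip_diff_right: "ip x (%i. y i - z i) = ip x y - ip x z"
 by (simp add: ip_def right_diff_distrib sum_subtractf)

lemma ip_scale_right: "ip x (%i. c * y i) = c * ip x y"
 by (simp add: ip_def sum_distrib_left mult_ac)

lemma ip_sum_right: "ip x (%i. \<Sum>s\<in>S. c s * y s i) = (\<Sum>s\<in>S. c s * ip x (y s))"
 unfolding ip_def sum_distrib_left
 by (subst sum.swap) (simp add: mult_ac)

lemma nq_nonneg: "0 <= nq x"
 by (simp add: ip_def sum_nonneg)

lemma ip_cs: "(ip x y)\<^sup>2 <= nq x * nq y"
 using Cauchy_Schwarz_ineq_sum[of x y U] by (simp add: ip_def power2_eq_square)

lemma ip_le_sqrt: "\<bar>ip x y\<bar> <= sqrt (nq x) * sqrt (nq y)"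
 using real_sqrt_le_mono[OF ip_cs[of x y]] by (simp add: real_sqrt_mult)

lemma abs_le_sqrt_nq: "i \<in> U ==> \<bar>x i\<bar> <= sqrt (nq x)"
proof -
 assume i: "i \<in> U"
 have "(x i)\<^sup>2 <= nq x"
  unfolding ip_def using i finU
  by (auto simp: power2_eq_square intro!: member_le_sum)
 from real_sqrt_le_mono[OF this] show ?thesis by simp
qed

lemma l1_nonneg: "0 <= l1 x"
 by (simp add: l1_def sum_nonneg)

lemma nq_le_l1: "nq x <= (l1 x)\<^sup>2"
proof -
 have "nq x <= (\<Sum>i\<in>U. \<bar>x i\<bar> * l1 x)"
  unfolding ip_def
 proof (rule sum_mono)
  fix i assume i: "i \<in> U"
  have "\<bar>x i\<bar> <= l1 x"
   unfolding l1_def using i finU by (intro member_le_sum) auto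
  then have "\<bar>x i\<bar> * \<bar>x i\<bar> <= \<bar>x i\<bar> * l1 x"
   by (intro mult_left_mono) auto
  then show "x i * x i <= \<bar>x i\<bar> * l1 x" by simp
 qed
 also have "... = (l1 x)\<^sup>2"
  by (simp add: l1_def sum_distrib_right power2_eq_square)
 finally show ?thesis .
qed

lemma l1_triangle: "l1 (%i. x i + c * y i) <= l1 x + \<bar>c\<bar> * l1 y"
 unfolding l1_def sum_distrib_left sum.distrib[symmetric]
 by (intro sum_mono) (metis abs_mult abs_triangle_ineq)

lemma l1_sum_le: "l1 (%i. \<Sum>s\<in>S. c s * y s i) <= (\<Sum>s\<in>S. \<bar>c s\<bar> * l1 (y s))"
proof -
 have "l1 (%i. \<Sum>s\<in>S. c s * y s i) <= (\<Sum>i\<in>U. \<Sum>s\<in>S. \<bar>c s\<bar> * \<bar>y s i\<bar>)"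
  unfolding l1_def by (intro sum_mono) (metis (no_types, lifting) abs_mult sum.cong sum_abs)
 also have "... = (\<Sum>s\<in>S. \<bar>c s\<bar> * l1 (y s))"
  by (subst sum.swap) (simp add: l1_def sum_distrib_left)
 finally show ?thesis .
qed

text \<open>Schur test: with \<open>A i k\<close> split into two square roots, Cauchy-Schwarz over
  pairs leaves the row sums on one side and, by symmetry, row sums again on the other; both are at
  most 1.\<close>

lemma form_abs_le:
 "(\<Sum>i\<in>U. \<Sum>k\<in>U. A i k * (\<bar>x i\<bar> * \<bar>y k\<bar>)) <= sqrt (nq x) * sqrt (nq y)"
proof -
 let ?a = "%(i, k). sqrt (A i k) * \<bar>x i\<bar>"
 let ?b = "%(i, k). sqrt (A i k) * \<bar>y k\<bar>"
 let ?S = "\<Sum>i\<in>U. \<Sum>k\<in>U. A i k * (\<bar>x i\<bar> * \<bar>y k\<bar>)"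
 have S: "?S = (\<Sum>p\<in>U \<times> U. ?a p * ?b p)"
  by (auto simp: sum.cartesian_product A_nonneg intro!: sum.cong)
 have a: "(\<Sum>p\<in>U \<times> U. (?a p)\<^sup>2) <= nq x"
 proof -
  have "(\<Sum>p\<in>U \<times> U. (?a p)\<^sup>2) = (\<Sum>i\<in>U. (x i)\<^sup>2 * (\<Sum>k\<in>U. A i k))"
   unfolding sum_distrib_left by (simp add: sum.cartesian_product' power_mult_distrib A_nonneg sum_distrib_left mult.commute[of "_ ^ 2"])
  also have "... <= (\<Sum>i\<in>U. (x i)\<^sup>2 * 1)"
   by (intro sum_mono mult_left_mono A_row) auto
  finally show ?thesis by (simp add: ip_def power2_eq_square)
 qed
 have b: "(\<Sum>p\<in>U \<times> U. (?b p)\<^sup>2) <= nq y"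
 proof -
  have "(\<Sum>p\<in>U \<times> U. (?b p)\<^sup>2) = (\<Sum>i\<in>U. \<Sum>k\<in>U. A i k * (y k)\<^sup>2)"
   by (simp add: sum.cartesian_product' power_mult_distrib A_nonneg)
  also have "... = (\<Sum>k\<in>U. (y k)\<^sup>2 * (\<Sum>i\<in>U. A k i))"
   unfolding sum_distrib_left by (subst sum.swap) (intro sum.cong refl, metis A_sym mult.commute)
  also have "... <= (\<Sum>k\<in>U. (y k)\<^sup>2 * 1)"
   by (intro sum_mono mult_left_mono A_row) auto
  finally show ?thesis by (simp add: ip_def power2_eq_square)
 qed
 have "?S\<^sup>2 <= (\<Sum>p\<in>U \<times> U. (?a p)\<^sup>2) * (\<Sum>p\<in>U \<times> U. (?b p)\<^sup>2)"
  unfolding S by (rule Cauchy_Schwarz_ineq_sum)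
 also have "... <= nq x * nq y"
  using a b by (intro mult_mono) (auto intro: sum_nonneg nq_nonneg)
 finally have "sqrt (?S\<^sup>2) <= sqrt (nq x * nq y)" by (rule real_sqrt_le_mono)
 then show ?thesis by (simp add: real_sqrt_mult)
qed

lemma ip_ap: "ip x (ap y) = (\<Sum>i\<in>U. \<Sum>k\<in>U. A i k * (x i * y k))"
 by (auto simp: ip_def ap_def sum_distrib_left mult_ac intro!: sum.cong)

lemma ip_ap_sym: "ip x (ap y) = ip (ap x) y"
proof -
 have "ip (ap x) y = ip y (ap x)" by (rule ip_sym)
 also have "... = (\<Sum>i\<in>U. \<Sum>k\<in>U. A i k * (y i * x k))" by (rule ip_ap)
 also have "... = (\<Sum>k\<in>U. \<Sum>i\<in>U. A i k * (y i * x k))" by (rule sum.swap)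
 also have "... = (\<Sum>i\<in>U. \<Sum>k\<in>U. A i k * (x i * y k))"
  by (auto simp: A_sym mult_ac intro!: sum.cong)
 finally show ?thesis by (simp add: ip_ap)
qed

lemma ip_ap_abs_le: "\<bar>ip x (ap y)\<bar> <= sqrt (nq x) * sqrt (nq y)"
proof -
 have "\<bar>ip x (ap y)\<bar> <= (\<Sum>i\<in>U. \<Sum>k\<in>U. \<bar>A i k * (x i * y k)\<bar>)"
  unfolding ip_ap by (rule order_trans[OF sum_abs]) (intro sum_mono sum_abs)
 also have "... = (\<Sum>i\<in>U. \<Sum>k\<in>U. A i k * (\<bar>x i\<bar> * \<bar>y k\<bar>))"
  by (simp add: abs_mult A_nonneg)
 finally show ?thesis using form_abs_le[of x y] by linarith
qed

lemma nq_ap_le: "nq (ap x) <= nq x"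
proof -
 have "nq (ap x) <= sqrt (nq (ap x)) * sqrt (nq x)"
  using ip_ap_abs_le[of "ap x" x] by simp
 then show ?thesis
  by (smt (verit) mult_le_cancel_left nq_nonneg real_sqrt_ge_zero real_sqrt_le_iff real_sqrt_mult_self)
qed

lemma ip_B: "ip x (B y) = ip x y + ip x (ap y)"
 by (simp add: B_def ip_add_right)

lemma ip_B_sym: "ip x (B y) = ip (B x) y"
proof -
 have "ip (B x) y = ip x y + ip (ap x) y"
  using ip_B[of y x] by (simp add: ip_sym)
 then show ?thesis by (simp add: ip_B ip_ap_sym)
qed

text \<open>This is the purpose of the shift by the identity: the form of \<open>A\<close> lies
  between -1 and 1 on unit vectors, so that of \<open>B\<close> is positive semidefinite and obeys
  its own Cauchy-Schwarz inequality.\<close>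

lemma ip_B_nonneg: "0 <= ip x (B x)"
 using ip_ap_abs_le[of x x] nq_nonneg[of x] by (simp add: ip_B)

text \<open>Discriminant of a quadratic polynomial in \<open>t\<close> that is nonnegative because
  it is the form of \<open>B\<close> at \<open>x\<close> minus \<open>t\<close> times
  \<open>y\<close>. If its leading coefficient vanishes, a suitable \<open>t\<close> would make it
  negative unless the linear coefficient vanishes too.\<close>

lemma ip_B_cs: "(ip x (B y))\<^sup>2 <= ip x (B x) * ip y (B y)"
proof -
 let ?a = "ip y (B y)" let ?b = "ip x (B y)" let ?c = "ip x (B x)"
 have quad: "0 <= ?c - 2 * t * ?b + t\<^sup>2 * ?a" for t
 proof -
  let ?z = "%i. x i - t * y i"
  have *: "ip ?z w = ip x w - t * ip y w" for w
   using ip_diff_right[of w x "%i. t * y i"] by (simp add: ip_sym[of _ w] ip_scale_right)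
  have **: "ip w (B ?z) = ip w (B x) - t * ip w (B y)" for w
   using *[of "B w"] by (simp add: ip_B_sym ip_sym[of "B w"])
  have "ip ?z (B ?z) = ?c - 2 * t * ?b + t\<^sup>2 * ?a"
   using ip_B_sym[of y x] ip_sym[of "B y" x] unfolding * ** by (simp add: algebra_simps power2_eq_square)
  then show ?thesis using ip_B_nonneg[of ?z] by simp
 qed
 show ?thesis
 proof (cases "?a = 0")
  case True
  have "?b = 0"
  proof (rule ccontr)
   assume b: "?b ~= 0"
   have "2 * ((?c + 1) / ?b) * ?b = 2 * (?c + 1)" using b by simp
   then show False using quad[of "(?c + 1) / ?b"] True ip_B_nonneg[of x] by (simp add: algebra_simps)
  qed
  then show ?thesis using True by simp
 next
  case False
  then have a: "?a > 0" using ip_B_nonneg[of y] by simp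
  have "0 <= (?c - 2 * (?b / ?a) * ?b + (?b / ?a)\<^sup>2 * ?a) * ?a"
   using quad[of "?b / ?a"] a by (intro mult_nonneg_nonneg) auto
  also have "... = ?c * ?a - ?b\<^sup>2"
   using a by (simp add: field_simps power2_eq_square)
  finally show ?thesis by simp
 qed
qed

subsection \<open>Moments\<close>

text \<open>The moments of the spectral measure of \<open>x\<close> with respect to
  \<open>B\<close>; working with them avoids diagonalising \<open>B\<close>.\<close>

definition mo :: "(nat => real) => nat => real" where
 "mo x j = ip x ((B ^^ j) x)"

lemma ip_B_pow: "ip ((B ^^ i) x) y = ip x ((B ^^ i) y)"
proof (induction i arbitrary: y)
 case (Suc i)
 have "ip ((B ^^ Suc i) x) y = ip ((B ^^ i) x) (B y)" by (simp add: ip_B_sym)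
 also have "... = ip x ((B ^^ Suc i) y)" by (simp only: Suc funpow.simps o_apply funpow_swap1)
 finally show ?case .
qed simp

lemma mo_even: "mo x (2 * i) = nq ((B ^^ i) x)"
 unfolding mo_def by (simp add: ip_B_pow mult_2 funpow_add)

lemma mo_odd: "mo x (2 * i + 1) = ip ((B ^^ i) x) (B ((B ^^ i) x))"
proof -
 have "(B ^^ (2 * i + 1)) x = (B ^^ i) (B ((B ^^ i) x))"
  by (simp add: mult_2 funpow_add funpow_swap1)
 then show ?thesis unfolding mo_def by (simp add: ip_B_pow)
qed

lemma mo_nonneg: "0 <= mo x j"
proof (cases "even j")
 case True
 then show ?thesis using mo_even[of x "j div 2"] nq_nonneg by (simp)
next
 case False
 then obtain i where "j = 2 * i + 1" by (auto elim: oddE)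
 then show ?thesis using mo_odd[of x i] ip_B_nonneg by simp
qed

text \<open>Even \<open>j\<close> is Cauchy-Schwarz for \<open>ip\<close>, odd \<open>j\<close> is
  Cauchy-Schwarz for the form of \<open>B\<close>, each applied to a vector
  \<open>(B ^^ i) x\<close> and its image under \<open>B\<close>.\<close>

lemma mo_log_convex: "(mo x (j + 1))\<^sup>2 <= mo x j * mo x (j + 2)"
proof (cases "even j")
 case True
 then obtain i where i: "j = 2 * i" by (auto elim: evenE)
 have "mo x (j + 2) = nq ((B ^^ Suc i) x)"
  using mo_even[of x "Suc i"] i by simp
 then show ?thesis
  using mo_odd[of x i] mo_even[of x i] ip_cs[of "(B ^^ i) x" "B ((B ^^ i) x)"] i by simp
next
 case False
 then obtain i where i: "j = 2 * i + 1" by (auto elim: oddE)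
 let ?u = "(B ^^ i) x"
 have 1: "mo x (j + 1) = ip ?u (B (B ?u))"
  using mo_even[of x "Suc i"] i by (simp add: ip_B_sym)
 have 2: "mo x (j + 2) = ip (B ?u) (B (B ?u))"
  using mo_odd[of x "Suc i"] i by simp
 show ?thesis using ip_B_cs[of ?u "B ?u"] mo_odd[of x i] i unfolding 1 2 by simp
qed

text \<open>By log-convexity the ratios of consecutive moments never decrease. The form without
  division covers vanishing moments.\<close>

lemma mo_ratio_mono:
 assumes "mo x (Suc j) \<ge> t * mo x j" "0 <= t" "j <= l"
 shows "mo x (Suc l) \<ge> t * mo x l"
 using assms(3)
proof (induction l rule: dec_induct)
 case base
 show ?case by (rule assms(1))
next
 case (step l)
 have c: "(mo x (Suc l))\<^sup>2 <= mo x l * mo x (Suc (Suc l))"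
  using mo_log_convex[of x l] by simp
 show ?case
 proof (cases "mo x l = 0")
  case True
  then have "mo x (Suc l) = 0" using c by simp
  then show ?thesis using mo_nonneg by simp
 next
  case False
  then have p: "mo x l > 0" using mo_nonneg[of x l] by simp
  have "mo x l * (t * mo x (Suc l)) <= mo x (Suc l) * mo x (Suc l)"
   using mult_right_mono[OF step.IH mo_nonneg[of x "Suc l"]] by (simp add: mult_ac)
  also have "... <= mo x l * mo x (Suc (Suc l))"
   using c by (simp add: power2_eq_square)
  finally show ?thesis using p by simp
 qed
qed

lemma mo_power_ge:
 assumes "ip x (B x) \<ge> t * nq x" "0 <= t"
 shows "mo x j \<ge> t ^ j * nq x"
proof (induction j)
 case 0
 show ?case by (simp add: mo_def)
next
 case (Suc j)
 have "mo x (Suc j) \<ge> t * mo x j"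
  using assms by (intro mo_ratio_mono[of t x 0 j]) (auto simp: mo_def)
 moreover have "t * mo x j \<ge> t * (t ^ j * nq x)"
  using Suc assms(2) by (intro mult_left_mono)
 ultimately show ?case by (simp add: mult_ac)
qed

text \<open>The moment of order \<open>2 * k\<close> over that of order 0 is a product of
  \<open>2 * k\<close> consecutive ratios. If it is at least \<open>t ^ (2 * k)\<close>, one of
  these ratios is at least \<open>t\<close>, hence so is the later ratio of order
  \<open>2 * k\<close>, which is the Rayleigh quotient of \<open>(B ^^ k) x\<close>.\<close>

lemma power_rayleigh:
 assumes "nq ((B ^^ k) x) \<ge> t ^ (2 * k) * nq x" "0 < t" "1 <= k"
 shows "ip ((B ^^ k) x) (B ((B ^^ k) x)) \<ge> t * nq ((B ^^ k) x)"
proof (cases "\<exists>j \<le> 2 * k. mo x (Suc j) \<ge> t * mo x j")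
 case True
 then show ?thesis
  using mo_ratio_mono[of t x _ "2 * k"] assms(2) mo_odd[of x k] mo_even[of x k] by auto
next
 case False
 then have lt: "mo x (Suc j) < t * mo x j" if "j <= 2 * k" for j using that by auto
 have "mo x j <= t ^ j * nq x" if "j <= 2 * k" for j
  using that
 proof (induction j)
  case (Suc j)
  have "mo x (Suc j) <= t * mo x j" using lt[of j] Suc by simp
  also have "... <= t * (t ^ j * nq x)" using Suc assms(2) by (intro mult_left_mono) auto
  finally show ?case by (simp add: mult_ac)
 qed (simp add: mo_def)
 moreover obtain l where l: "2 * k = Suc l" using assms(3) by (cases "2 * k") auto
 ultimately have "mo x l <= t ^ l * nq x" by simp
 then have "t * mo x l <= t ^ (2 * k) * nq x" using assms(2) l by (simp add: mult_ac)
 moreover have "mo x (2 * k) < t * mo x l" using lt[of l] l by simp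
 ultimately show ?thesis using assms(1) mo_even[of x k] by simp
qed

subsection \<open>Pivoted Gram--Schmidt\<close>

lemma ap_cong: "(\<And>i. i \<in> U ==> x i = y i) ==> ap x = ap y"
 by (auto simp: ap_def intro!: sum.cong)

lemma B_add: "B (%i. x i + c * y i) = (%i. B x i + c * B y i)"
 by (auto simp: B_def ap_def algebra_simps sum.distrib sum_distrib_left)

lemma B_pow_add: "(B ^^ k) (%i. x i + c * y i) = (%i. (B ^^ k) x i + c * (B ^^ k) y i)"
 by (induction k) (simp_all add: B_add)

lemma B_apply: "B x i = x i + ap x i"
 by (simp add: B_def)

lemma B_pow_Suc: "(B ^^ Suc k) x i = (B ^^ k) x i + ap ((B ^^ k) x) i"
 by (simp only: funpow.simps o_apply B_apply)

lemma B_zero: "B (%i. 0) = (%i. 0)"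
 by (auto simp: B_apply ap_def)

lemma B_pow_zero: "(B ^^ k) (%i. 0) = (%i. 0)"
 by (induction k) (simp_all add: B_zero)

lemma B_pow_scale: "(B ^^ k) (%i. c * y i) = (%i. c * (B ^^ k) y i)"
 using B_pow_add[of k "%_. 0" c y] by (simp add: B_pow_zero)

lemma B_pow_sum: "finite S ==>
 (B ^^ k) (%i. \<Sum>s\<in>S. c s * y s i) = (%i. \<Sum>s\<in>S. c s * (B ^^ k) (y s) i)"
proof (induction S rule: finite_induct)
 case empty
 show ?case by (simp add: B_pow_zero)
next
 case (insert a S)
 have "(B ^^ k) (%i. \<Sum>s\<in>insert a S. c s * y s i) = (B ^^ k) (%i. (\<Sum>s\<in>S. c s * y s i) + c a * y a i)"
  using insert by (simp add: add.commute)
 also have "... = (%i. \<Sum>s\<in>insert a S. c s * (B ^^ k) (y s) i)"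
  unfolding B_pow_add insert.IH using insert by (simp add: add.commute)
 finally show ?case .
qed

lemma B_pow_cong: "(\<And>i. i \<in> U ==> x i = y i) ==> i \<in> U ==> (B ^^ k) x i = (B ^^ k) y i"
proof (induction k arbitrary: i)
 case (Suc k)
 have "ap ((B ^^ k) x) = ap ((B ^^ k) y)" using Suc by (intro ap_cong) auto
 then show ?case using Suc unfolding B_pow_Suc by simp
qed simp

definition unit :: "nat => nat => real" where
 "unit v i = (if i = v then 1 else 0)"

lemma B_pow_expand: "i \<in> U ==> (B ^^ k) x i = (\<Sum>v\<in>U. x v * (B ^^ k) (unit v) i)"
proof -
 assume i: "i \<in> U"
 have "(B ^^ k) x i = (B ^^ k) (%i. \<Sum>v\<in>U. x v * unit v i) i"
  using finU by (intro B_pow_cong[OF _ i]) (simp add: unit_def if_distrib[of "%z. _ * z"] cong: if_cong)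
 then show ?thesis by (simp add: B_pow_sum finU)
qed

lemma B_sup_le: "(\<And>i. i \<in> U ==> \<bar>x i\<bar> <= c) ==> i \<in> U ==> \<bar>ap x i\<bar> <= c"
proof -
 assume x: "\<And>i. i \<in> U ==> \<bar>x i\<bar> <= c" and i: "i \<in> U"
 then have c: "0 <= c" by (meson abs_ge_zero order_trans)
 have "\<bar>ap x i\<bar> <= (\<Sum>k\<in>U. \<bar>A i k * x k\<bar>)" using i by (simp add: ap_def sum_abs)
 also have "... <= (\<Sum>k\<in>U. A i k * c)"
  using x by (intro sum_mono) (simp add: abs_mult A_nonneg mult_left_mono)
 also have "... <= 1 * c" unfolding sum_distrib_right[symmetric] using A_row[OF i] c by (rule mult_right_mono)
 finally show ?thesis by simp
qed

text \<open>Row sums at most 1 make \<open>ap\<close> a contraction in the supremum norm, so each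
  application of \<open>B\<close> at most doubles it. This controls how rounding a preimage affects
  the image.\<close>

lemma B_pow_sup_le:
 "(\<And>i. i \<in> U ==> \<bar>x i\<bar> <= c) ==> i \<in> U ==> \<bar>(B ^^ k) x i\<bar> <= 2 ^ k * c"
proof (induction k arbitrary: i)
 case (Suc k)
 have "\<bar>ap ((B ^^ k) x) i\<bar> <= 2 ^ k * c" using Suc by (intro B_sup_le) auto
 moreover have "\<bar>(B ^^ k) x i\<bar> <= 2 ^ k * c" using Suc by auto
 ultimately show ?case unfolding B_pow_Suc by simp
qed simp

definition ortho :: "nat => (nat => nat => real) => bool" where
 "ortho t w \<longleftrightarrow> (\<forall>s<t. \<forall>s'<t. ip (w s) (w s') = (if s = s' then 1 else 0))"

definition proj :: "nat => (nat => nat => real) => (nat => real) => nat => real" where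
 "proj t w x = (%i. \<Sum>s<t. ip x (w s) * w s i)"

definition res :: "nat => (nat => nat => real) => (nat => real) => nat => real" where
 "res t w x = (%i. x i - proj t w x i)"

lemma ip_proj: "ortho t w ==> s < t ==> ip (w s) (proj t w x) = ip x (w s)"
proof -
 assume o: "ortho t w" and s: "s < t"
 have "ip (w s) (proj t w x) = (\<Sum>s'<t. ip x (w s') * ip (w s) (w s'))"
  unfolding proj_def by (rule ip_sum_right)
 also have "... = (\<Sum>s'<t. if s' = s then ip x (w s) else 0)"
  using o s by (intro sum.cong) (auto simp: ortho_def)
 finally show ?thesis using s by simp
qed

lemma ip_res: "ortho t w ==> s < t ==> ip (w s) (res t w x) = 0"
 by (simp add: res_def ip_diff_right ip_proj ip_sym)

lemma ip_comb_res: "ortho t w ==> ip (res t w x) (%i. \<Sum>s<t. c s * w s i) = 0"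
 by (subst ip_sum_right) (auto simp: ip_res ip_sym[of "res t w x"] intro!: sum.neutral)

lemma nq_comb: "ortho t w ==> nq (%i. \<Sum>s<t. c s * w s i) = (\<Sum>s<t. (c s)\<^sup>2)"
proof -
 assume o: "ortho t w"
 have "ip (w s) (%i. \<Sum>s<t. c s * w s i) = c s" if "s < t" for s
 proof -
  have "ip (w s) (%i. \<Sum>s<t. c s * w s i) = (\<Sum>s'<t. c s' * ip (w s) (w s'))"
   by (rule ip_sum_right)
  also have "... = (\<Sum>s'<t. if s' = s then c s else 0)"
   using o that by (intro sum.cong) (auto simp: ortho_def)
  finally show ?thesis using that by simp
 qed
 then show ?thesis
  by (subst ip_sum_right) (auto simp: ip_sym power2_eq_square intro!: sum.cong)
qed

text \<open>\<open>T\<close> collects the pivots, \<open>xs s\<close> is a preimage under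
  \<open>B ^^ k\<close> of the orthonormal vector \<open>w s\<close>, and \<open>z v\<close> is a
  preimage of the residual of column \<open>v\<close>. The bounds on support and \<open>l1\<close>
  norm make the vectors describable by few digits, and they are what \<open>span_rayleigh\<close>
  exploits.\<close>

definition pivoted :: "nat => real => nat => (nat => nat => real) => (nat => nat => real) => nat set
  => (nat => nat => real) => bool" where
 "pivoted k \<eta> t w xs T z \<longleftrightarrow>
   T \<subseteq> U & card T <= t & ortho t w &
   (\<forall>s<t. w s = (B ^^ k) (xs s) & (\<forall>i. i ~: T --> xs s i = 0) & l1 (xs s) <= 2 ^ t / \<eta>) &
   (\<forall>v\<in>U. (B ^^ k) (z v) = res t w ((B ^^ k) (unit v)) &
    (\<forall>i. i ~: insert v T --> z v i = 0) & l1 (z v) <= 2 ^ t)"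

text \<open>
 Choosing the longest residual as the next pivot keeps the elimination coefficients below 1 in
 absolute value, so that the \<open>\<ell>\<^sub>1\<close> norms of the preimages at most double in every step.
\<close>

lemma pivoted_step:
 assumes p: "pivoted k \<eta> t w xs T z" and eta: "\<eta> > 0"
  and v0: "v0 \<in> U" "\<eta>\<^sup>2 <= nq (res t w ((B ^^ k) (unit v0)))"
 shows "\<exists>w xs T z. pivoted k \<eta> (Suc t) w xs T z"
proof -
 let ?u = "%v. (B ^^ k) (unit v)"
 let ?r = "%v. res t w (?u v)"
 have o: "ortho t w" and T: "T \<subseteq> U" "card T <= t" "finite T"
  using p finU by (auto simp: pivoted_def intro: finite_subset)
 have z: "(B ^^ k) (z v) = ?r v" "\<And>i. i ~: insert v T ==> z v i = 0" "l1 (z v) <= 2 ^ t"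
  if "v \<in> U" for v using p that by (auto simp: pivoted_def)
 obtain a where a: "a \<in> U" "\<And>v. v \<in> U ==> nq (?r v) <= nq (?r a)"
 proof -
  have "Max ((%v. nq (?r v)) ` U) \<in> (%v. nq (?r v)) ` U"
   using finU v0 by (intro Max_in) auto
  then obtain a where "a \<in> U" "nq (?r a) = Max ((%v. nq (?r v)) ` U)" by auto
  then show ?thesis using finU by (intro that[of a]) auto
 qed
 define \<nu> where "\<nu> = sqrt (nq (?r a))"
 have nu2: "\<nu>\<^sup>2 = nq (?r a)" by (simp add: \<nu>_def nq_nonneg)
 have "\<eta>\<^sup>2 <= \<nu>\<^sup>2" using v0 a(2)[OF v0(1)] nu2 by simp
 moreover have "0 <= \<nu>" by (simp add: \<nu>_def nq_nonneg)
 ultimately have nu: "\<eta> <= \<nu>" "0 < \<nu>" using eta by (auto simp: power2_le_iff_abs_le)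
 define wt where "wt = (%i. (1 / \<nu>) * ?r a i)"
 define xt where "xt = (%i. (1 / \<nu>) * z a i)"
 define w' where "w' = w(t := wt)"
 define xs' where "xs' = xs(t := xt)"
 define c where "c v = ip (?r v) wt / \<nu>" for v
 define z' where "z' v = (%i. z v i + (- c v) * z a i)" for v
 have wt1: "nq wt = 1"
 proof -
  have "nq wt = (1 / \<nu>) * ip (?r a) wt"
   using ip_scale_right[of wt "1 / \<nu>" "?r a"] by (simp add: wt_def ip_sym)
  also have "... = (1 / \<nu>) * ((1 / \<nu>) * nq (?r a))"
   using ip_scale_right[of "?r a" "1 / \<nu>" "?r a"] by (simp add: wt_def)
  finally show ?thesis using nu by (simp add: nu2[symmetric] power2_eq_square)
 qed
 have wt0: "ip (w s) wt = 0" if "s < t" for s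
 proof -
  have "ip (w s) wt = (1 / \<nu>) * ip (w s) (?r a)" unfolding wt_def by (rule ip_scale_right)
  then show ?thesis by (simp only: ip_res[OF o that] mult_zero_right)
 qed
 have wt0': "ip wt (w s) = 0" if "s < t" for s using wt0[OF that] by (simp only: ip_sym[of wt])
 have o': "ortho (Suc t) w'"
  using o wt1 wt0 wt0' by (auto simp: ortho_def w'_def less_Suc_eq)
 have c1: "\<bar>c v\<bar> <= 1" if "v \<in> U" for v
 proof -
  have "\<bar>ip (?r v) wt\<bar> <= sqrt (nq (?r v)) * sqrt (nq wt)" by (rule ip_le_sqrt)
  also have "... <= \<nu>" using a(2)[OF that] wt1 by (simp add: \<nu>_def)
  finally show ?thesis using nu by (simp add: c_def)
 qed
 \<comment> \<open>\<open>wt\<close> is orthogonal to the earlier vectors, so its inner product with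
   a column equals that with the residual of the column. This turns the new residual into the same
   elimination step that defines \<open>z'\<close>.\<close>
 have res': "res (Suc t) w' (?u v) = (%i. ?r v i + (- c v) * ?r a i)" for v
 proof -
  have "ip (?u v) wt = ip (?r v) wt"
  proof -
   have "ip wt (proj t w (?u v)) = 0"
    unfolding proj_def by (subst ip_sum_right) (auto simp: wt0' intro!: sum.neutral)
   then have "ip wt (?u v) = ip wt (?r v)" unfolding res_def by (simp only: ip_diff_right)
   then show ?thesis by (metis ip_sym)
  qed
  moreover have "proj (Suc t) w' (?u v) = (%i. proj t w (?u v) i + ip (?u v) wt * wt i)"
   by (auto simp: proj_def w'_def)
  ultimately show ?thesis using nu
   by (auto simp: res_def[of "Suc t"] c_def) (auto simp: wt_def res_def)
 qed
 have two: "(2::real) ^ t <= 2 ^ Suc t" by simp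
 have "pivoted k \<eta> (Suc t) w' xs' (insert a T) z'"
  unfolding pivoted_def
 proof (intro conjI allI impI ballI)
  show "insert a T \<subseteq> U" using a T by auto
  show "card (insert a T) <= Suc t" using T by (metis card_insert_le_m1 card_insert_if le_SucI not_less_eq_eq)
  show "ortho (Suc t) w'" by (rule o')
 next
  fix s assume s: "s < Suc t"
  show "w' s = (B ^^ k) (xs' s)"
  proof (cases "s = t")
   case True
   have "(B ^^ k) xt = wt" unfolding xt_def wt_def B_pow_scale z(1)[OF a(1)] ..
   then show ?thesis using True by (simp add: w'_def xs'_def)
  next
   case False
   then show ?thesis using s p by (simp add: w'_def xs'_def pivoted_def)
  qed
  show "xs' s i = 0" if "i ~: insert a T" for i
   using s p z(2)[OF a(1)] that by (auto simp: less_Suc_eq xs'_def xt_def pivoted_def)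
  show "l1 (xs' s) <= 2 ^ Suc t / \<eta>"
  proof (cases "s = t")
   case True
   have "l1 xt = (1 / \<nu>) * l1 (z a)" using nu by (simp add: l1_def xt_def abs_mult sum_distrib_left sum_divide_distrib)
   also have "... <= (1 / \<eta>) * 2 ^ Suc t"
    using nu eta order_trans[OF z(3)[OF a(1)] two] by (intro mult_mono) (auto simp: frac_le l1_nonneg)
   finally show ?thesis using True by (simp add: xs'_def)
  next
   case False
   then have "l1 (xs' s) <= 2 ^ t / \<eta>" using s p by (simp add: xs'_def pivoted_def)
   also have "... <= 2 ^ Suc t / \<eta>" using two eta by (intro divide_right_mono) auto
   finally show ?thesis .
  qed
 next
  fix v assume v: "v \<in> U"
  show "(B ^^ k) (z' v) = res (Suc t) w' (?u v)"
   unfolding res' z'_def B_pow_add using z(1)[OF v] z(1)[OF a(1)] by simp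
  show "z' v i = 0" if "i ~: insert v (insert a T)" for i
   using that z(2)[OF v] z(2)[OF a(1)] by (simp add: z'_def)
  have "l1 (z' v) <= l1 (z v) + \<bar>- c v\<bar> * l1 (z a)" unfolding z'_def by (rule l1_triangle)
  also have "... <= 2 ^ t + 1 * 2 ^ t"
   using c1[OF v] z(3)[OF v] z(3)[OF a(1)] by (intro add_mono mult_mono) (auto simp: l1_nonneg)
  finally show "l1 (z' v) <= 2 ^ Suc t" by simp
 qed
 then show ?thesis by blast
qed

lemma l1_unit: "v \<in> U ==> l1 (unit v) = 1"
proof -
 assume "v \<in> U"
 have "l1 (unit v) = (\<Sum>i\<in>U. if i = v then 1 else 0)" unfolding l1_def unit_def by (intro sum.cong) auto
 then show ?thesis using finU \<open>v \<in> U\<close> by simp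
qed

text \<open>Elimination stops for one of two reasons, and these become the two cases of the
  argument: \<open>D\<close> vectors have been found, or no column is far from their span.\<close>

lemma pivoted_exists:
 assumes eta: "\<eta> > 0"
 shows "\<exists>t\<le>D. \<exists>w xs T z. pivoted k \<eta> t w xs T z &
  (t = D \<or> (\<forall>v\<in>U. nq (res t w ((B ^^ k) (unit v))) < \<eta>\<^sup>2))"
proof (induction D)
 case 0
 have "pivoted k \<eta> 0 w xs {} unit" for w xs
  using finU by (auto simp: pivoted_def ortho_def res_def proj_def l1_unit) (auto simp: unit_def)
 then show ?case by blast
next
 case (Suc D)
 then obtain t w xs T z where t: "t <= D" "pivoted k \<eta> t w xs T z"
  "t = D \<or> (\<forall>v\<in>U. nq (res t w ((B ^^ k) (unit v))) < \<eta>\<^sup>2)" by blast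
 show ?case
 proof (cases "\<forall>v\<in>U. nq (res t w ((B ^^ k) (unit v))) < \<eta>\<^sup>2")
  case True
  then show ?thesis using t le_SucI by blast
 next
  case False
  then obtain v where "v \<in> U" "\<eta>\<^sup>2 <= nq (res t w ((B ^^ k) (unit v)))" by force
  then have "\<exists>w xs T z. pivoted k \<eta> (Suc t) w xs T z" using pivoted_step[OF t(2) eta] by blast
  moreover have "t = D" using t False by blast
  ultimately show ?thesis by blast
 qed
qed

text \<open>A vector of the span has a preimage whose \<open>l1\<close> norm, hence also its
  Euclidean norm, is at most \<open>t * 2 ^ t / \<eta>\<close> times the length of the vector. By
  \<open>small\<close>, \<open>B ^^ k\<close> therefore stretches this preimage by at least
  \<open>\<tau> ^ k\<close>, and \<open>power_rayleigh\<close> applies.\<close>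

lemma span_rayleigh:
 assumes p: "pivoted k \<eta> t w xs T z" and eta: "\<eta> > 0" and tau: "0 < \<tau>" and k: "1 <= k"
  and small: "\<tau> ^ k * (real t * 2 ^ t) <= \<eta>"
 shows "ip (%i. \<Sum>s<t. c s * w s i) (B (%i. \<Sum>s<t. c s * w s i))
  \<ge> \<tau> * nq (%i. \<Sum>s<t. c s * w s i)"
proof -
 let ?y = "%i. \<Sum>s<t. c s * w s i"
 let ?x = "%i. \<Sum>s<t. c s * xs s i"
 have o: "ortho t w" using p by (simp add: pivoted_def)
 have y: "(B ^^ k) ?x = ?y"
  using p by (subst B_pow_sum) (auto simp: pivoted_def intro!: sum.cong)
 have cs: "\<bar>c s\<bar> <= sqrt (nq ?y)" if "s < t" for s
 proof -
  have "(c s)\<^sup>2 <= nq ?y" unfolding nq_comb[OF o] using that by (intro member_le_sum) auto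
  from real_sqrt_le_mono[OF this] show ?thesis by simp
 qed
 have "l1 ?x <= (\<Sum>s<t. \<bar>c s\<bar> * l1 (xs s))" by (rule l1_sum_le)
 also have "... <= (\<Sum>s<t. sqrt (nq ?y) * (2 ^ t / \<eta>))"
  using p cs eta by (intro sum_mono mult_mono) (auto simp: pivoted_def l1_nonneg nq_nonneg)
 also have "... = sqrt (nq ?y) * (real t * 2 ^ t) / \<eta>" by simp
 finally have l1x: "l1 ?x <= sqrt (nq ?y) * (real t * 2 ^ t) / \<eta>" .
 have "\<tau> ^ k * l1 ?x <= \<tau> ^ k * (sqrt (nq ?y) * (real t * 2 ^ t) / \<eta>)"
  using l1x tau by (intro mult_left_mono) auto
 also have "... = sqrt (nq ?y) * (\<tau> ^ k * (real t * 2 ^ t) / \<eta>)" by simp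
 also have "... <= sqrt (nq ?y) * 1"
  using small eta by (intro mult_left_mono) (auto simp: nq_nonneg)
 finally have "(\<tau> ^ k * l1 ?x)\<^sup>2 <= (sqrt (nq ?y))\<^sup>2"
  using tau l1_nonneg by (intro power_mono) auto
 then have "\<tau> ^ (2 * k) * (l1 ?x)\<^sup>2 <= nq ?y"
  by (simp add: power_mult_distrib nq_nonneg power_mult[symmetric] mult.commute)
 moreover have "\<tau> ^ (2 * k) * nq ?x <= \<tau> ^ (2 * k) * (l1 ?x)\<^sup>2"
  using nq_le_l1 tau by (intro mult_left_mono) auto
 ultimately have "nq ((B ^^ k) ?x) \<ge> \<tau> ^ (2 * k) * nq ?x" unfolding y by linarith
 from power_rayleigh[OF this tau k] show ?thesis unfolding y .
qed

text \<open>
 If all residuals are short, then \<^term>\<open>(B ^^ k) (res t w f)\<close> lies almost in the span of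
 the pivots, to which \<^term>\<open>res t w f\<close> is orthogonal.
\<close>

lemma res_rayleigh:
 assumes o: "ortho t w" and eta: "\<eta> > 0" and tau: "0 <= \<tau>"
  and short: "\<forall>v\<in>U. nq (res t w ((B ^^ k) (unit v))) < \<eta>\<^sup>2"
  and big: "real (card U) * \<eta> < \<tau> ^ k"
 shows "ip (res t w f) (B (res t w f)) <= \<tau> * nq (res t w f)"
proof (rule ccontr)
 let ?g = "res t w f" let ?u = "%v. (B ^^ k) (unit v)"
 assume "\<not> ?thesis"
 then have c: "ip ?g (B ?g) > \<tau> * nq ?g" by simp
 have pos: "nq ?g > 0"
 proof (rule ccontr)
  assume "\<not> nq ?g > 0"
  then have 0: "nq ?g = 0" using nq_nonneg[of ?g] by simp
  then have "?g i = 0" if "i \<in> U" for i using abs_le_sqrt_nq[OF that, of ?g] by simp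
  then have "ip ?g (B ?g) = 0" by (simp add: ip_def)
  then show False using c 0 by simp
 qed
 \<comment> \<open>The contradiction comes from two bounds on the moment of order \<open>k\<close>:
   from below by the growth of moments, from above by expanding \<open>(B ^^ k) ?g\<close> in
   columns, of which \<open>?g\<close> sees only the residuals, each shorter than
   \<open>\<eta>\<close>.\<close>
 have "\<tau> ^ k * nq ?g <= mo ?g k" using c tau by (intro mo_power_ge) auto
 also have "mo ?g k = ip ?g (%i. \<Sum>v\<in>U. ?g v * ?u v i)"
  unfolding mo_def ip_def by (intro sum.cong) (auto simp: B_pow_expand[of _ k ?g])
 also have "... = (\<Sum>v\<in>U. ?g v * ip ?g (?u v))" by (rule ip_sum_right)
 also have "... <= (\<Sum>v\<in>U. nq ?g * \<eta>)"
 proof (rule sum_mono)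
  fix v assume v: "v \<in> U"
  have "ip ?g (proj t w (?u v)) = 0" unfolding proj_def by (rule ip_comb_res[OF o])
  then have "ip ?g (?u v) = ip ?g (res t w (?u v))" by (simp add: res_def[of t w "?u v"] ip_diff_right)
  then have "\<bar>ip ?g (?u v)\<bar> <= sqrt (nq ?g) * sqrt (nq (res t w (?u v)))"
   using ip_le_sqrt by simp
  also have "... <= sqrt (nq ?g) * \<eta>"
   using short v eta real_sqrt_le_mono[of "nq (res t w (?u v))" "\<eta>\<^sup>2"]
   by (intro mult_left_mono) (auto simp: nq_nonneg less_imp_le)
  finally have "\<bar>?g v\<bar> * \<bar>ip ?g (?u v)\<bar> <= sqrt (nq ?g) * (sqrt (nq ?g) * \<eta>)"
   using abs_le_sqrt_nq[OF v, of ?g] by (intro mult_mono) (auto simp: nq_nonneg)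
  then have "\<bar>?g v * ip ?g (?u v)\<bar> <= nq ?g * \<eta>"
   by (simp add: abs_mult nq_nonneg flip: mult.assoc)
  then show "?g v * ip ?g (?u v) <= nq ?g * \<eta>" by linarith
 qed
 also have "... = (real (card U) * \<eta>) * nq ?g" by simp
 also have "... < \<tau> ^ k * nq ?g" using big pos by simp
 finally show False by simp
qed

end

section \<open>Rounding vectors to dense vertex sets\<close>

definition inner_weight :: "(nat => nat => real) => nat set => real" where
 "inner_weight A X = (\<Sum>i\<in>X. \<Sum>k\<in>X. A i k)"

text \<open>The minimum of \<open>m i\<close> and \<open>m k\<close> is the measure of the levels
  that both reach, so the claim is the hypothesis integrated over \<open>\<tau>\<close>. The
  integral is taken by induction, peeling off the lowest level.\<close>

lemma layer_cake_bound:
 fixes m :: "nat => real"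
 assumes "finite Z" "\<And>i. i \<in> Z ==> 0 < m i"
  and "\<And>\<tau>. 0 < \<tau> ==> inner_weight A {i \<in> Z. \<tau> <= m i} <= \<beta> * real (card {i \<in> Z. \<tau> <= m i})"
 shows "(\<Sum>i\<in>Z. \<Sum>k\<in>Z. A i k * min (m i) (m k)) <= \<beta> * (\<Sum>i\<in>Z. m i)"
 using assms
proof (induction "card Z" arbitrary: Z m rule: less_induct)
 case less
 show ?case
 proof (cases "Z = {}")
  case False
  define t where "t = Min (m ` Z)"
  have tm: "t <= m i" if "i \<in> Z" for i using that less.prems by (simp add: t_def)
  have "t \<in> m ` Z" using False less.prems by (simp add: t_def)
  then obtain i0 where i0: "i0 \<in> Z" "m i0 = t" by auto
  have t0: "0 < t" using i0 less.prems by auto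
  define Z' where "Z' = {i \<in> Z. t < m i}"
  define m' where "m' i = m i - t" for i
  have Z': "finite Z'" "Z' \<subseteq> Z" "i0 ~: Z'" using less.prems i0 by (auto simp: Z'_def)
  then have "card Z' < card Z" using i0 less.prems by (metis psubsetI psubset_card_mono)
  moreover have "inner_weight A {i \<in> Z'. \<tau> <= m' i} <= \<beta> * real (card {i \<in> Z'. \<tau> <= m' i})"
   if "0 < \<tau>" for \<tau>
  proof -
   have "{i \<in> Z'. \<tau> <= m' i} = {i \<in> Z. \<tau> + t <= m i}" using that by (auto simp: Z'_def m'_def)
   then show ?thesis using less.prems(3)[of "\<tau> + t"] that t0 by simp
  qed
  ultimately have IH: "(\<Sum>i\<in>Z'. \<Sum>k\<in>Z'. A i k * min (m' i) (m' k)) <= \<beta> * (\<Sum>i\<in>Z'. m' i)"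
   using Z' by (intro less.hyps) (auto simp: Z'_def m'_def)
  have eZ: "inner_weight A Z <= \<beta> * card Z"
  proof -
   have "{i \<in> Z. t <= m i} = Z" using tm by auto
   then show ?thesis using less.prems(3)[OF t0] by simp
  qed
  have out: "m i = t" if "i \<in> Z - Z'" for i using that tm[of i] by (auto simp: Z'_def)
  have "(\<Sum>i\<in>Z. \<Sum>k\<in>Z. A i k * min (m i) (m k))
    = (\<Sum>i\<in>Z. \<Sum>k\<in>Z. A i k * t + (if i \<in> Z' & k \<in> Z' then A i k * min (m' i) (m' k) else 0))"
  proof (intro sum.cong refl)
   fix i k assume ik: "i \<in> Z" "k \<in> Z"
   have "min (m i) (m k) = t + (if i \<in> Z' & k \<in> Z' then min (m' i) (m' k) else 0)"
    using tm[OF ik(1)] tm[OF ik(2)] out[of i] out[of k] ik by (auto simp: m'_def min_def)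
   then show "A i k * min (m i) (m k)
     = A i k * t + (if i \<in> Z' & k \<in> Z' then A i k * min (m' i) (m' k) else 0)"
    by (simp add: distrib_left)
  qed
  also have "... = t * inner_weight A Z
    + (\<Sum>i\<in>Z. \<Sum>k\<in>Z. if i \<in> Z' & k \<in> Z' then A i k * min (m' i) (m' k) else 0)"
   by (simp add: sum.distrib inner_weight_def sum_distrib_left mult.commute)
  also have "(\<Sum>i\<in>Z. \<Sum>k\<in>Z. if i \<in> Z' & k \<in> Z' then A i k * min (m' i) (m' k) else 0)
    = (\<Sum>i\<in>Z'. \<Sum>k\<in>Z'. A i k * min (m' i) (m' k))"
  proof -
   have "(\<Sum>k\<in>Z. if i \<in> Z' & k \<in> Z' then A i k * min (m' i) (m' k) else 0)
     = (if i \<in> Z' then \<Sum>k\<in>Z'. A i k * min (m' i) (m' k) else 0)" for i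
    using Z' less.prems(1) by (auto intro!: sum.mono_neutral_cong_right)
   then show ?thesis using Z' less.prems(1) by (auto intro!: sum.mono_neutral_cong_right)
  qed
  also have "t * inner_weight A Z + ... <= t * (\<beta> * card Z) + \<beta> * (\<Sum>i\<in>Z'. m' i)"
   using IH eZ t0 by (intro add_mono mult_left_mono) auto
  also have "(\<Sum>i\<in>Z'. m' i) = (\<Sum>i\<in>Z. m' i)"
   using Z' less.prems(1) out by (intro sum.mono_neutral_left) (auto simp: m'_def)
  also have "t * (\<beta> * card Z) + \<beta> * (\<Sum>i\<in>Z. m' i) = \<beta> * (\<Sum>i\<in>Z. m i)"
   by (simp add: m'_def sum_subtractf algebra_simps)
  finally show ?thesis .
 qed simp
qed

section \<open>Dense level sets of vectors\<close>

context substochastic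
begin

lemma row_sum_le: "X \<subseteq> U ==> i \<in> U ==> (\<Sum>k\<in>X. A i k) <= 1"
 by (rule order_trans[OF sum_mono2[OF finU, of X "A i"] A_row[of i]]) (auto simp: A_nonneg)

lemma form_sq_le: "(\<Sum>i\<in>U. \<Sum>k\<in>U. A i k * ((x i)\<^sup>2 + (x k)\<^sup>2)) <= 2 * nq x"
proof -
 have 1: "(\<Sum>i\<in>U. \<Sum>k\<in>U. A i k * (x i)\<^sup>2) <= nq x"
 proof -
  have "(\<Sum>i\<in>U. \<Sum>k\<in>U. A i k * (x i)\<^sup>2) = (\<Sum>i\<in>U. (\<Sum>k\<in>U. A i k) * (x i)\<^sup>2)"
   by (simp add: sum_distrib_right)
  also have "... <= (\<Sum>i\<in>U. 1 * (x i)\<^sup>2)" by (intro sum_mono mult_right_mono A_row) auto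
  finally show ?thesis by (simp add: ip_def power2_eq_square)
 qed
 have "(\<Sum>i\<in>U. \<Sum>k\<in>U. A i k * (x k)\<^sup>2) = (\<Sum>k\<in>U. \<Sum>i\<in>U. A k i * (x k)\<^sup>2)"
  by (subst sum.swap) (simp add: A_sym)
 then show ?thesis using 1 by (simp add: distrib_left sum.distrib)
qed

text \<open>If pairs touching a small set \<open>H\<close> carry a fixed share of the form of
  \<open>x\<close>, then large entries of \<open>x\<close> carry it, because the small entries on
  \<open>H\<close> have too little norm. Pairs of comparable entries are then resolved into level
  sets by \<open>layer_cake_bound\<close>. A level set of large entries is small because the norm of
  \<open>x\<close> is bounded.\<close>

lemma level_set_dense:
 assumes nx: "nq x <= 4" and H: "H \<subseteq> U" "real (card H) * \<zeta> <= \<rho>\<^sup>2 / 2 ^ 16"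
  and rho: "0 < \<rho>" "\<rho> <= 1" and zeta: "0 < \<zeta>"
  and touch: "(\<Sum>i\<in>U. \<Sum>k\<in>U. if i \<in> H \<or> k \<in> H then A i k * (\<bar>x i\<bar> * \<bar>x k\<bar>) else 0) \<ge> \<rho> / 16"
 shows "\<exists>\<theta>>0. {i \<in> U. \<theta> <= \<bar>x i\<bar>} ~= {} &
  inner_weight A {i \<in> U. \<theta> <= \<bar>x i\<bar>} > \<rho>\<^sup>2 / 2 ^ 22 * real (card {i \<in> U. \<theta> <= \<bar>x i\<bar>}) &
  real (card {i \<in> U. \<theta> <= \<bar>x i\<bar>}) <= 2 ^ 26 / (\<rho>\<^sup>2 * \<zeta>)"
proof -
 let ?t = "%i k. A i k * (\<bar>x i\<bar> * \<bar>x k\<bar>)"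
 \<comment> \<open>Pairs whose entries differ by more than the factor \<open>K\<close> contribute at
   most \<open>8 / K\<close>, that is \<open>\<rho> / 2 ^ 9\<close>, which is small against the
   \<open>\<rho> / 64\<close> that large entries carry.\<close>
 define K :: real where "K = 2 ^ 12 / \<rho>"
 have K: "1 <= K" "0 < K" using rho by (auto simp: K_def field_simps)
 have tn: "0 <= ?t i k" for i k using A_nonneg by simp
 have fH: "finite H" using H finU finite_subset by blast
 have "(\<Sum>i\<in>U. \<Sum>k\<in>U. if i \<in> H \<or> k \<in> H then ?t i k else 0)
   <= (\<Sum>i\<in>U. \<Sum>k\<in>U. (if i \<in> H then ?t i k else 0) + (if k \<in> H then ?t k i else 0))"
  using tn by (intro sum_mono) (auto simp: A_sym mult_ac)
 also have "... = 2 * (\<Sum>i\<in>U. \<Sum>k\<in>U. if i \<in> H then ?t i k else 0)"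
  by (simp add: sum.distrib) (subst sum.swap, simp)
 finally have h1: "(\<Sum>i\<in>U. \<Sum>k\<in>U. if i \<in> H then ?t i k else 0) \<ge> \<rho> / 32" using touch by simp
 \<comment> \<open>The small entries of \<open>x\<close> on \<open>H\<close>; the bound on
   \<open>card H * \<zeta>\<close> limits their share of the form to a quarter of the lower bound
   \<open>h1\<close>.\<close>
 define xl where "xl i = (if i \<in> H & (x i)\<^sup>2 <= \<zeta> then x i else 0)" for i
 have "nq xl <= (\<Sum>i\<in>U. if i \<in> H then \<zeta> else 0)"
  unfolding ip_def using zeta by (intro sum_mono) (auto simp: xl_def power2_eq_square)
 also have "... = real (card H) * \<zeta>"
  using H finU by (simp add: sum.inter_restrict[symmetric] Int_absorb1)
 finally have "nq xl <= \<rho>\<^sup>2 / 2 ^ 16" using H by simp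
 then have "sqrt (nq xl) <= sqrt ((\<rho> / 2 ^ 8)\<^sup>2)" by (simp add: power_divide)
 then have "sqrt (nq xl) <= \<rho> / 2 ^ 8" using rho by simp
 moreover have "sqrt (nq x) <= 2" using real_sqrt_le_mono[OF nx] by simp
 ultimately have "sqrt (nq xl) * sqrt (nq x) <= \<rho> / 2 ^ 8 * 2"
  using rho by (intro mult_mono) (auto simp: nq_nonneg)
 then have light: "(\<Sum>i\<in>U. \<Sum>k\<in>U. A i k * (\<bar>xl i\<bar> * \<bar>x k\<bar>)) <= \<rho> / 128"
  using form_abs_le[of xl x] by simp
 have "(\<Sum>i\<in>U. \<Sum>k\<in>U. if i \<in> H then ?t i k else 0)
   <= (\<Sum>i\<in>U. \<Sum>k\<in>U. A i k * (\<bar>xl i\<bar> * \<bar>x k\<bar>) + (if \<zeta> < (x i)\<^sup>2 then ?t i k else 0))"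
  using tn by (intro sum_mono) (auto simp: xl_def)
 then have h2: "(\<Sum>i\<in>U. \<Sum>k\<in>U. if \<zeta> < (x i)\<^sup>2 then ?t i k else 0) \<ge> \<rho> / 64"
  using h1 light rho by (simp add: sum.distrib)
 define Z where "Z = {i \<in> U. \<zeta> / K\<^sup>2 <= (x i)\<^sup>2}"
 have Z: "finite Z" "Z \<subseteq> U" using finU by (auto simp: Z_def)
 have zK: "0 < \<zeta> / K\<^sup>2" using zeta K by simp
 \<comment> \<open>Pairs with incomparable entries are charged to the larger square. For comparable
   entries the product is at most \<open>K\<close> times the smaller square, and both ends lie in
   \<open>Z\<close>, because a partner of an entry with square above \<open>\<zeta>\<close> has
   square at least \<open>\<zeta> / K\<^sup>2\<close>.\<close>
 have pt: "(if \<zeta> < (x i)\<^sup>2 then ?t i k else 0)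
   <= (1 / K) * (A i k * ((x i)\<^sup>2 + (x k)\<^sup>2))
    + (if i \<in> Z & k \<in> Z then K * (A i k * min ((x i)\<^sup>2) ((x k)\<^sup>2)) else 0)"
  if ik: "i \<in> U" "k \<in> U" for i k
 proof (cases "\<zeta> < (x i)\<^sup>2")
  case False
  then show ?thesis using A_nonneg K by auto
 next
  case True
  consider "K * \<bar>x k\<bar> < \<bar>x i\<bar>" | "K * \<bar>x i\<bar> < \<bar>x k\<bar>" | "\<bar>x i\<bar> <= K * \<bar>x k\<bar>" "\<bar>x k\<bar> <= K * \<bar>x i\<bar>"
   by linarith
  then have "\<bar>x i\<bar> * \<bar>x k\<bar> <= (1 / K) * ((x i)\<^sup>2 + (x k)\<^sup>2)
    + (if i \<in> Z & k \<in> Z then K * min ((x i)\<^sup>2) ((x k)\<^sup>2) else 0)"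
  proof cases
   case 1
   have "K * (\<bar>x i\<bar> * \<bar>x k\<bar>) <= \<bar>x i\<bar> * \<bar>x i\<bar>" using mult_left_mono[of "K * \<bar>x k\<bar>" "\<bar>x i\<bar>" "\<bar>x i\<bar>"] 1 by (simp add: mult_ac)
   then have "\<bar>x i\<bar> * \<bar>x k\<bar> <= (1 / K) * (x i)\<^sup>2" using K by (simp add: field_simps power2_eq_square)
   also have "... <= (1 / K) * ((x i)\<^sup>2 + (x k)\<^sup>2)" using K by (intro mult_left_mono) auto
   finally show ?thesis using K by (auto intro: add_increasing2)
  next
   case 2
   have "K * (\<bar>x i\<bar> * \<bar>x k\<bar>) <= \<bar>x k\<bar> * \<bar>x k\<bar>" using mult_left_mono[of "K * \<bar>x i\<bar>" "\<bar>x k\<bar>" "\<bar>x k\<bar>"] 2 by (simp add: mult_ac)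
   then have "\<bar>x i\<bar> * \<bar>x k\<bar> <= (1 / K) * (x k)\<^sup>2" using K by (simp add: field_simps power2_eq_square)
   also have "... <= (1 / K) * ((x i)\<^sup>2 + (x k)\<^sup>2)" using K by (intro mult_left_mono) auto
   finally show ?thesis using K by (auto intro: add_increasing2)
  next
   case 3
   have K2: "1 <= K\<^sup>2" using K by simp
   have "\<zeta> / K\<^sup>2 <= \<zeta>" using K2 zeta K by (simp add: field_simps)
   then have iZ: "i \<in> Z" using ik True by (auto simp: Z_def)
   have "(x i)\<^sup>2 <= (K * \<bar>x k\<bar>)\<^sup>2" using power_mono[OF 3(1), of 2] by simp
   then have "\<zeta> <= K\<^sup>2 * (x k)\<^sup>2" using True by (simp add: power_mult_distrib)
   then have kZ: "k \<in> Z" using ik K by (simp add: Z_def field_simps)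
   have "\<bar>x i\<bar> * \<bar>x k\<bar> <= K * min ((x i)\<^sup>2) ((x k)\<^sup>2)"
   proof (cases "(x i)\<^sup>2 <= (x k)\<^sup>2")
    case True
    have "\<bar>x i\<bar> * \<bar>x k\<bar> <= \<bar>x i\<bar> * (K * \<bar>x i\<bar>)" using 3 by (intro mult_left_mono) auto
    then show ?thesis using True by (simp add: power2_eq_square mult_ac)
   next
    case False
    have "\<bar>x i\<bar> * \<bar>x k\<bar> <= (K * \<bar>x k\<bar>) * \<bar>x k\<bar>" using 3 by (intro mult_right_mono) auto
    then show ?thesis using False by (simp add: power2_eq_square mult_ac)
   qed
   moreover have "0 <= (1 / K) * ((x i)\<^sup>2 + (x k)\<^sup>2)" using K by simp
   ultimately show ?thesis using iZ kZ by simp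
  qed
  from mult_left_mono[OF this A_nonneg[of i k]] True show ?thesis
   by (auto simp: distrib_left mult_ac)
 qed
 have "\<rho> / 64 <= (\<Sum>i\<in>U. \<Sum>k\<in>U. (1 / K) * (A i k * ((x i)\<^sup>2 + (x k)\<^sup>2))
    + (if i \<in> Z & k \<in> Z then K * (A i k * min ((x i)\<^sup>2) ((x k)\<^sup>2)) else 0))"
  using h2 pt by (meson order_trans sum_mono)
 also have "... = (1 / K) * (\<Sum>i\<in>U. \<Sum>k\<in>U. A i k * ((x i)\<^sup>2 + (x k)\<^sup>2))
   + (\<Sum>i\<in>U. \<Sum>k\<in>U. if i \<in> Z & k \<in> Z then K * (A i k * min ((x i)\<^sup>2) ((x k)\<^sup>2)) else 0)"
  by (simp add: sum.distrib sum_distrib_left)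
 also have "(\<Sum>i\<in>U. \<Sum>k\<in>U. if i \<in> Z & k \<in> Z then K * (A i k * min ((x i)\<^sup>2) ((x k)\<^sup>2)) else 0)
   = (\<Sum>i\<in>Z. \<Sum>k\<in>Z. K * (A i k * min ((x i)\<^sup>2) ((x k)\<^sup>2)))"
 proof -
  have "(\<Sum>k\<in>U. if i \<in> Z & k \<in> Z then K * (A i k * min ((x i)\<^sup>2) ((x k)\<^sup>2)) else 0)
    = (if i \<in> Z then \<Sum>k\<in>Z. K * (A i k * min ((x i)\<^sup>2) ((x k)\<^sup>2)) else 0)" for i
   using Z finU by (auto intro!: sum.mono_neutral_cong_right)
  then show ?thesis using Z finU by (auto intro!: sum.mono_neutral_cong_right)
 qed
 also have "... = K * (\<Sum>i\<in>Z. \<Sum>k\<in>Z. A i k * min ((x i)\<^sup>2) ((x k)\<^sup>2))"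
  by (simp add: sum_distrib_left)
 also have "(1 / K) * (\<Sum>i\<in>U. \<Sum>k\<in>U. A i k * ((x i)\<^sup>2 + (x k)\<^sup>2)) <= (1 / K) * 8"
  using form_sq_le[of x] nx K by (intro mult_left_mono) auto
 also have "(1 / K) * 8 = \<rho> / 2 ^ 9" by (simp add: K_def)
 finally have "K * (\<Sum>i\<in>Z. \<Sum>k\<in>Z. A i k * min ((x i)\<^sup>2) ((x k)\<^sup>2)) \<ge> \<rho> / 64 - \<rho> / 2 ^ 9"
  by simp
 moreover have "K * (\<rho>\<^sup>2 / 2 ^ 19) = \<rho> / 128" using rho by (simp add: K_def power2_eq_square)
 ultimately have "K * (\<Sum>i\<in>Z. \<Sum>k\<in>Z. A i k * min ((x i)\<^sup>2) ((x k)\<^sup>2)) \<ge> K * (\<rho>\<^sup>2 / 2 ^ 19)"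
  using rho by simp
 then have big: "(\<Sum>i\<in>Z. \<Sum>k\<in>Z. A i k * min ((x i)\<^sup>2) ((x k)\<^sup>2)) \<ge> \<rho>\<^sup>2 / 2 ^ 19"
  using K by simp
 have sZ: "(\<Sum>i\<in>Z. (x i)\<^sup>2) <= 4"
  using sum_mono2[OF finU Z(2), of "%i. (x i)\<^sup>2"] nx by (simp add: ip_def power2_eq_square)
 \<comment> \<open>Otherwise the layer cake bound would give at most
   \<open>4 * \<rho>\<^sup>2 / 2 ^ 22\<close>, which is half of the lower bound
   \<open>big\<close>.\<close>
 have "\<exists>\<tau>>0. inner_weight A {i \<in> Z. \<tau> <= (x i)\<^sup>2} > \<rho>\<^sup>2 / 2 ^ 22 * real (card {i \<in> Z. \<tau> <= (x i)\<^sup>2})"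
 proof (rule ccontr)
  assume neg: "\<not> ?thesis"
  have "(\<Sum>i\<in>Z. \<Sum>k\<in>Z. A i k * min ((x i)\<^sup>2) ((x k)\<^sup>2)) <= \<rho>\<^sup>2 / 2 ^ 22 * (\<Sum>i\<in>Z. (x i)\<^sup>2)"
  proof (rule layer_cake_bound[OF Z(1)])
   show "0 < (x i)\<^sup>2" if "i \<in> Z" for i using that less_le_trans[OF zK] by (simp only: Z_def mem_Collect_eq)
  qed (use neg in \<open>meson not_less\<close>)
  also have "... <= \<rho>\<^sup>2 / 2 ^ 22 * 4" using sZ by (intro mult_left_mono) auto
  finally show False using big zero_less_power[OF rho(1), of 2] by simp
 qed
 then obtain \<tau> where \<tau>: "0 < \<tau>"
  "inner_weight A {i \<in> Z. \<tau> <= (x i)\<^sup>2} > \<rho>\<^sup>2 / 2 ^ 22 * real (card {i \<in> Z. \<tau> <= (x i)\<^sup>2})" by auto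
 \<comment> \<open>Raising the level to at least \<open>\<zeta> / K\<^sup>2\<close> turns the level
   set inside \<open>Z\<close> into a level set of the whole vector.\<close>
 define \<theta> where "\<theta> = sqrt (max \<tau> (\<zeta> / K\<^sup>2))"
 have th2: "\<theta>\<^sup>2 = max \<tau> (\<zeta> / K\<^sup>2)" using \<tau> by (simp add: \<theta>_def)
 have th0: "0 < \<theta>" using \<tau> by (simp add: \<theta>_def max_def zK)
 have "\<theta> <= \<bar>x i\<bar> \<longleftrightarrow> \<theta>\<^sup>2 <= (x i)\<^sup>2" for i
  using th0 by (metis abs_le_square_iff abs_of_pos)
 then have X: "{i \<in> U. \<theta> <= \<bar>x i\<bar>} = {i \<in> Z. \<tau> <= (x i)\<^sup>2}"
  unfolding th2 Z_def by auto
 let ?X = "{i \<in> U. \<theta> <= \<bar>x i\<bar>}"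
 have "(\<zeta> / K\<^sup>2) * real (card ?X) <= (\<Sum>i\<in>?X. (x i)\<^sup>2)"
  unfolding X using sum_mono[of "{i \<in> Z. \<tau> <= (x i)\<^sup>2}" "%_. \<zeta> / K\<^sup>2" "%i. (x i)\<^sup>2"]
  by (simp add: Z_def mult.commute)
 also have "... <= 4" unfolding X
  using sum_mono2[OF Z(1), of "{i \<in> Z. \<tau> <= (x i)\<^sup>2}" "%i. (x i)\<^sup>2"] sZ by auto
 finally have "real (card ?X) <= 4 * K\<^sup>2 / \<zeta>" using zeta K by (simp add: field_simps)
 also have "... = 2 ^ 26 / (\<rho>\<^sup>2 * \<zeta>)" by (simp add: K_def power_divide)
 finally have card: "real (card ?X) <= 2 ^ 26 / (\<rho>\<^sup>2 * \<zeta>)" .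
 have "?X ~= {}"
 proof
  assume "?X = {}"
  then have "{i \<in> Z. \<tau> <= (x i)\<^sup>2} = {}" by (simp only: X)
  then show False using \<tau>(2) by (simp only: inner_weight_def sum.empty card.empty)
 qed
 then show ?thesis using th0 card \<tau>(2)[folded X] by (intro exI[of _ \<theta>] conjI)
qed

lemma inner_weight_ip:
 "X \<subseteq> U ==> ip (%i. if i \<in> X then 1 else 0) (ap (%i. if i \<in> X then 1 else 0)) = inner_weight A X"
proof -
 assume X: "X \<subseteq> U"
 have "(\<Sum>k\<in>U. A i k * ((if i \<in> X then 1 else 0) * (if k \<in> X then 1 else 0)))
   = (if i \<in> X then \<Sum>k\<in>X. A i k else 0)" for i
  using X finU by (auto intro!: sum.mono_neutral_cong_right)
 then show ?thesis
  unfolding ip_ap inner_weight_def using X finU by (auto intro!: sum.mono_neutral_cong_right)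
qed

text \<open>\<open>y\<close> plays the projection of the indicator of \<open>S\<close>.
  Cauchy-Schwarz makes the level set of \<open>y1\<close> large, each of its rows draws a fixed
  share of its value from the level set of \<open>y0\<close>, and entries of \<open>y\<close> above
  a cap matter little because of the norm of \<open>y\<close>. So much weight of \<open>A\<close>
  runs between the two level sets.\<close>

lemma two_level_sets_dense:
 assumes S: "S \<subseteq> U" "real (card S) <= l" and rho: "0 < \<rho>" "\<rho> <= 1" and l: "0 < l"
  and y: "nq y <= l" "(\<Sum>i\<in>S. ap y i) \<ge> \<rho> * l / 4"
  and e: "\<And>i. i \<in> U ==> \<bar>y0 i - y i\<bar> <= \<epsilon>" "\<And>i. i \<in> U ==> \<bar>y1 i - ap y i\<bar> <= \<epsilon>" "\<epsilon> <= \<rho> / 2 ^ 10"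
  and X: "X = {i \<in> U. \<rho> / 32 <= y0 i} \<union> {i \<in> U. \<rho> / 16 <= y1 i}"
 shows "inner_weight A X \<ge> \<rho> ^ 6 * l / 2 ^ 26" "real (card X) <= 2 ^ 13 * l / \<rho>\<^sup>2"
proof -
 let ?T = "{i \<in> U. \<rho> / 32 <= y0 i}"
 let ?T' = "{i \<in> U. \<rho> / 16 <= y1 i}"
 have fin: "finite ?T" "finite ?T'" "finite X" using finU X by auto
 have sq_card: "c\<^sup>2 * real (card Y) <= nq z" if "Y \<subseteq> U" "\<And>i. i \<in> Y ==> c <= z i" "0 <= c" for Y z c
 proof -
  have "c\<^sup>2 * real (card Y) = (\<Sum>i\<in>Y. c\<^sup>2)" by simp
  also have "... <= (\<Sum>i\<in>Y. (z i)\<^sup>2)" using that by (intro sum_mono power_mono) auto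
  also have "... <= (\<Sum>i\<in>U. (z i)\<^sup>2)" using that finU by (intro sum_mono2) auto
  finally show ?thesis by (simp add: ip_def power2_eq_square)
 qed
 have cT: "real (card ?T) <= 2 ^ 12 * l / \<rho>\<^sup>2"
 proof -
  have "\<rho> / 64 <= y i" if "i \<in> ?T" for i
   using that e(1)[of i] e(3) rho(1) unfolding abs_le_iff by auto
  then have "(\<rho> / 64)\<^sup>2 * real (card ?T) <= l"
   using sq_card[of ?T "\<rho> / 64" y] rho y by auto
  then show ?thesis using rho by (simp add: field_simps power2_eq_square)
 qed
 have cT': "real (card ?T') <= 2 ^ 12 * l / \<rho>\<^sup>2"
 proof -
  have "\<rho> / 64 <= ap y i" if "i \<in> ?T'" for i
   using that e(2)[of i] e(3) rho(1) unfolding abs_le_iff by auto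
  then have "(\<rho> / 64)\<^sup>2 * real (card ?T') <= l"
   using sq_card[of ?T' "\<rho> / 64" "ap y"] rho y nq_ap_le[of y] by auto
  then show ?thesis using rho by (simp add: field_simps power2_eq_square)
 qed
 have "real (card X) <= real (card ?T) + real (card ?T')"
  unfolding X using card_Un_le[of ?T ?T'] by linarith
 then show "real (card X) <= 2 ^ 13 * l / \<rho>\<^sup>2" using cT cT' by simp
 have lowT': "real (card ?T') \<ge> \<rho>\<^sup>2 * l / 64"
 proof -
  have fS: "finite S" using S finU finite_subset by blast
  have "(\<Sum>i\<in>S - ?T'. ap y i) <= (\<Sum>i\<in>S - ?T'. \<rho> / 8)"
  proof (rule sum_mono)
   fix i assume i: "i \<in> S - ?T'"
   then have "i \<in> U" "y1 i < \<rho> / 16" using S by auto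
   then show "ap y i <= \<rho> / 8" using e(2)[of i] e(3) rho by (auto simp: abs_le_iff)
  qed
  also have "... = real (card (S - ?T')) * (\<rho> / 8)" by simp
  also have "... <= l * (\<rho> / 8)"
  proof -
   have "real (card (S - ?T')) <= real (card S)" using fS by (intro of_nat_mono card_mono) auto
   then show ?thesis using S rho by (intro mult_right_mono) auto
  qed
  finally have "(\<Sum>i\<in>S \<inter> ?T'. ap y i) \<ge> \<rho> * l / 8"
   using y(2) sum.Int_Diff[OF fS, of "ap y" ?T'] by (simp add: algebra_simps)
  then have "(\<rho> * l / 8)\<^sup>2 <= (\<Sum>i\<in>S \<inter> ?T'. ap y i * 1)\<^sup>2"
   using rho l by (intro power_mono) auto
  also have "... <= (\<Sum>i\<in>S \<inter> ?T'. (ap y i)\<^sup>2) * (\<Sum>i\<in>S \<inter> ?T'. 1\<^sup>2)"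
   by (rule Cauchy_Schwarz_ineq_sum)
  also have "... <= l * real (card ?T')"
  proof (intro mult_mono)
   have "(\<Sum>i\<in>S \<inter> ?T'. (ap y i)\<^sup>2) <= (\<Sum>i\<in>U. (ap y i)\<^sup>2)" using finU by (intro sum_mono2) auto
   also have "... <= l" using nq_ap_le[of y] y(1) by (simp add: ip_def power2_eq_square)
   finally show "(\<Sum>i\<in>S \<inter> ?T'. (ap y i)\<^sup>2) <= l" .
   show "(\<Sum>i\<in>S \<inter> ?T'. 1\<^sup>2) <= real (card ?T')" using fin by (auto intro!: card_mono)
  qed (use l in auto)
  finally have "l * (\<rho>\<^sup>2 * l / 64) <= l * real (card ?T')"
   by (simp add: power2_eq_square algebra_simps)
  then show ?thesis using l by simp
 qed
 \<comment> \<open>With this cap the loss \<open>l / K\<close> is exactly half of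
   \<open>\<rho> / 64 * (\<rho>\<^sup>2 * l / 64)\<close>, the lower bound on the total of the
   rows.\<close>
 define K where "K = 2 ^ 13 / \<rho> ^ 3"
 have K: "0 < K" using rho by (simp add: K_def)
 have row: "(\<Sum>k\<in>?T. A i k * y k) \<ge> \<rho> / 64" if i: "i \<in> ?T'" for i
 proof -
  have iU: "i \<in> U" using i by simp
  have "ap y i = (\<Sum>k\<in>U. A i k * y k)" using iU by (simp add: ap_def)
  also have "... = (\<Sum>k\<in>?T. A i k * y k) + (\<Sum>k\<in>U - ?T. A i k * y k)"
   using finU by (subst sum.subset_diff[of ?T U]) auto
  also have "(\<Sum>k\<in>U - ?T. A i k * y k) <= (\<Sum>k\<in>U - ?T. A i k * (\<rho> / 32 + \<epsilon>))"
   using e(1) by (intro sum_mono mult_left_mono A_nonneg) (force simp: abs_le_iff)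
  also have "... = (\<Sum>k\<in>U - ?T. A i k) * (\<rho> / 32 + \<epsilon>)" by (simp add: sum_distrib_right)
  also have "... <= 1 * (\<rho> / 32 + \<epsilon>)"
  proof (intro mult_right_mono row_sum_le)
   have "0 <= \<epsilon>" using e(1)[OF iU] by simp
   then show "0 <= \<rho> / 32 + \<epsilon>" using rho by simp
  qed (use iU in auto)
  finally have "ap y i <= (\<Sum>k\<in>?T. A i k * y k) + (\<rho> / 32 + \<epsilon>)" by simp
  moreover have "ap y i \<ge> \<rho> / 16 - \<epsilon>" using i e(2)[OF iU] by (auto simp: abs_le_iff)
  ultimately show ?thesis using e(3) rho by simp
 qed
 have cap: "y k <= K + (if K < y k then y k else 0)" for k using K by auto
 have col: "(\<Sum>i\<in>?T'. A i k) <= 1" if "k \<in> U" for k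
  using row_sum_le[of ?T' k] that A_sym by auto
 have "\<rho> / 64 * real (card ?T') <= (\<Sum>i\<in>?T'. \<Sum>k\<in>?T. A i k * y k)"
  using sum_mono[of ?T' "%_. \<rho> / 64" "%i. \<Sum>k\<in>?T. A i k * y k"] row by (simp add: mult.commute)
 also have "... <= (\<Sum>i\<in>?T'. \<Sum>k\<in>?T. A i k * K + A i k * (if K < y k then y k else 0))"
  using cap mult_left_mono[OF cap A_nonneg] by (intro sum_mono) (simp add: distrib_left)
 also have "... = K * (\<Sum>i\<in>?T'. \<Sum>k\<in>?T. A i k) + (\<Sum>k\<in>?T. (\<Sum>i\<in>?T'. A i k) * (if K < y k then y k else 0))"
  by (simp add: sum.distrib sum_distrib_left mult.commute sum_distrib_right) (subst sum.swap, simp)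
 also have "(\<Sum>k\<in>?T. (\<Sum>i\<in>?T'. A i k) * (if K < y k then y k else 0)) <= (\<Sum>k\<in>?T. 1 * ((y k)\<^sup>2 / K))"
 proof (intro sum_mono mult_mono)
  fix k
  show "(if K < y k then y k else 0) <= (y k)\<^sup>2 / K" using K by (auto simp: field_simps power2_eq_square)
 qed (use col K in auto)
 also have "(\<Sum>k\<in>?T. 1 * ((y k)\<^sup>2 / K)) <= (\<Sum>k\<in>U. (y k)\<^sup>2 / K)"
  using finU K by (simp only: mult_1) (intro sum_mono2, auto)
 also have "... <= l / K"
  using y(1) K by (simp add: ip_def power2_eq_square divide_right_mono flip: sum_divide_distrib)
 also have "l / K <= \<rho> / 128 * real (card ?T')"
 proof -
  have "l / K = \<rho> / 128 * (\<rho>\<^sup>2 * l / 64)" using rho by (simp add: K_def field_simps power2_eq_square power3_eq_cube)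
  also have "... <= \<rho> / 128 * real (card ?T')" using lowT' rho by (intro mult_left_mono) auto
  finally show ?thesis .
 qed
 finally have "K * (\<Sum>i\<in>?T'. \<Sum>k\<in>?T. A i k) \<ge> \<rho> / 128 * real (card ?T')" by simp
 moreover have "\<rho> / 128 * real (card ?T') \<ge> \<rho> / 128 * (\<rho>\<^sup>2 * l / 64)"
  using lowT' rho by (intro mult_left_mono) auto
 ultimately have "K * (\<Sum>i\<in>?T'. \<Sum>k\<in>?T. A i k) \<ge> \<rho> / 128 * (\<rho>\<^sup>2 * l / 64)" by linarith
 then have "(\<Sum>i\<in>?T'. \<Sum>k\<in>?T. A i k) \<ge> \<rho> / 128 * (\<rho>\<^sup>2 * l / 64) / K" using K by (simp add: field_simps)
 also have "\<rho> / 128 * (\<rho>\<^sup>2 * l / 64) / K = \<rho> ^ 6 * l / 2 ^ 26"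
  using rho by (simp add: K_def field_simps power2_eq_square power3_eq_cube eval_nat_numeral)
 finally have "(\<Sum>i\<in>?T'. \<Sum>k\<in>?T. A i k) \<ge> \<rho> ^ 6 * l / 2 ^ 26" .
 also have "(\<Sum>i\<in>?T'. \<Sum>k\<in>?T. A i k) <= inner_weight A X"
 proof -
  have "(\<Sum>i\<in>?T'. \<Sum>k\<in>?T. A i k) <= (\<Sum>i\<in>?T'. \<Sum>k\<in>X. A i k)"
   using fin A_nonneg X by (intro sum_mono sum_mono2) auto
  also have "... <= inner_weight A X" unfolding inner_weight_def
   using fin A_nonneg X by (intro sum_mono2) (auto intro: sum_nonneg)
  finally show ?thesis .
 qed
 finally show "inner_weight A X \<ge> \<rho> ^ 6 * l / 2 ^ 26" .
qed

end

subsection \<open>Random signs\<close>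

definition signs :: "'i set => ('i => real) set" where
 "signs I = PiE I (%_. {-1, 1})"

text \<open>Expectation over independent uniform signs, as a finite average;
  \<open>avg_attained\<close> later replaces the random signs by fixed ones.\<close>

definition avg :: "'i set => (('i => real) => real) => real" where
 "avg I F = (\<Sum>u\<in>signs I. F u) / 2 ^ card I"

lemma finite_signs: "finite I ==> finite (signs I)"
 unfolding signs_def by (intro finite_PiE) auto

lemma card_signs: "finite I ==> card (signs I) = 2 ^ card I"
 unfolding signs_def by (subst card_PiE) (auto simp: numeral_2_eq_2)

lemma avg_prod:
 assumes "finite I"
 shows "avg I (%u. \<Prod>i\<in>I. g i (u i)) = (\<Prod>i\<in>I. (g i (-1) + g i 1) / 2)"
proof -
 have "(\<Sum>u\<in>signs I. \<Prod>i\<in>I. g i (u i)) = (\<Prod>i\<in>I. \<Sum>y\<in>{-1, 1}. g i y)"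
  unfolding signs_def using assms by (intro prod_sum_PiE[symmetric]) auto
 then show ?thesis by (simp add: avg_def prod_dividef)
qed

lemma avg_add: "avg I (%u. F u + G u) = avg I F + avg I G"
 by (simp add: avg_def sum.distrib add_divide_distrib)

lemma avg_diff: "avg I (%u. F u - G u) = avg I F - avg I G"
 by (simp add: avg_def sum_subtractf diff_divide_distrib)

lemma avg_scale: "avg I (%u. c * F u) = c * avg I F"
 by (simp add: avg_def sum_distrib_left)

lemma avg_sum: "avg I (%u. \<Sum>x\<in>X. F x u) = (\<Sum>x\<in>X. avg I (F x))"
 unfolding avg_def by (subst sum.swap) (simp add: sum_divide_distrib)

lemma avg_attained:
 assumes "finite I" "c <= avg I F"
 shows "\<exists>u\<in>signs I. c <= F u"
proof (rule ccontr)
 assume "\<not> ?thesis"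
 then have "\<forall>u\<in>signs I. F u < c" by auto
 moreover have "signs I ~= {}" by (auto simp: signs_def PiE_eq_empty_iff)
 ultimately have "(\<Sum>u\<in>signs I. F u) < (\<Sum>u\<in>signs I. c)"
  using finite_signs[OF assms(1)] by (intro sum_strict_mono) auto
 also have "... = 2 ^ card I * c" using card_signs[OF assms(1)] by simp
 finally have "avg I F < c" by (simp add: avg_def field_simps)
 then show False using assms(2) by simp
qed

lemma signs_abs: "u \<in> signs I ==> i \<in> I ==> u i = -1 \<or> u i = 1"
 unfolding signs_def by (auto dest: PiE_mem)

lemma one_plus_ge_exp:
 fixes x :: real
 assumes "\<bar>x\<bar> <= 1 / 2"
 shows "exp (x - 2 * x\<^sup>2) <= 1 + x"
proof -
 have "\<bar>ln (1 + x) - x\<bar> <= 2 * x\<^sup>2" using assms by (rule abs_ln_one_plus_x_minus_x_bound)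
 then have "x - 2 * x\<^sup>2 <= ln (1 + x)" by linarith
 then have "exp (x - 2 * x\<^sup>2) <= exp (ln (1 + x))" by simp
 then show ?thesis using assms by simp
qed

text \<open>Products of random sign factors behave like log-normal random variables.\<close>

lemma avg_two_products_upper:
 assumes "finite I" "\<And>i. i \<in> I ==> \<bar>a i\<bar> <= 1/2" "\<And>i. i \<in> I ==> \<bar>b i\<bar> <= 1/2"
 shows "avg I (%u. (\<Prod>i\<in>I. 1 + u i * a i) * (\<Prod>i\<in>I. 1 + u i * b i)) <= exp (\<Sum>i\<in>I. a i * b i)"
  and "avg I (%u. (\<Prod>i\<in>I. 1 + u i * a i) * (\<Prod>i\<in>I. 1 + u i * b i))
   \<ge> exp ((\<Sum>i\<in>I. a i * b i) - 2 * (\<Sum>i\<in>I. (a i * b i)\<^sup>2))"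
proof -
 have ab: "\<bar>a i * b i\<bar> <= 1 / 4" if "i \<in> I" for i
  using mult_mono[OF assms(2)[OF that] assms(3)[OF that]] by (simp add: abs_mult)
 have E: "avg I (%u. (\<Prod>i\<in>I. 1 + u i * a i) * (\<Prod>i\<in>I. 1 + u i * b i)) = (\<Prod>i\<in>I. 1 + a i * b i)"
 proof -
  have "((1 + (-1) * a i) * (1 + (-1) * b i) + (1 + 1 * a i) * (1 + 1 * b i)) / 2 = 1 + a i * b i" for i
   by (simp add: algebra_simps)
  then show ?thesis unfolding prod.distrib[symmetric]
   by (simp only: avg_prod[OF assms(1), of "%i w. (1 + w * a i) * (1 + w * b i)"])
 qed
 show "avg I (%u. (\<Prod>i\<in>I. 1 + u i * a i) * (\<Prod>i\<in>I. 1 + u i * b i)) <= exp (\<Sum>i\<in>I. a i * b i)"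
  unfolding E exp_sum[OF assms(1)]
 proof (intro prod_mono conjI)
  fix i assume "i \<in> I"
  then show "0 <= 1 + a i * b i" using ab[of i] by linarith
  show "1 + a i * b i <= exp (a i * b i)" by (rule exp_ge_add_one_self)
 qed
 have "exp ((\<Sum>i\<in>I. a i * b i) - 2 * (\<Sum>i\<in>I. (a i * b i)\<^sup>2)) = exp (\<Sum>i\<in>I. a i * b i - 2 * (a i * b i)\<^sup>2)"
  by (simp add: sum_subtractf sum_distrib_left)
 also have "... <= (\<Prod>i\<in>I. 1 + a i * b i)"
  unfolding exp_sum[OF assms(1)]
  using ab by (intro prod_mono) (force intro!: one_plus_ge_exp)
 finally show "avg I (%u. (\<Prod>i\<in>I. 1 + u i * a i) * (\<Prod>i\<in>I. 1 + u i * b i))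
   \<ge> exp ((\<Sum>i\<in>I. a i * b i) - 2 * (\<Sum>i\<in>I. (a i * b i)\<^sup>2))"
  unfolding E .
qed

text \<open>Bounds the third-order terms that cutting probabilities at 1 costs.\<close>

lemma avg_three_products_upper:
 assumes "finite I" "\<And>i. i \<in> I ==> \<bar>a i\<bar> <= 1/2" "\<And>i. i \<in> I ==> \<bar>b i\<bar> <= 1/2"
 shows "avg I (%u. (\<Prod>i\<in>I. 1 + u i * a i)\<^sup>2 * (\<Prod>i\<in>I. 1 + u i * b i))
  <= exp (2 * (\<Sum>i\<in>I. (a i)\<^sup>2) + (\<Sum>i\<in>I. (b i)\<^sup>2))"
proof -
 have ab: "\<bar>a i * b i\<bar> <= 1 / 4" if "i \<in> I" for i
  using mult_mono[OF assms(2)[OF that] assms(3)[OF that]] by (simp add: abs_mult)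
 have "avg I (%u. (\<Prod>i\<in>I. 1 + u i * a i)\<^sup>2 * (\<Prod>i\<in>I. 1 + u i * b i))
   = (\<Prod>i\<in>I. 1 + (a i)\<^sup>2 + 2 * (a i * b i))"
 proof -
  have "((1 + (-1) * a i)\<^sup>2 * (1 + (-1) * b i) + (1 + 1 * a i)\<^sup>2 * (1 + 1 * b i)) / 2
    = 1 + (a i)\<^sup>2 + 2 * (a i * b i)" for i
   by (simp add: algebra_simps power2_eq_square)
  then show ?thesis
   unfolding prod_power_distrib prod.distrib[symmetric]
   by (simp only: avg_prod[OF assms(1), of "%i w. (1 + w * a i)\<^sup>2 * (1 + w * b i)"])
 qed
 also have "... <= (\<Prod>i\<in>I. exp (2 * (a i)\<^sup>2 + (b i)\<^sup>2))"
 proof (intro prod_mono conjI)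
  fix i assume i: "i \<in> I"
  have "0 <= (a i)\<^sup>2" by simp
  then show "0 <= 1 + (a i)\<^sup>2 + 2 * (a i * b i)" using ab[OF i] by linarith
  have "0 <= (a i - b i)\<^sup>2" by simp
  then have "1 + (a i)\<^sup>2 + 2 * (a i * b i) <= 1 + (2 * (a i)\<^sup>2 + (b i)\<^sup>2)"
   by (simp add: power2_eq_square algebra_simps)
  also have "... <= exp (2 * (a i)\<^sup>2 + (b i)\<^sup>2)" by (rule exp_ge_add_one_self)
  finally show "1 + (a i)\<^sup>2 + 2 * (a i * b i) <= exp (2 * (a i)\<^sup>2 + (b i)\<^sup>2)" .
 qed
 also have "... = exp (2 * (\<Sum>i\<in>I. (a i)\<^sup>2) + (\<Sum>i\<in>I. (b i)\<^sup>2))"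
  by (simp add: exp_sum[OF assms(1), symmetric] sum.distrib sum_distrib_left)
 finally show ?thesis .
qed

text \<open>The cut at 1 is paid for by cubic terms which, unlike the minimum, have averages that
  factor over the signs.\<close>

lemma min_one_product_ge:
 fixes x y :: real
 assumes "0 <= x" "0 <= y"
 shows "min 1 x * min 1 y \<ge> x * y - x\<^sup>2 * y - y\<^sup>2 * x"
proof (cases "x <= 1 & y <= 1")
 case True
 then have "min 1 x * min 1 y = x * y" by simp
 moreover have "0 <= x\<^sup>2 * y" "0 <= y\<^sup>2 * x" using assms by simp_all
 ultimately show ?thesis by linarith
next
 case False
 have "x * y - x\<^sup>2 * y - y\<^sup>2 * x = x * y * (1 - x - y)" by (simp add: algebra_simps power2_eq_square)
 also have "... <= 0" using False assms by (intro mult_nonneg_nonpos) auto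
 also have "0 <= min 1 x * min 1 y" using assms by simp
 finally show ?thesis .
qed

lemma exp_le_one_plus_abs:
 fixes x c :: real
 assumes "\<bar>x\<bar> <= c"
 shows "exp x <= 1 + \<bar>x\<bar> * exp c"
proof (cases "x <= 0")
 case True
 then have "exp x <= 1" by simp
 moreover have "0 <= \<bar>x\<bar> * exp c" by simp
 ultimately show ?thesis by linarith
next
 case False
 have "1 - x <= exp (- x)" using exp_ge_add_one_self[of "- x"] by simp
 then have "exp x * (1 - x) <= exp x * exp (- x)" by (intro mult_left_mono) auto
 then have "exp x <= 1 + x * exp x" by (simp add: algebra_simps flip: exp_add)
 also have "x * exp x <= x * exp c" using False assms by (intro mult_left_mono) auto
 finally show ?thesis using False by simp
qed

section \<open>From orthonormal vectors to fractional dense sets\<close>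

context substochastic
begin

text \<open>Vertex \<open>i\<close> is taken with probability \<open>q i * hh u i\<close> cut at 1,
  where \<open>hh u i\<close> is a product version of the exponential of a random sign combination
  of the coordinates of \<open>v i\<close>. Two such weights correlate like the exponential of the
  scaled inner product, so the form gains the first-order term
  \<open>\<mu>\<^sup>2 * \<Lambda> / 2 * vv i k\<close>, and \<open>\<Lambda>\<close>, of order
  \<open>L\<close>, cancels the \<open>1 / L\<close> in \<open>form\<close>. Near orthogonality of
  most pairs, as in \<open>corr\<close>, keeps the second moment of the total size under
  control.\<close>

lemma spread_rounding:
 fixes v :: "nat => nat => real" and D :: nat and \<mu> L h N :: real
 defines "vv \<equiv> %i k. \<Sum>t<D. v i t * v k t"
 assumes U': "U' \<subseteq> U" and N: "N = real (card U)" "0 < N" and D: "0 < D"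
  and L: "0 < L" "\<mu> = exp (- L)" and h: "1 <= h"
  and form: "(\<Sum>i\<in>U'. \<Sum>k\<in>U'. A i k * vv i k) \<ge> N / (64 * L)"
  and len: "\<And>i. i \<in> U' ==> vv i i <= h"
  and total: "(\<Sum>i\<in>U'. vv i i) <= 2 * N"
  and corr: "(\<Sum>i\<in>U'. \<Sum>k\<in>U'. (vv i k)\<^sup>2) <= 4 * N\<^sup>2 / D"
  and D_big: "L / 5 * h * exp (L / 10) <= sqrt D"
  and mu_small: "2 * h ^ 3 * \<mu> * exp (3 * (L / 10)) <= 1 / 1280 - 1 / 2000"
 shows "\<exists>p. (\<forall>i. 0 <= p i & p i <= 1) & (\<forall>i. i ~: U' --> p i = 0) &
  (\<forall>i\<in>U'. \<forall>k\<in>U'. (\<forall>t<D. v i t = v k t) --> p i = p k) &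
  ip p (ap p) - 1 / 30000 * (\<mu> * (\<Sum>i\<in>U. p i) + (\<Sum>i\<in>U. p i)\<^sup>2 / N) \<ge> \<mu>\<^sup>2 * N / 20000"
proof -
 \<comment> \<open>One tenth of \<open>L\<close>: third moments of order
   \<open>exp (3 * \<Lambda>)\<close> then still lose against the additional factor
   \<open>\<mu> = exp (- L)\<close> of the cubic terms.\<close>
 define \<Lambda> where "\<Lambda> = L / 10"
 have lam: "0 < \<Lambda>" using L by (simp add: \<Lambda>_def)
 have mu: "0 < \<mu>" using L by simp
 have fU': "finite U'" using U' finU finite_subset by blast
 \<comment> \<open>Each coordinate is spread over \<open>K\<close> independent signs, so that every
   factor of \<open>hh\<close> lies between 1/2 and 3/2 and the squares of the products
   \<open>a i \<tau> * a k \<tau>\<close> sum to at most 1/4.\<close>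
 define K where "K = nat \<lceil>4 * \<Lambda>\<^sup>2 + 4 * \<Lambda> + 1\<rceil>"
 have K: "4 * \<Lambda>\<^sup>2 <= K" "4 * \<Lambda> <= K" "0 < K"
 proof -
  have "4 * \<Lambda>\<^sup>2 + 4 * \<Lambda> + 1 <= real K" unfolding K_def by linarith
  moreover have "0 <= 4 * \<Lambda>\<^sup>2" by simp
  ultimately show "4 * \<Lambda>\<^sup>2 <= K" "4 * \<Lambda> <= K" using lam by linarith+
  show "0 < K" using lam \<open>4 * \<Lambda> <= K\<close> by (metis mult_pos_pos of_nat_0_less_iff order_less_le_trans zero_less_numeral)
 qed
 define I where "I = {..<D} \<times> {..<K}"
 have fI: "finite I" by (simp add: I_def)
 define m where "m i = max 1 (vv i i)" for i
 define q where "q i = \<mu> * m i" for i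
 \<comment> \<open>The scaling bounds the variance \<open>(s i)\<^sup>2 * vv i i\<close> of the
   exponent by \<open>\<Lambda>\<close>. Long vectors get a larger base probability
   \<open>q i\<close> in return, so that \<open>q i * s i\<close> is never below
   \<open>\<mu> * sqrt \<Lambda>\<close>.\<close>
 define s where "s i = sqrt (\<Lambda> / m i)" for i
 define a where "a i = (%(t, l::nat). s i * v i t / sqrt K)" for i
 define hh where "hh u i = (\<Prod>\<tau>\<in>I. 1 + u \<tau> * a i \<tau>)" for u i
 have m1: "1 <= m i" for i by (simp add: m_def)
 have mh: "m i <= h" if "i \<in> U'" for i using len[OF that] h by (simp add: m_def)
 have vv0: "0 <= vv i i" for i by (simp add: vv_def sum_nonneg)
 have s0: "0 < s i" for i using m1[of i] lam by (auto simp: s_def intro!: divide_pos_pos)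
 have s2: "(s i)\<^sup>2 * vv i i <= \<Lambda>" for i
 proof -
  have "(s i)\<^sup>2 = \<Lambda> / m i" using m1[of i] lam by (simp add: s_def)
  moreover have "vv i i <= m i" by (simp add: m_def)
  moreover have "(\<Lambda> / m i) * vv i i <= (\<Lambda> / m i) * m i"
   using lam m1[of i] by (intro mult_left_mono) (auto simp: m_def)
  ultimately show ?thesis using m1[of i] by simp
 qed
 have sum_ab: "(\<Sum>\<tau>\<in>I. a i \<tau> * a k \<tau>) = s i * s k * vv i k" for i k
 proof -
  have "(\<Sum>\<tau>\<in>I. a i \<tau> * a k \<tau>) = (\<Sum>t<D. \<Sum>l<K. s i * v i t / sqrt K * (s k * v k t / sqrt K))"
   by (simp add: I_def a_def sum.cartesian_product')
  also have "... = (\<Sum>t<D. real K * (s i * v i t / sqrt K * (s k * v k t / sqrt K)))"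
   by simp
  also have "... = (\<Sum>t<D. s i * s k * (v i t * v k t))"
   using K by (intro sum.cong) (auto simp: field_simps)
  finally show ?thesis by (simp add: vv_def sum_distrib_left)
 qed
 have sum_a2: "(\<Sum>\<tau>\<in>I. (a i \<tau>)\<^sup>2) <= \<Lambda>" for i
  using sum_ab[of i i] s2[of i] by (simp add: power2_eq_square)
 have a2: "(a i \<tau>)\<^sup>2 <= \<Lambda> / K" if tauI: "\<tau> \<in> I" for i \<tau>
 proof -
  obtain t l where \<tau>: "\<tau> = (t, l)" "t < D" using tauI by (auto simp: I_def)
  have "(v i t)\<^sup>2 <= vv i i" unfolding vv_def using \<tau> 
   by (auto simp: power2_eq_square intro!: member_le_sum[of t "{..<D}" "%t. v i t * v i t"])
  then have "(s i)\<^sup>2 * (v i t)\<^sup>2 <= \<Lambda>" using s2[of i] mult_left_mono[of "(v i t)\<^sup>2" "vv i i" "(s i)\<^sup>2"] by simp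
  then show ?thesis using K \<tau> by (simp add: a_def power_divide power_mult_distrib divide_right_mono)
 qed
 have a_half: "\<bar>a i \<tau>\<bar> <= 1 / 2" if "\<tau> \<in> I" for i \<tau>
 proof -
  have "\<Lambda> / K <= 1 / 4" using K by (simp add: field_simps)
  also have "1 / 4 = (1 / 2 :: real)\<^sup>2" by (simp add: power2_eq_square)
  finally have "(a i \<tau>)\<^sup>2 <= (1 / 2)\<^sup>2" using a2[OF that, of i] by linarith
  then show ?thesis by (simp add: abs_le_square_iff[symmetric])
 qed
 have a4: "2 * (\<Sum>\<tau>\<in>I. (a i \<tau> * a k \<tau>)\<^sup>2) <= 1 / 2" for i k
 proof -
  have "(\<Sum>\<tau>\<in>I. (a i \<tau> * a k \<tau>)\<^sup>2) <= (\<Sum>\<tau>\<in>I. (a i \<tau>)\<^sup>2 * (\<Lambda> / K))"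
   unfolding power_mult_distrib using a2 by (intro sum_mono mult_left_mono) auto
  also have "... = (\<Sum>\<tau>\<in>I. (a i \<tau>)\<^sup>2) * (\<Lambda> / K)" by (rule sum_distrib_right[symmetric])
  also have "... <= \<Lambda> * (\<Lambda> / K)" using sum_a2 lam by (intro mult_right_mono) auto
  also have "... <= 1 / 4" using K by (simp add: field_simps power2_eq_square)
  finally show ?thesis by simp
 qed
 have hh0: "0 <= hh u i" if "u \<in> signs I" for u i
  unfolding hh_def
 proof (intro prod_nonneg)
  fix \<tau> assume "\<tau> \<in> I"
  then show "0 <= 1 + u \<tau> * a i \<tau>" using a_half[of \<tau> i] signs_abs[OF that, of \<tau>] by auto
 qed
 have E1: "avg I (%u. hh u i) = 1" for i
  unfolding hh_def using avg_prod[OF fI, of "%\<tau> w. 1 + w * a i \<tau>"] by simp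
 have E2u: "avg I (%u. hh u i * hh u k) <= exp (s i * s k * vv i k)" for i k
  unfolding hh_def sum_ab[symmetric] by (rule avg_two_products_upper(1)[OF fI a_half a_half])
 have E2l: "avg I (%u. hh u i * hh u k) \<ge> exp (s i * s k * vv i k) / 2" for i k
 proof -
  have "exp (s i * s k * vv i k) / 2 <= exp (s i * s k * vv i k) * exp (- (1 / 2))"
   using exp_ge_add_one_self[of "- (1/2) :: real"] by simp
  also have "... = exp (s i * s k * vv i k - 1 / 2)" by (simp flip: exp_add)
  also have "... <= exp ((\<Sum>\<tau>\<in>I. a i \<tau> * a k \<tau>) - 2 * (\<Sum>\<tau>\<in>I. (a i \<tau> * a k \<tau>)\<^sup>2))"
   using a4[of i k] by (simp add: sum_ab)
  also have "... <= avg I (%u. hh u i * hh u k)"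
   unfolding hh_def by (rule avg_two_products_upper(2)[OF fI a_half a_half])
  finally show ?thesis .
 qed
 have E3: "avg I (%u. (hh u i)\<^sup>2 * hh u k) <= exp (3 * \<Lambda>)" for i k
 proof -
  have "avg I (%u. (hh u i)\<^sup>2 * hh u k) <= exp (2 * (\<Sum>\<tau>\<in>I. (a i \<tau>)\<^sup>2) + (\<Sum>\<tau>\<in>I. (a k \<tau>)\<^sup>2))"
   unfolding hh_def by (rule avg_three_products_upper[OF fI a_half a_half])
  also have "... <= exp (3 * \<Lambda>)" using sum_a2[of i] sum_a2[of k] by simp
  finally show ?thesis .
 qed
 have q0: "0 < q i" for i using mu m1[of i] by (simp add: q_def)
 have qh: "q i <= \<mu> * h" if "i \<in> U'" for i using mu mh[OF that] by (simp add: q_def)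
 have sumq: "(\<Sum>i\<in>U'. q i) <= 3 * \<mu> * N"
 proof -
  have "(\<Sum>i\<in>U'. q i) <= (\<Sum>i\<in>U'. \<mu> * (1 + vv i i))"
   using mu vv0 by (intro sum_mono) (auto simp: q_def m_def intro!: mult_left_mono)
  also have "... = \<mu> * (real (card U') + (\<Sum>i\<in>U'. vv i i))"
   by (simp add: sum.distrib flip: sum_distrib_left)
  also have "... <= \<mu> * (N + 2 * N)"
   using total card_mono[OF finU U'] N mu by (intro mult_left_mono add_mono) auto
  finally show ?thesis by simp
 qed
 define P where "P u i = (if i \<in> U' then min 1 (q i * hh u i) else 0)" for u i
 define W where "W u = (\<Sum>i\<in>U'. q i * hh u i)" for u
 \<comment> \<open>A lower bound for the objective at \<open>P u\<close>, written in terms whose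
   averages over the signs are under control.\<close>
 define F where "F u = (\<Sum>i\<in>U'. \<Sum>k\<in>U'. A i k * (q i * q k * (hh u i * hh u k)
    - (q i)\<^sup>2 * q k * ((hh u i)\<^sup>2 * hh u k) - (q k)\<^sup>2 * q i * ((hh u k)\<^sup>2 * hh u i)))
   - 1 / 30000 * (\<mu> * W u + (W u)\<^sup>2 / N)" for u
 have sumP: "(\<Sum>i\<in>U. P u i) <= W u" "0 <= (\<Sum>i\<in>U. P u i)" if "u \<in> signs I" for u
 proof -
  have "(\<Sum>i\<in>U. P u i) = (\<Sum>i\<in>U'. P u i)"
   using U' finU by (intro sum.mono_neutral_right) (auto simp: P_def)
  also have "... <= W u" unfolding W_def by (intro sum_mono) (auto simp: P_def)
  finally show "(\<Sum>i\<in>U. P u i) <= W u" .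
  show "0 <= (\<Sum>i\<in>U. P u i)" using hh0[OF that] q0 by (intro sum_nonneg) (auto simp: P_def less_imp_le)
 qed
 have FP: "F u <= ip (P u) (ap (P u)) - 1 / 30000 * (\<mu> * (\<Sum>i\<in>U. P u i) + (\<Sum>i\<in>U. P u i)\<^sup>2 / N)"
  if u: "u \<in> signs I" for u
 proof -
  have "(\<Sum>i\<in>U'. \<Sum>k\<in>U'. A i k * (q i * q k * (hh u i * hh u k)
    - (q i)\<^sup>2 * q k * ((hh u i)\<^sup>2 * hh u k) - (q k)\<^sup>2 * q i * ((hh u k)\<^sup>2 * hh u i)))
    <= (\<Sum>i\<in>U'. \<Sum>k\<in>U'. A i k * (P u i * P u k))"
  proof (intro sum_mono mult_left_mono A_nonneg)
   fix i k assume "i \<in> U'" "k \<in> U'"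
   then show "q i * q k * (hh u i * hh u k) - (q i)\<^sup>2 * q k * ((hh u i)\<^sup>2 * hh u k)
     - (q k)\<^sup>2 * q i * ((hh u k)\<^sup>2 * hh u i) <= P u i * P u k"
    using min_one_product_ge[of "q i * hh u i" "q k * hh u k"] q0[of i] q0[of k] hh0[OF u, of i] hh0[OF u, of k]
    by (simp add: P_def power_mult_distrib mult_ac)
  qed
  also have "... = ip (P u) (ap (P u))"
  proof -
   have "(\<Sum>k\<in>U'. A i k * (P u i * P u k)) = (\<Sum>k\<in>U. A i k * (P u i * P u k))" for i
    using U' finU by (intro sum.mono_neutral_left) (auto simp: P_def)
   moreover have "(\<Sum>i\<in>U'. \<Sum>k\<in>U. A i k * (P u i * P u k)) = (\<Sum>i\<in>U. \<Sum>k\<in>U. A i k * (P u i * P u k))"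
    using U' finU by (intro sum.mono_neutral_left) (auto simp: P_def)
   ultimately show ?thesis by (simp add: ip_ap)
  qed
  finally have 1: "(\<Sum>i\<in>U'. \<Sum>k\<in>U'. A i k * (q i * q k * (hh u i * hh u k)
    - (q i)\<^sup>2 * q k * ((hh u i)\<^sup>2 * hh u k) - (q k)\<^sup>2 * q i * ((hh u k)\<^sup>2 * hh u i))) <= ip (P u) (ap (P u))" .
  have 2: "\<mu> * (\<Sum>i\<in>U. P u i) + (\<Sum>i\<in>U. P u i)\<^sup>2 / N <= \<mu> * W u + (W u)\<^sup>2 / N"
   using sumP[OF u] mu N by (intro add_mono mult_left_mono divide_right_mono power_mono) auto
  show ?thesis unfolding F_def using 1 2 by (intro diff_mono mult_left_mono) auto
 qed
 have EW: "avg I W <= 3 * \<mu> * N"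
  unfolding W_def avg_sum avg_scale E1 using sumq by simp
 \<comment> \<open>Uncorrelated weights would give the square of the mean, at most
   \<open>9 * \<mu>\<^sup>2 * N\<^sup>2\<close>. The excess is governed by the sum of the
   \<open>\<bar>vv i k\<bar>\<close>, which is small by \<open>corr\<close> and Cauchy-Schwarz;
   \<open>D_big\<close> makes it at most \<open>\<mu>\<^sup>2 * N\<^sup>2\<close>.\<close>
 have EW2: "avg I (%u. (W u)\<^sup>2) <= 10 * \<mu>\<^sup>2 * N\<^sup>2"
 proof -
  have "avg I (%u. (W u)\<^sup>2) = avg I (%u. \<Sum>i\<in>U'. \<Sum>k\<in>U'. q i * q k * (hh u i * hh u k))"
   by (simp add: W_def power2_eq_square sum_product mult_ac)
  also have "... = (\<Sum>i\<in>U'. \<Sum>k\<in>U'. q i * q k * avg I (%u. hh u i * hh u k))"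
   by (simp add: avg_sum avg_scale)
  also have "... <= (\<Sum>i\<in>U'. \<Sum>k\<in>U'. q i * q k + \<mu>\<^sup>2 * \<Lambda> * h * exp \<Lambda> * \<bar>vv i k\<bar>)"
  proof (intro sum_mono)
   fix i k assume ik: "i \<in> U'" "k \<in> U'"
   have cs: "(vv i k)\<^sup>2 <= vv i i * vv k k"
    using Cauchy_Schwarz_ineq_sum[of "v i" "v k" "{..<D}"] by (simp add: vv_def power2_eq_square)
   have "(s i * s k * vv i k)\<^sup>2 <= ((s i)\<^sup>2 * vv i i) * ((s k)\<^sup>2 * vv k k)"
    using mult_left_mono[OF cs, of "(s i * s k)\<^sup>2"] by (simp add: power_mult_distrib mult_ac)
   also have "... <= \<Lambda> * \<Lambda>" using s2 vv0 lam by (intro mult_mono) auto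
   finally have "(s i * s k * vv i k)\<^sup>2 <= \<Lambda>\<^sup>2" by (simp add: power2_eq_square)
   then have "\<bar>s i * s k * vv i k\<bar> <= \<Lambda>" using lam by (simp add: abs_le_square_iff[symmetric])
   then have "exp (s i * s k * vv i k) <= 1 + \<bar>s i * s k * vv i k\<bar> * exp \<Lambda>" by (rule exp_le_one_plus_abs)
   then have "avg I (%u. hh u i * hh u k) <= 1 + s i * s k * \<bar>vv i k\<bar> * exp \<Lambda>"
    using E2u[of i k] s0[of i] s0[of k] by (simp add: abs_mult)
   then have "q i * q k * avg I (%u. hh u i * hh u k) <= q i * q k * (1 + s i * s k * \<bar>vv i k\<bar> * exp \<Lambda>)"
    using q0 by (intro mult_left_mono) (auto simp: less_imp_le)
   also have "... = q i * q k + (q i * s i) * (q k * s k) * exp \<Lambda> * \<bar>vv i k\<bar>" by (simp add: algebra_simps)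
   also have "(q i * s i) * (q k * s k) * exp \<Lambda> * \<bar>vv i k\<bar> <= \<mu>\<^sup>2 * \<Lambda> * h * exp \<Lambda> * \<bar>vv i k\<bar>"
   proof (intro mult_right_mono)
    have qs: "q j * s j <= \<mu> * sqrt (\<Lambda> * h)" if "j \<in> U'" for j
    proof -
     have "m j * s j = sqrt (\<Lambda> * m j)"
      using m1[of j] lam by (simp add: s_def real_sqrt_mult real_sqrt_divide) (simp add: field_simps)
     also have "... <= sqrt (\<Lambda> * h)" using mh[OF that] lam by simp
     finally show ?thesis using mu by (simp add: q_def mult.assoc)
    qed
    have "(q i * s i) * (q k * s k) <= (\<mu> * sqrt (\<Lambda> * h)) * (\<mu> * sqrt (\<Lambda> * h))"
     using q0[of k] s0[of k] mu lam h by (intro mult_mono[OF qs[OF ik(1)] qs[OF ik(2)]]) auto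
    also have "... = \<mu>\<^sup>2 * \<Lambda> * h" using lam h by (simp add: power2_eq_square)
    finally show "(q i * s i) * (q k * s k) <= \<mu>\<^sup>2 * \<Lambda> * h" .
   qed auto
   finally show "q i * q k * avg I (%u. hh u i * hh u k) <= q i * q k + \<mu>\<^sup>2 * \<Lambda> * h * exp \<Lambda> * \<bar>vv i k\<bar>" by simp
  qed
  also have "... = (\<Sum>i\<in>U'. q i)\<^sup>2 + \<mu>\<^sup>2 * \<Lambda> * h * exp \<Lambda> * (\<Sum>i\<in>U'. \<Sum>k\<in>U'. \<bar>vv i k\<bar>)"
  proof -
   have "(\<Sum>i\<in>U'. \<Sum>k\<in>U'. q i * q k) = (\<Sum>i\<in>U'. q i)\<^sup>2"
    unfolding power2_eq_square sum_product ..
   moreover have "(\<Sum>i\<in>U'. \<Sum>k\<in>U'. \<mu>\<^sup>2 * \<Lambda> * h * exp \<Lambda> * \<bar>vv i k\<bar>)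
     = \<mu>\<^sup>2 * \<Lambda> * h * exp \<Lambda> * (\<Sum>i\<in>U'. \<Sum>k\<in>U'. \<bar>vv i k\<bar>)"
    by (simp only: sum_distrib_left)
   ultimately show ?thesis by (simp only: sum.distrib)
  qed
  also have "... <= (3 * \<mu> * N)\<^sup>2 + \<mu>\<^sup>2 * \<Lambda> * h * exp \<Lambda> * (N * (2 * N / sqrt D))"
  proof (intro add_mono power_mono sumq mult_left_mono)
   have "(\<Sum>p\<in>U' \<times> U'. \<bar>case p of (i, k) => vv i k\<bar> * 1)\<^sup>2
     <= (\<Sum>p\<in>U' \<times> U'. (\<bar>case p of (i, k) => vv i k\<bar>)\<^sup>2) * (\<Sum>p\<in>U' \<times> U'. 1\<^sup>2)"
    by (rule Cauchy_Schwarz_ineq_sum)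
   also have "(\<Sum>p\<in>U' \<times> U'. (\<bar>case p of (i, k) => vv i k\<bar>)\<^sup>2) = (\<Sum>i\<in>U'. \<Sum>k\<in>U'. (vv i k)\<^sup>2)"
    by (simp add: sum.cartesian_product')
   also have "(\<Sum>p\<in>U' \<times> U'. 1\<^sup>2) = (real (card U'))\<^sup>2" by (simp add: card_cartesian_product power2_eq_square)
   also have "(\<Sum>i\<in>U'. \<Sum>k\<in>U'. (vv i k)\<^sup>2) * (real (card U'))\<^sup>2 <= 4 * N\<^sup>2 / D * N\<^sup>2"
    using corr card_mono[OF finU U'] N by (intro mult_mono power_mono) (auto intro: sum_nonneg)
   also have "... = (N * (2 * N / sqrt D))\<^sup>2" using D by (simp add: power_mult_distrib power_divide)
   finally have "(\<Sum>p\<in>U' \<times> U'. \<bar>case p of (i, k) => vv i k\<bar> * 1) <= N * (2 * N / sqrt D)"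
    by (rule power2_le_imp_le) (use N in auto)
   then show "(\<Sum>i\<in>U'. \<Sum>k\<in>U'. \<bar>vv i k\<bar>) <= N * (2 * N / sqrt D)"
    by (simp add: sum.cartesian_product')
  qed (use q0 lam h in \<open>auto intro!: sum_nonneg simp: less_imp_le\<close>)
  also have "... = 9 * \<mu>\<^sup>2 * N\<^sup>2 + \<mu>\<^sup>2 * N\<^sup>2 * ((L / 5 * h * exp (L / 10)) / sqrt D)"
   by (simp add: \<Lambda>_def power2_eq_square)
  also have "... <= 9 * \<mu>\<^sup>2 * N\<^sup>2 + \<mu>\<^sup>2 * N\<^sup>2 * 1"
   using D_big D by (intro add_mono mult_left_mono) auto
  finally show ?thesis by (simp add: mult_ac)
 qed
 have EF: "avg I F \<ge> \<mu>\<^sup>2 * N / 20000"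
 proof -
  have "avg I F = (\<Sum>i\<in>U'. \<Sum>k\<in>U'. A i k * (q i * q k * avg I (%u. hh u i * hh u k)
    - (q i)\<^sup>2 * q k * avg I (%u. (hh u i)\<^sup>2 * hh u k) - (q k)\<^sup>2 * q i * avg I (%u. (hh u k)\<^sup>2 * hh u i)))
   - 1 / 30000 * (\<mu> * avg I W + avg I (%u. (W u)\<^sup>2) / N)"
   unfolding F_def avg_diff avg_sum avg_scale avg_add
   using avg_scale[of I "1 / N" "%u. (W u)\<^sup>2"] by (simp add: avg_sum avg_scale avg_diff)
  also have "... \<ge> (\<Sum>i\<in>U'. \<Sum>k\<in>U'. A i k * (\<mu>\<^sup>2 * \<Lambda> / 2 * vv i k - 2 * ((\<mu> * h) ^ 3 * exp (3 * \<Lambda>))))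
   - 1 / 30000 * (\<mu> * (3 * \<mu> * N) + (10 * \<mu>\<^sup>2 * N\<^sup>2) / N)"
  proof (rule diff_mono)
   show "(\<Sum>i\<in>U'. \<Sum>k\<in>U'. A i k * (\<mu>\<^sup>2 * \<Lambda> / 2 * vv i k - 2 * ((\<mu> * h) ^ 3 * exp (3 * \<Lambda>))))
    <= (\<Sum>i\<in>U'. \<Sum>k\<in>U'. A i k * (q i * q k * avg I (%u. hh u i * hh u k)
    - (q i)\<^sup>2 * q k * avg I (%u. (hh u i)\<^sup>2 * hh u k) - (q k)\<^sup>2 * q i * avg I (%u. (hh u k)\<^sup>2 * hh u i)))"
   proof (intro sum_mono mult_left_mono A_nonneg)
    fix i k assume ik: "i \<in> U'" "k \<in> U'"
    have cub: "(q i)\<^sup>2 * q k * avg I (%u. (hh u i)\<^sup>2 * hh u k) <= (\<mu> * h) ^ 3 * exp (3 * \<Lambda>)"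
     if "i \<in> U'" "k \<in> U'" for i k
    proof -
     have "(q i)\<^sup>2 * q k * avg I (%u. (hh u i)\<^sup>2 * hh u k) <= (q i)\<^sup>2 * q k * exp (3 * \<Lambda>)"
      using E3[of i k] q0[of k] by (intro mult_left_mono) auto
     also have "... <= (\<mu> * h)\<^sup>2 * (\<mu> * h) * exp (3 * \<Lambda>)"
      using qh[OF that(1)] qh[OF that(2)] q0[of i] q0[of k] mu h
      by (intro mult_right_mono mult_mono power_mono) auto
     finally show ?thesis by (simp add: power2_eq_square power3_eq_cube)
    qed
    \<comment> \<open>For a nonpositive inner product the left side is nonpositive and the average
      positive; otherwise \<open>exp x\<close> is at least \<open>x\<close>.\<close>
    have main: "\<mu>\<^sup>2 * \<Lambda> / 2 * vv i k <= q i * q k * avg I (%u. hh u i * hh u k)"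
    proof (cases "vv i k <= 0")
     case True
     have "0 <= exp (s i * s k * vv i k) / 2" by simp
     then have "0 <= avg I (%u. hh u i * hh u k)" using E2l[of i k] by linarith
     then have "0 <= q i * q k * avg I (%u. hh u i * hh u k)" using q0[of i] q0[of k] by simp
     moreover have "\<mu>\<^sup>2 * \<Lambda> / 2 * vv i k <= 0" using True lam by (intro mult_nonneg_nonpos) auto
     ultimately show ?thesis by linarith
    next
     case False
     have "s i * s k * vv i k / 2 <= exp (s i * s k * vv i k) / 2"
      using exp_ge_add_one_self[of "s i * s k * vv i k"] by linarith
     then have x: "s i * s k * vv i k / 2 <= avg I (%u. hh u i * hh u k)" using E2l[of i k] by linarith
     have qs: "q j * s j \<ge> \<mu> * sqrt \<Lambda>" for j
     proof -
      have "m j * s j = sqrt (\<Lambda> * m j)"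
       using m1[of j] lam by (simp add: s_def real_sqrt_mult real_sqrt_divide) (simp add: field_simps)
      also have "... \<ge> sqrt \<Lambda>" using m1[of j] lam by simp
      finally show ?thesis using mu by (simp add: q_def mult.assoc)
     qed
     have "\<mu>\<^sup>2 * \<Lambda> / 2 * vv i k = (\<mu> * sqrt \<Lambda>) * (\<mu> * sqrt \<Lambda>) * (vv i k / 2)"
      using lam by (simp add: power2_eq_square)
     also have "... <= (q i * s i) * (q k * s k) * (vv i k / 2)"
      using q0[of i] s0[of i] mu lam False by (intro mult_right_mono mult_mono[OF qs qs]) auto
     also have "... = q i * q k * (s i * s k * vv i k / 2)" by simp
     also have "... <= q i * q k * avg I (%u. hh u i * hh u k)"
      using x q0[of i] q0[of k] by (intro mult_left_mono) auto
     finally show ?thesis .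
    qed
    show "\<mu>\<^sup>2 * \<Lambda> / 2 * vv i k - 2 * ((\<mu> * h) ^ 3 * exp (3 * \<Lambda>)) <= q i * q k * avg I (%u. hh u i * hh u k)
    - (q i)\<^sup>2 * q k * avg I (%u. (hh u i)\<^sup>2 * hh u k) - (q k)\<^sup>2 * q i * avg I (%u. (hh u k)\<^sup>2 * hh u i)"
     using main cub[OF ik] cub[OF ik(2) ik(1)] by linarith
   qed
   show "1 / 30000 * (\<mu> * avg I W + avg I (%u. (W u)\<^sup>2) / N) <= 1 / 30000 * (\<mu> * (3 * \<mu> * N) + (10 * \<mu>\<^sup>2 * N\<^sup>2) / N)"
    using EW EW2 mu N by (intro mult_left_mono add_mono divide_right_mono) auto
  qed
  finally have 1: "avg I F \<ge> (\<Sum>i\<in>U'. \<Sum>k\<in>U'. A i k * (\<mu>\<^sup>2 * \<Lambda> / 2 * vv i k - 2 * ((\<mu> * h) ^ 3 * exp (3 * \<Lambda>))))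
   - 1 / 30000 * (\<mu> * (3 * \<mu> * N) + (10 * \<mu>\<^sup>2 * N\<^sup>2) / N)" .
  have "(\<Sum>i\<in>U'. \<Sum>k\<in>U'. A i k * (\<mu>\<^sup>2 * \<Lambda> / 2 * vv i k - 2 * ((\<mu> * h) ^ 3 * exp (3 * \<Lambda>))))
    = \<mu>\<^sup>2 * \<Lambda> / 2 * (\<Sum>i\<in>U'. \<Sum>k\<in>U'. A i k * vv i k) - (2 * ((\<mu> * h) ^ 3 * exp (3 * \<Lambda>))) * (\<Sum>i\<in>U'. \<Sum>k\<in>U'. A i k)"
  proof -
   have "(\<Sum>i\<in>U'. \<Sum>k\<in>U'. A i k * (c * vv i k - e)) = c * (\<Sum>i\<in>U'. \<Sum>k\<in>U'. A i k * vv i k) - e * (\<Sum>i\<in>U'. \<Sum>k\<in>U'. A i k)" for c e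
    by (simp add: right_diff_distrib sum_subtractf sum_distrib_left mult.left_commute mult.commute[of _ e])
   then show ?thesis .
  qed
  also have "... \<ge> \<mu>\<^sup>2 * \<Lambda> / 2 * (N / (64 * L)) - (2 * ((\<mu> * h) ^ 3 * exp (3 * \<Lambda>))) * N"
  proof (intro diff_mono mult_left_mono form)
   have "(\<Sum>i\<in>U'. \<Sum>k\<in>U'. A i k) <= (\<Sum>i\<in>U'. 1)" using U' by (intro sum_mono row_sum_le) auto
   also have "... <= N" using card_mono[OF finU U'] N by simp
   finally show "(\<Sum>i\<in>U'. \<Sum>k\<in>U'. A i k) <= N" .
  qed (use mu lam h in auto)
  finally have 2: "(\<Sum>i\<in>U'. \<Sum>k\<in>U'. A i k * (\<mu>\<^sup>2 * \<Lambda> / 2 * vv i k - 2 * ((\<mu> * h) ^ 3 * exp (3 * \<Lambda>))))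
    \<ge> \<mu>\<^sup>2 * \<Lambda> / 2 * (N / (64 * L)) - (2 * ((\<mu> * h) ^ 3 * exp (3 * \<Lambda>))) * N" .
  \<comment> \<open>The main term is \<open>1 / 1280\<close>. By \<open>mu_small\<close> the cubic
    terms leave at least \<open>1 / 2000\<close> of it, and the penalty \<open>13 / 30000\<close>
    comes from the constants 3 and 10 in \<open>EW\<close> and \<open>EW2\<close>.\<close>
  have "\<mu>\<^sup>2 * \<Lambda> / 2 * (N / (64 * L)) - (2 * ((\<mu> * h) ^ 3 * exp (3 * \<Lambda>))) * N
    - 1 / 30000 * (\<mu> * (3 * \<mu> * N) + (10 * \<mu>\<^sup>2 * N\<^sup>2) / N)
    = \<mu>\<^sup>2 * N * (1 / 1280 - 2 * h ^ 3 * \<mu> * exp (3 * (L / 10)) - 13 / 30000)"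
   using L N by (simp add: \<Lambda>_def field_simps power2_eq_square power3_eq_cube)
  also have "... \<ge> \<mu>\<^sup>2 * N * (1 / 20000)"
   using mu_small N by (intro mult_left_mono) auto
  finally have 3: "\<mu>\<^sup>2 * N * (1 / 20000) <= \<mu>\<^sup>2 * \<Lambda> / 2 * (N / (64 * L)) - (2 * ((\<mu> * h) ^ 3 * exp (3 * \<Lambda>))) * N
    - 1 / 30000 * (\<mu> * (3 * \<mu> * N) + (10 * \<mu>\<^sup>2 * N\<^sup>2) / N)" .
  show ?thesis using order_trans[OF 3 order_trans[OF diff_right_mono[OF 2] 1]] by (simp only: mult_1_right times_divide_eq_right)
 qed
 obtain u where u: "u \<in> signs I" "\<mu>\<^sup>2 * N / 20000 <= F u" using avg_attained[OF fI EF] by blast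
 have same: "P u i = P u k" if "i \<in> U'" "k \<in> U'" "\<forall>t<D. v i t = v k t" for i k
 proof -
  have vvs: "vv i i = vv k k" using that by (simp add: vv_def)
  have "a i \<tau> = a k \<tau>" if "\<tau> \<in> I" for \<tau>
   using that \<open>\<forall>t<D. v i t = v k t\<close> vvs by (auto simp: a_def s_def m_def I_def)
  then have "hh u i = hh u k" unfolding hh_def by (intro prod.cong) auto
  then show ?thesis using that vvs by (simp add: P_def q_def m_def)
 qed
 show ?thesis
 proof (intro exI[of _ "P u"] conjI allI ballI impI)
  show "0 <= P u i" "P u i <= 1" for i using hh0[OF u(1), of i] q0[of i] by (auto simp: P_def)
  show "P u i = 0" if "i ~: U'" for i using that by (simp add: P_def)
  show "P u i = P u k" if "i \<in> U'" "k \<in> U'" "\<forall>t<D. v i t = v k t" for i k using that by (rule same)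
  show "\<mu>\<^sup>2 * N / 20000 <= ip (P u) (ap (P u)) - 1 / 30000 * (\<mu> * sum (P u) U + (sum (P u) U)\<^sup>2 / N)"
   using FP[OF u(1)] u(2) by linarith
 qed
qed

text \<open>Up-sets stand for threshold sets without naming a threshold, so scaling the vector by a
  positive factor changes nothing.\<close>

definition upper :: "(nat => real) => nat set => bool" where
 "upper y X \<longleftrightarrow> X \<subseteq> U & (\<forall>i\<in>X. \<forall>k\<in>U. y i <= y k --> k \<in> X)"

text \<open>A fractional set \<open>P / q\<close> that is constant on the atoms of \<open>m\<close>
  threshold sets. With \<open>A\<close> the pair weights over \<open>d\<close> and
  \<open>\<mu> = M / n\<close>, the final inequality is a fractional form of
  \<open>dense 30000 d M\<close>, which the rounding turns into an actual set.\<close>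

definition dense_candidate :: "(nat => real) set => nat => nat => real => real => bool" where
 "dense_candidate Y m q \<mu> n \<longleftrightarrow> (\<exists>Xs P. (\<forall>b<m. \<exists>y\<in>Y. upper y (Xs b)) &
   (\<forall>i. P i <= q) & (\<forall>i. i ~: U --> P i = 0) &
   (\<forall>i\<in>U. \<forall>k\<in>U. (\<forall>b<m. i \<in> Xs b \<longleftrightarrow> k \<in> Xs b) --> P i = P k) &
   ip (%i. real (P i) / real q) (ap (%i. real (P i) / real q))
    > 1 / 30000 * (\<mu> * (\<Sum>i\<in>U. real (P i) / real q) + (\<Sum>i\<in>U. real (P i) / real q)\<^sup>2 / n))"

text \<open>The integral case. Two threshold sets are allowed because a level set of an absolute
  value, or the union of two level sets, is not a threshold set of a single vector.\<close>

lemma dense_candidateI_set: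
 assumes X: "X \<subseteq> U" and q: "0 < q" and m: "2 <= m"
  and y: "y0 \<in> Y" "upper y0 X0" "y1 \<in> Y" "upper y1 X1"
  and resp: "\<And>i k. i \<in> U ==> k \<in> U ==> (i \<in> X0 \<longleftrightarrow> k \<in> X0) ==> (i \<in> X1 \<longleftrightarrow> k \<in> X1) ==> i \<in> X \<longleftrightarrow> k \<in> X"
  and big: "inner_weight A X > 1 / 30000 * (\<mu> * real (card X) + (real (card X))\<^sup>2 / n)"
 shows "dense_candidate Y m q \<mu> n"
 unfolding dense_candidate_def
proof (intro exI[of _ "%b. if b = 0 then X0 else X1"] exI[of _ "%i. if i \<in> X then q else 0"] conjI)
 have ind: "(%i. real (if i \<in> X then q else 0) / real q) = (%i. if i \<in> X then 1 else 0)"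
  using q by auto
 have s: "(\<Sum>i\<in>U. if i \<in> X then 1 else 0 :: real) = real (card X)"
  using X finU by (simp add: Int_absorb1 flip: sum.inter_restrict)
 show "ip (%i. real (if i \<in> X then q else 0) / real q) (ap (%i. real (if i \<in> X then q else 0) / real q))
  > 1 / 30000 * (\<mu> * (\<Sum>i\<in>U. real (if i \<in> X then q else 0) / real q)
    + (\<Sum>i\<in>U. real (if i \<in> X then q else 0) / real q)\<^sup>2 / n)"
  unfolding ind s inner_weight_ip[OF X] by (rule big)
 show "\<forall>i\<in>U. \<forall>k\<in>U. (\<forall>b<m. i \<in> (if b = 0 then X0 else X1) \<longleftrightarrow> k \<in> (if b = 0 then X0 else X1)) -->
   (if i \<in> X then q else 0) = (if k \<in> X then q else 0)"
 proof (intro ballI impI)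
  fix i k assume ik: "i \<in> U" "k \<in> U"
   and b: "\<forall>b<m. i \<in> (if b = 0 then X0 else X1) \<longleftrightarrow> k \<in> (if b = 0 then X0 else X1)"
  have "i \<in> X0 \<longleftrightarrow> k \<in> X0" using b m by (auto dest: spec[of _ 0])
  moreover have "i \<in> X1 \<longleftrightarrow> k \<in> X1" using b m by (auto dest: spec[of _ 1])
  ultimately show "(if i \<in> X then q else 0) = (if k \<in> X then q else 0)" using resp[OF ik] by auto
 qed
qed (use X y in auto)

lemma upper_ge: "upper y {i \<in> U. \<theta> <= y i}"
 by (auto simp: upper_def)

lemma upper_gr: "upper y {i \<in> U. \<theta> < y i}"
 by (auto simp: upper_def)

lemma pivoted_coeff_le:
 assumes "pivoted k \<eta> t w xs T z" "1 <= \<eta>" "s < t" "t <= D"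
 shows "\<bar>xs s i\<bar> <= 2 ^ D"
proof (cases "i \<in> T")
 case True
 then have "i \<in> U" using assms(1) by (auto simp: pivoted_def)
 then have "\<bar>xs s i\<bar> <= l1 (xs s)" unfolding l1_def using finU by (intro member_le_sum) auto
 also have "... <= 2 ^ t / \<eta>" using assms by (auto simp: pivoted_def)
 also have "... <= 2 ^ t / 1" using assms by (intro divide_left_mono) auto
 also have "... <= 2 ^ D" using assms by simp
 finally show ?thesis .
next
 case False
 then show ?thesis using assms by (auto simp: pivoted_def)
qed

lemma nq_proj: "ortho t w ==> nq (proj t w f) = (\<Sum>s<t. (ip f (w s))\<^sup>2)"
 unfolding proj_def by (rule nq_comb)

lemma ip_f_proj: "ip f (proj t w f) = (\<Sum>s<t. (ip f (w s))\<^sup>2)"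
 unfolding proj_def ip_sum_right by (simp add: power2_eq_square)

lemma nq_res: "ortho t w ==> nq (res t w f) = nq f - nq (proj t w f)"
proof -
 assume o: "ortho t w"
 have "ip (res t w f) (proj t w f) = 0" unfolding proj_def by (rule ip_comb_res[OF o])
 then have "nq (res t w f) = ip (res t w f) f"
  using ip_diff_right[of "res t w f" f "proj t w f"] by (simp add: res_def)
 also have "... = nq f - ip f (proj t w f)"
  using ip_diff_right[of f f "proj t w f"] by (simp add: res_def ip_sym)
 finally show ?thesis by (simp add: ip_f_proj nq_proj[OF o])
qed

lemma ip_ap_diff:
 "ip (%i. x i - y i) (ap (%i. x i - y i)) = ip x (ap x) - 2 * ip x (ap y) + ip y (ap y)"
proof -
 have ap: "ap (%i. x i - y i) = (%i. ap x i - ap y i)"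
  by (auto simp: ap_def right_diff_distrib sum_subtractf)
 have l: "ip (%i. x i - y i) z = ip x z - ip y z" for z
  using ip_diff_right[of z x y] by (simp only: ip_sym[of _ z])
 have "ip y (ap x) = ip x (ap y)" by (metis ip_ap_sym ip_sym)
 then show ?thesis unfolding ap ip_diff_right l by simp
qed

text \<open>The only property of the enumerated family \<open>Y\<close> that the analysis relies on;
  it keeps the digit encoding out of the linear algebra.\<close>

definition approximable :: "(nat => real) set => nat => nat => real => real => bool" where
 "approximable Y k D b \<epsilon> \<longleftrightarrow> (\<forall>x T. T \<subseteq> U --> card T <= D --> (\<forall>i. i ~: T --> x i = 0) --> (\<forall>i. \<bar>x i\<bar> <= b) -->
   (\<exists>y\<in>Y. \<forall>i\<in>U. \<bar>y i - (B ^^ k) x i\<bar> <= \<epsilon>) & (\<exists>y\<in>Y. \<forall>i\<in>U. \<bar>y i - ap ((B ^^ k) x) i\<bar> <= \<epsilon>))"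

text \<open>The residual of the indicator of \<open>S\<close> has form at most
  \<open>\<rho> * l / 2\<close>, its projection \<open>y\<close> has nonnegative form, and the
  indicator itself has form at least \<open>\<rho> * l\<close>. Expanding the form of the residual
  leaves at least \<open>\<rho> * l / 4\<close> for the sum of \<open>ap y\<close> over
  \<open>S\<close>, which is what \<open>two_level_sets_dense\<close> asks for.\<close>

lemma dense_candidate_low_rank:
 assumes p: "pivoted k \<eta> t w xs T z" and t: "t <= D"
  and short: "\<forall>v\<in>U. nq (res t w ((B ^^ k) (unit v))) < \<eta>\<^sup>2"
  and k: "1 <= k" and eta: "1 <= \<eta>" and rho: "0 < \<rho>" "\<rho> <= 1"
  and k1: "real (card U) * \<eta> < (1 + \<rho> / 2) ^ k"
  and k2: "(1 + \<rho> / 4) ^ k * (real D * 2 ^ D) <= \<eta>"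
  and S: "S \<subseteq> U" "real (card S) <= l" "inner_weight A S \<ge> \<rho> * l" and l: "l = \<mu> * n" "0 < l" "0 < n"
  and Y: "approximable Y k D (real D * real (card U) * 2 ^ D) \<epsilon>" and eps: "\<epsilon> <= \<rho> / 2 ^ 10"
  and mu: "1 / 30000 * (\<mu> * 2 ^ 13 / \<rho>\<^sup>2 + \<mu> * 2 ^ 26 / \<rho> ^ 4) < \<rho> ^ 6 / 2 ^ 26"
  and q: "0 < q" and m: "2 <= m"
 shows "dense_candidate Y m q \<mu> n"
proof -
 define f :: "nat => real" where "f = (%i. if i \<in> S then 1 else 0)"
 define y where "y = proj t w f"
 define x where "x = (%i. \<Sum>s<t. ip f (w s) * xs s i)"
 let ?g = "res t w f"
 have o: "ortho t w" using p by (simp add: pivoted_def)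
 have T: "T \<subseteq> U" "card T <= D" using p t by (auto simp: pivoted_def)
 have fS: "finite S" using S finU finite_subset by blast
 have nf: "nq f = real (card S)"
 proof -
  have "nq f = (\<Sum>i\<in>U. if i \<in> S then 1 else 0)" unfolding ip_def f_def by (intro sum.cong) auto
  then show ?thesis using S finU by (simp add: Int_absorb1 flip: sum.inter_restrict)
 qed
 have yx: "y = (B ^^ k) x"
  unfolding y_def proj_def x_def using p by (subst B_pow_sum) (auto simp: pivoted_def intro!: sum.cong)
 have ny: "nq y <= l" using nq_res[OF o, of f] nq_nonneg[of ?g] nf S(2) by (simp add: y_def)
 have ng: "nq ?g <= l" using nq_res[OF o, of f] nq_nonneg[of y] nf S(2) by (simp add: y_def)
 have "ip ?g (B ?g) <= (1 + \<rho> / 2) * nq ?g"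
  using eta rho k1 short by (intro res_rayleigh[OF o, of \<eta>]) auto
 then have "ip ?g (ap ?g) <= \<rho> / 2 * nq ?g" by (simp add: ip_B algebra_simps)
 also have "... <= \<rho> / 2 * l" using ng rho by (intro mult_left_mono) auto
 finally have g: "ip ?g (ap ?g) <= \<rho> / 2 * l" .
 have "real t * 2 ^ t <= real D * 2 ^ D" using t by (intro mult_mono) auto
 then have "(1 + \<rho> / 4) ^ k * (real t * 2 ^ t) <= \<eta>"
  using k2 rho by (intro order_trans[OF mult_left_mono k2]) auto
 then have "ip y (B y) \<ge> (1 + \<rho> / 4) * nq y"
  unfolding y_def proj_def using eta rho k by (intro span_rayleigh[OF p]) auto
 then have "ip y (ap y) \<ge> \<rho> / 4 * nq y" by (simp add: ip_B algebra_simps)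
 then have yy: "ip y (ap y) \<ge> 0" using rho nq_nonneg[of y] by (meson divide_nonneg_nonneg less_imp_le mult_nonneg_nonneg order_trans zero_le_numeral)
 have "ip ?g (ap ?g) = ip f (ap f) - 2 * ip f (ap y) + ip y (ap y)"
  unfolding res_def y_def by (rule ip_ap_diff)
 moreover have "ip f (ap f) = inner_weight A S" unfolding f_def by (rule inner_weight_ip[OF S(1)])
 ultimately have "ip f (ap y) \<ge> \<rho> * l / 4" using g yy S(3) by linarith
 moreover have "ip f (ap y) = (\<Sum>i\<in>S. ap y i)"
  unfolding ip_def f_def using S finU by (intro sum.mono_neutral_cong_right) auto
 ultimately have fy: "(\<Sum>i\<in>S. ap y i) \<ge> \<rho> * l / 4" by simp
 have x0: "\<forall>i. i ~: T --> x i = 0" using p by (auto simp: x_def pivoted_def intro!: sum.neutral)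
 have "\<forall>i. \<bar>x i\<bar> <= real D * real (card U) * 2 ^ D"
 proof
  fix i
  have "\<bar>x i\<bar> <= (\<Sum>s<t. \<bar>ip f (w s)\<bar> * \<bar>xs s i\<bar>)"
   unfolding x_def by (rule order_trans[OF sum_abs]) (simp add: abs_mult)
  also have "... <= (\<Sum>s<t. real (card U) * 2 ^ D)"
  proof (intro sum_mono mult_mono)
   fix s assume s: "s \<in> {..<t}"
   have c: "card S <= card U" using card_mono[OF finU S(1)] .
   have "\<bar>ip f (w s)\<bar> <= sqrt (nq f) * sqrt (nq (w s))" by (rule ip_le_sqrt)
   also have "... = sqrt (real (card S))" using nf o s by (simp add: ortho_def)
   also have "... <= real (card S)"
    by (cases "card S = 0") (auto intro!: real_le_lsqrt simp: power2_eq_square)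
   finally show "\<bar>ip f (w s)\<bar> <= real (card U)" using c by linarith
   show "\<bar>xs s i\<bar> <= 2 ^ D" using s by (intro pivoted_coeff_le[OF p eta _ t]) auto
  qed auto
  also have "... = real t * (real (card U) * 2 ^ D)" by simp
  also have "... <= real D * (real (card U) * 2 ^ D)" using t by (intro mult_right_mono) auto
  finally show "\<bar>x i\<bar> <= real D * real (card U) * 2 ^ D" by (simp add: mult.assoc)
 qed
 then obtain y0 y1 where y01: "y0 \<in> Y" "\<forall>i\<in>U. \<bar>y0 i - y i\<bar> <= \<epsilon>" "y1 \<in> Y" "\<forall>i\<in>U. \<bar>y1 i - ap y i\<bar> <= \<epsilon>"
  using Y[unfolded approximable_def, rule_format, OF T] x0 unfolding yx by blast
 define X where "X = {i \<in> U. \<rho> / 32 <= y0 i} \<union> {i \<in> U. \<rho> / 16 <= y1 i}"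
 have eX: "inner_weight A X \<ge> \<rho> ^ 6 * l / 2 ^ 26" "real (card X) <= 2 ^ 13 * l / \<rho>\<^sup>2"
  using two_level_sets_dense[OF S(1,2) rho l(2) ny fy _ _ eps X_def] y01 by auto
 have mu0: "0 < \<mu>" using l by (simp add: zero_less_mult_iff)
 have "1 / 30000 * (\<mu> * real (card X) + (real (card X))\<^sup>2 / n)
   <= 1 / 30000 * (\<mu> * (2 ^ 13 * l / \<rho>\<^sup>2) + (2 ^ 13 * l / \<rho>\<^sup>2)\<^sup>2 / n)"
  using eX(2) mu0 l(3) by (intro mult_left_mono add_mono divide_right_mono power_mono) auto
 also have "... = l * (1 / 30000 * (\<mu> * 2 ^ 13 / \<rho>\<^sup>2 + \<mu> * 2 ^ 26 / \<rho> ^ 4))"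
  using l rho by (simp add: field_simps power2_eq_square eval_nat_numeral)
 also have "... < l * (\<rho> ^ 6 / 2 ^ 26)" using mu l(2) by (intro mult_strict_left_mono)
 also have "... <= inner_weight A X" using eX(1) by (simp add: mult.commute)
 finally have big: "1 / 30000 * (\<mu> * real (card X) + (real (card X))\<^sup>2 / n) < inner_weight A X" .
 show ?thesis
  by (rule dense_candidateI_set[OF _ q m y01(1) upper_ge[of y0 "\<rho> / 32"] y01(3) upper_ge[of y1 "\<rho> / 16"] _ big])
   (auto simp: X_def)
qed

text \<open>The \<open>D\<close> orthonormal vectors, scaled, are read as \<open>D\<close>
  coordinates of each vertex and rounded to a grid, so that membership in boundedly many threshold
  sets determines them. The vertices with long vectors form a small set \<open>H\<close>. If they
  carry much of the form, a level set of a single vector is already dense; otherwise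
  \<open>spread_rounding\<close> applies to the remaining vertices.\<close>

lemma dense_candidate_high_rank:
 fixes D G m q :: nat and L \<mu> n h \<gamma> \<epsilon> \<rho> :: real
 defines "N \<equiv> real (card U)"
 assumes w: "ortho D w" "\<And>t. t < D ==> ip (w t) (ap (w t)) \<ge> \<rho> / 4"
  and L: "0 < L" "\<mu> = exp (- L)" and rho: "\<rho> = 1 / (4 * L)" "\<rho> <= 1"
  and N: "0 < N" "N <= n" and D: "0 < D" and h: "h = 2 ^ 70 / \<rho> ^ 6"
  and y: "\<And>t. t < D ==> y t \<in> Y" "\<And>t i. t < D ==> i \<in> U ==> \<bar>y t i - w t i\<bar> <= \<epsilon>"
  and eps: "\<epsilon> * sqrt N <= \<rho> / 100" "\<epsilon> * sqrt N <= \<gamma>" "0 <= \<epsilon>"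
  and gam: "0 < \<gamma>" "2 * \<gamma> * D * (2 * sqrt h + 2 * \<gamma>) <= \<rho> / 32" "2 * \<gamma> * D * (2 * sqrt h + 2 * \<gamma>) <= 1 / sqrt D"
   "8 * \<gamma>\<^sup>2 * D <= h / 2" "sqrt h < real G * \<gamma>"
  and D_big: "L / 5 * h * exp (L / 10) <= sqrt D"
  and mu_small: "2 * h ^ 3 * \<mu> * exp (3 * (L / 10)) <= 1 / 1280 - 1 / 2000"
   "1 / 30000 * (\<mu> + 2 ^ 44 / (h * \<rho> ^ 4)) < \<rho>\<^sup>2 / 2 ^ 22"
  and q: "0 < q" "2 / real q < \<mu>\<^sup>2 / 20000" and m: "D * (2 * G + 1) <= m" "2 <= m"
 shows "dense_candidate Y m q \<mu> n"
proof -
 have rho0: "0 < \<rho>" using L rho by simp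
 have h1: "1 <= h" "0 < h"
 proof -
  have "\<rho> ^ 6 <= 1" using rho rho0 by (intro power_le_one) auto
  then show "1 <= h" using rho0 by (simp add: h field_simps)
  then show "0 < h" by simp
 qed
 \<comment> \<open>With this scale the squared lengths of the vertex vectors add up to
   \<open>N\<close>, so they are 1 on average.\<close>
 define \<sigma> where "\<sigma> = sqrt (N / D)"
 have sig: "0 < \<sigma>" "\<sigma>\<^sup>2 = N / D" using N D by (auto simp: \<sigma>_def)
 have sigN: "\<sigma> <= sqrt N" using D N by (simp add: \<sigma>_def field_simps)
 define W where "W i t = \<sigma> * w t i" for i t
 define z where "z i t = \<sigma> * y t i" for i t
 have zW: "\<bar>z i t - W i t\<bar> <= \<gamma>" if "t < D" "i \<in> U" for i t
 proof -
  have "\<bar>z i t - W i t\<bar> = \<sigma> * \<bar>y t i - w t i\<bar>" using sig by (simp add: z_def W_def abs_mult flip: right_diff_distrib)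
  also have "... <= sqrt N * \<epsilon>" using y(2)[OF that] sigN sig N by (intro mult_mono) auto
  finally show ?thesis using eps(2) by (simp add: mult.commute)
 qed
 define J where "J = {- int G..int G}"
 have cJ: "card J = 2 * G + 1" by (simp add: J_def)
 \<comment> \<open>Counting the thresholds passed rounds \<open>z i t\<close> down to the grid of
   width \<open>\<gamma>\<close>. Values beyond the \<open>2 * G + 1\<close> thresholds are clipped,
   and absolute values grow by at most \<open>\<gamma>\<close> in all cases.\<close>
 define v where "v i t = \<gamma> * (real (card {j \<in> J. real_of_int j * \<gamma> <= z i t}) - real G - 1)" for i t
 have v_in: "v i t <= z i t" "z i t <= v i t + \<gamma>" if "- real G * \<gamma> <= v i t" "v i t < real G * \<gamma>" for i t
 proof -
  define f where "f = \<lfloor>z i t / \<gamma>\<rfloor>"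
  have set: "{j \<in> J. real_of_int j * \<gamma> <= z i t} = {- int G..min f (int G)}"
   using gam(1) by (auto simp: J_def f_def le_floor_iff field_simps)
  have c: "real (card {j \<in> J. real_of_int j * \<gamma> <= z i t}) = real (nat (min f (int G) + int G + 1))"
   unfolding set by simp
  have "- real G <= real (nat (min f (int G) + int G + 1)) - real G - 1"
   using that(1) gam(1) unfolding v_def c by (metis mult.commute mult_le_cancel_left_pos)
  moreover have "real (nat (min f (int G) + int G + 1)) - real G - 1 < real G"
   using that(2) gam(1) unfolding v_def c by (metis mult.commute mult_less_cancel_left_pos)
  ultimately have "f < int G" "- int G <= f" by (auto simp: min_def split: if_splits)
  then have "v i t = \<gamma> * real_of_int f" unfolding v_def c by simp
  moreover have "real_of_int f <= z i t / \<gamma>" "z i t / \<gamma> < real_of_int f + 1" unfolding f_def by linarith+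
  ultimately show "v i t <= z i t" "z i t <= v i t + \<gamma>" using gam(1) by (auto simp: field_simps)
 qed
 have v_abs: "\<bar>v i t\<bar> <= \<bar>z i t\<bar> + \<gamma>" for i t
 proof (cases "- real G * \<gamma> <= v i t & v i t < real G * \<gamma>")
  case True
  then show ?thesis using v_in[of i t] by auto
 next
  case False
  show ?thesis
  proof (cases "v i t < - real G * \<gamma>")
   case True
   have "card {j \<in> J. real_of_int j * \<gamma> <= z i t} < 1"
   proof (rule ccontr)
    assume "\<not> ?thesis"
    then have "1 <= real (card {j \<in> J. real_of_int j * \<gamma> <= z i t})" by linarith
    then have "\<gamma> * (- real G) <= v i t" unfolding v_def using gam(1) by (intro mult_left_mono) auto
    then show False using True by (simp add: mult.commute)
   qed
   moreover have "finite {j \<in> J. real_of_int j * \<gamma> <= z i t}" by (rule finite_subset[of _ J]) (auto simp: J_def)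
   ultimately have e: "{j \<in> J. real_of_int j * \<gamma> <= z i t} = {}" by (metis card_eq_0_iff less_one)
   then have "- int G ~: {j \<in> J. real_of_int j * \<gamma> <= z i t}" by blast
   then have "z i t < - real G * \<gamma>" by (auto simp: J_def)
   moreover have "v i t = - (real G * \<gamma>) - \<gamma>" unfolding v_def e by (simp add: algebra_simps)
   moreover have "0 <= real G * \<gamma>" using gam(1) by simp
   ultimately show ?thesis using gam(1) by linarith
  next
   case nl: False
   then have ge: "real G * \<gamma> <= v i t" using False by simp
   have "card {j \<in> J. real_of_int j * \<gamma> <= z i t} <= card J" by (intro card_mono) (auto simp: J_def)
   then have "real (card {j \<in> J. real_of_int j * \<gamma> <= z i t}) <= 2 * real G + 1" using cJ by linarith
   then have "v i t <= \<gamma> * real G" unfolding v_def using gam(1) by (intro mult_left_mono) auto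
   then have vG: "v i t = real G * \<gamma>" using ge by (simp add: mult.commute)
   then have "\<gamma> * (real (card {j \<in> J. real_of_int j * \<gamma> <= z i t}) - real G - 1) = \<gamma> * real G"
    unfolding v_def by (simp add: mult.commute)
   then have "real (card {j \<in> J. real_of_int j * \<gamma> <= z i t}) = real (card J)" using gam(1) cJ by simp
   then have "{j \<in> J. real_of_int j * \<gamma> <= z i t} = J" by (intro card_subset_eq) (auto simp: J_def)
   then have "int G \<in> {j \<in> J. real_of_int j * \<gamma> <= z i t}" by (simp add: J_def)
   then have "real G * \<gamma> <= z i t" by simp
   then show ?thesis using vG gam(1) by simp
  qed
 qed
 define vv where "vv i k = (\<Sum>t<D. v i t * v k t)" for i k
 define WW where "WW i k = (\<Sum>t<D. W i t * W k t)" for i k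
 define H where "H = {i \<in> U. h < vv i i}"
 define U' where "U' = U - H"
 have U': "U' \<subseteq> U" "H \<subseteq> U" by (auto simp: U'_def H_def)
 have WW_sum: "(\<Sum>i\<in>U. WW i i) = N"
 proof -
  have "(\<Sum>i\<in>U. WW i i) = (\<Sum>t<D. \<sigma>\<^sup>2 * nq (w t))"
   unfolding WW_def by (subst sum.swap) (simp add: W_def ip_def sum_distrib_left power2_eq_square mult_ac)
  also have "... = (\<Sum>t<D. \<sigma>\<^sup>2)" using w(1) by (intro sum.cong) (auto simp: ortho_def)
  finally show ?thesis using sig D by simp
 qed
 \<comment> \<open>The double sum over vertices factors into the squared inner products of the
   vectors \<open>w t\<close>, of which orthonormality leaves only the \<open>D\<close> diagonal
   ones.\<close>
 have WW_sq: "(\<Sum>i\<in>U. \<Sum>k\<in>U. (WW i k)\<^sup>2) = N\<^sup>2 / D"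
 proof -
  have "(\<Sum>i\<in>U. \<Sum>k\<in>U. (WW i k)\<^sup>2) = (\<Sum>i\<in>U. \<Sum>k\<in>U. \<Sum>t<D. \<Sum>s<D. (W i t * W i s) * (W k t * W k s))"
   by (simp add: WW_def power2_eq_square sum_product mult_ac)
  also have "... = (\<Sum>i\<in>U. \<Sum>t<D. \<Sum>s<D. \<Sum>k\<in>U. (W i t * W i s) * (W k t * W k s))"
  proof (rule sum.cong[OF refl])
   fix i
   show "(\<Sum>k\<in>U. \<Sum>t<D. \<Sum>s<D. (W i t * W i s) * (W k t * W k s)) = (\<Sum>t<D. \<Sum>s<D. \<Sum>k\<in>U. (W i t * W i s) * (W k t * W k s))"
    by (rule trans[OF sum.swap], rule sum.cong[OF refl], rule sum.swap)
  qed
  also have "... = (\<Sum>t<D. \<Sum>s<D. \<Sum>i\<in>U. \<Sum>k\<in>U. (W i t * W i s) * (W k t * W k s))"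
   by (rule trans[OF sum.swap], rule sum.cong[OF refl], rule sum.swap)
  also have "... = (\<Sum>t<D. \<Sum>s<D. (\<sigma>\<^sup>2 * ip (w t) (w s))\<^sup>2)"
   by (intro sum.cong refl) (simp add: W_def ip_def sum_product sum_distrib_left power2_eq_square mult_ac)
  also have "... = (\<Sum>t<D. \<Sum>s<D. if s = t then (\<sigma>\<^sup>2)\<^sup>2 else 0)"
   using w(1) by (intro sum.cong refl) (auto simp: ortho_def)
  also have "... = real D * (N / D)\<^sup>2" by (simp add: sig)
  also have "... = N\<^sup>2 / D" using D by (simp add: power2_eq_square field_simps)
  finally show ?thesis .
 qed
 have WW_form: "(\<Sum>i\<in>U. \<Sum>k\<in>U. A i k * WW i k) \<ge> \<rho> / 4 * N"
 proof -
  have "(\<Sum>i\<in>U. \<Sum>k\<in>U. A i k * WW i k) = (\<Sum>i\<in>U. \<Sum>k\<in>U. \<Sum>t<D. A i k * (W i t * W k t))"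
   by (simp add: WW_def sum_distrib_left)
  also have "... = (\<Sum>t<D. \<Sum>i\<in>U. \<Sum>k\<in>U. A i k * (W i t * W k t))"
   by (subst (2) sum.swap, subst sum.swap) simp
  also have "... = (\<Sum>t<D. \<sigma>\<^sup>2 * ip (w t) (ap (w t)))"
   unfolding ip_ap by (intro sum.cong refl) (simp add: W_def sum_distrib_left power2_eq_square mult_ac)
  also have "... \<ge> (\<Sum>t<D. \<sigma>\<^sup>2 * (\<rho> / 4))" using w(2) by (intro sum_mono mult_left_mono) auto
  also have "(\<Sum>t<D. \<sigma>\<^sup>2 * (\<rho> / 4)) = \<rho> / 4 * N" using D by (simp add: sig)
  finally show ?thesis .
 qed
 have cH: "real (card H) * (h / 4) <= N"
 proof -
  have "h / 4 <= WW i i" if "i \<in> H" for i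
  proof -
   have iU: "i \<in> U" using that by (simp add: H_def)
   have "vv i i <= (\<Sum>t<D. 2 * (W i t)\<^sup>2 + 8 * \<gamma>\<^sup>2)"
    unfolding vv_def
   proof (intro sum_mono)
    fix t assume "t \<in> {..<D}"
    then have "\<bar>v i t\<bar> <= \<bar>W i t\<bar> + 2 * \<gamma>" using v_abs[of i t] zW[of t i] iU by auto
    then have "\<bar>v i t\<bar>\<^sup>2 <= (\<bar>W i t\<bar> + 2 * \<gamma>)\<^sup>2" by (intro power_mono) auto
    also have "... <= 2 * (W i t)\<^sup>2 + 8 * \<gamma>\<^sup>2"
     using sum_squares_bound[of "\<bar>W i t\<bar>" "2 * \<gamma>"] by (simp add: power2_sum power_mult_distrib)
    finally show "v i t * v i t <= 2 * (W i t)\<^sup>2 + 8 * \<gamma>\<^sup>2" by (simp add: power2_eq_square)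
   qed
   also have "... = 2 * WW i i + 8 * \<gamma>\<^sup>2 * D"
    by (simp add: WW_def sum.distrib sum_distrib_left power2_eq_square)
   finally show ?thesis using that gam(4) by (simp add: H_def)
  qed
  then have "real (card H) * (h / 4) <= (\<Sum>i\<in>H. WW i i)"
   using sum_mono[of H "%_. h / 4" "%i. WW i i"] by simp
  also have "... <= (\<Sum>i\<in>U. WW i i)"
   using U' finU by (intro sum_mono2) (auto simp: WW_def intro!: sum_nonneg)
  finally show ?thesis by (simp add: WW_sum)
 qed
 show ?thesis
 \<comment> \<open>Either pairs touching \<open>H\<close> carry more than half of the form
   guaranteed by \<open>WW_form\<close>, and by averaging a single \<open>w t\<close> witnesses
   this, or at least half of that guarantee survives on \<open>U'\<close>.\<close>
 proof (cases "(\<Sum>i\<in>U. \<Sum>k\<in>U. if i \<in> H \<or> k \<in> H then A i k * WW i k else 0) > \<rho> / 8 * N")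
  case True
  have "(\<Sum>i\<in>U. \<Sum>k\<in>U. if i \<in> H \<or> k \<in> H then A i k * WW i k else 0)
    = (\<Sum>t<D. \<sigma>\<^sup>2 * (\<Sum>i\<in>U. \<Sum>k\<in>U. if i \<in> H \<or> k \<in> H then A i k * (w t i * w t k) else 0))"
  proof -
   have "(\<Sum>i\<in>U. \<Sum>k\<in>U. if i \<in> H \<or> k \<in> H then A i k * WW i k else 0)
     = (\<Sum>i\<in>U. \<Sum>k\<in>U. \<Sum>t<D. \<sigma>\<^sup>2 * (if i \<in> H \<or> k \<in> H then A i k * (w t i * w t k) else 0))"
    by (intro sum.cong refl) (auto simp: WW_def W_def sum_distrib_left power2_eq_square mult_ac)
   also have "... = (\<Sum>t<D. \<Sum>i\<in>U. \<Sum>k\<in>U. \<sigma>\<^sup>2 * (if i \<in> H \<or> k \<in> H then A i k * (w t i * w t k) else 0))"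
    by (subst (2) sum.swap, subst sum.swap) simp
   finally show ?thesis by (simp only: sum_distrib_left)
  qed
  then have gt: "(\<Sum>t<D. \<sigma>\<^sup>2 * (\<Sum>i\<in>U. \<Sum>k\<in>U. if i \<in> H \<or> k \<in> H then A i k * (w t i * w t k) else 0)) > \<rho> / 8 * N"
   using True by simp
  have "\<exists>t<D. (\<Sum>i\<in>U. \<Sum>k\<in>U. if i \<in> H \<or> k \<in> H then A i k * (w t i * w t k) else 0) > \<rho> / 8"
  proof (rule ccontr)
   assume neg: "\<not> ?thesis"
   have "(\<Sum>i\<in>U. \<Sum>k\<in>U. if i \<in> H \<or> k \<in> H then A i k * (w t i * w t k) else 0) <= \<rho> / 8" if "t \<in> {..<D}" for t
    using neg that by (meson lessThan_iff not_less)
   then have "(\<Sum>t<D. \<sigma>\<^sup>2 * (\<Sum>i\<in>U. \<Sum>k\<in>U. if i \<in> H \<or> k \<in> H then A i k * (w t i * w t k) else 0))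
     <= (\<Sum>t<D. \<sigma>\<^sup>2 * (\<rho> / 8))" by (intro sum_mono mult_left_mono) simp_all
   also have "... = \<rho> / 8 * N" using D by (simp add: sig)
   finally show False using gt by simp
  qed
  then obtain t where t: "t < D" "(\<Sum>i\<in>U. \<Sum>k\<in>U. if i \<in> H \<or> k \<in> H then A i k * (w t i * w t k) else 0) > \<rho> / 8"
   by auto
  let ?x = "y t"
  define e where "e i = y t i - w t i" for i
  have nw: "nq (w t) = 1" using w(1) t by (simp add: ortho_def)
  have ne: "sqrt (nq e) <= \<rho> / 100"
  proof -
   have "nq e <= (\<Sum>i\<in>U. \<epsilon>\<^sup>2)" unfolding ip_def
    using y(2)[OF t(1)] eps(3) by (intro sum_mono) (auto simp: e_def power2_eq_square[symmetric] abs_le_square_iff[symmetric])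
   also have "... = (\<epsilon> * sqrt N)\<^sup>2" using N by (simp add: N_def power_mult_distrib)
   finally have "sqrt (nq e) <= \<epsilon> * sqrt N" using eps(3) N by (intro real_le_lsqrt) (auto simp: nq_nonneg)
   then show ?thesis using eps(1) by simp
  qed
  have ye: "?x i = w t i + e i" for i by (simp add: e_def)
  have ny: "nq ?x <= 4"
  proof -
   have "nq ?x <= (\<Sum>i\<in>U. 2 * (w t i)\<^sup>2 + 2 * (e i)\<^sup>2)"
    unfolding ip_def
   proof (intro sum_mono)
    fix i
    show "?x i * ?x i <= 2 * (w t i)\<^sup>2 + 2 * (e i)\<^sup>2"
     using sum_squares_bound[of "w t i" "e i"] by (simp add: ye power2_eq_square algebra_simps)
   qed
   also have "... = 2 * nq (w t) + 2 * nq e" by (simp add: ip_def sum.distrib sum_distrib_left power2_eq_square)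
   also have "nq e <= 1"
   proof -
    have "sqrt (nq e) <= 1" using ne rho rho0 by linarith
    then show ?thesis by simp
   qed
   finally show ?thesis using nw by simp
  qed
  have touch: "(\<Sum>i\<in>U. \<Sum>k\<in>U. if i \<in> H \<or> k \<in> H then A i k * (\<bar>?x i\<bar> * \<bar>?x k\<bar>) else 0) \<ge> \<rho> / 16"
  proof -
   have "(\<Sum>i\<in>U. \<Sum>k\<in>U. if i \<in> H \<or> k \<in> H then A i k * (w t i * w t k) else 0)
    <= (\<Sum>i\<in>U. \<Sum>k\<in>U. (if i \<in> H \<or> k \<in> H then A i k * (\<bar>?x i\<bar> * \<bar>?x k\<bar>) else 0)
       + A i k * (\<bar>e i\<bar> * \<bar>?x k\<bar>) + A i k * (\<bar>w t i\<bar> * \<bar>e k\<bar>))"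
   proof (intro sum_mono)
    fix i k
    have "w t i * w t k = ?x i * ?x k - e i * ?x k - w t i * e k" by (simp add: ye algebra_simps)
    also have "... <= \<bar>?x i\<bar> * \<bar>?x k\<bar> + \<bar>e i\<bar> * \<bar>?x k\<bar> + \<bar>w t i\<bar> * \<bar>e k\<bar>"
     unfolding abs_mult[symmetric] by linarith
    finally have "A i k * (w t i * w t k) <= A i k * (\<bar>?x i\<bar> * \<bar>?x k\<bar> + \<bar>e i\<bar> * \<bar>?x k\<bar> + \<bar>w t i\<bar> * \<bar>e k\<bar>)"
     by (intro mult_left_mono) (simp_all add: A_nonneg)
    moreover have "0 <= A i k * (\<bar>e i\<bar> * \<bar>?x k\<bar>)" "0 <= A i k * (\<bar>w t i\<bar> * \<bar>e k\<bar>)" using A_nonneg by auto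
    ultimately show "(if i \<in> H \<or> k \<in> H then A i k * (w t i * w t k) else 0)
     <= (if i \<in> H \<or> k \<in> H then A i k * (\<bar>?x i\<bar> * \<bar>?x k\<bar>) else 0) + A i k * (\<bar>e i\<bar> * \<bar>?x k\<bar>) + A i k * (\<bar>w t i\<bar> * \<bar>e k\<bar>)"
     by (auto simp: distrib_left)
   qed
   also have "... = (\<Sum>i\<in>U. \<Sum>k\<in>U. (if i \<in> H \<or> k \<in> H then A i k * (\<bar>?x i\<bar> * \<bar>?x k\<bar>) else 0))
     + (\<Sum>i\<in>U. \<Sum>k\<in>U. A i k * (\<bar>e i\<bar> * \<bar>?x k\<bar>)) + (\<Sum>i\<in>U. \<Sum>k\<in>U. A i k * (\<bar>w t i\<bar> * \<bar>e k\<bar>))"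
    by (simp only: sum.distrib)
   also have "(\<Sum>i\<in>U. \<Sum>k\<in>U. A i k * (\<bar>e i\<bar> * \<bar>?x k\<bar>)) <= \<rho> / 100 * 2"
   proof (rule order_trans[OF form_abs_le], intro mult_mono ne)
    show "sqrt (nq ?x) <= 2" using real_sqrt_le_mono[OF ny] by simp
   qed (use rho0 in \<open>auto simp: nq_nonneg\<close>)
   also have "(\<Sum>i\<in>U. \<Sum>k\<in>U. A i k * (\<bar>w t i\<bar> * \<bar>e k\<bar>)) <= 1 * (\<rho> / 100)"
    using nw by (intro order_trans[OF form_abs_le] mult_mono ne) (auto simp: nq_nonneg)
   finally show ?thesis using t(2) rho0 by simp
  qed
  \<comment> \<open>Chosen so that the bound \<open>4 * N / h\<close> on \<open>card H\<close>
    yields precisely the requirement of \<open>level_set_dense\<close>.\<close>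
  define \<zeta> where "\<zeta> = h * \<rho>\<^sup>2 / (2 ^ 18 * N)"
  have zeta: "0 < \<zeta>" using h1 rho0 N by (simp add: \<zeta>_def)
  have "real (card H) * \<zeta> = (real (card H) * (h / 4)) * (\<rho>\<^sup>2 / (2 ^ 16 * N))" by (simp add: \<zeta>_def)
  also have "... <= N * (\<rho>\<^sup>2 / (2 ^ 16 * N))" using cH N by (intro mult_right_mono) auto
  finally have Hz: "real (card H) * \<zeta> <= \<rho>\<^sup>2 / 2 ^ 16" using N by simp
  obtain \<theta> where th: "0 < \<theta>" "{i \<in> U. \<theta> <= \<bar>?x i\<bar>} ~= {}"
    "inner_weight A {i \<in> U. \<theta> <= \<bar>?x i\<bar>} > \<rho>\<^sup>2 / 2 ^ 22 * real (card {i \<in> U. \<theta> <= \<bar>?x i\<bar>})"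
    "real (card {i \<in> U. \<theta> <= \<bar>?x i\<bar>}) <= 2 ^ 26 / (\<rho>\<^sup>2 * \<zeta>)"
   using level_set_dense[OF ny U'(2) Hz rho0 rho(2) zeta touch] by blast
  define X where "X = {i \<in> U. \<theta> <= \<bar>?x i\<bar>}"
  have cX: "0 < real (card X)" using th(2) finU by (simp add: X_def card_gt_0_iff)
  have "real (card X) <= 2 ^ 44 / (h * \<rho> ^ 4) * N"
   using th(4) by (simp add: X_def \<zeta>_def field_simps power2_eq_square eval_nat_numeral)
  also have "... <= 2 ^ 44 / (h * \<rho> ^ 4) * n" using N h1 rho0 by (intro mult_left_mono) auto
  finally have "real (card X) / n <= 2 ^ 44 / (h * \<rho> ^ 4)" using N by (simp add: field_simps)
  then have "\<mu> + real (card X) / n <= \<mu> + 2 ^ 44 / (h * \<rho> ^ 4)" by (rule add_left_mono)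
  then have "1 / 30000 * (\<mu> + real (card X) / n) <= 1 / 30000 * (\<mu> + 2 ^ 44 / (h * \<rho> ^ 4))"
   by (rule mult_left_mono) simp
  then have "1 / 30000 * (\<mu> + real (card X) / n) < \<rho>\<^sup>2 / 2 ^ 22"
   using mu_small(2) by (rule le_less_trans)
  then have "real (card X) * (1 / 30000 * (\<mu> + real (card X) / n)) < real (card X) * (\<rho>\<^sup>2 / 2 ^ 22)"
   using cX by (intro mult_strict_left_mono)
  also have "real (card X) * (\<rho>\<^sup>2 / 2 ^ 22) = \<rho>\<^sup>2 / 2 ^ 22 * real (card X)" by (rule mult.commute)
  also note th(3)[folded X_def]
  finally have "real (card X) * (1 / 30000 * (\<mu> + real (card X) / n)) < inner_weight A X" .
  moreover have "real (card X) * (1 / 30000 * (\<mu> + real (card X) / n)) = 1 / 30000 * (\<mu> * real (card X) + (real (card X))\<^sup>2 / n)"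
   by (simp add: algebra_simps power2_eq_square)
  ultimately have big: "1 / 30000 * (\<mu> * real (card X) + (real (card X))\<^sup>2 / n) < inner_weight A X" by simp
  show ?thesis
   by (rule dense_candidateI_set[OF _ q(1) m(2) y(1)[OF t(1)] upper_ge[of ?x \<theta>] y(1)[OF t(1)] upper_gr[of ?x "- \<theta>"] _ big])
    (auto simp: X_def abs_real_def split: if_splits)
 next
  case False
  have vin: "\<bar>v i t\<bar> <= sqrt h" "\<bar>v i t - W i t\<bar> <= 2 * \<gamma>" if "i \<in> U'" "t < D" for i t
  proof -
   have "(v i t)\<^sup>2 <= vv i i" unfolding vv_def using that
    by (auto simp: power2_eq_square intro!: member_le_sum[of t "{..<D}" "%t. v i t * v i t"])
   also have "... <= h" using that by (auto simp: U'_def H_def)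
   finally show a: "\<bar>v i t\<bar> <= sqrt h" using real_sqrt_le_mono by fastforce
   have "v i t <= z i t" "z i t <= v i t + \<gamma>" using v_in[of i t] a gam(5) by (auto simp: abs_le_iff)
   then show "\<bar>v i t - W i t\<bar> <= 2 * \<gamma>" using zW[of t i] that U' gam(1) by (auto simp: abs_le_iff)
  qed
  define \<theta> where "\<theta> = 2 * \<gamma> * D * (2 * sqrt h + 2 * \<gamma>)"
  have vW: "\<bar>vv i k - WW i k\<bar> <= \<theta>" if "i \<in> U'" "k \<in> U'" for i k
  proof -
   have "\<bar>vv i k - WW i k\<bar> <= (\<Sum>t<D. \<bar>v i t * v k t - W i t * W k t\<bar>)"
    unfolding vv_def WW_def sum_subtractf[symmetric] by (rule sum_abs)
   also have "... <= (\<Sum>t<D. 2 * \<gamma> * (2 * sqrt h + 2 * \<gamma>))"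
   proof (intro sum_mono)
    fix t assume "t \<in> {..<D}"
    then have t: "t < D" by simp
    have "v i t * v k t - W i t * W k t = (v i t - W i t) * v k t + W i t * (v k t - W k t)" by (simp add: algebra_simps)
    then have "\<bar>v i t * v k t - W i t * W k t\<bar> <= \<bar>v i t - W i t\<bar> * \<bar>v k t\<bar> + \<bar>W i t\<bar> * \<bar>v k t - W k t\<bar>"
     by (metis abs_mult abs_triangle_ineq)
    also have "... <= 2 * \<gamma> * sqrt h + (sqrt h + 2 * \<gamma>) * (2 * \<gamma>)"
     using vin[OF that(1) t] vin[OF that(2) t] gam(1) h1 by (intro add_mono mult_mono) auto
    finally show "\<bar>v i t * v k t - W i t * W k t\<bar> <= 2 * \<gamma> * (2 * sqrt h + 2 * \<gamma>)" by (simp add: algebra_simps)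
   qed
   also have "... = \<theta>" by (simp add: \<theta>_def)
   finally show ?thesis .
  qed
  have th: "\<theta> <= \<rho> / 32" "\<theta> <= 1 / sqrt D" "0 <= \<theta>" using gam h1 by (auto simp: \<theta>_def)
  have fU': "finite U'" using U' finU finite_subset by blast
  have cU': "real (card U') <= N" using card_mono[OF finU U'(1)] by (simp add: N_def)
  have form: "(\<Sum>i\<in>U'. \<Sum>k\<in>U'. A i k * vv i k) \<ge> N / (64 * L)"
  proof -
   have "(\<Sum>i\<in>U. \<Sum>k\<in>U. A i k * WW i k)
     = (\<Sum>i\<in>U. \<Sum>k\<in>U. if i \<in> H \<or> k \<in> H then A i k * WW i k else 0)
      + (\<Sum>i\<in>U. \<Sum>k\<in>U. if i \<in> H \<or> k \<in> H then 0 else A i k * WW i k)"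
    unfolding sum.distrib[symmetric] by (intro sum.cong refl) auto
   also have "(\<Sum>i\<in>U. \<Sum>k\<in>U. if i \<in> H \<or> k \<in> H then 0 else A i k * WW i k) = (\<Sum>i\<in>U'. \<Sum>k\<in>U'. A i k * WW i k)"
   proof -
    have "(\<Sum>k\<in>U. if i \<in> H \<or> k \<in> H then 0 else A i k * WW i k)
      = (if i \<in> H then 0 else \<Sum>k\<in>U'. A i k * WW i k)" for i
     using U' finU by (auto simp: U'_def intro!: sum.mono_neutral_cong_right)
    then show ?thesis using U' finU by (auto simp: U'_def intro!: sum.mono_neutral_cong_right)
   qed
   finally have "(\<Sum>i\<in>U'. \<Sum>k\<in>U'. A i k * WW i k) \<ge> \<rho> / 8 * N"
    using WW_form False by simp
   also have "(\<Sum>i\<in>U'. \<Sum>k\<in>U'. A i k * WW i k) <= (\<Sum>i\<in>U'. \<Sum>k\<in>U'. A i k * vv i k + A i k * \<theta>)"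
   proof (intro sum_mono)
    fix i k assume "i \<in> U'" "k \<in> U'"
    then have "WW i k <= vv i k + \<theta>" using vW[of i k] by (auto simp: abs_le_iff)
    from mult_left_mono[OF this A_nonneg] show "A i k * WW i k <= A i k * vv i k + A i k * \<theta>" by (simp add: distrib_left)
   qed
   also have "... = (\<Sum>i\<in>U'. \<Sum>k\<in>U'. A i k * vv i k) + (\<Sum>i\<in>U'. \<Sum>k\<in>U'. A i k) * \<theta>"
    by (simp add: sum.distrib sum_distrib_right)
   also have "(\<Sum>i\<in>U'. \<Sum>k\<in>U'. A i k) * \<theta> <= N * (\<rho> / 32)"
   proof (intro mult_mono th)
    have "(\<Sum>i\<in>U'. \<Sum>k\<in>U'. A i k) <= (\<Sum>i\<in>U'. 1)" using U' by (intro sum_mono row_sum_le) auto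
    then show "(\<Sum>i\<in>U'. \<Sum>k\<in>U'. A i k) <= N" using cU' by simp
   qed (use N in auto)
   finally have "(\<Sum>i\<in>U'. \<Sum>k\<in>U'. A i k * vv i k) \<ge> \<rho> * N * (3 / 32)" by (simp add: algebra_simps)
   moreover have "N / (64 * L) = \<rho> * N / 16" using L by (simp add: rho)
   moreover have "0 < \<rho> * N" using rho0 N by simp
   ultimately show ?thesis by simp
  qed
  have len: "vv i i <= h" if "i \<in> U'" for i using that by (auto simp: U'_def H_def)
  have th1: "\<theta> <= 1" using th(1) rho(2) by linarith
  have total: "(\<Sum>i\<in>U'. vv i i) <= 2 * N"
  proof -
   have "(\<Sum>i\<in>U'. vv i i) <= (\<Sum>i\<in>U'. WW i i + 1)"
   proof (intro sum_mono)
    fix i assume "i \<in> U'"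
    then show "vv i i <= WW i i + 1" using vW[of i i] th1 by (auto simp: abs_le_iff)
   qed
   also have "... = (\<Sum>i\<in>U'. WW i i) + real (card U')" by (simp add: sum.distrib)
   also have "(\<Sum>i\<in>U'. WW i i) <= N"
    unfolding WW_sum[symmetric] using U' finU by (intro sum_mono2) (auto simp: WW_def intro!: sum_nonneg)
   finally show ?thesis using cU' by simp
  qed
  have corr: "(\<Sum>i\<in>U'. \<Sum>k\<in>U'. (vv i k)\<^sup>2) <= 4 * N\<^sup>2 / D"
  proof -
   have "(\<Sum>i\<in>U'. \<Sum>k\<in>U'. (vv i k)\<^sup>2) <= (\<Sum>i\<in>U'. \<Sum>k\<in>U'. 2 * (WW i k)\<^sup>2 + 2 / D)"
   proof (intro sum_mono)
    fix i k assume ik: "i \<in> U'" "k \<in> U'"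
    define d where "d = vv i k - WW i k"
    have "\<bar>d\<bar> <= 1 / sqrt D" using vW[OF ik] th(2) by (simp add: d_def)
    then have "\<bar>d\<bar>\<^sup>2 <= (1 / sqrt D)\<^sup>2" by (intro power_mono) auto
    then have d2: "d\<^sup>2 <= 1 / D" using D by (simp add: power_divide)
    have "(vv i k)\<^sup>2 = (WW i k + d)\<^sup>2" by (simp add: d_def)
    also have "... <= 2 * (WW i k)\<^sup>2 + 2 * d\<^sup>2" using sum_squares_bound[of "WW i k" d] by (simp add: power2_sum)
    finally show "(vv i k)\<^sup>2 <= 2 * (WW i k)\<^sup>2 + 2 / D" using d2 by simp
   qed
   also have "... = 2 * (\<Sum>i\<in>U'. \<Sum>k\<in>U'. (WW i k)\<^sup>2) + (real (card U'))\<^sup>2 * (2 / D)"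
    by (simp add: sum.distrib sum_distrib_left power2_eq_square)
   also have "(\<Sum>i\<in>U'. \<Sum>k\<in>U'. (WW i k)\<^sup>2) <= N\<^sup>2 / D"
   proof -
    have "(\<Sum>i\<in>U'. \<Sum>k\<in>U'. (WW i k)\<^sup>2) <= (\<Sum>i\<in>U'. \<Sum>k\<in>U. (WW i k)\<^sup>2)"
     using U' finU by (intro sum_mono sum_mono2) auto
    also have "... <= (\<Sum>i\<in>U. \<Sum>k\<in>U. (WW i k)\<^sup>2)"
     using U' finU by (intro sum_mono2) (auto intro!: sum_nonneg)
    finally show ?thesis by (simp add: WW_sq)
   qed
   also have "(real (card U'))\<^sup>2 * (2 / D) <= N\<^sup>2 * (2 / D)"
    using cU' by (intro mult_right_mono power_mono) auto
   finally show ?thesis by simp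
  qed
  obtain p where p: "\<forall>i. 0 <= p i & p i <= 1" "\<forall>i. i ~: U' --> p i = 0"
    "\<forall>i\<in>U'. \<forall>k\<in>U'. (\<forall>t<D. v i t = v k t) --> p i = p k"
    "ip p (ap p) - 1 / 30000 * (\<mu> * (\<Sum>i\<in>U. p i) + (\<Sum>i\<in>U. p i)\<^sup>2 / N) \<ge> \<mu>\<^sup>2 * N / 20000"
   using spread_rounding[OF U'(1) meta_eq_to_obj_eq[OF N_def] N(1) D L h1(1) form[unfolded vv_def] len[unfolded vv_def]
     total[unfolded vv_def] corr[unfolded vv_def] D_big mu_small(1)] by blast
  \<comment> \<open>Probabilities are rounded down to multiples of \<open>1 / q\<close> so that they
    can be enumerated. The form loses at most \<open>2 / q\<close> per vertex, less than the surplus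
    \<open>\<mu>\<^sup>2 / 20000\<close>.\<close>
  define P where "P i = nat \<lfloor>real q * p i\<rfloor>" for i
  have Pq: "real (P i) / q <= p i" "p i - 1 / q <= real (P i) / q" for i
  proof -
   have "0 <= real q * p i" using p(1) by simp
   then have "real (P i) = real_of_int \<lfloor>real q * p i\<rfloor>" by (simp add: P_def)
   then have "real (P i) <= real q * p i" "real q * p i <= real (P i) + 1" by linarith+
   then have "real (P i) / q <= p i" "p i <= (real (P i) + 1) / q"
    using q(1) by (auto simp: pos_divide_le_eq pos_le_divide_eq mult.commute)
   then show "real (P i) / q <= p i" "p i - 1 / q <= real (P i) / q" by (auto simp: add_divide_distrib)
  qed
  let ?p' = "%i. real (P i) / real q"
  have sums: "(\<Sum>i\<in>U. ?p' i) <= (\<Sum>i\<in>U. p i)" "0 <= (\<Sum>i\<in>U. ?p' i)"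
   using Pq(1) by (auto intro!: sum_mono sum_nonneg)
  have mu0: "0 < \<mu>" using L by simp
  have ipp: "ip p (ap p) <= ip ?p' (ap ?p') + N * (2 / q)"
  proof -
   have "ip p (ap p) <= (\<Sum>i\<in>U. \<Sum>k\<in>U. A i k * (?p' i * ?p' k) + A i k * (2 / q))"
    unfolding ip_ap
   proof (intro sum_mono)
    fix i k
    have "p i * p k = ?p' i * ?p' k + (p i - ?p' i) * p k + ?p' i * (p k - ?p' k)" by (simp add: algebra_simps)
    also have "(p i - ?p' i) * p k <= 1 / q * 1"
     using p(1) Pq[of i] by (intro mult_mono) (auto simp: algebra_simps)
    also have "?p' i * (p k - ?p' k) <= 1 * (1 / q)"
     using p(1) Pq[of k] order_trans[OF Pq(1)[of i]] by (intro mult_mono) (auto simp: algebra_simps)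
    finally have "p i * p k <= ?p' i * ?p' k + 2 / q" by simp
    from mult_left_mono[OF this A_nonneg] show "A i k * (p i * p k) <= A i k * (?p' i * ?p' k) + A i k * (2 / q)"
     by (simp add: distrib_left)
   qed
   also have "... = ip ?p' (ap ?p') + (\<Sum>i\<in>U. \<Sum>k\<in>U. A i k) * (2 / q)"
    unfolding ip_ap by (simp only: sum.distrib sum_distrib_right)
   also have "(\<Sum>i\<in>U. \<Sum>k\<in>U. A i k) * (2 / q) <= N * (2 / q)"
    using sum_mono[of U "%i. \<Sum>k\<in>U. A i k" "%_. 1"] A_row by (intro mult_right_mono) (auto simp: N_def)
   finally show ?thesis by simp
  qed
  have "1 / 30000 * (\<mu> * (\<Sum>i\<in>U. ?p' i) + (\<Sum>i\<in>U. ?p' i)\<^sup>2 / n)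
    <= 1 / 30000 * (\<mu> * (\<Sum>i\<in>U. p i) + (\<Sum>i\<in>U. p i)\<^sup>2 / N)"
   using sums mu0 N by (intro mult_left_mono add_mono frac_le power_mono) auto
  also have "... <= ip p (ap p) - \<mu>\<^sup>2 * N / 20000" using p(4) by linarith
  also have "... <= ip ?p' (ap ?p') + N * (2 / q - \<mu>\<^sup>2 / 20000)" using ipp by (simp add: algebra_simps)
  also have "... < ip ?p' (ap ?p')" using q N by (simp add: mult_pos_neg)
  finally have big: "1 / 30000 * (\<mu> * (\<Sum>i\<in>U. ?p' i) + (\<Sum>i\<in>U. ?p' i)\<^sup>2 / n) < ip ?p' (ap ?p')" .
  \<comment> \<open>Index \<open>b\<close> encodes a coordinate and a grid value. \<open>Xs\<close>
    fills the remaining indices below \<open>m\<close> with an arbitrary threshold set.\<close>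
  define g where "g b = (b div (2 * G + 1), int (b mod (2 * G + 1)) - int G)" for b
  define Xs where "Xs b = (if b < D * (2 * G + 1) then {i \<in> U. real_of_int (snd (g b)) * \<gamma> <= z i (fst (g b))} else {i \<in> U. 0 <= y 0 i})" for b
  have Xs_upper: "\<exists>y\<in>Y. upper y (Xs b)" for b
  proof (cases "b < D * (2 * G + 1)")
   case True
   then have t: "fst (g b) < D" by (simp add: g_def less_mult_imp_div_less)
   have "Xs b = {i \<in> U. real_of_int (snd (g b)) * \<gamma> / \<sigma> <= y (fst (g b)) i}"
    using True sig by (auto simp: Xs_def z_def pos_divide_le_eq mult.commute)
   then have "upper (y (fst (g b))) (Xs b)" by (simp only: upper_ge)
   then show ?thesis using y(1)[OF t] by blast
  next
   case False
   then have "Xs b = {i \<in> U. 0 <= y 0 i}" by (simp add: Xs_def)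
   then show ?thesis using y(1)[OF D] upper_ge[of "y 0" 0] by auto
  qed
  have resp: "P i = P k" if ik: "i \<in> U" "k \<in> U" "\<forall>b<m. i \<in> Xs b \<longleftrightarrow> k \<in> Xs b" for i k
  proof -
   have vt: "v i t = v k t" if t: "t < D" for t
   proof -
    have "real_of_int j * \<gamma> <= z i t \<longleftrightarrow> real_of_int j * \<gamma> <= z k t" if j: "j \<in> J" for j
    proof -
     define b where "b = t * (2 * G + 1) + nat (j + int G)"
     have jl: "nat (j + int G) < 2 * G + 1" using j by (auto simp: J_def)
     have "t * (2 * G + 1) + (2 * G + 1) <= D * (2 * G + 1)"
      using t mult_le_mono1[of "Suc t" D "2 * G + 1"] by simp
     then have bD: "b < D * (2 * G + 1)" using jl by (simp add: b_def)
     have "b div (2 * G + 1) = t" "b mod (2 * G + 1) = nat (j + int G)"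
      using jl unfolding b_def by (auto simp: div_mult_self3 simp del: mult_Suc_right add_Suc_right)
     then have "g b = (t, j)" using j by (auto simp: g_def J_def)
     then have "Xs b = {i \<in> U. real_of_int j * \<gamma> <= z i t}" using bD by (simp add: Xs_def)
     moreover have "i \<in> Xs b \<longleftrightarrow> k \<in> Xs b" using ik(3) less_le_trans[OF bD m(1)] by blast
     ultimately show ?thesis using ik by simp
    qed
    then have "{j \<in> J. real_of_int j * \<gamma> <= z i t} = {j \<in> J. real_of_int j * \<gamma> <= z k t}" by auto
    then show ?thesis by (simp add: v_def)
   qed
   then have "vv i i = vv k k" by (simp add: vv_def)
   then have "i \<in> U' \<longleftrightarrow> k \<in> U'" using ik by (simp add: U'_def H_def)
   then have "p i = p k"
    using p(2)[rule_format, of i] p(2)[rule_format, of k] p(3)[rule_format, of i k] vt by (cases "i \<in> U'") simp_all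
   then show ?thesis by (simp add: P_def)
  qed
  have "P i <= q" for i
  proof -
   have "real q * p i <= real q" using p(1) q by simp
   then have "\<lfloor>real q * p i\<rfloor> <= int q" by linarith
   then show ?thesis by (simp add: P_def nat_le_iff)
  qed
  moreover have "P i = 0" if "i ~: U" for i using that U' p(2) by (auto simp: P_def)
  ultimately show ?thesis
   unfolding dense_candidate_def using Xs_upper resp big by blast
 qed
qed

text \<open>The requirements of both cases that do not involve \<open>n\<close>, collected so that
  they can be met by a choice depending on \<open>L\<close> only.\<close>

definition good_params :: "real => real => real => real => nat => nat => nat => nat => bool" where
 "good_params L \<rho> h \<gamma> D G m q \<longleftrightarrow>
   0 < L & \<rho> = 1 / (4 * L) & \<rho> <= 1 & h = 2 ^ 70 / \<rho> ^ 6 & 0 < D &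
   0 < \<gamma> & 2 * \<gamma> * D * (2 * sqrt h + 2 * \<gamma>) <= \<rho> / 32 & 2 * \<gamma> * D * (2 * sqrt h + 2 * \<gamma>) <= 1 / sqrt D &
   8 * \<gamma>\<^sup>2 * D <= h / 2 & sqrt h < real G * \<gamma> &
   L / 5 * h * exp (L / 10) <= sqrt D &
   2 * h ^ 3 * exp (- L) * exp (3 * (L / 10)) <= 1 / 1280 - 1 / 2000 &
   1 / 30000 * (exp (- L) + 2 ^ 44 / (h * \<rho> ^ 4)) < \<rho>\<^sup>2 / 2 ^ 22 &
   1 / 30000 * (exp (- L) * 2 ^ 13 / \<rho>\<^sup>2 + exp (- L) * 2 ^ 26 / \<rho> ^ 4) < \<rho> ^ 6 / 2 ^ 26 &
   0 < q & 2 / real q < (exp (- L))\<^sup>2 / 20000 & D * (2 * G + 1) <= m & 2 <= m"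

text \<open>The cut-off \<open>\<eta> = (1 + \<rho> / 3) ^ k\<close> sits between the powers of
  \<open>1 + \<rho> / 4\<close> and \<open>1 + \<rho> / 2\<close> with room on both sides: a factor
  \<open>D * 2 ^ D\<close> for the span of the pivots, a factor \<open>n\<close> for the residual of
  \<open>S\<close>.\<close>

lemma dense_candidate_exists:
 assumes par: "good_params L \<rho> h \<gamma> D G m q" and mu: "\<mu> = exp (- L)"
  and U: "U ~= {}" "real (card U) <= n" and k: "1 <= k"
  and k1: "n * (1 + \<rho> / 3) ^ k < (1 + \<rho> / 2) ^ k"
  and k2: "(1 + \<rho> / 4) ^ k * (real D * 2 ^ D) <= (1 + \<rho> / 3) ^ k"
  and S: "S \<subseteq> U" "real (card S) <= \<mu> * n" "inner_weight A S \<ge> \<rho> * (\<mu> * n)"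
  and Y: "approximable Y k D (real D * real (card U) * 2 ^ D) \<epsilon>"
  and eps: "\<epsilon> * sqrt n <= \<rho> / 2 ^ 10" "\<epsilon> * sqrt n <= \<gamma>" "0 <= \<epsilon>"
 shows "dense_candidate Y m q \<mu> n"
proof -
 note P = par[unfolded good_params_def]
 define \<eta> where "\<eta> = (1 + \<rho> / 3) ^ k"
 have rho: "0 < \<rho>" "\<rho> <= 1" using P by auto
 have eta: "1 <= \<eta>" "0 < \<eta>" using rho by (auto simp: \<eta>_def)
 have "0 < card U" using U finU by (simp add: card_gt_0_iff)
 then have N: "0 < real (card U)" "1 <= real (card U)" by simp_all
 then have n: "1 <= n" "0 < n" using U by linarith+
 have epsN: "\<epsilon> * sqrt (real (card U)) <= \<epsilon> * sqrt n" using U(2) eps(3) by (intro mult_left_mono) auto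
 have eps1: "\<epsilon> <= \<epsilon> * sqrt n" using n eps(3) by (simp add: mult_le_cancel_left1)
 obtain t w xs T z where t: "t <= D" and p: "pivoted k \<eta> t w xs T z"
  and or: "t = D \<or> (\<forall>v\<in>U. nq (res t w ((B ^^ k) (unit v))) < \<eta>\<^sup>2)"
  using pivoted_exists[OF eta(2), of D k] by blast
 show ?thesis
 proof (cases "\<forall>v\<in>U. nq (res t w ((B ^^ k) (unit v))) < \<eta>\<^sup>2")
  case True
  have "real (card U) * \<eta> <= n * \<eta>" using U eta by (intro mult_right_mono) auto
  then have k1': "real (card U) * \<eta> < (1 + \<rho> / 2) ^ k" using k1 by (simp add: \<eta>_def)
  show ?thesis
   using P n mu k2 eps eps1
   by (intro dense_candidate_low_rank[OF p t True k eta(1) rho k1' _ S refl _ n(2) Y]) (auto simp: \<eta>_def)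
 next
  case False
  then have tD: "t = D" using or by blast
  have T: "T \<subseteq> U" "card T <= D" and xs: "\<And>s. s < D ==> w s = (B ^^ k) (xs s)" "\<And>s i. s < D ==> i ~: T ==> xs s i = 0"
   using p tD by (auto simp: pivoted_def)
  have "1 * 1 * 2 ^ D <= real D * real (card U) * 2 ^ D"
   using P N by (intro mult_right_mono mult_mono) auto
  then have "\<bar>xs s i\<bar> <= real D * real (card U) * 2 ^ D" if "s < D" for s i
  proof -
   have "s < t" using that tD by simp
   from order_trans[OF pivoted_coeff_le[OF p eta(1) this t]] show ?thesis
    using \<open>1 * 1 * 2 ^ D <= real D * real (card U) * 2 ^ D\<close> by (simp only: mult_1)
  qed
  then have "\<exists>y\<in>Y. \<forall>i\<in>U. \<bar>y i - w s i\<bar> <= \<epsilon>" if "s < D" for s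
   using Y[unfolded approximable_def, rule_format, OF T] xs that by metis
  then obtain y where y: "\<And>s. s < D ==> y s \<in> Y" "\<And>s i. s < D ==> i \<in> U ==> \<bar>y s i - w s i\<bar> <= \<epsilon>" by metis
  have o: "ortho D w" using p tD by (simp add: pivoted_def)
  have ray: "ip (w s) (ap (w s)) \<ge> \<rho> / 4" if s: "s < D" for s
  proof -
   have "w s = (%i. \<Sum>s'<t. (if s' = s then 1 else 0) * w s' i)"
   proof
    fix i
    have "(\<Sum>s'<t. (if s' = s then 1 else 0) * w s' i) = (\<Sum>s'<t. if s' = s then w s i else 0)" by (intro sum.cong) auto
    then show "w s i = (\<Sum>s'<t. (if s' = s then 1 else 0) * w s' i)" using s tD by simp
   qed
   then have "ip (w s) (B (w s)) \<ge> (1 + \<rho> / 4) * nq (w s)"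
    using span_rayleigh[OF p eta(2) _ k, of "1 + \<rho> / 4" "%s'. if s' = s then 1 else 0"] k2 rho tD
    by (simp add: \<eta>_def)
   moreover have "nq (w s) = 1" using o s by (simp add: ortho_def)
   ultimately show ?thesis by (simp add: ip_B)
  qed
  have e: "\<epsilon> * sqrt (real (card U)) <= \<rho> / 100" "\<epsilon> * sqrt (real (card U)) <= \<gamma>"
  proof -
   have "\<rho> / 2 ^ 10 <= \<rho> / 100" using rho by simp
   then show "\<epsilon> * sqrt (real (card U)) <= \<rho> / 100" using epsN eps(1) by linarith
   show "\<epsilon> * sqrt (real (card U)) <= \<gamma>" using epsN eps(2) by linarith
  qed
  show ?thesis
  proof (rule dense_candidate_high_rank[where D = D and G = G and L = L and h = h and \<gamma> = \<gamma> and \<epsilon> = \<epsilon> and \<rho> = \<rho> and w = w and y = y])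
   show "ip (w t) (ap (w t)) \<ge> \<rho> / 4" if "t < D" for t using that by (rule ray)
   show "y t \<in> Y" if "t < D" for t using that by (rule y)
   show "\<bar>y t i - w t i\<bar> <= \<epsilon>" if "t < D" "i \<in> U" for t i using that by (rule y)
  qed (use P[folded mu] mu o N U(2) e eps(3) in \<open>blast+\<close>)
 qed
qed

end

section \<open>The program\<close>

lemma For_add:
 assumes "iv ~: writes c" "iv ~= dst" and N: "N = min (eval_expr e s) (s 5 0)"
  and step: "\<And>s' j i. j < N ==> s' iv 0 = j ==> (\<And>b. b ~: insert iv (writes c) ==> s' b = s b) ==>
   den c s' dst i = s' dst i + F j i"
 shows "den (For iv e c) s dst i = s dst i + (\<Sum>j<N. F j i)"
proof -
 have "\<forall>i. den (For iv e c) s dst i = s dst i + (\<Sum>j'<N. F j' i)"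
 proof (rule For_rule[where s = s and I = "%j s'. \<forall>i. s' dst i = s dst i + (\<Sum>j'<j. F j' i)"])
  fix j s' assume "j < N" "\<forall>i. s' dst i = s dst i + (\<Sum>j'<j. F j' i)" "s' iv 0 = j"
   "\<And>b. b ~: insert iv (writes c) ==> s' b = s b"
  then show "\<forall>i. den c s' dst i = s dst i + (\<Sum>j'<Suc j. F j' i)"
   using step[of j s'] by simp
 qed (use assms in auto)
 then show ?thesis by blast
qed

lemma For_map:
 assumes "iv ~: writes c" "iv ~= dst" and N: "N = min (eval_expr e s) (s 5 0)"
  and step: "\<And>s' j i. j < N ==> s' iv 0 = j ==> (\<And>b. b ~: insert iv (writes c) ==> s' b = s b) ==>
   (\<And>i. j <= i ==> s' dst i = s dst i) ==> den c s' dst i = (if i = j then F j else s' dst i)"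
 shows "den (For iv e c) s dst i = (if i < N then F i else s dst i)"
proof -
 have "\<forall>i. den (For iv e c) s dst i = (if i < N then F i else s dst i)"
 proof (rule For_rule[where s = s and I = "%j s'. \<forall>i. s' dst i = (if i < j then F i else s dst i)"])
  fix j s' assume *: "j < N" "\<forall>i. s' dst i = (if i < j then F i else s dst i)" "s' iv 0 = j"
   "\<And>b. b ~: insert iv (writes c) ==> s' b = s b"
  show "\<forall>i. den c s' dst i = (if i < Suc j then F i else s dst i)"
  proof
   fix i
   have "den c s' dst i = (if i = j then F j else s' dst i)"
    using * by (intro step) auto
   then show "den c s' dst i = (if i < Suc j then F i else s dst i)" using *(2) by auto
  qed
 qed (use assms in auto)
 then show ?thesis by blast
qed

fun mulc :: "nat => expr => expr" where
 "mulc 0 e = Lit 0"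
| "mulc (Suc k) e = Add e (mulc k e)"

lemma eval_mulc [simp]: "eval_expr (mulc k e) s = k * eval_expr e s"
 by (induction k) auto

fun sqs :: "cmd list => cmd" where
 "sqs [] = Nop"
| "sqs (c # cs) = Sq c (sqs cs)"

lemma writes_sqs: "writes (sqs cs) = (\<Union>c\<in>set cs. writes c)"
 by (induction cs) auto

abbreviation ixE :: "nat => nat => expr" where
 "ixE a iv \<equiv> Arr a (cell iv)"

text \<open>Tests by truncated subtraction: this one normalises a value to 0 or 1,
  \<open>leE\<close> yields 1 exactly for a true inequality, and \<open>neqE\<close> is nonzero
  exactly when the values differ.\<close>

abbreviation nz :: "expr => expr" where
 "nz e \<equiv> Sub (Lit 1) (Sub (Lit 1) e)"

abbreviation leE :: "expr => expr => expr" where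
 "leE e f \<equiv> Sub (Lit 1) (Sub e f)"

abbreviation neqE :: "expr => expr => expr" where
 "neqE e f \<equiv> Add (Sub e f) (Sub f e)"

definition mapE :: "nat => nat => expr => cmd" where
 "mapE iv dst e = For iv (cell 0) (St dst (cell iv) e)"

definition mapIf :: "nat => nat => expr => expr => expr => cmd" where
 "mapIf iv dst t e f = For iv (cell 0) (If t (St dst (cell iv) e) (St dst (cell iv) f))"

definition sumE :: "nat => nat => expr => cmd" where
 "sumE iv dst e = Sq (St dst (Lit 0) (Lit 0)) (For iv (cell 0) (St dst (Lit 0) (Add (cell dst) e)))"

text \<open>Iterated addition. Loops are capped, so the first factor has to be at most
  \<open>n + m\<close> when this is run, while the second factor may be arbitrarily large.\<close>

definition mulE :: "nat => nat => expr => expr => cmd" where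
 "mulE iv dst e f = Sq (St dst (Lit 0) (Lit 0)) (For iv e (St dst (Lit 0) (Add (cell dst) f)))"

lemma writes_macros [simp]:
 "writes (mapE iv dst e) = {iv, dst}" "writes (mapIf iv dst t e f) = {iv, dst}"
 "writes (sumE iv dst e) = {iv, dst}" "writes (mulE iv dst e f) = {iv, dst}"
 by (auto simp: mapE_def mapIf_def sumE_def mulE_def)

lemma wf_macros [simp]:
 "wf_cmd (mapE iv dst e) \<longleftrightarrow> iv ~= dst & iv ~= 5 & dst ~= 5"
 "wf_cmd (mapIf iv dst t e f) \<longleftrightarrow> iv ~= dst & iv ~= 5 & dst ~= 5"
 "wf_cmd (sumE iv dst e) \<longleftrightarrow> iv ~= dst & iv ~= 5 & dst ~= 5"
 "wf_cmd (mulE iv dst e f) \<longleftrightarrow> iv ~= dst & iv ~= 5 & dst ~= 5"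
 by (auto simp: mapE_def mapIf_def sumE_def mulE_def)

lemma depth_macros [simp]:
 "depth (mapE iv dst e) = 1" "depth (mapIf iv dst t e f) = 1" "depth (sumE iv dst e) = 1" "depth (mulE iv dst e f) = 1"
 by (auto simp: mapE_def mapIf_def sumE_def mulE_def)

lemma den_mulE:
 assumes "iv ~= dst" "dst ~= 5" "eval_expr e (upd s dst 0 0) = x" "x <= s 5 0"
  "\<And>s'. (\<And>b. b ~= iv ==> b ~= dst ==> s' b = s b) ==> eval_expr f s' = y"
 shows "den (mulE iv dst e f) s dst 0 = x * y"
proof -
 have "den (For iv e (St dst (Lit 0) (Add (cell dst) f))) (upd s dst 0 0) dst 0
   = upd s dst 0 0 dst 0 + (\<Sum>j<x. (%j i. if i = 0 then y else 0) j (0::nat))"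
  by (rule For_add[where s = "upd s dst 0 0" and F = "%j i. if i = 0 then y else 0"]) (use assms in auto)
 then show ?thesis by (simp add: mulE_def)
qed

locale input =
 fixes n r :: nat and es :: "nat list list"
 assumes es_len: "e \<in> set es ==> length e = r"
  and es_distinct: "e \<in> set es ==> distinct e"
  and es_lt: "e \<in> set es ==> set e \<subseteq> {..<n}"
  and r_le: "r < n" and r_ge: "2 <= r"
begin

abbreviation m :: nat where "m \<equiv> length es"

definition inp :: "mem => bool" where
 "inp s \<longleftrightarrow> s 0 0 = n & s 1 0 = m & s 5 0 = n + m & (\<forall>j<m. \<forall>l<r. s 2 (r * j + l) = es ! j ! l)"

lemma inp_cong: "inp s ==> s' 0 = s 0 ==> s' 1 = s 1 ==> s' 2 = s 2 ==> s' 5 = s 5 ==> inp s'"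
 by (simp add: inp_def)

lemma inp_den: "inp s ==> writes c \<inter> {0, 1, 2, 5} = {} ==> inp (den c s)"
 by (rule inp_cong) (auto simp: den_frame)

lemma den_mapE:
 assumes "inp s" "iv ~= dst"
  and "\<And>s' i. i < n ==> s' iv 0 = i ==> (\<And>b. b ~= iv ==> b ~= dst ==> s' b = s b) ==> s' dst i = s dst i ==>
   eval_expr e s' = F i"
 shows "den (mapE iv dst e) s dst i = (if i < n then F i else s dst i)"
 unfolding mapE_def using assms by (intro For_map) (auto simp: inp_def)

lemma den_mapIf:
 assumes "inp s" "iv ~= dst"
  and "\<And>s' i. i < n ==> s' iv 0 = i ==> (\<And>b. b ~= iv ==> b ~= dst ==> s' b = s b) ==> s' dst i = s dst i ==>
   (if eval_expr t s' ~= 0 then eval_expr e s' else eval_expr f s') = F i"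
 shows "den (mapIf iv dst t e f) s dst i = (if i < n then F i else s dst i)"
 unfolding mapIf_def
proof (rule For_map)
 fix s' j i assume *: "j < n" "s' iv 0 = j" "\<And>i. j <= i ==> s' dst i = s dst i"
  "\<And>b. b ~: insert iv (writes (If t (St dst (cell iv) e) (St dst (cell iv) f))) ==> s' b = s b"
 have "(if eval_expr t s' ~= 0 then eval_expr e s' else eval_expr f s') = F j"
  using * by (intro assms(3)) auto
 then show "den (If t (St dst (cell iv) e) (St dst (cell iv) f)) s' dst i = (if i = j then F j else s' dst i)"
  using *(2) by auto
qed (use assms in \<open>auto simp: inp_def\<close>)

lemma den_sumE:
 assumes "inp s" "iv ~= dst" "dst ~= 0" "dst ~= 5"
  and "\<And>s' i. i < n ==> s' iv 0 = i ==> (\<And>b. b ~= iv ==> b ~= dst ==> s' b = s b) ==> eval_expr e s' = F i"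
 shows "den (sumE iv dst e) s dst 0 = (\<Sum>i<n. F i)"
proof -
 have "den (For iv (cell 0) (St dst (Lit 0) (Add (cell dst) e))) (upd s dst 0 0) dst 0
   = upd s dst 0 0 dst 0 + (\<Sum>j<n. (%j i. if i = 0 then F j else 0) j (0::nat))"
  by (rule For_add[where s = "upd s dst 0 0" and F = "%j i. if i = 0 then F j else 0"])
   (use assms in \<open>auto simp: inp_def\<close>)
 then show ?thesis by (simp add: sumE_def)
qed

subsection \<open>Pair weights\<close>

definition wt :: "nat => nat => nat" where
 "wt u v = (\<Sum>j<m. if u ~= v & u \<in> set (es ! j) & v \<in> set (es ! j) then 1 else 0)"

definition Wy :: "(nat => nat) => nat => nat" where
 "Wy y u = (\<Sum>v<n. wt u v * y v)"

definition EV :: "nat => nat => expr" where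
 "EV e l = Arr 2 (Add (mulc r (cell e)) (cell l))"

text \<open>Multiplication by the pair weights without storing the matrix: every ordered pair of
  distinct positions in a hyperedge passes one entry of \<open>y\<close> on.\<close>

definition wapp :: "nat => nat => cmd" where
 "wapp y z = Sq (mapE 30 z (Lit 0))
   (For 31 (cell 1) (For 32 (Lit r) (For 33 (Lit r)
    (If (neqE (EV 31 32) (EV 31 33)) (St z (EV 31 32) (Add (Arr z (EV 31 32)) (Arr y (EV 31 33)))) Nop))))"

lemma writes_wapp [simp]: "writes (wapp y z) = {30, 31, 32, 33, z}"
 by (auto simp: wapp_def)

lemma sum_over_edge:
 assumes j: "j < m"
 shows "(\<Sum>l<r. f (es ! j ! l)) = (\<Sum>v\<in>set (es ! j). f v)"
proof -
 have e: "length (es ! j) = r" "distinct (es ! j)" using j es_len es_distinct by auto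
 have "(\<Sum>v\<in>set (es ! j). f v) = sum_list (map f (es ! j))"
  using e by (simp add: sum_list_distinct_conv_sum_set)
 also have "... = (\<Sum>l<r. f (es ! j ! l))"
  using e by (simp add: sum_list_sum_nth atLeast0LessThan)
 finally show ?thesis by simp
qed

lemma Wy_eq: "i < n ==> (\<Sum>j<m. \<Sum>l<r. \<Sum>l'<r. if es ! j ! l = i & es ! j ! l' ~= i then y (es ! j ! l') else 0) = Wy y i"
proof -
 assume i: "i < n"
 have "(\<Sum>l<r. \<Sum>l'<r. if es ! j ! l = i & es ! j ! l' ~= i then y (es ! j ! l') else 0)
   = (\<Sum>v<n. if i ~= v & i \<in> set (es ! j) & v \<in> set (es ! j) then y v else 0)" if j: "j < m" for j
 proof -
  have sub: "set (es ! j) \<subseteq> {..<n}" using j es_lt by simp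
  have "(\<Sum>l<r. \<Sum>l'<r. if es ! j ! l = i & es ! j ! l' ~= i then y (es ! j ! l') else 0)
    = (\<Sum>u\<in>set (es ! j). \<Sum>l'<r. if u = i & es ! j ! l' ~= i then y (es ! j ! l') else 0)"
   using sum_over_edge[OF j, of "%u. \<Sum>l'<r. if u = i & es ! j ! l' ~= i then y (es ! j ! l') else 0"] by simp
  also have "... = (\<Sum>u\<in>set (es ! j). \<Sum>v\<in>set (es ! j). if u = i & v ~= i then y v else 0)"
   by (intro sum.cong refl sum_over_edge[OF j])
  also have "... = (\<Sum>u\<in>set (es ! j). if u = i then (\<Sum>v\<in>set (es ! j). if v ~= i then y v else 0) else 0)"
   by (intro sum.cong) auto
  also have "... = (if i \<in> set (es ! j) then (\<Sum>v\<in>set (es ! j). if v ~= i then y v else 0) else 0)"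
   by (simp add: sum.delta)
  also have "... = (\<Sum>v<n. if i ~= v & i \<in> set (es ! j) & v \<in> set (es ! j) then y v else 0)"
   using sub by (auto intro!: sum.mono_neutral_cong_left)
  finally show ?thesis .
 qed
 then have "(\<Sum>j<m. \<Sum>l<r. \<Sum>l'<r. if es ! j ! l = i & es ! j ! l' ~= i then y (es ! j ! l') else 0)
   = (\<Sum>j<m. \<Sum>v<n. if i ~= v & i \<in> set (es ! j) & v \<in> set (es ! j) then y v else 0)"
  by (intro sum.cong[OF refl]) simp
 also have "... = (\<Sum>v<n. \<Sum>j<m. if i ~= v & i \<in> set (es ! j) & v \<in> set (es ! j) then y v else 0)" by (rule sum.swap)
 also have "... = Wy y i"
  unfolding Wy_def wt_def sum_distrib_right by (intro sum.cong refl) auto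
 finally show ?thesis .
qed

lemma eval_EV: "inp s ==> s e 0 < m ==> s l 0 < r ==> eval_expr (EV e l) s = es ! (s e 0) ! (s l 0)"
 by (auto simp: EV_def inp_def)

lemma min_r: "inp s ==> min r (s 5 0) = r"
 using r_le by (simp add: inp_def)

lemma den_wapp:
 assumes s: "inp s" and yz: "y ~: {30, 31, 32, 33, z}" "z ~: {0, 1, 2, 5, 30, 31, 32, 33}" and i: "i < n"
 shows "den (wapp y z) s z i = Wy (s y) i"
proof -
 let ?c3 = "If (neqE (EV 31 32) (EV 31 33)) (St z (EV 31 32) (Add (Arr z (EV 31 32)) (Arr y (EV 31 33)))) Nop"
 let ?c2 = "For 33 (Lit r) ?c3"
 let ?c1 = "For 32 (Lit r) ?c2"
 let ?F = "%j l l' i. if es ! j ! l = i & es ! j ! l' ~= i then s y (es ! j ! l') else 0"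
 define s0 where "s0 = den (mapE 30 z (Lit 0)) s"
 have s0: "inp s0" unfolding s0_def using yz by (intro inp_den[OF s]) auto
 have s0y: "s0 y = s y" using yz by (simp add: s0_def den_frame)
 have w3: "writes ?c3 = {z}" by simp
 have e: "den (For 31 (cell 1) ?c1) s0 z i = s0 z i + (\<Sum>j<m. (%j i. \<Sum>l<r. \<Sum>l'<r. ?F j l l' i) j i)"
 proof (rule For_add)
  show "m = min (eval_expr (cell 1) s0) (s0 5 0)" using s0 by (simp add: inp_def)
  fix s1 j i assume j: "j < m" "s1 31 0 = j" "\<And>b. b ~: insert 31 (writes ?c1) ==> s1 b = s0 b"
  have i1: "inp s1" using yz j(3) by (intro inp_cong[OF s0]) auto
  have "den ?c1 s1 z i = s1 z i + (\<Sum>l<r. (%l i. \<Sum>l'<r. ?F j l l' i) l i)"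
  proof (rule For_add)
   show "r = min (eval_expr (Lit r) s1) (s1 5 0)" using min_r[OF i1] by simp
   fix s2 l i assume l: "l < r" "s2 32 0 = l" "\<And>b. b ~: insert 32 (writes ?c2) ==> s2 b = s1 b"
   have i2: "inp s2" using yz l(3) by (intro inp_cong[OF i1]) auto
   have "den ?c2 s2 z i = s2 z i + (\<Sum>l'<r. (%l' i. ?F j l l' i) l' i)"
   proof (rule For_add)
    show "r = min (eval_expr (Lit r) s2) (s2 5 0)" using min_r[OF i2] by simp
    fix s3 l' i assume l': "l' < r" "s3 33 0 = l'" "\<And>b. b ~: insert 33 (writes ?c3) ==> s3 b = s2 b"
    have i3: "inp s3" using yz l'(3) by (intro inp_cong[OF i2]) auto
    have v: "s3 31 0 = j" "s3 32 0 = l" "s3 y = s y"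
     using j(2,3) l(2,3) l'(3) yz s0y by auto
    have u: "eval_expr (EV 31 32) s3 = es ! j ! l" "eval_expr (EV 31 33) s3 = es ! j ! l'"
     using eval_EV[OF i3, of 31 32] eval_EV[OF i3, of 31 33] v j(1) l(1) l'(1,2) by simp_all
    show "den ?c3 s3 z i = s3 z i + ?F j l l' i"
     using v(3) by (auto simp: u)
   qed (use yz in auto)
   then show "den ?c2 s2 z i = s2 z i + (\<Sum>l'<r. ?F j l l' i)" by simp
  qed (use yz in auto)
  then show "den ?c1 s1 z i = s1 z i + (\<Sum>l<r. \<Sum>l'<r. ?F j l l' i)" by simp
 qed (use yz in auto)
 have z0: "s0 z i = 0" unfolding s0_def using den_mapE[OF s, of 30 z "Lit 0" "%_. 0" i] yz i by simp
 have "den (wapp y z) s z i = den (For 31 (cell 1) ?c1) s0 z i" by (simp add: wapp_def s0_def)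
 then show ?thesis using e z0 Wy_eq[OF i, of "s y"] by simp
qed

lemma Wy_cong: "(\<And>v. v < n ==> y v = y' v) ==> Wy y u = Wy y' u"
 by (simp add: Wy_def)

subsection \<open>Vectors described by digits\<close>

definition scale :: "nat => expr => cmd" where
 "scale y e = For 30 (cell 0) (Sq (mulE 31 34 e (ixE y 30)) (St y (cell 30) (cell 34)))"

lemma writes_scale [simp]: "writes (scale y e) = {30, 31, 34, y}"
 by (auto simp: scale_def)

lemma den_scale:
 assumes s: "inp s" and y: "y ~: {0, 1, 2, 5, 30, 31, 34}"
  and e: "\<And>s'. (\<And>b. b ~: {30, 31, 34, y} ==> s' b = s b) ==> eval_expr e s' = c" "c <= n + m" and i: "i < n"
 shows "den (scale y e) s y i = c * s y i"
proof -
 have "den (scale y e) s y i = (if i < n then (%i. c * s y i) i else s y i)"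
  unfolding scale_def
 proof (rule For_map)
  show "n = min (eval_expr (cell 0) s) (s 5 0)" using s by (simp add: inp_def)
  fix s' j i
  assume *: "j < n" "s' 30 0 = j" "\<And>i. j <= i ==> s' y i = s y i"
   "\<And>b. b ~: insert 30 (writes (Sq (mulE 31 34 e (ixE y 30)) (St y (cell 30) (cell 34)))) ==> s' b = s b"
  let ?s = "den (mulE 31 34 e (ixE y 30)) s'"
  have "?s 34 0 = c * s y j"
  proof (rule den_mulE)
   show "eval_expr e (upd s' 34 0 0) = c" using * by (intro e(1)) auto
   show "c <= s' 5 0" using e(2) s *(4)[of 5] y by (simp add: inp_def)
   show "eval_expr (ixE y 30) s'' = s y j" if "\<And>b. b ~= 31 ==> b ~= 34 ==> s'' b = s' b" for s''
    using that[of 30] that[of y] * y by simp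
  qed auto
  moreover have "?s y = s' y" "?s 30 = s' 30" using y by (auto simp: den_frame)
  ultimately show "den (Sq (mulE 31 34 e (ixE y 30)) (St y (cell 30) (cell 34))) s' y i = (if i = j then c * s y j else s' y i)"
   using * by simp
 qed (use y in auto)
 then show ?thesis using i by simp
qed

text \<open>On vectors vanishing on \<open>R\<close> this is \<open>d\<close> times the operator
  \<open>B\<close> for the weights over \<open>d\<close> outside \<open>R\<close>, kept integral by
  clearing the denominator. With 0 in place of \<open>d\<close> it is multiplication by the pair
  weights outside \<open>R\<close>.\<close>

definition stepv :: "nat set => nat => (nat => nat) => nat => nat" where
 "stepv R d y i = (if i \<in> R then 0 else Wy y i + d * y i)"

definition step_cmd :: "nat => expr => cmd" where
 "step_cmd y e = Sq (wapp y 18) (Sq (scale y e) (mapIf 30 y (ixE 12 30) (Lit 0) (Add (ixE 18 30) (ixE y 30))))"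

lemma writes_step [simp]: "writes (step_cmd y e) = {18, 30, 31, 32, 33, 34, y}"
 by (auto simp: step_cmd_def)

definition setof :: "mem => nat => nat set" where
 "setof s a = {i. i < n & s a i ~= 0}"

lemma setof_cong: "s' a = s a ==> setof s' a = setof s a"
 by (simp add: setof_def)

lemma setof_sub: "setof s a \<subseteq> {..<n}" "finite (setof s a)"
 by (auto simp: setof_def)

lemma den_step:
 assumes s: "inp s" and y: "y ~: {0, 1, 2, 5, 12, 18, 30, 31, 32, 33, 34}"
  and e: "\<And>s'. (\<And>b. b ~: {18, 30, 31, 32, 33, 34, y} ==> s' b = s b) ==> eval_expr e s' = c" "c <= n + m"
  and i: "i < n"
 shows "den (step_cmd y e) s y i = stepv (setof s 12) c (s y) i"
proof -
 define s1 where "s1 = den (wapp y 18) s"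
 define s2 where "s2 = den (scale y e) s1"
 have i1: "inp s1" unfolding s1_def using y by (intro inp_den[OF s]) auto
 have i2: "inp s2" unfolding s2_def using y by (intro inp_den[OF i1]) auto
 have f1: "s1 b = s b" if "b ~: {18, 30, 31, 32, 33}" for b using that by (simp add: s1_def den_frame)
 have f2: "s2 b = s1 b" if "b ~: {30, 31, 34, y}" for b using that by (simp add: s2_def den_frame)
 have z: "s1 18 i = Wy (s y) i" if "i < n" for i unfolding s1_def using y that by (intro den_wapp[OF s]) auto
 have yy: "s2 y i = c * s y i" if "i < n" for i
  unfolding s2_def using y that f1 e by (subst den_scale[OF i1, of y e c]) auto
 have "den (mapIf 30 y (ixE 12 30) (Lit 0) (Add (ixE 18 30) (ixE y 30))) s2 y i
   = (if i < n then stepv (setof s 12) c (s y) i else s2 y i)"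
 by (rule den_mapIf[OF i2]) (use y f1[of 12] f2[of 12] f2[of 18] z yy y in \<open>auto simp: stepv_def setof_def\<close>)
 then show ?thesis using i by (simp add: step_cmd_def s1_def s2_def)
qed

lemma stepv_cong: "(\<And>v. v < n ==> y v = y' v) ==> i < n ==> stepv R d y i = stepv R d y' i"
 using Wy_cong[of y y' i] by (simp add: stepv_def)

lemma funpow_stepv_cong:
 "(\<And>v. v < n ==> y v = y' v) ==> i < n ==> (stepv R d ^^ k) y i = (stepv R d ^^ k) y' i"
proof (induction k arbitrary: i)
 case (Suc k)
 then have "stepv R d ((stepv R d ^^ k) y) i = stepv R d ((stepv R d ^^ k) y') i" by (intro stepv_cong) auto
 then show ?case by simp
qed auto

definition iter_cmd :: "nat => nat => expr => cmd" where
 "iter_cmd y k e = For 35 (cell k) (step_cmd y e)"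

lemma writes_iter [simp]: "writes (iter_cmd y k e) = {18, 30, 31, 32, 33, 34, 35, y}"
 by (auto simp: iter_cmd_def)

lemma den_iter:
 assumes s: "inp s" and y: "y ~: {0, 1, 2, 5, 12, 18, 30, 31, 32, 33, 34, 35}" and k: "s k 0 <= n + m"
  and e: "\<And>s'. (\<And>b. b ~: {18, 30, 31, 32, 33, 34, 35, y} ==> s' b = s b) ==> eval_expr e s' = c" "c <= n + m"
  and i: "i < n"
 shows "den (iter_cmd y k e) s y i = (stepv (setof s 12) c ^^ s k 0) (s y) i"
proof -
 let ?I = "%j s'. \<forall>i<n. s' y i = (stepv (setof s 12) c ^^ j) (s y) i"
 have "?I (s k 0) (den (iter_cmd y k e) s)"
  unfolding iter_cmd_def
 proof (rule For_rule[where s = s and I = ?I])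
  show "s k 0 = min (eval_expr (cell k) s) (s 5 0)" using s k by (simp add: inp_def)
  fix j s' assume *: "?I j s'" "\<And>b. b ~: insert 35 (writes (step_cmd y e)) ==> s' b = s b"
  have i': "inp s'" using * y by (intro inp_cong[OF s]) auto
  show "?I (Suc j) (den (step_cmd y e) s')"
  proof (intro allI impI)
   fix i assume i: "i < n"
   have "den (step_cmd y e) s' y i = stepv (setof s' 12) c (s' y) i"
    using y e *(2) i by (intro den_step[OF i']) auto
   also have "setof s' 12 = setof s 12" using *(2) y by (intro setof_cong) auto
   also have "stepv (setof s 12) c (s' y) i = stepv (setof s 12) c ((stepv (setof s 12) c ^^ j) (s y)) i"
    using * i by (intro stepv_cong) auto
   finally show "den (step_cmd y e) s' y i = (stepv (setof s 12) c ^^ Suc j) (s y) i" by simp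
  qed
 qed (use y in auto)
 then show ?thesis using i by simp
qed

text \<open>
 A vector with at most \<open>D\<close> nonzero entries, given by positions and by base \<open>n + m\<close> digits of the
 entries.
\<close>

fun horner :: "(nat => nat) => (nat => nat => nat) => nat => nat => nat => nat" where
 "horner pos dig D 0 v = 0"
| "horner pos dig D (Suc j) v = (n + m) * horner pos dig D j v + (\<Sum>t<D. if pos t = v then dig j t else 0)"

definition add_digits :: "nat => (nat => nat) => (nat => nat) => nat => cmd" where
 "add_digits y pos dig D = sqs (map (%t. St y (cell (pos t)) (Add (Arr y (cell (pos t))) (cell (dig t)))) [0..<D])"

lemma writes_add_digits: "writes (add_digits y pos dig D) \<subseteq> {y}"
 by (auto simp: add_digits_def writes_sqs)

lemma sqs_append: "den (sqs (cs @ ds)) s = den (sqs ds) (den (sqs cs) s)"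
 by (induction cs arbitrary: s) auto

lemma den_add_digits:
 assumes "\<And>t. t < D ==> pos t ~= y & dig t ~= y"
 shows "den (add_digits y pos dig D) s y v = s y v + (\<Sum>t<D. if s (pos t) 0 = v then s (dig t) 0 else 0)"
 using assms
proof (induction D arbitrary: v)
 case (Suc D)
 let ?s = "den (add_digits y pos dig D) s"
 have f: "?s b = s b" if "b ~= y" for b using that writes_add_digits[of y pos dig D] by (auto intro: den_frame)
 have "den (add_digits y pos dig (Suc D)) s = den (St y (cell (pos D)) (Add (Arr y (cell (pos D))) (cell (dig D)))) ?s"
  by (simp add: add_digits_def sqs_append)
 then show ?case using Suc f by auto
qed (simp add: add_digits_def)

definition horner_cmd :: "nat => (nat => nat) => (nat => nat => nat) => nat => nat => cmd" where
 "horner_cmd y pos dig D E = Sq (mapE 30 y (Lit 0)) (sqs (map (%j. Sq (scale y (cell 5)) (add_digits y pos (dig j) D)) [0..<E]))"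

lemma writes_horner: "writes (horner_cmd y pos dig D E) \<subseteq> {30, 31, 34, y}"
proof -
 have "writes (add_digits y pos d D) \<subseteq> {30, 31, 34, y}" for d using writes_add_digits by blast
 then show ?thesis by (simp add: horner_cmd_def writes_sqs UN_subset_iff)
qed

lemma den_horner:
 assumes s: "inp s" and y: "y ~: {0, 1, 2, 5, 30, 31, 34}"
  and pd: "\<And>t. t < D ==> pos t ~: {y, 30, 31, 34}" "\<And>j t. j < E ==> t < D ==> dig j t ~: {y, 30, 31, 34}"
  and v: "v < n"
 shows "den (horner_cmd y pos dig D E) s y v = horner (%t. s (pos t) 0) (%j t. s (dig j t) 0) D E v"
 using pd(2) v
proof (induction E arbitrary: v)
 case 0
 then show ?case using den_mapE[OF s, of 30 y "Lit 0" "%_. 0" v] y by (simp add: horner_cmd_def)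
next
 case (Suc E)
 define s1 where "s1 = den (horner_cmd y pos dig D E) s"
 define s2 where "s2 = den (scale y (cell 5)) s1"
 have f: "s1 b = s b" if "b ~: {30, 31, 34, y}" for b
  unfolding s1_def by (rule den_frame) (use that writes_horner in blast)
 have f': "s2 b = s b" if "b ~: {30, 31, 34, y}" for b
 proof -
  have "s2 b = s1 b" unfolding s2_def by (rule den_frame) (use that in auto)
  then show ?thesis using f[OF that] by simp
 qed
 have is1: "inp s1" by (rule inp_cong[OF s]; rule f) (use y in auto)
 have sc: "s2 y v = (n + m) * s1 y v" if "v < n" for v
  unfolding s2_def
 proof (rule den_scale[OF is1 y _ _ that])
  fix s' :: mem assume "\<And>b. b ~: {30, 31, 34, y} ==> s' b = s1 b"
  then have "s' 5 = s1 5" using y by auto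
  then show "eval_expr (cell 5) s' = n + m" using is1 by (simp add: inp_def)
 qed simp
 have IH: "s1 y v = horner (%t. s (pos t) 0) (%j t. s (dig j t) 0) D E v"
  unfolding s1_def using Suc.prems by (intro Suc.IH) auto
 have "den (horner_cmd y pos dig D (Suc E)) s = den (add_digits y pos (dig E) D) s2"
  by (simp add: horner_cmd_def sqs_append s1_def s2_def)
 moreover have "den (add_digits y pos (dig E) D) s2 y v = s2 y v + (\<Sum>t<D. if s2 (pos t) 0 = v then s2 (dig E t) 0 else 0)"
  using pd(1) Suc.prems(1)[of E] by (intro den_add_digits) auto
 moreover have "(\<Sum>t<D. if s2 (pos t) 0 = v then s2 (dig E t) 0 else 0) = (\<Sum>t<D. if s (pos t) 0 = v then s (dig E t) 0 else 0)"
 proof (rule sum.cong[OF refl])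
  fix t assume "t \<in> {..<D}"
  then have "s2 (pos t) = s (pos t)" "s2 (dig E t) = s (dig E t)"
   using pd(1)[of t] Suc.prems(1)[of E t] by (auto intro!: f')
  then show "(if s2 (pos t) 0 = v then s2 (dig E t) 0 else 0) = (if s (pos t) 0 = v then s (dig E t) 0 else 0)" by simp
 qed
 ultimately show ?case using sc[OF Suc.prems(2)] IH by simp
qed

subsection \<open>Types of vertices\<close>

text \<open>One threshold set takes \<open>3 + D + 2 * (E * D)\<close> digits: the number of steps
  with \<open>d\<close>, the number of further steps with 0, the threshold vertex, \<open>D\<close>
  positions, and \<open>D\<close> numbers of \<open>E\<close> digits for the positive and again for
  the negative part of the start vector.\<close>

definition blk :: "nat => nat => nat => nat" where
 "blk D E b = b * (3 + D + 2 * (E * D))"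

definition vecd :: "nat => nat => nat set => nat => (nat => nat) => nat => nat => nat => nat" where
 "vecd D E R d dg \<sigma> b = (stepv R 0 ^^ dg (blk D E b + 1)) ((stepv R d ^^ dg (blk D E b))
   (horner (%t. dg (blk D E b + 3 + t)) (%j t. dg (blk D E b + 3 + D + \<sigma> * (E * D) + (j * D + t))) D E))"

text \<open>The vector meant is the difference of \<open>y\<close> and \<open>y'\<close>, and the
  comparison with its entry at \<open>h\<close> is rearranged to avoid negative numbers. Naming the
  threshold by a vertex spares an enumeration of real numbers.\<close>

definition cut :: "nat => nat => nat set => nat => (nat => nat) => nat => nat => bool" where
 "cut D E R d dg b i \<longleftrightarrow> (let h = dg (blk D E b + 2); y = vecd D E R d dg 0 b; y' = vecd D E R d dg 1 b
   in y h + y' i <= y i + y' h)"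

definition vec_cmd :: "nat => nat => nat => nat => nat => cmd" where
 "vec_cmd D E y \<sigma> b = (let k = 100 + blk D E b in
   Sq (horner_cmd y (%t. k + 3 + t) (%j t. k + 3 + D + \<sigma> * (E * D) + (j * D + t)) D E)
    (Sq (iter_cmd y k (cell 10)) (iter_cmd y (k + 1) (Lit 0))))"

lemma writes_vec: "writes (vec_cmd D E y \<sigma> b) \<subseteq> {18, 30, 31, 32, 33, 34, 35, y}"
 using writes_horner by (fastforce simp: vec_cmd_def Let_def)

lemma den_vec:
 assumes s: "inp s" and y: "y = 20 \<or> y = 21" and d: "s 10 0 <= n + m"
  and dg: "\<And>x. s (100 + x) 0 <= n + m" and i: "i < n"
 shows "den (vec_cmd D E y \<sigma> b) s y i = vecd D E (setof s 12) (s 10 0) (%x. s (100 + x) 0) \<sigma> b i"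
proof -
 let ?k = "100 + blk D E b"
 let ?h = "horner (%t. s (?k + 3 + t) 0) (%j t. s (?k + 3 + D + \<sigma> * (E * D) + (j * D + t)) 0) D E"
 define s1 where "s1 = den (horner_cmd y (%t. ?k + 3 + t) (%j t. ?k + 3 + D + \<sigma> * (E * D) + (j * D + t)) D E) s"
 define s2 where "s2 = den (iter_cmd y ?k (cell 10)) s1"
 have f1: "s1 b = s b" if "b ~: {30, 31, 34, y}" for b
  unfolding s1_def by (rule den_frame) (use that writes_horner in blast)
 have f2: "s2 b = s1 b" if "b ~: {18, 30, 31, 32, 33, 34, 35, y}" for b
  unfolding s2_def by (rule den_frame) (use that in simp)
 have i1: "inp s1" by (rule inp_cong[OF s]; rule f1) (use y in auto)
 have i2: "inp s2" by (rule inp_cong[OF i1]; rule f2) (use y in auto)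
 have v1: "s1 y v = ?h v" if "v < n" for v
  unfolding s1_def using y that by (intro den_horner[OF s]) auto
 have k: "s1 ?k = s ?k" "s1 10 = s 10" "s1 12 = s 12" "s2 (?k + 1) = s (?k + 1)" "s2 12 = s 12"
  using y by (auto simp: f1 f2)
 have v2: "s2 y v = (stepv (setof s 12) (s 10 0) ^^ s ?k 0) ?h v" if v: "v < n" for v
 proof -
  have "s2 y v = (stepv (setof s1 12) (s 10 0) ^^ s1 ?k 0) (s1 y) v"
   unfolding s2_def
  proof (rule den_iter[OF i1 _ _ _ d v])
   show "s1 ?k 0 <= n + m" using k dg[of "blk D E b"] by simp
   fix s' :: mem assume "\<And>b. b ~: {18, 30, 31, 32, 33, 34, 35, y} ==> s' b = s1 b"
   then have "s' 10 = s1 10" using y by auto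
   then show "eval_expr (cell 10) s' = s 10 0" using k by simp
  qed (use y in auto)
  also have "... = (stepv (setof s1 12) (s 10 0) ^^ s1 ?k 0) ?h v" by (rule funpow_stepv_cong[OF v1 v])
  finally show ?thesis using k setof_cong[of s1 12 s] by simp
 qed
 have "den (iter_cmd y (?k + 1) (Lit 0)) s2 y i = (stepv (setof s2 12) 0 ^^ s2 (?k + 1) 0) (s2 y) i"
  using k dg[of "blk D E b + 1"] i y by (intro den_iter[OF i2]) auto
 also have "... = (stepv (setof s2 12) 0 ^^ s2 (?k + 1) 0) ((stepv (setof s 12) (s 10 0) ^^ s ?k 0) ?h) i"
  by (rule funpow_stepv_cong[OF v2 i])
 finally have "den (iter_cmd y (?k + 1) (Lit 0)) s2 y i
   = (stepv (setof s 12) 0 ^^ s (?k + 1) 0) ((stepv (setof s 12) (s 10 0) ^^ s ?k 0) ?h) i"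
  using k setof_cong[of s2 12 s] by simp
 then show ?thesis by (simp add: vec_cmd_def Let_def s1_def s2_def vecd_def add_ac)
qed

definition block_cmd :: "nat => nat => nat => cmd" where
 "block_cmd D E b = Sq (vec_cmd D E 20 0 b) (Sq (vec_cmd D E 21 1 b)
   (let h = cell (100 + blk D E b + 2) in
   mapIf 30 22 (leE (Add (Arr 20 h) (ixE 21 30)) (Add (ixE 20 30) (Arr 21 h))) (Add (ixE 22 30) (Lit (2 ^ b))) (ixE 22 30)))"

lemma writes_block: "writes (block_cmd D E b) \<subseteq> {18, 20, 21, 22, 30, 31, 32, 33, 34, 35}"
 using writes_vec by (fastforce simp: block_cmd_def Let_def)

lemma den_block:
 assumes s: "inp s" and d: "s 10 0 <= n + m" and dg: "\<And>x. s (100 + x) 0 <= n + m"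
  and h: "s (100 + (blk D E b + 2)) 0 < n" and i: "i < n"
 shows "den (block_cmd D E b) s 22 i
  = s 22 i + (if cut D E (setof s 12) (s 10 0) (%x. s (100 + x) 0) b i then 2 ^ b else 0)"
proof -
 let ?dg = "%x. s (100 + x) 0"
 define s1 where "s1 = den (vec_cmd D E 20 0 b) s"
 define s2 where "s2 = den (vec_cmd D E 21 1 b) s1"
 have f1: "s1 b = s b" if "b ~: {18, 20, 30, 31, 32, 33, 34, 35}" for b
  unfolding s1_def by (rule den_frame) (use that writes_vec in blast)
 have f2: "s2 b = s1 b" if "b ~: {18, 21, 30, 31, 32, 33, 34, 35}" for b
  unfolding s2_def by (rule den_frame) (use that writes_vec in blast)
 have i1: "inp s1" by (rule inp_cong[OF s]; rule f1) auto
 have i2: "inp s2" by (rule inp_cong[OF i1]; rule f2) auto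
 have dg1: "(%x. s1 (100 + x) 0) = ?dg" by (simp add: f1)
 have y1: "s2 20 v = vecd D E (setof s 12) (s 10 0) ?dg 0 b v" if "v < n" for v
  using den_vec[OF s _ d dg that, of 20 D E 0 b] by (simp add: f2 s1_def)
 have y2: "s2 21 v = vecd D E (setof s 12) (s 10 0) ?dg 1 b v" if "v < n" for v
 proof -
  have "s2 21 v = vecd D E (setof s1 12) (s1 10 0) (%x. s1 (100 + x) 0) 1 b v"
   unfolding s2_def using d dg that by (intro den_vec[OF i1]) (auto simp: f1)
  moreover have "setof s1 12 = setof s 12" "s1 10 = s 10" by (auto simp: f1 intro!: setof_cong)
  ultimately show ?thesis by (simp only: dg1)
 qed
 let ?h = "cell (100 + blk D E b + 2)"
 have "den (mapIf 30 22 (leE (Add (Arr 20 ?h) (ixE 21 30)) (Add (ixE 20 30) (Arr 21 ?h))) (Add (ixE 22 30) (Lit (2 ^ b))) (ixE 22 30)) s2 22 i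
   = (if i < n then (%i. s 22 i + (if cut D E (setof s 12) (s 10 0) ?dg b i then 2 ^ b else 0)) i else s2 22 i)"
 proof (rule den_mapIf[OF i2])
  fix s' i assume *: "i < n" "s' 30 0 = i" "\<And>b. b ~= 30 ==> b ~= 22 ==> s' b = s2 b" "s' 22 i = s2 22 i"
  have "s' (100 + blk D E b + 2) 0 = ?dg (blk D E b + 2)" using *(3) by (simp add: f1 f2 add_ac)
  moreover have "s' 20 = s2 20" "s' 21 = s2 21" using *(3) by auto
  moreover have "s' 22 i = s 22 i" using *(4) by (simp add: f1 f2)
  ultimately show "(if eval_expr (leE (Add (Arr 20 ?h) (ixE 21 30)) (Add (ixE 20 30) (Arr 21 ?h))) s' ~= 0
    then eval_expr (Add (ixE 22 30) (Lit (2 ^ b))) s' else eval_expr (ixE 22 30) s')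
    = s 22 i + (if cut D E (setof s 12) (s 10 0) ?dg b i then 2 ^ b else 0)"
   using *(1,2) h y1 y2 by (auto simp: cut_def Let_def)
 qed auto
 then show ?thesis using i by (simp add: block_cmd_def Let_def s1_def s2_def)
qed

definition types_cmd :: "nat => nat => nat => cmd" where
 "types_cmd D E k = Sq (mapE 30 22 (Lit 0)) (sqs (map (block_cmd D E) [0..<k]))"

lemma writes_types: "writes (types_cmd D E k) \<subseteq> {18, 20, 21, 22, 30, 31, 32, 33, 34, 35}"
 using writes_block by (fastforce simp: types_cmd_def writes_sqs)

text \<open>The atom of the first \<open>k\<close> threshold sets that contains \<open>i\<close>,
  coded in binary, so that one table of length \<open>2 ^ k\<close> can list the
  probabilities.\<close>

definition vtype :: "nat => nat => nat => nat set => nat => (nat => nat) => nat => nat" where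
 "vtype D E k R d dg i = (\<Sum>b<k. if cut D E R d dg b i then 2 ^ b else 0)"

lemma den_types:
 assumes s: "inp s" and d: "s 10 0 <= n + m" and dg: "\<And>x. s (100 + x) 0 <= n + m"
  and h: "\<And>b. b < k ==> s (100 + (blk D E b + 2)) 0 < n" and i: "i < n"
 shows "den (types_cmd D E k) s 22 i = vtype D E k (setof s 12) (s 10 0) (%x. s (100 + x) 0) i"
 using h
proof (induction k)
 case 0
 then show ?case using den_mapE[OF s, of 30 22 "Lit 0" "%_. 0" i] i by (simp add: types_cmd_def vtype_def)
next
 case (Suc k)
 define s1 where "s1 = den (types_cmd D E k) s"
 have f1: "s1 b = s b" if "b ~: {18, 20, 21, 22, 30, 31, 32, 33, 34, 35}" for b
  unfolding s1_def by (rule den_frame) (use that writes_types in blast)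
 have i1: "inp s1" by (rule inp_cong[OF s]; rule f1) auto
 have dg1: "(%x. s1 (100 + x) 0) = (%x. s (100 + x) 0)" by (simp add: f1)
 have "den (types_cmd D E (Suc k)) s = den (block_cmd D E k) s1"
  by (simp add: types_cmd_def sqs_append s1_def)
 moreover have "den (block_cmd D E k) s1 22 i
   = s1 22 i + (if cut D E (setof s1 12) (s1 10 0) (%x. s1 (100 + x) 0) k i then 2 ^ k else 0)"
  using d dg Suc.prems[of k] by (intro den_block[OF i1 _ _ _ i]) (auto simp: f1)
 moreover have "setof s1 12 = setof s 12" "s1 10 = s 10" by (auto simp: f1 intro!: setof_cong)
 ultimately show ?case using Suc unfolding dg1 by (simp add: s1_def vtype_def)
qed

lemma vtype_less: "vtype D E k R d dg i < 2 ^ k"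
proof -
 have "vtype D E k R d dg i <= (\<Sum>b<k. 2 ^ b)" unfolding vtype_def by (intro sum_mono) auto
 also have "... < 2 ^ k" by (induction k) auto
 finally show ?thesis .
qed

lemma bits_inj:
 fixes k :: nat
 shows "(\<Sum>b<k. if P b then 2 ^ b else 0 :: nat) = (\<Sum>b<k. if Q b then 2 ^ b else 0) ==> b < k ==> P b \<longleftrightarrow> Q b"
proof (induction k)
 case (Suc k)
 have lt: "(\<Sum>b<k. if P b then 2 ^ b else 0 :: nat) < 2 ^ k" for P
 proof -
  have "(\<Sum>b<k. if P b then 2 ^ b else 0 :: nat) <= (\<Sum>b<k. 2 ^ b)" by (intro sum_mono) auto
  also have "... < 2 ^ k" by (induction k) auto
  finally show ?thesis .
 qed
 have "P k \<longleftrightarrow> Q k"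
  using Suc.prems(1) lt[of P] lt[of Q] by (auto split: if_splits)
 then show ?case using Suc by (cases "b = k") auto
qed simp

subsection \<open>Rounding fractional vertex sets\<close>

definition wS :: "nat set => nat" where
 "wS X = (\<Sum>u\<in>X. \<Sum>v\<in>X. wt u v)"

definition pairs :: "(nat => nat) => nat" where
 "pairs P = (\<Sum>i<n. \<Sum>k<n. if i = k then 0 else P i * P k)"

definition quad :: "(nat => nat) => nat" where
 "quad P = (\<Sum>i<n. \<Sum>k<n. wt i k * (P i * P k))"

text \<open>The inequality of \<open>dense_candidate\<close> with denominators cleared.
  \<open>pairs\<close> leaves out the diagonal and \<open>wt\<close> vanishes on it, so
  \<open>gain\<close> is affine in each \<open>P i\<close> separately; conditional expectations
  depend on this.\<close>

definition gain :: "nat => nat => nat => nat => (nat => nat) => int" where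
 "gain c d M q P = int (c * n * quad P) - int (d * (M * q * (\<Sum>i<n. P i) + pairs P))"

lemma wt_sym: "wt u v = wt v u"
 unfolding wt_def by (intro sum.cong) auto

lemma wt_self: "wt u u = 0"
 by (simp add: wt_def)

lemma sum_upd_form:
 fixes f :: "nat => nat => nat"
 assumes i: "i < n" and sym: "\<And>u v. f u v = f v u" and diag: "\<And>u. f u u = 0"
 shows "(\<Sum>u<n. \<Sum>v<n. f u v * ((P(i := x)) u * (P(i := x)) v))
  = (\<Sum>u<n. \<Sum>v<n. f u v * ((P(i := 0)) u * (P(i := 0)) v)) + 2 * x * (\<Sum>v<n. f i v * P v)"
proof -
 let ?N = "{..<n} - {i}"
 have split: "(\<Sum>v<n. g v) = g i + (\<Sum>v\<in>?N. g v)" for g :: "nat => nat"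
  using i by (simp add: sum.remove)
 have s1: "(\<Sum>v<n. f i v * P v) = (\<Sum>v\<in>?N. f i v * P v)" by (subst split) (simp add: diag)
 have E: "(\<Sum>u<n. \<Sum>v<n. f u v * ((P(i := x)) u * (P(i := x)) v))
   = (\<Sum>u\<in>?N. \<Sum>v\<in>?N. f u v * (P u * P v)) + 2 * x * (\<Sum>v\<in>?N. f i v * P v)" for x
 proof -
  have row: "(\<Sum>v<n. f u v * ((P(i := x)) u * (P(i := x)) v)) = f u i * (P u * x) + (\<Sum>v\<in>?N. f u v * (P u * P v))"
   if "u \<in> ?N" for u using that by (subst split) (auto intro!: sum.cong)
  have "(\<Sum>u<n. \<Sum>v<n. f u v * ((P(i := x)) u * (P(i := x)) v))
    = (\<Sum>v<n. f i v * (x * (P(i := x)) v)) + (\<Sum>u\<in>?N. \<Sum>v<n. f u v * ((P(i := x)) u * (P(i := x)) v))"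
   by (subst split) simp
  also have "(\<Sum>v<n. f i v * (x * (P(i := x)) v)) = (\<Sum>v\<in>?N. f i v * (x * P v))"
   by (subst split) (auto simp: diag intro!: sum.cong)
  also have "(\<Sum>u\<in>?N. \<Sum>v<n. f u v * ((P(i := x)) u * (P(i := x)) v))
    = (\<Sum>u\<in>?N. f i u * (x * P u)) + (\<Sum>u\<in>?N. \<Sum>v\<in>?N. f u v * (P u * P v))"
   unfolding sum.distrib[symmetric] by (rule sum.cong[OF refl]) (subst row, simp_all add: sym mult_ac)
  also have "(\<Sum>v\<in>?N. f i v * (x * P v)) = x * (\<Sum>v\<in>?N. f i v * P v)"
   by (simp only: sum_distrib_left mult.left_commute)
  finally show ?thesis by simp
 qed
 show ?thesis unfolding E s1 by simp
qed

lemma gain_upd: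
 assumes i: "i < n"
 shows "gain c d M q (P(i := x)) = gain c d M q (P(i := 0))
  + int x * (int (2 * c * (n * Wy P i)) - int (d * (M * q + 2 * ((\<Sum>k<n. P k) - P i))))"
proof -
 have 1: "quad (P(i := x)) = quad (P(i := 0)) + 2 * x * Wy P i"
  unfolding quad_def Wy_def by (rule sum_upd_form[OF i wt_sym wt_self])
 have p: "pairs P = (\<Sum>u<n. \<Sum>v<n. (if u = v then 0 else 1) * (P u * P v))" for P
  unfolding pairs_def by (intro sum.cong refl) auto
 have rest: "(\<Sum>v<n. (if i = v then 0 else 1) * P v) = (\<Sum>k<n. P k) - P i"
 proof -
  have "(\<Sum>v<n. (if i = v then 0 else 1) * P v) = (\<Sum>v\<in>{..<n} - {i}. P v)"
   using i by (intro sum.mono_neutral_cong_right) auto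
  also have "... = (\<Sum>k<n. P k) - P i" using i by (simp add: sum_diff1_nat)
  finally show ?thesis .
 qed
 have 2: "pairs (P(i := x)) = pairs (P(i := 0)) + 2 * x * ((\<Sum>k<n. P k) - P i)"
  unfolding p rest[symmetric] by (rule sum_upd_form[OF i]) auto
 have 3: "(\<Sum>k<n. (P(i := x)) k) = (\<Sum>k<n. (P(i := 0)) k) + x"
  using i by (simp add: sum.remove[of "{..<n}" i])
 define t where "t = (\<Sum>k<n. P k) - P i"
 show ?thesis unfolding gain_def 1 2 3 t_def[symmetric] by (simp add: algebra_simps)
qed

text \<open>Method of conditional expectations: one after the other, the values outside
  \<open>R\<close> move to 0 or to \<open>q\<close> according to the sign of the slope of
  \<open>gain\<close>, which never decreases.\<close>

definition round_cmd :: "nat => nat => cmd" where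
 "round_cmd c q = For 40 (cell 0) (If (ixE 12 40) Nop (sqs [wapp 24 18, sumE 30 26 (ixE 24 30),
   mulE 31 27 (cell 0) (ixE 18 40),
   mulE 31 28 (cell 10) (Add (mulc q (cell 6)) (mulc 2 (Sub (cell 26) (ixE 24 40)))),
   If (leE (cell 28) (mulc (2 * c) (cell 27))) (St 24 (cell 40) (Lit q)) (St 24 (cell 40) (Lit 0))]))"

lemma writes_round [simp]: "writes (round_cmd c q) = {18, 24, 26, 27, 28, 30, 31, 32, 33, 40}"
 by (auto simp: round_cmd_def)

lemma gain_cong: "(\<And>i. i < n ==> P i = P' i) ==> gain c d M q P = gain c d M q P'"
 by (simp add: gain_def quad_def pairs_def cong: if_cong)

lemma den_round:
 fixes c q :: nat and s :: mem
 assumes s: "inp s" and d: "s 10 0 <= n + m"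
  and P: "\<And>i. i < n ==> s 24 i <= q" "\<And>i. i \<in> setof s 12 ==> s 24 i = 0"
 defines "s' \<equiv> den (round_cmd c q) s"
 shows "gain c (s 10 0) (s 6 0) q (s' 24) \<ge> gain c (s 10 0) (s 6 0) q (s 24)"
  and "i < n ==> s' 24 i = 0 \<or> s' 24 i = q" and "i \<in> setof s 12 ==> s' 24 i = 0"
proof -
 let ?b = "sqs [wapp 24 18, sumE 30 26 (ixE 24 30), mulE 31 27 (cell 0) (ixE 18 40),
   mulE 31 28 (cell 10) (Add (mulc q (cell 6)) (mulc 2 (Sub (cell 26) (ixE 24 40)))),
   If (leE (cell 28) (mulc (2 * c) (cell 27))) (St 24 (cell 40) (Lit q)) (St 24 (cell 40) (Lit 0))]"
 let ?g = "gain c (s 10 0) (s 6 0) q"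
 let ?R = "setof s 12"
 let ?I = "%j s1. ?g (s1 24) \<ge> ?g (s 24) & (\<forall>i<n. s1 24 i <= q) & (\<forall>i<j. i < n --> s1 24 i = 0 \<or> s1 24 i = q) & (\<forall>i\<in>?R. s1 24 i = 0)"
 have "?I n s'"
  unfolding s'_def round_cmd_def
 proof (rule For_rule[where s = s and I = ?I])
  show "n = min (eval_expr (cell 0) s) (s 5 0)" using s by (simp add: inp_def)
  fix j s1 assume j: "j < n" and I: "?I j s1" and s140: "s1 40 0 = j"
   and fr: "\<And>b. b ~: insert 40 (writes (If (ixE 12 40) Nop ?b)) ==> s1 b = s b"
  have i1: "inp s1" by (rule inp_cong[OF s]; rule fr) auto
  have e12: "s1 12 = s 12" "s1 10 = s 10" "s1 6 = s 6" by (auto intro!: fr)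
  show "?I (Suc j) (den (If (ixE 12 40) Nop ?b) s1)"
  proof (cases "s1 12 j = 0")
   case False
   then have jR: "j \<in> ?R" using j e12 by (simp add: setof_def)
   have "den (If (ixE 12 40) Nop ?b) s1 = s1" using False s140 by simp
   then show ?thesis using I jR by (auto simp: less_Suc_eq)
  next
   case True
   define s2 where "s2 = den (wapp 24 18) s1"
   define s3 where "s3 = den (sumE 30 26 (ixE 24 30)) s2"
   define s4 where "s4 = den (mulE 31 27 (cell 0) (ixE 18 40)) s3"
   define s5 where "s5 = den (mulE 31 28 (cell 10) (Add (mulc q (cell 6)) (mulc 2 (Sub (cell 26) (ixE 24 40))))) s4"
   have f2: "s2 b = s1 b" if "b ~: {18, 30, 31, 32, 33}" for b using that by (simp add: s2_def den_frame)
   have f3: "s3 b = s2 b" if "b ~: {30, 26}" for b using that by (simp add: s3_def den_frame)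
   have f4: "s4 b = s3 b" if "b ~: {31, 27}" for b using that by (simp add: s4_def den_frame)
   have f5: "s5 b = s4 b" if "b ~: {31, 28}" for b using that by (simp add: s5_def den_frame)
   have i2: "inp s2" by (rule inp_cong[OF i1]; rule f2) auto
   have i3: "inp s3" by (rule inp_cong[OF i2]; rule f3) auto
   have i4: "inp s4" by (rule inp_cong[OF i3]; rule f4) auto
   have z: "s2 18 j = Wy (s1 24) j" unfolding s2_def by (rule den_wapp[OF i1 _ _ j]) auto
   have tot: "s3 26 0 = (\<Sum>i<n. s1 24 i)"
    unfolding s3_def
   by (rule den_sumE[OF i2]) (auto simp: f2)
   have m4: "s4 27 0 = n * Wy (s1 24) j"
    unfolding s4_def
   proof (rule den_mulE)
    show "eval_expr (cell 0) (upd s3 27 0 0) = n" "n <= s3 5 0" using i3 by (auto simp: inp_def)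
    fix s' :: mem assume "\<And>b. b ~= 31 ==> b ~= 27 ==> s' b = s3 b"
    then show "eval_expr (ixE 18 40) s' = Wy (s1 24) j" using z s140 by (simp add: f2 f3)
   qed auto
   have m5: "s5 28 0 = s 10 0 * (q * s 6 0 + 2 * ((\<Sum>i<n. s1 24 i) - s1 24 j))"
    unfolding s5_def
   proof (rule den_mulE)
    show "eval_expr (cell 10) (upd s4 28 0 0) = s 10 0" by (simp add: f2 f3 f4 e12)
    show "s 10 0 <= s4 5 0" using d i4 by (simp add: inp_def)
    fix s' :: mem assume s': "\<And>b. b ~= 31 ==> b ~= 28 ==> s' b = s4 b"
    have "s' 6 = s 6" "s' 26 = s3 26" "s' 40 = s1 40" "s' 24 = s1 24" by (simp_all add: s' f2 f3 f4 e12)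
    then show "eval_expr (Add (mulc q (cell 6)) (mulc 2 (Sub (cell 26) (ixE 24 40)))) s'
      = q * s 6 0 + 2 * ((\<Sum>i<n. s1 24 i) - s1 24 j)" using tot s140 by simp
   qed auto
   have s27: "s5 27 0 = n * Wy (s1 24) j" using m4 by (simp add: f5)
   have s24: "s5 24 = s1 24" "s5 40 = s1 40" by (simp_all add: f2 f3 f4 f5)
   define x where "x = (if s5 28 0 <= 2 * c * s5 27 0 then q else 0)"
   have res: "den (If (ixE 12 40) Nop ?b) s1 24 = (s1 24)(j := x)"
    using True s140 s24 by (cases "s5 28 0 <= 2 * c * s5 27 0")
     (auto simp: s2_def[symmetric] s3_def[symmetric] s4_def[symmetric] s5_def[symmetric] x_def)
   let ?P = "s1 24"
   let ?sl = "int (2 * c * (n * Wy ?P j)) - int (s 10 0 * (s 6 0 * q + 2 * ((\<Sum>k<n. ?P k) - ?P j)))"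
   \<comment> \<open>The value at \<open>j\<close> moves from \<open>?P j\<close> to
     \<open>x\<close> along a line of slope \<open>?sl\<close>; the test of the program picks the
     better end.\<close>
   have "?g ?P = ?g (?P(j := ?P j))" by simp
   also have "... = ?g (?P(j := 0)) + int (?P j) * ?sl" by (rule gain_upd[OF j])
   also have "int (?P j) * ?sl <= int x * ?sl"
   proof (cases "s5 28 0 <= 2 * c * s5 27 0")
    case True
    then have "s 10 0 * (s 6 0 * q + 2 * ((\<Sum>k<n. ?P k) - ?P j)) <= 2 * c * (n * Wy ?P j)"
     unfolding m5 s27 by (simp only: mult.commute[of q])
    then have "0 <= ?sl" unfolding diff_ge_0_iff_ge by (rule of_nat_mono)
    moreover have "int (?P j) <= int x" using True I j by (simp add: x_def)
    ultimately show ?thesis by (intro mult_right_mono)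
   next
    case False
    then have "2 * c * (n * Wy ?P j) <= s 10 0 * (s 6 0 * q + 2 * ((\<Sum>k<n. ?P k) - ?P j))"
     unfolding m5 s27 by (simp only: mult.commute[of q])
    then have "?sl <= 0" unfolding diff_le_0_iff_le by (rule of_nat_mono)
    then show ?thesis using False by (simp add: x_def mult_nonneg_nonpos)
   qed
   also have "?g (?P(j := 0)) + int x * ?sl = ?g (?P(j := x))" by (rule gain_upd[OF j, symmetric])
   finally have "?g (?P(j := x)) \<ge> ?g (s 24)" using I by linarith
   moreover have "j ~: ?R" using True e12 by (simp add: setof_def)
   moreover have "x = 0 \<or> x = q" by (simp add: x_def)
   ultimately show ?thesis unfolding res using I by (auto simp: less_Suc_eq)
  qed
 qed (use P in \<open>auto simp: setof_def\<close>)
 then show "?g (s' 24) \<ge> ?g (s 24)" "i < n ==> s' 24 i = 0 \<or> s' 24 i = q" "i \<in> ?R ==> s' 24 i = 0"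
  by (auto simp: setof_def)
qed

lemma gain_indicator:
 assumes "X \<subseteq> {..<n}"
 shows "gain c d M q (%i. if i \<in> X then q else 0)
  = int (q * q) * (int (c * n * wS X) - int (d * (card X * (M + card X - 1))))"
proof -
 have fX: "finite X" using assms finite_subset by blast
 have 1: "quad (%i. if i \<in> X then q else 0) = q * q * wS X"
 proof -
  have "(\<Sum>k<n. wt i k * ((if i \<in> X then q else 0) * (if k \<in> X then q else 0))) = (if i \<in> X then \<Sum>k\<in>X. q * q * wt i k else 0)" for i
   using assms by (auto intro!: sum.mono_neutral_cong_right)
  then have "quad (%i. if i \<in> X then q else 0) = (\<Sum>i<n. if i \<in> X then \<Sum>k\<in>X. q * q * wt i k else 0)"
   by (simp add: quad_def)
  also have "... = (\<Sum>i\<in>X. \<Sum>k\<in>X. q * q * wt i k)" using assms by (auto intro!: sum.mono_neutral_cong_right)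
  finally show ?thesis by (simp add: wS_def sum_distrib_left)
 qed
 have 2: "(\<Sum>i<n. if i \<in> X then q else 0) = card X * q"
  using assms by (simp add: Int_absorb1 flip: sum.inter_restrict)
 have 3: "pairs (%i. if i \<in> X then q else 0) = q * q * (card X * (card X - 1))"
 proof -
  have "(\<Sum>k<n. if i = k then 0 else (if i \<in> X then q else 0) * (if k \<in> X then q else 0))
    = (if i \<in> X then (card X - 1) * (q * q) else 0)" for i
  proof (cases "i \<in> X")
   case True
   then have "(\<Sum>k<n. if i = k then 0 else (if i \<in> X then q else 0) * (if k \<in> X then q else 0)) = (\<Sum>k\<in>X - {i}. q * q)"
    using assms by (intro sum.mono_neutral_cong_right) auto
   then show ?thesis using True fX by simp
  qed simp
  then have "pairs (%i. if i \<in> X then q else 0) = (\<Sum>i<n. if i \<in> X then (card X - 1) * (q * q) else 0)"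
   by (simp add: pairs_def)
  also have "... = card X * ((card X - 1) * (q * q))"
   using assms by (simp add: Int_absorb1 flip: sum.inter_restrict)
  finally show ?thesis by simp
 qed
 define k where "k = card X - 1"
 have 4: "card X * (M + card X - 1) = card X * M + card X * k"
  by (cases "card X = 0") (auto simp: algebra_simps k_def)
 show ?thesis unfolding gain_def 1 2 3 4 k_def[symmetric] by (simp add: algebra_simps)
qed

subsection \<open>Candidate sets\<close>

text \<open>The term with \<open>M\<close> demands average degree above
  \<open>d * M / (c * n)\<close> up to a lower-order correction even in a tiny set. Thus disjoint
  small sets can be united until they reach a fixed share of \<open>M\<close>, and the union is
  still dense at that size.\<close>

definition dense :: "nat => nat => nat => nat set => bool" where
 "dense c d M X \<longleftrightarrow> d * (card X * (M + card X - 1)) < c * n * wS X"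

text \<open>Cell 0 of array 16 is a flag that freezes the state once a dense set larger than
  \<open>a\<close> has been stored in array 13. Smaller dense sets are absorbed into
  \<open>R\<close>, held by array 12, as long as \<open>R\<close> has fewer than
  \<open>2 * a\<close> elements.\<close>

definition upd_cmd :: cmd where
 "upd_cmd = If (cell 16) Nop (If (leE (Add (cell 37) (Lit 1)) (mulc 2 (cell 7)))
   (If (leE (cell 26) (cell 7)) (mapE 30 12 (nz (Add (ixE 12 30) (ixE 25 30))))
    (Sq (mapE 30 13 (ixE 25 30)) (St 16 (Lit 0) (Lit 1)))) Nop)"

definition test_cmd :: "nat => cmd" where
 "test_cmd c = sqs [sumE 30 26 (ixE 25 30), wapp 25 18, mapIf 30 19 (ixE 25 30) (ixE 18 30) (Lit 0),
   sumE 30 27 (ixE 19 30), mulE 31 28 (cell 0) (cell 27), mulE 31 29 (cell 26) (Add (cell 6) (Sub (cell 26) (Lit 1))),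
   mulE 31 36 (cell 10) (cell 29), sumE 30 37 (nz (ixE 12 30)),
   If (leE (Add (cell 36) (Lit 1)) (mulc c (cell 28))) upd_cmd Nop]"

lemma writes_upd [simp]: "writes upd_cmd = {12, 13, 16, 30}"
 by (auto simp: upd_cmd_def)

lemma writes_test [simp]: "writes (test_cmd c) = {12, 13, 16, 18, 19, 26, 27, 28, 29, 30, 31, 32, 33, 36, 37}"
 by (auto simp: test_cmd_def)

lemma sum_nz: "(\<Sum>i<n. 1 - (1 - f i)) = card {i. i < n & f i ~= (0::nat)}"
proof -
 have "(\<Sum>i<n. 1 - (1 - f i)) = (\<Sum>i<n. if f i ~= 0 then 1 else 0)" by (intro sum.cong) auto
 also have "... = card {i \<in> {..<n}. f i ~= 0}" by (simp flip: sum.inter_filter)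
 finally show ?thesis by (simp add: lessThan_def)
qed

lemma wS_eq_sum:
 assumes "X \<subseteq> {..<n}" "\<And>i. i < n ==> x i = (if i \<in> X then 1 else 0)"
 shows "(\<Sum>i<n. if i \<in> X then Wy x i else 0) = wS X"
proof -
 have "Wy x i = (\<Sum>v\<in>X. wt i v)" for i
  unfolding Wy_def using assms by (intro sum.mono_neutral_cong_right) auto
 then show ?thesis unfolding wS_def using assms(1) by (auto intro!: sum.mono_neutral_cong_right)
qed

type_synonym st = "nat set \<times> nat set \<times> nat"

definition st :: "mem => st" where
 "st s = (setof s 12, setof s 13, s 16 0)"

definition chg :: "nat => nat => nat => nat => (st \<times> st) set" where
 "chg c d M a = {((R, B, f), (R', B', f')). f = 0 & R \<subseteq> {..<n} & card R < 2 * a &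
   (\<exists>X. X \<subseteq> {..<n} - R & dense c d M X &
    (card X <= a & R' = R \<union> X & B' = B & f' = 0 \<or> a < card X & R' = R & B' = X & f' = 1))}"

lemma st_cong: "s' 12 = s 12 ==> s' 13 = s 13 ==> s' 16 = s 16 ==> st s' = st s"
 by (simp add: st_def setof_def)

lemma den_test:
 fixes c :: nat
 assumes s: "inp s" and d: "s 10 0 <= n + m"
  and X: "\<And>i. i < n ==> s 25 i = (if i \<in> X then 1 else 0)" "X \<subseteq> {..<n} - setof s 12"
 defines "s' \<equiv> den (test_cmd c) s"
 shows "(st s, st s') \<in> chg c (s 10 0) (s 6 0) (s 7 0) \<or> st s' = st s"
  and "dense c (s 10 0) (s 6 0) X ==> s 16 0 = 0 ==> card (setof s 12) < 2 * s 7 0 ==>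
   (st s, st s') \<in> chg c (s 10 0) (s 6 0) (s 7 0)"
proof -
 define s1 where "s1 = den (sumE 30 26 (ixE 25 30)) s"
 define s2 where "s2 = den (wapp 25 18) s1"
 define s3 where "s3 = den (mapIf 30 19 (ixE 25 30) (ixE 18 30) (Lit 0)) s2"
 define s4 where "s4 = den (sumE 30 27 (ixE 19 30)) s3"
 define s5 where "s5 = den (mulE 31 28 (cell 0) (cell 27)) s4"
 define s6 where "s6 = den (mulE 31 29 (cell 26) (Add (cell 6) (Sub (cell 26) (Lit 1)))) s5"
 define s7 where "s7 = den (mulE 31 36 (cell 10) (cell 29)) s6"
 define s8 where "s8 = den (sumE 30 37 (nz (ixE 12 30))) s7"
 have f1: "s1 b = s b" if "b ~: {30, 26}" for b using that by (simp add: s1_def den_frame)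
 have f2: "s2 b = s1 b" if "b ~: {18, 30, 31, 32, 33}" for b using that by (simp add: s2_def den_frame)
 have f3: "s3 b = s2 b" if "b ~: {30, 19}" for b using that by (simp add: s3_def den_frame)
 have f4: "s4 b = s3 b" if "b ~: {30, 27}" for b using that by (simp add: s4_def den_frame)
 have f5: "s5 b = s4 b" if "b ~: {31, 28}" for b using that by (simp add: s5_def den_frame)
 have f6: "s6 b = s5 b" if "b ~: {31, 29}" for b using that by (simp add: s6_def den_frame)
 have f7: "s7 b = s6 b" if "b ~: {31, 36}" for b using that by (simp add: s7_def den_frame)
 have f8: "s8 b = s7 b" if "b ~: {30, 37}" for b using that by (simp add: s8_def den_frame)
 note fs = f1 f2 f3 f4 f5 f6 f7 f8
 have i1: "inp s1" by (rule inp_cong[OF s]; rule f1) auto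
 have i2: "inp s2" by (rule inp_cong[OF i1]; rule f2) auto
 have i3: "inp s3" by (rule inp_cong[OF i2]; rule f3) auto
 have i4: "inp s4" by (rule inp_cong[OF i3]; rule f4) auto
 have i5: "inp s5" by (rule inp_cong[OF i4]; rule f5) auto
 have i6: "inp s6" by (rule inp_cong[OF i5]; rule f6) auto
 have i7: "inp s7" by (rule inp_cong[OF i6]; rule f7) auto
 have i8: "inp s8" by (rule inp_cong[OF i7]; rule f8) auto
 have XV: "X \<subseteq> {..<n}" using X by auto
 have "s1 26 0 = (\<Sum>i<n. if i \<in> X then 1 else 0)"
  unfolding s1_def
 by (rule den_sumE[OF s]) (use X(1) in auto)
 then have sz: "s1 26 0 = card X" using XV by (simp add: Int_absorb1 flip: sum.inter_restrict)
 have z: "s2 18 i = Wy (s 25) i" if "i < n" for i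
  unfolding s2_def using den_wapp[OF i1, of 25 18 i] that by (simp add: f1)
 have s19: "s3 19 i = (if i \<in> X then Wy (s 25) i else 0)" if i: "i < n" for i
 proof -
  have "s3 19 i = (if i < n then (%i. if i \<in> X then Wy (s 25) i else 0) i else s2 19 i)"
   unfolding s3_def
  by (rule den_mapIf[OF i2]) (use X(1) z in \<open>auto simp: f1 f2\<close>)
  then show ?thesis using i by simp
 qed
 have "s4 27 0 = (\<Sum>i<n. if i \<in> X then Wy (s 25) i else 0)"
  unfolding s4_def
 by (rule den_sumE[OF i3]) (use s19 in auto)
 then have w: "s4 27 0 = wS X" using wS_eq_sum[OF XV X(1)] by simp
 have l: "s5 28 0 = n * wS X"
  unfolding s5_def
  by (rule den_mulE) (use i4 w in \<open>auto simp: inp_def\<close>)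
 have cX: "card X <= n" using card_mono[OF _ XV] by simp
 have r1: "s6 29 0 = card X * (s 6 0 + (card X - 1))"
  unfolding s6_def
  by (rule den_mulE) (use i5 cX sz in \<open>auto simp: inp_def fs\<close>)
 have r2: "s7 36 0 = s 10 0 * (card X * (s 6 0 + (card X - 1)))"
  unfolding s7_def
  by (rule den_mulE) (use i6 d r1 in \<open>auto simp: inp_def fs\<close>)
 have "s8 37 0 = (\<Sum>i<n. 1 - (1 - s 12 i))"
  unfolding s8_def
 by (rule den_sumE[OF i7]) (auto simp: fs)
 then have cR: "s8 37 0 = card (setof s 12)" unfolding sum_nz by (simp add: setof_def)
 have v8: "s8 36 0 = s 10 0 * (card X * (s 6 0 + card X - 1))" "s8 28 0 = n * wS X" "s8 26 0 = card X"
  "s8 7 = s 7" "s8 16 = s 16" "s8 12 = s 12" "s8 13 = s 13" "s8 25 = s 25"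
  using r2 l sz by (cases "card X = 0"; simp add: fs)+
 have cond: "eval_expr (leE (Add (cell 36) (Lit 1)) (mulc c (cell 28))) s8 ~= 0 \<longleftrightarrow> dense c (s 10 0) (s 6 0) X"
  using v8 by (auto simp: dense_def mult_ac)
 have s': "s' = den (If (leE (Add (cell 36) (Lit 1)) (mulc c (cell 28))) upd_cmd Nop) s8"
  unfolding s'_def test_cmd_def by (simp only: sqs.simps den.simps s1_def s2_def s3_def s4_def s5_def s6_def s7_def s8_def)
 have m12: "den (mapE 30 12 (nz (Add (ixE 12 30) (ixE 25 30)))) s8 12 i
   = (if i < n then (%i. 1 - (1 - (s 12 i + s 25 i))) i else s8 12 i)" for i
 by (rule den_mapE[OF i8]) (use v8 in auto)
 have m13: "den (mapE 30 13 (ixE 25 30)) s8 13 i = (if i < n then (%i. s 25 i) i else s8 13 i)" for i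
 by (rule den_mapE[OF i8]) (use v8 in auto)
 consider (no) "\<not> (dense c (s 10 0) (s 6 0) X & s 16 0 = 0 & card (setof s 12) < 2 * s 7 0)"
  | (add) "dense c (s 10 0) (s 6 0) X" "s 16 0 = 0" "card (setof s 12) < 2 * s 7 0" "card X <= s 7 0"
  | (big) "dense c (s 10 0) (s 6 0) X" "s 16 0 = 0" "card (setof s 12) < 2 * s 7 0" "s 7 0 < card X"
  by linarith
 then have *: "(if dense c (s 10 0) (s 6 0) X & s 16 0 = 0 & card (setof s 12) < 2 * s 7 0
   then (st s, st s') \<in> chg c (s 10 0) (s 6 0) (s 7 0) else st s' = st s)"
 proof cases
  case no
  have "s' = s8"
   using no cond cR v8 unfolding s' by (auto simp: upd_cmd_def)
  then show ?thesis using no v8 by (auto intro: st_cong)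
 next
  case add
  have "s' = den (mapE 30 12 (nz (Add (ixE 12 30) (ixE 25 30)))) s8"
   using add cond cR v8 unfolding s' by (simp add: upd_cmd_def)
  then have "setof s' 12 = setof s 12 \<union> X" "s' 13 = s 13" "s' 16 = s 16"
   using m12 X(1) XV v8 by (auto simp: setof_def den_frame split: if_splits)
  then have "st s' = (setof s 12 \<union> X, setof s 13, 0)" using add by (simp add: st_def setof_def)
  then show ?thesis using add X(2) setof_sub by (auto simp: chg_def st_def)
 next
  case big
  have "s' = den (St 16 (Lit 0) (Lit 1)) (den (mapE 30 13 (ixE 25 30)) s8)"
   using big cond cR v8 unfolding s' by (simp add: upd_cmd_def)
  then have "s' 12 = s 12" "setof s' 13 = X" "s' 16 0 = 1"
   using m13 X(1) XV v8 by (auto simp: setof_def den_frame split: if_splits)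
  then have "st s' = (setof s 12, X, 1)" by (simp add: st_def setof_def)
  then show ?thesis using big X(2) setof_sub by (auto simp: chg_def st_def)
 qed
 then show "(st s, st s') \<in> chg c (s 10 0) (s 6 0) (s 7 0) \<or> st s' = st s" by (auto split: if_splits)
 show "dense c (s 10 0) (s 6 0) X ==> s 16 0 = 0 ==> card (setof s 12) < 2 * s 7 0 ==>
   (st s, st s') \<in> chg c (s 10 0) (s 6 0) (s 7 0)" using * by simp
qed

definition table_cmd :: "nat list => cmd" where
 "table_cmd \<phi> = sqs (map (%x. St 23 (Lit x) (Lit (\<phi> ! x))) [0..<length \<phi>])"

lemma writes_table: "writes (table_cmd \<phi>) \<subseteq> {23}"
 by (auto simp: table_cmd_def writes_sqs)

lemma den_table_aux: "den (sqs (map (%x. St 23 (Lit x) (Lit (g x))) [0..<k])) s 23 x = (if x < k then g x else s 23 x)"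
 by (induction k) (auto simp: sqs_append)

lemma den_table: "x < length \<phi> ==> den (table_cmd \<phi>) s 23 x = \<phi> ! x"
 by (simp add: table_cmd_def den_table_aux)

definition cand_cmd :: "nat => nat => nat list => cmd" where
 "cand_cmd c q \<phi> = sqs [table_cmd \<phi>, mapIf 30 24 (ixE 12 30) (Lit 0) (Arr 23 (ixE 22 30)), round_cmd c q,
   mapIf 30 25 (ixE 12 30) (Lit 0) (nz (ixE 24 30)), test_cmd c]"

lemma writes_cand: "writes (cand_cmd c q \<phi>) \<subseteq> {12, 13, 16, 18, 19, 23, 24, 25, 26, 27, 28, 29, 30, 31, 32, 33, 36, 37, 40}"
 using writes_table by (fastforce simp: cand_cmd_def)

lemma den_cand:
 fixes c :: nat and \<phi> :: "nat list"
 assumes s: "inp s" and d: "s 10 0 <= n + m" and q: "0 < q"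
 defines "s' \<equiv> den (cand_cmd c q \<phi>) s"
 shows "(st s, st s') \<in> chg c (s 10 0) (s 6 0) (s 7 0) \<or> st s' = st s"
  and "[|s 16 0 = 0; card (setof s 12) < 2 * s 7 0; \<forall>i<n. s 22 i < length \<phi>; \<forall>x\<in>set \<phi>. x <= q;
   0 < gain c (s 10 0) (s 6 0) q (%i. if i \<in> setof s 12 then 0 else \<phi> ! (s 22 i))|] ==>
   (st s, st s') \<in> chg c (s 10 0) (s 6 0) (s 7 0)"
proof -
 define s1 where "s1 = den (table_cmd \<phi>) s"
 define s2 where "s2 = den (mapIf 30 24 (ixE 12 30) (Lit 0) (Arr 23 (ixE 22 30))) s1"
 define s3 where "s3 = den (round_cmd c q) s2"
 define s4 where "s4 = den (mapIf 30 25 (ixE 12 30) (Lit 0) (nz (ixE 24 30))) s3"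
 have f1: "s1 b = s b" if "b ~= 23" for b unfolding s1_def by (rule den_frame) (use that writes_table in blast)
 have f2: "s2 b = s1 b" if "b ~: {30, 24}" for b using that by (simp add: s2_def den_frame)
 have f3: "s3 b = s2 b" if "b ~: {18, 24, 26, 27, 28, 30, 31, 32, 33, 40}" for b using that by (simp add: s3_def den_frame)
 have f4: "s4 b = s3 b" if "b ~: {30, 25}" for b using that by (simp add: s4_def den_frame)
 note fs = f1 f2 f3 f4
 have i1: "inp s1" by (rule inp_cong[OF s]; rule f1) auto
 have i2: "inp s2" by (rule inp_cong[OF i1]; rule f2) auto
 have i3: "inp s3" by (rule inp_cong[OF i2]; rule f3) auto
 have i4: "inp s4" by (rule inp_cong[OF i3]; rule f4) auto
 have s': "s' = den (test_cmd c) s4"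
  unfolding s'_def cand_cmd_def by (simp add: s1_def s2_def s3_def s4_def)
 define X where "X = {i. i < n & i ~: setof s 12 & s3 24 i ~= 0}"
 have s25: "s4 25 i = (if i \<in> X then 1 else 0)" if i: "i < n" for i
 proof -
  have "s4 25 i = (if i < n then (%i. if i \<in> X then 1 else 0) i else s3 25 i)"
   unfolding s4_def
  by (rule den_mapIf[OF i3]) (auto simp: X_def setof_def fs)
  then show ?thesis using i by simp
 qed
 have v4: "s4 10 = s 10" "s4 6 = s 6" "s4 7 = s 7" "s4 12 = s 12" "s4 13 = s 13" "s4 16 = s 16" by (simp_all add: fs)
 have st4: "st s4 = st s" "setof s4 12 = setof s 12" using v4 by (simp_all add: st_def setof_def)
 have XR: "X \<subseteq> {..<n} - setof s4 12" unfolding st4 by (auto simp: X_def)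
 note T = den_test[OF i4 _ s25 XR, of c, folded s', unfolded v4 st4, OF d]
 show "(st s, st s') \<in> chg c (s 10 0) (s 6 0) (s 7 0) \<or> st s' = st s" by (rule T(1))
 assume a: "s 16 0 = 0" "card (setof s 12) < 2 * s 7 0" and ty: "\<forall>i<n. s 22 i < length \<phi>"
  and phi: "\<forall>x\<in>set \<phi>. x <= q"
  and g: "0 < gain c (s 10 0) (s 6 0) q (%i. if i \<in> setof s 12 then 0 else \<phi> ! (s 22 i))"
 have s24: "s2 24 i = (if i \<in> setof s 12 then 0 else \<phi> ! (s 22 i))" if i: "i < n" for i
 proof -
  have "s2 24 i = (if i < n then (%i. if i \<in> setof s 12 then 0 else \<phi> ! (s 22 i)) i else s1 24 i)"
   unfolding s2_def
  proof (rule den_mapIf[OF i1])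
   fix s' i assume *: "i < n" "s' 30 0 = i" "\<And>b. b ~= 30 ==> b ~= 24 ==> s' b = s1 b"
   have "s1 23 (s 22 i) = \<phi> ! (s 22 i)" unfolding s1_def using ty *(1) by (intro den_table) auto
   then show "(if eval_expr (ixE 12 30) s' ~= 0 then eval_expr (Lit 0) s' else eval_expr (Arr 23 (ixE 22 30)) s')
     = (if i \<in> setof s 12 then 0 else \<phi> ! (s 22 i))" using * by (auto simp: setof_def f1)
  qed auto
  then show ?thesis using i by simp
 qed
 have v2: "s2 10 = s 10" "s2 6 = s 6" "setof s2 12 = setof s 12" by (simp_all add: fs setof_def)
 have Pq: "s2 24 i <= q" if "i < n" for i using s24[OF that] ty phi that by (auto simp: nth_mem)
 have PR: "s2 24 i = 0" if "i \<in> setof s2 12" for i using that s24[of i] v2(3) setof_sub[of s 12] by auto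
 have dd: "s2 10 0 <= n + m" using d v2 by simp
 note rd = den_round[where c = c and q = q, OF i2 dd, folded s3_def, unfolded v2]
 have rd1: "gain c (s 10 0) (s 6 0) q (s2 24) <= gain c (s 10 0) (s 6 0) q (s3 24)"
  by (rule rd(1)) (use Pq PR v2 in auto)
 have rd2: "s3 24 i = 0 \<or> s3 24 i = q" if "i < n" for i by (rule rd(2)) (use Pq PR v2 that in auto)
 have rd3: "s3 24 i = 0" if "i \<in> setof s 12" for i by (rule rd(3)) (use Pq PR v2 that in auto)
 have "0 < gain c (s 10 0) (s 6 0) q (s2 24)" using g gain_cong[of "s2 24"] s24 by simp
 then have "0 < gain c (s 10 0) (s 6 0) q (s3 24)" using rd1 by linarith
 also have "gain c (s 10 0) (s 6 0) q (s3 24) = gain c (s 10 0) (s 6 0) q (%i. if i \<in> X then q else 0)"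
 proof (rule gain_cong)
  fix i assume i: "i < n"
  show "s3 24 i = (if i \<in> X then q else 0)"
   using rd2[OF i] rd3[of i] i by (auto simp: X_def)
 qed
 also have "... = int (q * q) * (int (c * n * wS X) - int (s 10 0 * (card X * (s 6 0 + card X - 1))))"
  by (rule gain_indicator) (auto simp: X_def)
 finally have "0 < int (c * n * wS X) - int (s 10 0 * (card X * (s 6 0 + card X - 1)))"
  by (metis of_nat_0_le_iff zero_less_mult_pos q of_nat_0_less_iff nat_0_less_mult_iff)
 then have "dense c (s 10 0) (s 6 0) X" unfolding dense_def by (metis diff_gt_0_iff_gt of_nat_less_iff)
 then show "(st s, st s') \<in> chg c (s 10 0) (s 6 0) (s 7 0)" using a by (intro T(2))
qed

subsection \<open>Exhaustive search\<close>

definition ok :: "nat => nat => nat => mem => bool" where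
 "ok d M a s \<longleftrightarrow> inp s & s 10 0 = d & s 6 0 = M & s 7 0 = a"

abbreviation digs :: "mem => nat => nat" where
 "digs s \<equiv> %x. s (100 + x) 0"

definition meas :: "st => nat" where
 "meas z = card (fst z) + snd (snd z)"

text \<open>The inequality in \<open>dense\<close> is strict, so a dense set is nonempty; each
  change therefore enlarges \<open>R\<close> or raises the flag.\<close>

lemma chg_meas: "(z, z') \<in> chg c d M a ==> meas z < meas z'"
proof -
 assume "(z, z') \<in> chg c d M a"
 then obtain R B R' B' f' X where z: "z = (R, B, 0)" "z' = (R', B', f')" and R: "R \<subseteq> {..<n}"
  and X: "X \<subseteq> {..<n} - R" "dense c d M X"
   "card X <= a & R' = R \<union> X & B' = B & f' = 0 \<or> a < card X & R' = R & B' = X & f' = 1"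
  by (auto simp: chg_def)
 have fin: "finite R" "finite X" using R X(1) by (auto intro: finite_subset)
 have "X ~= {}" using X(2) by (auto simp: dense_def wS_def)
 then have "0 < card X" using fin by (simp add: card_gt_0_iff)
 moreover have "card (R \<union> X) = card R + card X" using fin X(1) by (intro card_Un_disjoint) auto
 ultimately show ?thesis using X(3) z by (auto simp: meas_def)
qed

lemma chg_rtrancl_meas: "(z, z') \<in> (chg c d M a)^* ==> z = z' \<or> meas z < meas z'"
 by (induction rule: rtrancl_induct) (auto dest!: chg_meas)

lemma chg_rtrancl_meas_le: "(z, z') \<in> (chg c d M a)^* ==> meas z <= meas z'"
 using chg_rtrancl_meas by fastforce

text \<open>
 \<open>F\<close> expresses that the attempts encoded by a digit assignment fail in a state; a search step
 that does not change the state certifies failure.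
\<close>

definition searches :: "nat => nat => nat => nat => cmd => (st => (nat => nat) => bool) => bool" where
 "searches c d M a p F \<longleftrightarrow> (\<forall>s. ok d M a s --> ok d M a (den p s) & (st s, st (den p s)) \<in> (chg c d M a)^* &
   (st (den p s) = st s --> F (st s) (digs s)))"

lemma searchesD:
 assumes "searches c d M a p F" "ok d M a s"
 shows "ok d M a (den p s)" "(st s, st (den p s)) \<in> (chg c d M a)^*" "st (den p s) = st s ==> F (st s) (digs s)"
 using assms by (auto simp: searches_def)

text \<open>The combinations of state, digits and table for which an attempt is sure to change the
  state.\<close>

definition trial :: "nat => nat => nat => nat => nat => nat => nat => nat => nat list => st => (nat => nat) => bool" where
 "trial c d M a q D E k \<phi> z dg \<longleftrightarrow> (case z of (R, B, f) => f = 0 & card R < 2 * a & (\<forall>x. dg x <= n + m) & (\<forall>b<k. dg (blk D E b + 2) < n) &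
   0 < gain c d M q (%i. if i \<in> R then 0 else \<phi> ! vtype D E k R d dg i))"

definition body_cmd :: "nat => nat => nat => nat => nat => nat list list => cmd" where
 "body_cmd c q D E k \<Phi> = Sq (types_cmd D E k) (sqs (map (cand_cmd c q) \<Phi>))"

lemma writes_body:
 "writes (body_cmd c q D E k \<Phi>) \<subseteq> {12, 13, 16, 18, 19, 20, 21, 22, 23, 24, 25, 26, 27, 28, 29, 30, 31, 32, 33, 34, 35, 36, 37, 40}"
 using writes_types writes_cand by (fastforce simp: body_cmd_def writes_sqs)

lemma ok_cong:
 assumes "ok d M a s" "\<And>b. b \<in> {0, 1, 2, 5, 6, 7, 10} ==> s' b = s b"
 shows "ok d M a s'"
 using assms(1) inp_cong[of s s'] assms(2) by (auto simp: ok_def)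

text \<open>Changes cannot cancel, because \<open>meas\<close> strictly grows. So an unchanged final
  state means that every attempt was made in that same state and left it alone.\<close>

lemma cands_search:
 fixes c :: nat and \<Phi> :: "nat list list"
 assumes ok: "ok d M a s" and d: "d <= n + m" and q: "0 < q"
 defines "s' \<equiv> den (sqs (map (cand_cmd c q) \<Phi>)) s"
 shows "(st s, st s') \<in> (chg c d M a)^*"
  and "[|\<phi> \<in> set \<Phi>; s 16 0 = 0; card (setof s 12) < 2 * a; \<forall>i<n. s 22 i < length \<phi>; \<forall>x\<in>set \<phi>. x <= q;
   0 < gain c d M q (%i. if i \<in> setof s 12 then 0 else \<phi> ! (s 22 i))|] ==> st s' ~= st s"
proof -
 have "(st s, st s') \<in> (chg c d M a)^* & (\<phi> \<in> set \<Phi> & s 16 0 = 0 & card (setof s 12) < 2 * a & (\<forall>i<n. s 22 i < length \<phi>) & (\<forall>x\<in>set \<phi>. x <= q) &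
   0 < gain c d M q (%i. if i \<in> setof s 12 then 0 else \<phi> ! (s 22 i)) --> st s' ~= st s)"
  unfolding s'_def using ok
 proof (induction \<Phi> arbitrary: s)
  case (Cons \<psi> \<Phi>)
  define t where "t = den (cand_cmd c q \<psi>) s"
  define u where "u = den (sqs (map (cand_cmd c q) \<Phi>)) t"
  have i: "inp s" and c: "s 10 0 = d" "s 6 0 = M" "s 7 0 = a" using Cons.prems by (auto simp: ok_def)
  have ft: "t b = s b" if "b ~: {12, 13, 16, 18, 19, 23, 24, 25, 26, 27, 28, 29, 30, 31, 32, 33, 36, 37, 40}" for b
   unfolding t_def by (rule den_frame) (use that writes_cand in blast)
  have okt: "ok d M a t" by (rule ok_cong[OF Cons.prems], rule ft) auto
  have dd: "s 10 0 <= n + m" using c d by simp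
  note C = den_cand[OF i dd q, where c = c and \<phi> = \<psi>, folded t_def, unfolded c]
  note IH = Cons.IH[OF okt, folded u_def]
  have all: "(st s, st u) \<in> (chg c d M a)^*" using C(1) IH by (auto intro: converse_rtrancl_into_rtrancl)
  have ne: "st u ~= st s" if "\<phi> \<in> set (\<psi> # \<Phi>)" "s 16 0 = 0" "card (setof s 12) < 2 * a" "\<forall>i<n. s 22 i < length \<phi>" "\<forall>x\<in>set \<phi>. x <= q"
   "0 < gain c d M q (%i. if i \<in> setof s 12 then 0 else \<phi> ! (s 22 i))"
  proof (cases "st t = st s")
   case False
   then have "(st s, st t) \<in> chg c d M a" using C(1) by blast
   then have "meas (st s) < meas (st t)" by (rule chg_meas)
   then show ?thesis using chg_rtrancl_meas_le[of "st t" "st u"] IH by fastforce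
  next
   case True
   have "\<psi> ~= \<phi>"
   proof
    assume "\<psi> = \<phi>"
    then have "(st s, st t) \<in> chg c d M a" using C(2) that by blast
    then show False using chg_meas True by fastforce
   qed
   moreover have t22: "t 22 = s 22" by (rule ft) auto
   moreover have "t 16 0 = s 16 0" "setof t 12 = setof s 12" using True by (auto simp: st_def)
   ultimately show ?thesis using IH that True unfolding t22 by auto
  qed
  show ?case using all ne by (auto simp: t_def u_def)
 qed simp
 then show "(st s, st s') \<in> (chg c d M a)^*"
  and "[|\<phi> \<in> set \<Phi>; s 16 0 = 0; card (setof s 12) < 2 * a; \<forall>i<n. s 22 i < length \<phi>; \<forall>x\<in>set \<phi>. x <= q;
   0 < gain c d M q (%i. if i \<in> setof s 12 then 0 else \<phi> ! (s 22 i))|] ==> st s' ~= st s" by blast+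
qed

lemma body_searches:
 assumes d: "d <= n + m" and q: "0 < q" and \<Phi>: "\<And>\<phi>. \<phi> \<in> set \<Phi> ==> length \<phi> = 2 ^ k & (\<forall>x\<in>set \<phi>. x <= q)"
 shows "searches c d M a (body_cmd c q D E k \<Phi>) (%z dg. \<forall>\<phi>\<in>set \<Phi>. \<not> trial c d M a q D E k \<phi> z dg)"
 unfolding searches_def
proof (intro allI impI)
 fix s assume ok: "ok d M a s"
 define t where "t = den (types_cmd D E k) s"
 define u where "u = den (sqs (map (cand_cmd c q) \<Phi>)) t"
 have u: "den (body_cmd c q D E k \<Phi>) s = u" by (simp add: body_cmd_def t_def u_def)
 have ft: "t b = s b" if "b ~: {18, 20, 21, 22, 30, 31, 32, 33, 34, 35}" for b
  unfolding t_def by (rule den_frame) (use that writes_types in blast)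
 have okt: "ok d M a t" by (rule ok_cong[OF ok], rule ft) auto
 have "writes (sqs (map (cand_cmd c q) \<Phi>)) \<subseteq> {12, 13, 16, 18, 19, 23, 24, 25, 26, 27, 28, 29, 30, 31, 32, 33, 36, 37, 40}"
  using writes_cand by (fastforce simp: writes_sqs)
 then have fu: "u b = t b" if "b ~: {12, 13, 16, 18, 19, 23, 24, 25, 26, 27, 28, 29, 30, 31, 32, 33, 36, 37, 40}" for b
  unfolding u_def by (intro den_frame) (use that in blast)
 have oku: "ok d M a u" by (rule ok_cong[OF okt], rule fu) auto
 have stt: "st t = st s" by (rule st_cong; rule ft) auto
 note C = cands_search[OF okt d q, where c = c and \<Phi> = \<Phi>, folded u_def]
 have nt: "\<not> trial c d M a q D E k \<phi> (st s) (digs s)" if \<phi>: "\<phi> \<in> set \<Phi>" and eq: "st u = st s" for \<phi>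
 proof
  assume tr: "trial c d M a q D E k \<phi> (st s) (digs s)"
  have i: "inp s" "s 10 0 = d" and dg: "\<And>x. s (100 + x) 0 <= n + m" using ok tr by (auto simp: ok_def trial_def st_def)
  have ty: "t 22 i = vtype D E k (setof s 12) d (digs s) i" if "i < n" for i
   unfolding t_def using den_types[OF i(1) _ dg _ that, of k D E] i(2) d tr by (simp add: trial_def st_def)
  have "setof t 12 = setof s 12" "t 16 0 = s 16 0" using stt by (auto simp: st_def)
  moreover have "gain c d M q (%i. if i \<in> setof s 12 then 0 else \<phi> ! (t 22 i))
    = gain c d M q (%i. if i \<in> setof s 12 then 0 else \<phi> ! vtype D E k (setof s 12) d (digs s) i)"
   by (rule gain_cong) (simp add: ty)
  ultimately have "st u ~= st t"
   using tr \<Phi>[OF \<phi>] ty vtype_less by (intro C(2)[OF \<phi>]) (auto simp: trial_def st_def)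
  then show False using eq stt by simp
 qed
 show "ok d M a (den (body_cmd c q D E k \<Phi>) s) & (st s, st (den (body_cmd c q D E k \<Phi>) s)) \<in> (chg c d M a)^* &
   (st (den (body_cmd c q D E k \<Phi>) s) = st s --> (\<forall>\<phi>\<in>set \<Phi>. \<not> trial c d M a q D E k \<phi> (st s) (digs s)))"
  unfolding u using oku C(1) stt nt by auto
qed

text \<open>The digits are the loop counters themselves: digit \<open>x\<close> is cell 0 of array
  \<open>100 + x\<close>. The depth of this nest is what puts the number of digits into the exponent
  of the running time.\<close>

fun nest :: "nat => cmd => cmd" where
 "nest 0 p = p"
| "nest (Suc k) p = For (100 + k) (cell 5) (nest k p)"

lemma writes_nest: "writes (nest k p) = writes p \<union> {100..<100 + k}"
proof (induction k)
 case (Suc k)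
 have "{100..<100 + Suc k} = insert (100 + k) {100..<100 + k}" by auto
 then show ?case using Suc by simp
qed simp

text \<open>Each run of the inner search certifies failure only for the state it started in. If the
  whole nest ends in its start state, monotonicity of \<open>meas\<close> shows that all inner runs
  had this same state, so their certificates combine.\<close>

lemma nest_searches:
 assumes p: "searches c d M a p F" "\<And>b. b \<in> writes p ==> b < 100"
 shows "searches c d M a (nest k p) (%z dg. \<forall>\<delta>. (\<forall>x<k. \<delta> x < n + m) & (\<forall>x\<ge>k. \<delta> x = dg x) --> F z \<delta>)"
proof (induction k)
 case 0
 have "\<delta> = dg" if "\<forall>x\<ge>0. \<delta> x = dg x" for \<delta> dg :: "nat => nat" using that by auto
 then show ?case using p(1) by (auto simp: searches_def)
next
 case (Suc k)
 let ?F = "%z dg. \<forall>\<delta>. (\<forall>x<k. \<delta> x < n + m) & (\<forall>x\<ge>k. \<delta> x = dg x) --> F z \<delta>"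
 show ?case
  unfolding searches_def
 proof (intro allI impI)
  fix s assume ok: "ok d M a s"
  let ?I = "%j s'. ok d M a s' & (st s, st s') \<in> (chg c d M a)^* &
    (st s' = st s --> (\<forall>j'<j. \<forall>\<delta>. (\<forall>x<k. \<delta> x < n + m) & \<delta> k = j' & (\<forall>x\<ge>Suc k. \<delta> x = digs s x) --> F (st s) \<delta>))"
  have "?I (n + m) (den (For (100 + k) (cell 5) (nest k p)) s)"
  proof (rule For_rule[where s = s and I = ?I and N = "n + m"])
   show "100 + k ~: writes (nest k p)" using p(2)[of "100 + k"] by (auto simp: writes_nest)
   show N: "n + m = min (eval_expr (cell 5) s) (s 5 0)" using ok by (simp add: ok_def inp_def)
   show "?I 0 s" using ok by auto
   show "?I j (s'(100 + k := x))" if "?I j s'" for j s' x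
   proof -
    have "ok d M a (s'(100 + k := x))" "st (s'(100 + k := x)) = st s'"
     using that by (simp_all add: ok_def inp_def st_def setof_def)
    then show ?thesis using that by metis
   qed
   fix j s' assume j: "j < n + m" "?I j s'" "s' (100 + k) 0 = j" 
    and fr: "\<And>b. b ~: insert (100 + k) (writes (nest k p)) ==> s' b = s b"
   then have I: "?I j s'" by simp
   note P = searchesD[OF Suc.IH, of s']
   let ?t = "den (nest k p) s'"
   have all: "(st s, st ?t) \<in> (chg c d M a)^*" using P(2) I by (meson rtrancl_trans)
   show "?I (Suc j) ?t"
   proof (intro conjI impI allI)
    show "ok d M a ?t" using P(1) I by blast
    show "(st s, st ?t) \<in> (chg c d M a)^*" by (rule all)
    fix j' \<delta> assume eq: "st ?t = st s" and j': "j' < Suc j"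
     and \<delta>: "(\<forall>x<k. \<delta> x < n + m) & \<delta> k = j' & (\<forall>x\<ge>Suc k. \<delta> x = digs s x)"
    have "meas (st s) <= meas (st s')" "meas (st s') <= meas (st ?t)"
     using chg_rtrancl_meas_le I P(2) by blast+
    then have eq': "st s' = st s" using chg_rtrancl_meas[of "st s" "st s'"] I eq by fastforce
    show "F (st s) \<delta>"
    proof (cases "j' = j")
     case True
     have "digs s' x = digs s x" if "x \<ge> Suc k" for x
     proof -
      have "100 + x ~: insert (100 + k) (writes (nest k p))" using that p(2)[of "100 + x"] by (auto simp: writes_nest)
      then show ?thesis using fr by simp
     qed
     then have "\<forall>x\<ge>k. \<delta> x = digs s' x"
      using \<delta> True j(3) by (metis le_antisym not_less_eq_eq)
     then have "F (st s') \<delta>" using P(3) I \<delta> eq eq' by simp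
     then show ?thesis using eq' by simp
    next
     case False
     then have "j' < j" using j' by simp
     then show ?thesis using I eq' \<delta> by blast
    qed
   qed
  qed
  then show "ok d M a (den (nest (Suc k) p) s) & (st s, st (den (nest (Suc k) p) s)) \<in> (chg c d M a)^* &
    (st (den (nest (Suc k) p) s) = st s --> (\<forall>\<delta>. (\<forall>x<Suc k. \<delta> x < n + m) & (\<forall>x\<ge>Suc k. \<delta> x = digs s x) --> F (st s) \<delta>))"
   by (auto simp: less_Suc_eq)
 qed
qed

text \<open>Every pass that changes the state raises \<open>meas\<close>, which stays below
  \<open>n\<close>. So one of the \<open>n\<close> passes changes nothing, and the state
  \<open>z\<close> in which it runs withstands all digit assignments.\<close>

lemma passes:
 assumes p: "searches c d M a p F" "\<And>b. b \<in> writes p ==> b < 100" "17 ~: writes p"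
  and s: "ok d M a s" "\<And>x. k <= x ==> digs s x = 0"
  and meas: "\<And>z. (st s, z) \<in> (chg c d M a)^* ==> meas z < n"
 defines "s' \<equiv> den (For 17 (cell 0) (nest k p)) s"
 shows "\<exists>z. (st s, z) \<in> (chg c d M a)^* & (z, st s') \<in> (chg c d M a)^* &
   (\<forall>\<delta>. (\<forall>x<k. \<delta> x < n + m) & (\<forall>x\<ge>k. \<delta> x = 0) --> F z \<delta>)"
proof -
 let ?G = "%z. \<forall>\<delta>. (\<forall>x<k. \<delta> x < n + m) & (\<forall>x\<ge>k. \<delta> x = 0) --> F z \<delta>"
 let ?c = "(chg c d M a)^*"
 let ?I = "%j s1. ok d M a s1 & (st s, st s1) \<in> ?c &
  ((\<exists>z. (st s, z) \<in> ?c & (z, st s1) \<in> ?c & ?G z) \<or> j <= meas (st s1))"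
 have "?I n s'"
  unfolding s'_def
 proof (rule For_rule[where s = s and I = ?I and N = n])
  show "17 ~: writes (nest k p)" using p(3) by (auto simp: writes_nest)
  show "n = min (eval_expr (cell 0) s) (s 5 0)" using s by (simp add: ok_def inp_def)
  show "?I 0 s" using s by auto
  show "?I j (s1(17 := x))" if "?I j s1" for j s1 x
  proof -
   have "ok d M a (s1(17 := x))" "st (s1(17 := x)) = st s1"
    using that by (simp_all add: ok_def inp_def st_def setof_def)
   then show ?thesis using that by metis
  qed
  fix j s1 assume j: "j < n" "?I j s1" and fr: "\<And>b. b ~: insert 17 (writes (nest k p)) ==> s1 b = s b"
  define t where "t = den (nest k p) s1"
  note N = searchesD[OF nest_searches[OF p(1,2)], of s1 k, folded t_def]
  have ok: "ok d M a t" and c: "(st s1, st t) \<in> ?c" using N j by blast+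
  have sc: "(st s, st t) \<in> ?c" using c j by (meson rtrancl_trans)
  have dg: "digs s1 x = 0" if "k <= x" for x
  proof -
   have "100 + x ~: insert 17 (writes (nest k p))" using that p(2)[of "100 + x"] by (auto simp: writes_nest)
   then show ?thesis using fr s(2) that by simp
  qed
  have "(\<exists>z. (st s, z) \<in> ?c & (z, st t) \<in> ?c & ?G z) \<or> Suc j <= meas (st t)"
  proof (cases "\<exists>z. (st s, z) \<in> ?c & (z, st s1) \<in> ?c & ?G z")
   case True
   then show ?thesis using c by (meson rtrancl_trans)
  next
   case False
   then have m: "j <= meas (st s1)" using j by blast
   show ?thesis
   proof (cases "st t = st s1")
    case True
    then have "?G (st s1)" using N(3) j dg by auto
    then show ?thesis using sc True by (metis rtrancl.rtrancl_refl)
   next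
    case False
    then have "meas (st s1) < meas (st t)" using chg_rtrancl_meas[OF c] by auto
    then show ?thesis using m by linarith
   qed
  qed
  then show "?I (Suc j) (den (nest k p) s1)" using ok sc unfolding t_def by blast
 qed
 moreover have "\<not> n <= meas (st s')" using meas calculation by (meson not_le)
 ultimately show ?thesis by blast
qed

subsection \<open>Greedy removal\<close>

text \<open>Cell 0 of array 44 holds one plus the index of the best vertex so far, 0 meaning none;
  the keys are in array 19.\<close>

definition argmin_cmd :: "nat => nat => cmd" where
 "argmin_cmd C K = (let b = St 44 (Lit 0) (Add (cell 45) (Lit 1)) in Sq (St 44 (Lit 0) (Lit 0))
   (For 45 (cell 0) (If (ixE C 45) (If (ixE K 45) Nop
    (If (cell 44) (If (leE (Arr 19 (Sub (cell 44) (Lit 1))) (ixE 19 45)) Nop b) b)) Nop)))"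

lemma writes_argmin [simp]: "writes (argmin_cmd C K) = {44, 45}"
 by (auto simp: argmin_cmd_def Let_def)

lemma den_argmin:
 assumes s: "inp s" and CK: "C ~: {44, 45}" "K ~: {44, 45}" and A: "A = setof s C - setof s K" "A ~= {}"
 obtains v where "v \<in> A" "den (argmin_cmd C K) s 44 0 = Suc v" "\<And>u. u \<in> A ==> s 19 v <= s 19 u"
proof -
 let ?I = "%j s1. (if A \<inter> {..<j} = {} then s1 44 0 = 0 else
  \<exists>v\<in>A \<inter> {..<j}. s1 44 0 = Suc v & (\<forall>u\<in>A \<inter> {..<j}. s 19 v <= s 19 u))"
 let ?b = "If (ixE C 45) (If (ixE K 45) Nop
    (If (cell 44) (If (leE (Arr 19 (Sub (cell 44) (Lit 1))) (ixE 19 45)) Nop (St 44 (Lit 0) (Add (cell 45) (Lit 1))))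
    (St 44 (Lit 0) (Add (cell 45) (Lit 1))))) Nop"
 have "?I n (den (For 45 (cell 0) ?b) (upd s 44 0 0))"
 proof (rule For_rule[where s = "upd s 44 0 0" and I = ?I and N = n])
  show "n = min (eval_expr (cell 0) (upd s 44 0 0)) (upd s 44 0 0 5 0)" using s by (simp add: inp_def)
  show "?I j (s1(45 := x))" if "?I j s1" for j x and s1 :: mem using that by simp
  fix j s1 assume j: "j < n" "?I j s1" "s1 45 0 = j"
   and fr: "\<And>b. b ~: insert 45 (writes ?b) ==> s1 b = upd s 44 0 0 b"
  have f: "s1 C = s C" "s1 K = s K" "s1 19 = s 19" using fr CK by auto
  show "?I (Suc j) (den ?b s1)"
  proof (cases "j \<in> A")
   case False
   then have e: "A \<inter> {..<Suc j} = A \<inter> {..<j}" by (auto simp: less_Suc_eq)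
   have "den ?b s1 = s1" using False j f A(1) by (auto simp: setof_def)
   then show ?thesis using j(2) unfolding e by simp
  next
   case True
   then have jA: "s C j ~= 0" "s K j = 0" using A(1) by (auto simp: setof_def)
   have e: "A \<inter> {..<Suc j} = insert j (A \<inter> {..<j})" using True by (auto simp: less_Suc_eq)
   show ?thesis
   proof (cases "A \<inter> {..<j} = {}")
    case True
    then have "den ?b s1 = upd s1 44 0 (Suc j)" using j f jA by simp
    then show ?thesis unfolding e using True by simp
   next
    case False
    then obtain v where v: "v \<in> A \<inter> {..<j}" "s1 44 0 = Suc v" "\<forall>u\<in>A \<inter> {..<j}. s 19 v <= s 19 u"
     using j(2) by auto
    show ?thesis
    proof (cases "s 19 v <= s 19 j")
     case True
     then have "den ?b s1 = s1" using j f jA v by simp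
     then show ?thesis unfolding e using v True by auto
    next
     case F: False
     then have "den ?b s1 = upd s1 44 0 (Suc j)" using j f jA v by simp
     moreover have "\<forall>u\<in>insert j (A \<inter> {..<j}). s 19 j <= s 19 u" using v(3) F by (metis insert_iff linear order_trans)
     ultimately show ?thesis unfolding e by simp
    qed
   qed
  qed
 qed auto
 moreover have "A \<inter> {..<n} = A" using A(1) setof_sub by blast
 ultimately show thesis using A(2) by (auto simp: argmin_cmd_def Let_def intro: that)
qed

text \<open>Generic greedy deletion: \<open>zc\<close> fills array 19 with keys, and a vertex of
  \<open>C\<close> outside \<open>K\<close> with the least key is dropped, until \<open>g\<close>
  vertices remain. The four uses differ in the key and in the invariant that it preserves.\<close>

definition shrink_cmd :: "nat => nat => expr => cmd => cmd" where
 "shrink_cmd C K g zc = For 42 (cell 0) (Sq (sumE 30 43 (nz (ixE C 30))) (If (leE (Add g (Lit 1)) (cell 43))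
   (Sq zc (Sq (argmin_cmd C K) (St C (Sub (cell 44) (Lit 1)) (Lit 0)))) Nop))"

lemma writes_shrink [simp]: "writes (shrink_cmd C K g zc) = {C, 30, 42, 43, 44, 45} \<union> writes zc"
 by (auto simp: shrink_cmd_def)

lemma den_shrink:
 fixes C K :: nat
 assumes s: "inp s" and CK: "C ~: {0, 1, 2, 5, 19, 30, 42, 43, 44, 45, K}" "K ~: {30, 42, 43, 44, 45}"
  and zc: "writes zc \<inter> {0, 1, 2, 5, 42, C, K} = {}"
  and g: "\<And>s'. (\<And>b. b ~: {C, 30, 42, 43, 44, 45} \<union> writes zc ==> s' b = s b) ==> eval_expr g s' = tgt"
  and K: "setof s K \<subseteq> setof s C" "card (setof s K) <= tgt" "tgt <= card (setof s C)"
  and P0: "P (setof s C)"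
  and step: "\<And>X v s'. [|P X; setof s K \<subseteq> X; X \<subseteq> setof s C; tgt < card X; inp s'; setof s' C = X; setof s' K = setof s K;
   \<forall>b. b ~: {C, 30, 42, 43, 44, 45} \<union> writes zc --> s' b = s b; v \<in> X - setof s K;
   \<And>u. u \<in> X - setof s K ==> den zc s' 19 v <= den zc s' 19 u|] ==> P (X - {v})"
 defines "X \<equiv> setof (den (shrink_cmd C K g zc) s) C"
 shows "P X" "card X = tgt" "setof s K \<subseteq> X" "X \<subseteq> setof s C"
proof -
 let ?K = "setof s K"
 let ?b = "Sq (sumE 30 43 (nz (ixE C 30))) (If (leE (Add g (Lit 1)) (cell 43))
   (Sq zc (Sq (argmin_cmd C K) (St C (Sub (cell 44) (Lit 1)) (Lit 0)))) Nop)"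
 \<comment> \<open>The last conjunct measures progress: after \<open>j\<close> rounds at most
   \<open>n - j\<close> vertices exceed the target, so at \<open>j = n\<close> the size is exactly
   \<open>tgt\<close>.\<close>
 let ?J = "%j X. P X & ?K \<subseteq> X & X \<subseteq> setof s C & tgt <= card X & card X + j <= max (n + tgt) (tgt + j)"
 let ?I = "%j s1. ?J j (setof s1 C)"
 have cC: "card (setof s C) <= n" using card_mono[OF _ setof_sub(1), of s C] by simp
 have "?I n (den (shrink_cmd C K g zc) s)"
  unfolding shrink_cmd_def
 proof (rule For_rule[where s = s and I = ?I and N = n])
  show "n = min (eval_expr (cell 0) s) (s 5 0)" using s by (simp add: inp_def)
  show "?I 0 s" using K P0 cC by simp
  show "42 ~: writes ?b" using CK zc by auto
  show "?I j (s1(42 := x))" if "?I j s1" for j s1 x using that CK by (simp add: setof_def)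
  fix j s1 assume j: "j < n" "?I j s1" "s1 42 0 = j"
   and fr: "\<And>b. b ~: insert 42 (writes ?b) ==> s1 b = s b"
  have i1: "inp s1" by (rule inp_cong[OF s]; rule fr) (use CK zc in auto)
  define X where "X = setof s1 C"
  define s2 where "s2 = den (sumE 30 43 (nz (ixE C 30))) s1"
  have f2: "s2 b = s1 b" if "b ~: {30, 43}" for b using that by (simp add: s2_def den_frame)
  have i2: "inp s2" by (rule inp_cong[OF i1]; rule f2) auto
  have fs2: "s2 b = s b" if "b ~: {C, 30, 42, 43, 44, 45} \<union> writes zc" for b using that fr[of b] f2[of b] by auto
  have "s2 43 0 = (\<Sum>i<n. 1 - (1 - s1 C i))"
   unfolding s2_def
  by (rule den_sumE[OF i1]) (use CK in auto)
  then have sz: "s2 43 0 = card X" unfolding sum_nz X_def by (simp add: setof_def)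
  have gt: "eval_expr g s2 = tgt" by (rule g) (rule fs2)
  have X2: "setof s2 C = X" "setof s2 K = ?K"
   using CK zc f2 fr[of K] by (auto simp: X_def setof_def)
  have JX: "?J j X" using j(2) by (simp add: X_def)
  show "?I (Suc j) (den ?b s1)"
  proof (cases "tgt < card X")
   case False
   then have "den ?b s1 = s2" using sz gt by (simp add: s2_def)
   then show ?thesis using JX False X2 by auto
  next
   case True
   define s3 where "s3 = den zc s2"
   define s4 where "s4 = den (argmin_cmd C K) s3"
   have f3: "s3 b = s2 b" if "b ~: writes zc" for b using that by (simp add: s3_def den_frame)
   have i3: "inp s3" by (rule inp_cong[OF i2]; rule f3) (use zc in auto)
   have X3: "setof s3 C = X" "setof s3 K = ?K" using X2 f3 zc by (auto simp: setof_def)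
   have Xn: "X \<subseteq> {..<n}" "finite X" unfolding X_def by (rule setof_sub)+
   have ne: "X - ?K ~= {}"
   proof
    assume "X - ?K = {}"
    then have "card X <= card ?K" using setof_sub(2) by (intro card_mono) auto
    then show False using True K(2) by simp
   qed
   obtain v where v: "v \<in> X - ?K" "s4 44 0 = Suc v" "\<And>u. u \<in> X - ?K ==> s3 19 v <= s3 19 u"
    using den_argmin[OF i3, of C K "X - ?K"] X3 CK ne s4_def by (metis insert_iff)
   have f4: "s4 C = s3 C" unfolding s4_def using CK by (auto intro: den_frame)
   have "den ?b s1 = upd s4 C v 0"
    using True sz gt v(2) by (simp add: s2_def s3_def s4_def)
   then have X': "setof (den ?b s1) C = X - {v}" using X3(1) f4 by (auto simp: setof_def)
   have "P (X - {v})"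
    by (rule step[of X s2 v]) (use JX True i2 X2 fs2 v in \<open>auto simp: s3_def\<close>)
   moreover have "card (X - {v}) = card X - 1" using v Xn by simp
   moreover have "?K \<subseteq> X - {v}" "X - {v} \<subseteq> setof s C" using JX v by auto
   ultimately show ?thesis unfolding X' using JX True by auto
  qed
 qed
 then show "P X" "card X = tgt" "setof s K \<subseteq> X" "X \<subseteq> setof s C" unfolding X_def by auto
qed

subsection \<open>Degrees and edge counts\<close>

definition dgr :: "nat set => nat => nat" where
 "dgr X i = (\<Sum>v\<in>X. wt i v)"

definition deg_cmd :: "nat => cmd" where
 "deg_cmd a = Sq (mapE 30 38 (nz (ixE a 30))) (wapp 38 19)"

lemma writes_deg [simp]: "writes (deg_cmd a) = {19, 30, 31, 32, 33, 38}"
 by (auto simp: deg_cmd_def)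

lemma den_deg:
 assumes s: "inp s" and a: "a ~: {30, 38}" and i: "i < n"
 shows "den (deg_cmd a) s 19 i = dgr (setof s a) i"
proof -
 define s1 where "s1 = den (mapE 30 38 (nz (ixE a 30))) s"
 have f1: "s1 b = s b" if "b ~: {30, 38}" for b using that by (simp add: s1_def den_frame)
 have i1: "inp s1" by (rule inp_cong[OF s]; rule f1) auto
 have e: "s1 38 i = (if i < n then (%i. 1 - (1 - s a i)) i else s 38 i)" for i
  unfolding s1_def
 by (rule den_mapE[OF s]) (use a in auto)
 have "den (deg_cmd a) s 19 i = Wy (s1 38) i"
  using den_wapp[OF i1 _ _ i, of 38 19] by (simp add: deg_cmd_def s1_def)
 also have "... = dgr (setof s a) i"
  unfolding Wy_def dgr_def using e by (intro sum.mono_neutral_cong_right) (auto simp: setof_def)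
 finally show ?thesis .
qed

definition ed :: "nat set => nat set => nat => nat set" where
 "ed X T j = {i. i < m & set (es ! i) \<subseteq> X & card (set (es ! i) \<inter> T) = j}"

definition cnt :: "nat set => nat" where
 "cnt X = card {i. i < m & set (es ! i) \<subseteq> X}"

fun insE :: "nat => nat => expr" where
 "insE a 0 = Lit 0"
| "insE a (Suc l) = Add (nz (Arr a (Arr 2 (Add (mulc r (cell 31)) (Lit l))))) (insE a l)"

lemma eval_insE:
 assumes s: "inp s" and j: "s 31 0 < m"
 shows "eval_expr (insE a r) s = card (set (es ! s 31 0) \<inter> setof s a)"
proof -
 have "eval_expr (insE a k) s = (\<Sum>l<k. if s a (es ! s 31 0 ! l) ~= 0 then 1 else 0)" if "k <= r" for k
  using that s j by (induction k) (auto simp: inp_def)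
 then have "eval_expr (insE a r) s = (\<Sum>l<r. (%u. if s a u ~= 0 then 1 else 0) (es ! s 31 0 ! l))" by simp
 also have "... = (\<Sum>u\<in>set (es ! s 31 0). if s a u ~= 0 then 1 else 0)" by (rule sum_over_edge[OF j])
 also have "... = card {u \<in> set (es ! s 31 0). s a u ~= 0}" by (simp flip: sum.inter_filter)
 also have "{u \<in> set (es ! s 31 0). s a u ~= 0} = set (es ! s 31 0) \<inter> setof s a"
  using es_lt[of "es ! s 31 0"] j by (auto simp: setof_def)
 finally show ?thesis .
qed

lemma card_edge: "j < m ==> card (set (es ! j)) = r" "j < m ==> set (es ! j) \<subseteq> {..<n}"
 using es_len[of "es ! j"] es_distinct[of "es ! j"] es_lt[of "es ! j"] by (auto simp: distinct_card)

lemma edge_sub_iff: "j < m ==> card (set (es ! j) \<inter> X) = r \<longleftrightarrow> set (es ! j) \<subseteq> X"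
 using card_edge(1)[of j] by (metis Int_absorb2 List.finite_set card_subset_eq inf_le1 le_iff_inf)

definition key_cmd :: "nat => nat => nat => cmd" where
 "key_cmd C T j = Sq (mapE 30 19 (Lit 0)) (For 31 (cell 1) (If (neqE (insE C r) (Lit r)) Nop (If (neqE (insE T r) (Lit j)) Nop
   (For 32 (Lit r) (St 19 (EV 31 32) (Add (Arr 19 (EV 31 32)) (Lit 1)))))))"

lemma writes_key [simp]: "writes (key_cmd C T j) = {19, 30, 31, 32}"
 by (auto simp: key_cmd_def)

lemma den_key:
 assumes s: "inp s" and CT: "C ~: {19, 30, 31, 32}" "T ~: {19, 30, 31, 32}" and i: "i < n"
 shows "den (key_cmd C T j) s 19 i = card {x \<in> ed (setof s C) (setof s T) j. i \<in> set (es ! x)}"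
proof -
 let ?f = "For 32 (Lit r) (St 19 (EV 31 32) (Add (Arr 19 (EV 31 32)) (Lit 1)))"
 let ?b = "If (neqE (insE C r) (Lit r)) Nop (If (neqE (insE T r) (Lit j)) Nop ?f)"
 define s1 where "s1 = den (mapE 30 19 (Lit 0)) s"
 let ?E = "ed (setof s C) (setof s T) j"
 have f1: "s1 b = s b" if "b ~: {30, 19}" for b using that by (simp add: s1_def den_frame)
 have i1: "inp s1" by (rule inp_cong[OF s]; rule f1) auto
 have z: "s1 19 i = (if i < n then (%i. 0) i else s 19 i)" for i
  unfolding s1_def by (rule den_mapE[OF s]) auto
 have "den (For 31 (cell 1) ?b) s1 19 i = s1 19 i + (\<Sum>x<m. (%x i. if x \<in> ?E & i \<in> set (es ! x) then 1 else 0) x i)"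
 proof (rule For_add[where s = s1 and F = "%x i. if x \<in> ?E & i \<in> set (es ! x) then 1 else 0"])
  show "m = min (eval_expr (cell 1) s1) (s1 5 0)" using i1 by (simp add: inp_def)
  fix s' x i assume x: "x < m" "s' 31 0 = x" and fr: "\<And>b. b ~: insert 31 (writes ?b) ==> s' b = s1 b"
  have i': "inp s'" by (rule inp_cong[OF i1]; rule fr) auto
  have ss: "setof s' C = setof s C" "setof s' T = setof s T" using fr f1 CT by (auto simp: setof_def)
  have cond: "x \<in> ?E \<longleftrightarrow> eval_expr (insE C r) s' = r & eval_expr (insE T r) s' = j"
   using eval_insE[OF i'] x edge_sub_iff[of x] by (auto simp: ed_def ss)
  have "den ?f s' 19 i = s' 19 i + (\<Sum>l<r. (%l i. if es ! x ! l = i then 1 else 0) l i)"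
  proof (rule For_add[where s = s' and F = "%l i. if es ! x ! l = i then 1 else 0"])
   show "r = min (eval_expr (Lit r) s') (s' 5 0)" using min_r[OF i'] by simp
   fix s2 l i assume l: "l < r" "s2 32 0 = l"
    and fr2: "\<And>b. b ~: insert 32 (writes (St 19 (EV 31 32) (Add (Arr 19 (EV 31 32)) (Lit 1)))) ==> s2 b = s' b"
   have i2: "inp s2" by (rule inp_cong[OF i']; rule fr2) auto
   have "s2 31 0 = x" using fr2[of 31] x by simp
   then show "den (St 19 (EV 31 32) (Add (Arr 19 (EV 31 32)) (Lit 1))) s2 19 i = s2 19 i + (if es ! x ! l = i then 1 else 0)"
    using eval_EV[OF i2, of 31 32] l x by simp
  qed auto
  also have "(\<Sum>l<r. (%l i. if es ! x ! l = i then 1 else 0) l i) = (\<Sum>u\<in>set (es ! x). if u = i then 1 else 0)"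
   using sum_over_edge[OF x(1), of "%u. if u = i then 1 else 0"] by simp
  also have "... = (if i \<in> set (es ! x) then 1 else 0)" by simp
  finally have f: "den ?f s' 19 i = s' 19 i + (if i \<in> set (es ! x) then 1 else 0)" .
  show "den ?b s' 19 i = s' 19 i + (if x \<in> ?E & i \<in> set (es ! x) then 1 else 0)"
  proof (cases "x \<in> ?E")
   case True
   then have "den ?b s' = den ?f s'" using cond by (simp del: den.simps(4))
   then show ?thesis using f True by presburger
  next
   case False
   then have "den ?b s' = s'" using cond by auto
   then show ?thesis using False by simp
  qed
 qed auto
 moreover have "(\<Sum>x<m. if x \<in> ?E & i \<in> set (es ! x) then 1 else 0) = card {x \<in> ?E. i \<in> set (es ! x)}"
 proof -
  have "{x \<in> {..<m}. x \<in> ?E & i \<in> set (es ! x)} = {x \<in> ?E. i \<in> set (es ! x)}" by (auto simp: ed_def)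
  then show ?thesis by (simp flip: sum.inter_filter)
 qed
 ultimately show ?thesis using z i by (simp add: key_cmd_def s1_def[symmetric] del: den.simps(4))
qed

definition count_cmd :: "nat => cmd" where
 "count_cmd C = Sq (St 46 (Lit 0) (Lit 0))
   (For 31 (cell 1) (If (neqE (insE C r) (Lit r)) Nop (St 46 (Lit 0) (Add (cell 46) (Lit 1)))))"

lemma writes_count [simp]: "writes (count_cmd C) = {31, 46}"
 by (auto simp: count_cmd_def)

lemma den_count:
 assumes s: "inp s" and C: "C ~: {31, 46}"
 shows "den (count_cmd C) s 46 0 = cnt (setof s C)"
proof -
 let ?b = "If (neqE (insE C r) (Lit r)) Nop (St 46 (Lit 0) (Add (cell 46) (Lit 1)))"
 let ?F = "%x i. if i = 0 & set (es ! x) \<subseteq> setof s C then 1 else 0 :: nat"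
 have i1: "inp (upd s 46 0 0)" using s by (simp add: inp_def)
 have "den (For 31 (cell 1) ?b) (upd s 46 0 0) 46 0 = upd s 46 0 0 46 0 + (\<Sum>x<m. ?F x (0::nat))"
 proof (rule For_add[where s = "upd s 46 0 0" and F = ?F])
  show "m = min (eval_expr (cell 1) (upd s 46 0 0)) (upd s 46 0 0 5 0)" using s by (simp add: inp_def)
  fix s' i x assume x: "x < m" "s' 31 0 = x" and fr: "\<And>b. b ~: insert 31 (writes ?b) ==> s' b = upd s 46 0 0 b"
  have i': "inp s'" by (rule inp_cong[OF i1]; rule fr) auto
  have ss: "setof s' C = setof s C" using fr C by (auto simp: setof_def)
  have "set (es ! x) \<subseteq> setof s C \<longleftrightarrow> eval_expr (insE C r) s' = r"
   using eval_insE[OF i'] x edge_sub_iff[of x] by (auto simp: ss)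
  then show "den ?b s' 46 i = s' 46 i + ?F x i" by auto
 qed auto
 moreover have "(\<Sum>x<m. ?F x 0) = cnt (setof s C)"
 proof -
  have "{x \<in> {..<m}. set (es ! x) \<subseteq> setof s C} = {x. x < m & set (es ! x) \<subseteq> setof s C}" by auto
  then show ?thesis by (simp add: cnt_def flip: sum.inter_filter)
 qed
 ultimately show ?thesis by (simp add: count_cmd_def del: den.simps(4))
qed

text \<open>Division by counting: in each round the quotient goes up by one if the divisor still
  fits, so \<open>n\<close> rounds suffice for quotients up to \<open>n\<close>.\<close>

definition div_cmd :: "nat => nat => expr => cmd" where
 "div_cmd dst k e = Sq (St dst (Lit 0) (Lit 0))
   (For 30 (cell 0) (If (leE (mulc k (Add (cell dst) (Lit 1))) e) (St dst (Lit 0) (Add (cell dst) (Lit 1))) Nop))"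

lemma writes_div [simp]: "writes (div_cmd dst k e) = {30, dst}"
 by (auto simp: div_cmd_def)

lemma den_div:
 assumes s: "inp s" and d: "dst ~: {0, 1, 2, 5, 30}" and k: "0 < k" and x: "x div k <= n"
  and e: "\<And>s'. (\<And>b. b ~: {30, dst} ==> s' b = s b) ==> eval_expr e s' = x"
 shows "den (div_cmd dst k e) s dst 0 = x div k"
proof -
 let ?b = "If (leE (mulc k (Add (cell dst) (Lit 1))) e) (St dst (Lit 0) (Add (cell dst) (Lit 1))) Nop"
 have "den (For 30 (cell 0) ?b) (upd s dst 0 0) dst 0 = min n (x div k)"
 proof (rule For_rule[where s = "upd s dst 0 0" and N = n and I = "%j s'. s' dst 0 = min j (x div k)"])
  show "n = min (eval_expr (cell 0) (upd s dst 0 0)) (upd s dst 0 0 5 0)" using s d by (auto simp: inp_def)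
  fix j s' assume j: "s' dst 0 = min j (x div k)" and fr: "\<And>b. b ~: insert 30 (writes ?b) ==> s' b = upd s dst 0 0 b"
  have ev: "eval_expr e s' = x" by (rule e) (use fr in auto)
  have "k * (min j (x div k) + 1) <= x \<longleftrightarrow> j < x div k"
   using less_eq_div_iff_mult_less_eq[OF k, of "min j (x div k) + 1" x] by (auto simp: mult.commute)
  then show "den ?b s' dst 0 = min (Suc j) (x div k)" using j ev by auto
 qed (use d in auto)
 then show ?thesis using x by (simp add: div_cmd_def del: den.simps(4))
qed

end

section \<open>Falling factorials, and densities preserved by greedy removal\<close>

fun pf :: "nat => nat => nat" where
 "pf c 0 = 1"
| "pf c (Suc k) = pf c k * (c - k)"

lemma pf_Suc: "pf c (Suc k) = c * pf (c - 1) k"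
 by (induction k) auto

lemma card_times_min_le_sum:
 fixes f :: "'a => nat"
 assumes "\<And>u. u \<in> A ==> f v <= f u"
 shows "card A * f v <= sum f A"
 using sum_bounded_below[of A "f v" f] assms by simp

context input
begin

lemma finite_V [simp]: "X \<subseteq> {..<n} ==> finite X"
 by (rule finite_subset) auto

lemma sum_dgr: "(\<Sum>u\<in>X. dgr X u) = wS X"
 by (simp add: wS_def dgr_def)

lemma wS_mono: "X \<subseteq> Y ==> finite Y ==> wS X <= wS Y"
proof -
 assume X: "X \<subseteq> Y" "finite Y"
 then have "wS X <= (\<Sum>u\<in>X. \<Sum>v\<in>Y. wt u v)" unfolding wS_def by (intro sum_mono sum_mono2) auto
 also have "... <= wS Y" unfolding wS_def using X by (intro sum_mono2) auto
 finally show ?thesis .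
qed

lemma wS_superadd:
 assumes "finite A" "finite B" "A \<inter> B = {}"
 shows "wS A + wS B <= wS (A \<union> B)"
proof -
 have "wS (A \<union> B) = (\<Sum>u\<in>A. \<Sum>v\<in>A \<union> B. wt u v) + (\<Sum>u\<in>B. \<Sum>v\<in>A \<union> B. wt u v)"
  unfolding wS_def using assms by (simp add: sum.union_disjoint)
 also have "... \<ge> (\<Sum>u\<in>A. \<Sum>v\<in>A. wt u v) + (\<Sum>u\<in>B. \<Sum>v\<in>B. wt u v)"
  using assms by (intro add_mono sum_mono sum_mono2) auto
 finally show ?thesis by (simp add: wS_def)
qed

lemma wS_remove:
 assumes "finite X" "v \<in> X"
 shows "wS X = wS (X - {v}) + 2 * dgr X v"
proof -
 define Y where "Y = X - {v}"
 have X: "X = insert v Y" "v ~: Y" "finite Y" using assms by (auto simp: Y_def)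
 have "(\<Sum>u\<in>Y. wt u v) = (\<Sum>u\<in>Y. wt v u)" by (simp add: wt_sym)
 then have "wS X = wS Y + 2 * dgr X v"
  unfolding X(1) wS_def dgr_def using X by (simp add: sum.distrib wt_self)
 then show ?thesis by (simp add: Y_def)
qed

text \<open>Compares the weight per ordered pair in \<open>X\<close> with that of a set of
  \<open>t\<close> elements and weight \<open>w\<close>, cross-multiplied to stay in the
  naturals.\<close>

definition dens_ge :: "nat => nat => nat set => bool" where
 "dens_ge w t X \<longleftrightarrow> w * (card X * (card X - 1)) <= wS X * (t * (t - 1))"

text \<open>A vertex of least degree has at most the average degree, so at least the share
  \<open>(x - 2) / x\<close> of the weight remains, and \<open>(x - 2) / x\<close> is exactly the
  share of ordered pairs that remains.\<close>

lemma dens_ge_remove: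
 assumes X: "dens_ge w t X" "finite X" "v \<in> X" "\<And>u. u \<in> X ==> dgr X v <= dgr X u"
 shows "dens_ge w t (X - {v})"
proof -
 define x where "x = card X"
 have "x > 0" using X by (auto simp: x_def card_gt_0_iff)
 have cx: "card (X - {v}) = x - 1" using X by (simp add: x_def)
 have "x * dgr X v <= wS X" using card_times_min_le_sum[of X "dgr X" v] X(4) sum_dgr by (simp add: x_def)
 moreover have w: "wS X = wS (X - {v}) + 2 * dgr X v" using X by (intro wS_remove)
 moreover have "(x - 2) * wS X = x * wS X - 2 * wS X" by (rule diff_mult_distrib)
 moreover have "x * wS X = x * wS (X - {v}) + 2 * (x * dgr X v)" by (simp add: w algebra_simps)
 ultimately have "(x - 2) * wS X <= x * wS (X - {v})" by linarith
 then have le: "(x - 2) * wS X * (t * (t - 1)) <= x * wS (X - {v}) * (t * (t - 1))" by (rule mult_le_mono1)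
 have "x * (w * ((x - 1) * (x - 2))) = (x - 2) * (w * (x * (x - 1)))" by (simp only: mult_ac)
 also have "... <= (x - 2) * (wS X * (t * (t - 1)))"
  using X(1) by (intro mult_le_mono2) (simp add: dens_ge_def x_def)
 also have "... = (x - 2) * wS X * (t * (t - 1))" by (simp only: mult_ac)
 also note le
 also have "x * wS (X - {v}) * (t * (t - 1)) = x * (wS (X - {v}) * (t * (t - 1)))" by (simp only: mult_ac)
 finally have "x * (w * ((x - 1) * (x - 2))) <= x * (wS (X - {v}) * (t * (t - 1)))" .
 then have "w * ((x - 1) * (x - 2)) <= wS (X - {v}) * (t * (t - 1))" using \<open>x > 0\<close> by simp
 then show ?thesis unfolding dens_ge_def cx by (simp add: numeral_2_eq_2)
qed

lemma finite_ed [simp]: "finite (ed X T j)"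
 by (simp add: ed_def)

lemma ed_remove:
 "card (ed X T j) = card (ed (X - {v}) T j) + card {x \<in> ed X T j. v \<in> set (es ! x)}"
proof -
 have "ed X T j = ed (X - {v}) T j \<union> {x \<in> ed X T j. v \<in> set (es ! x)}"
  and "ed (X - {v}) T j \<inter> {x \<in> ed X T j. v \<in> set (es ! x)} = {}" by (auto simp: ed_def)
 then show ?thesis by (metis card_Un_disjoint finite_Un finite_ed)
qed

lemma sum_ed_keys:
 assumes "T \<subseteq> X" "X \<subseteq> {..<n}"
 shows "(\<Sum>v\<in>X - T. card {x \<in> ed X T j. v \<in> set (es ! x)}) = card (ed X T j) * (r - j)"
proof -
 have "(\<Sum>v\<in>X - T. card {x \<in> ed X T j. v \<in> set (es ! x)})
   = (\<Sum>v\<in>X - T. \<Sum>x\<in>ed X T j. if v \<in> set (es ! x) then 1 else 0)"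
  by (intro sum.cong refl) (simp flip: sum.inter_filter)
 also have "... = (\<Sum>x\<in>ed X T j. \<Sum>v\<in>X - T. if v \<in> set (es ! x) then 1 else 0)" by (rule sum.swap)
 also have "... = (\<Sum>x\<in>ed X T j. r - j)"
 proof (intro sum.cong refl)
  fix x assume x: "x \<in> ed X T j"
  have "{v \<in> X - T. v \<in> set (es ! x)} = set (es ! x) - (set (es ! x) \<inter> T)" using x by (auto simp: ed_def)
  also have "card ... = r - j" using x card_edge(1)[of x] by (subst card_Diff_subset) (auto simp: ed_def)
  finally show "(\<Sum>v\<in>X - T. if v \<in> set (es ! x) then 1 else 0) = r - j"
   using assms by (simp flip: sum.inter_filter)
 qed
 finally show ?thesis by simp
qed

definition ext_ge :: "nat set => nat => nat set => bool" where
 "ext_ge T j X \<longleftrightarrow> card (ed {..<n} T j) * pf (card X - card T) (r - j) <= card (ed X T j) * pf (n - card T) (r - j)"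

text \<open>Each hyperedge counted has \<open>r - j\<close> vertices among the \<open>c\<close>
  removable ones, so the least frequent vertex lies in at most the share \<open>(r - j) / c\<close>
  of them. The falling factorial of \<open>c\<close> loses precisely this share when
  \<open>c\<close> drops by one.\<close>

lemma ext_ge_remove:
 assumes X: "ext_ge T j X" "T \<subseteq> X" "X \<subseteq> {..<n}" "v \<in> X - T"
  "\<And>u. u \<in> X - T ==> card {x \<in> ed X T j. v \<in> set (es ! x)} <= card {x \<in> ed X T j. u \<in> set (es ! x)}"
 shows "ext_ge T j (X - {v})"
proof -
 define c where "c = card X - card T"
 define k where "k = r - j"
 define N where "N = card (ed X T j)"
 define N' where "N' = card (ed (X - {v}) T j)"
 have fin: "finite X" "finite T" using X finite_V by (auto intro: finite_subset)
 have cX: "card (X - T) = c" using X fin by (simp add: c_def card_Diff_subset)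
 have "c > 0" using X(4) fin cX[symmetric] by (auto simp: card_gt_0_iff)
 have c': "card (X - {v}) - card T = c - 1" using X fin by (simp add: c_def)
 have "c * card {x \<in> ed X T j. v \<in> set (es ! x)} <= N * k"
  using card_times_min_le_sum[of "X - T" "%v. card {x \<in> ed X T j. v \<in> set (es ! x)}" v] X
  by (simp add: cX sum_ed_keys N_def k_def)
 moreover have "N * c = N' * c + c * card {x \<in> ed X T j. v \<in> set (es ! x)}"
  using ed_remove[of X T j v] by (simp add: N_def N'_def algebra_simps)
 moreover have "N * (c - k) = N * c - N * k" by (rule diff_mult_distrib2)
 ultimately have NN: "N * (c - k) <= N' * c" by linarith
 let ?A = "card (ed {..<n} T j)" and ?B = "pf (n - card T) k"
 have "?A * pf (c - 1) k * c = ?A * pf c k * (c - k)" using pf_Suc[of c k] by simp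
 also have "... <= N * ?B * (c - k)"
  using X(1) by (intro mult_le_mono1) (simp add: ext_ge_def c_def k_def N_def)
 also have "... <= N' * ?B * c" using mult_le_mono1[OF NN, of ?B] by (simp add: mult_ac)
 finally have "?A * pf (c - 1) k <= N' * ?B" using \<open>c > 0\<close> by simp
 then show ?thesis unfolding ext_ge_def c' by (simp add: N'_def k_def)
qed

lemma setof_mapE_const:
 assumes "inp s" "a ~= 30"
 shows "setof (den (mapE 30 a (Lit x)) s) a = (if x = 0 then {} else {..<n})"
proof -
 have "den (mapE 30 a (Lit x)) s a i = (if i < n then (%_. x) i else s a i)" for i
  by (rule den_mapE) (use assms in auto)
 then show ?thesis by (auto simp: setof_def)
qed

lemma setof_mapE_copy:
 assumes "inp s" "a ~= 30" "b ~: {30, a}"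
 shows "setof (den (mapE 30 a (ixE b 30)) s) a = setof s b"
proof -
 have "den (mapE 30 a (ixE b 30)) s a i = (if i < n then (%i. s b i) i else s a i)" for i
  by (rule den_mapE) (use assms in auto)
 then show ?thesis by (auto simp: setof_def)
qed

subsection \<open>Extension by greedy removal\<close>

definition ext_cmd :: "nat => cmd" where
 "ext_cmd j = sqs [mapE 30 15 (Lit 1), shrink_cmd 15 14 (cell 6) (key_cmd 15 14 j), count_cmd 15,
   If (leE (cell 9) (cell 46)) (Sq (mapE 30 3 (ixE 15 30)) (St 9 (Lit 0) (Add (cell 46) (Lit 1)))) Nop]"

lemma writes_ext [simp]: "writes (ext_cmd j) = {3, 9, 15, 19, 30, 31, 32, 42, 43, 44, 45, 46}"
 by (auto simp: ext_cmd_def)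

text \<open>Cell 0 of array 9 stores one plus the best count so far; 0 means that array 3 holds no
  set yet.\<close>

definition best :: "nat => mem => bool" where
 "best M s \<longleftrightarrow> s 9 0 = 0 \<or> card (setof s 3) = M & s 9 0 = Suc (cnt (setof s 3))"

text \<open>Here \<open>b\<close> is the best count plus one. The ratio of the falling factorials is
  the probability that the other \<open>r - j\<close> vertices of a hyperedge fall into a uniformly
  random set of size \<open>M\<close> containing \<open>T\<close>: greedy removal does at least as
  well as that average.\<close>

definition ext_ok :: "nat => nat set => nat => nat => bool" where
 "ext_ok M T j b \<longleftrightarrow> 0 < b &
   card (ed {..<n} T j) * pf (M - card T) (r - j) <= (b - 1) * pf (n - card T) (r - j)"

lemma den_ext:
 fixes j :: nat
 assumes s: "inp s" and M: "card (setof s 14) <= s 6 0" "s 6 0 <= n" and b: "best (s 6 0) s"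
 defines "s' \<equiv> den (ext_cmd j) s"
 shows "best (s 6 0) s'" "s 9 0 <= s' 9 0" "ext_ok (s 6 0) (setof s 14) j (s' 9 0)"
proof -
 define T where "T = setof s 14"
 define s1 where "s1 = den (mapE 30 15 (Lit 1)) s"
 define s2 where "s2 = den (shrink_cmd 15 14 (cell 6) (key_cmd 15 14 j)) s1"
 define s3 where "s3 = den (count_cmd 15) s2"
 have f1: "s1 b = s b" if "b ~: {15, 30}" for b using that by (simp add: s1_def den_frame)
 have f2: "s2 b = s1 b" if "b ~: {15, 19, 30, 31, 32, 42, 43, 44, 45}" for b using that by (simp add: s2_def den_frame)
 have f3: "s3 b = s2 b" if "b ~: {31, 46}" for b using that by (simp add: s3_def den_frame)
 have i1: "inp s1" by (rule inp_cong[OF s]; rule f1) auto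
 have i2: "inp s2" by (rule inp_cong[OF i1]; rule f2) auto
 have i3: "inp s3" by (rule inp_cong[OF i2]; rule f3) auto
 have T: "T \<subseteq> {..<n}" unfolding T_def by (rule setof_sub)
 have S1: "setof s1 15 = {..<n}" "setof s1 14 = T"
  using setof_mapE_const[OF s, of 15 1] f1[of 14] by (simp_all add: s1_def T_def setof_def)
 define X where "X = setof s2 15"
 have c1: "15 ~: {0, 1, 2, 5, 19, 30, 42, 43, 44, 45, 14::nat}" "14 ~: {30, 42, 43, 44, 45::nat}"
  "writes (key_cmd 15 14 j) \<inter> {0, 1, 2, 5, 42, 15, 14} = {}" by auto
 have c2: "eval_expr (cell 6) t = s 6 0"
  if "\<And>b. b ~: {15, 30, 42, 43, 44, 45} \<union> writes (key_cmd 15 14 j) ==> t b = s1 b" for t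
  using that[of 6] f1[of 6] by simp
 have c3: "setof s1 14 \<subseteq> setof s1 15" "card (setof s1 14) <= s 6 0" "s 6 0 <= card (setof s1 15)" "ext_ge T j (setof s1 15)"
  using S1 T M by (auto simp: T_def ext_ge_def)
 have c4: "ext_ge T j (X - {v})" if "ext_ge T j X" "setof s1 14 \<subseteq> X" "X \<subseteq> setof s1 15" "inp t" "setof t 15 = X" "setof t 14 = setof s1 14"
  "v \<in> X - setof s1 14" "\<And>u. u \<in> X - setof s1 14 ==> den (key_cmd 15 14 j) t 19 v <= den (key_cmd 15 14 j) t 19 u" for X v t
 proof (rule ext_ge_remove[OF that(1)])
  show "T \<subseteq> X" "X \<subseteq> {..<n}" "v \<in> X - T" using that S1 by auto
  fix u assume u: "u \<in> X - T"
  then have "u < n" "v < n" using that S1 by auto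
  then show "card {x \<in> ed X T j. v \<in> set (es ! x)} <= card {x \<in> ed X T j. u \<in> set (es ! x)}"
   using that(8)[of u] u den_key[OF that(4), of 15 14] S1 that by simp
 qed
 have X: "ext_ge T j X" "card X = s 6 0" "X \<subseteq> {..<n}"
  using den_shrink[where P = "ext_ge T j", OF i1 c1 c2 c3 c4] S1 unfolding X_def s2_def by auto
 have c46: "s3 46 0 = cnt X" unfolding s3_def X_def by (rule den_count[OF i2]) auto
 have X3: "setof s3 15 = X" using f3[of 15] by (simp add: X_def setof_def)
 have o: "s3 9 = s 9" "s3 3 = s 3" using f1 f2 f3 by auto
 have "card (ed X T j) <= cnt X" unfolding cnt_def by (intro card_mono) (auto simp: ed_def)
 then have le: "card (ed X T j) * pf (n - card T) (r - j) <= (b - 1) * pf (n - card T) (r - j)" if "cnt X < b" for b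
  using that by (intro mult_le_mono1) simp
 have ok: "ext_ok (s 6 0) T j b" if "cnt X < b" for b
  using order_trans[OF X(1)[unfolded ext_ge_def X(2)] le[OF that]] le_less_trans[OF zero_le that] unfolding ext_ok_def by blast
 have s': "s' = (if s 9 0 <= cnt X then upd (den (mapE 30 3 (ixE 15 30)) s3) 9 0 (Suc (cnt X)) else s3)"
 proof -
  have "s' = den (If (leE (cell 9) (cell 46)) (Sq (mapE 30 3 (ixE 15 30)) (St 9 (Lit 0) (Add (cell 46) (Lit 1)))) Nop) s3"
   by (simp add: s'_def ext_cmd_def s1_def s2_def s3_def)
  moreover have "den (mapE 30 3 (ixE 15 30)) s3 46 = s3 46" by (simp add: den_frame)
  ultimately show ?thesis using c46 o by auto
 qed
 have "best (s 6 0) s' & s 9 0 <= s' 9 0 & cnt X < s' 9 0"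
 proof (cases "s 9 0 <= cnt X")
  case True
  have "setof s' 3 = X" using setof_mapE_copy[OF i3, of 3 15] True X3 unfolding s' by (auto simp: setof_def)
  then show ?thesis using True X unfolding s' by (simp add: best_def)
 next
  case False
  then show ?thesis using b o unfolding s' by (auto simp: best_def setof_def)
 qed
 then show "best (s 6 0) s'" "s 9 0 <= s' 9 0" "ext_ok (s 6 0) (setof s 14) j (s' 9 0)"
  using ok by (auto simp: T_def)
qed

lemma ext_ok_mono: "ext_ok M T j b ==> b <= b' ==> ext_ok M T j b'"
 unfolding ext_ok_def by (meson diff_le_mono less_le_trans mult_le_mono1 order_trans)

lemma den_exts:
 fixes js :: "nat list"
 assumes "inp s" "card (setof s 14) <= s 6 0" "s 6 0 <= n" "best (s 6 0) s"
 defines "s' \<equiv> den (sqs (map ext_cmd js)) s"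
 shows "best (s 6 0) s'" "s 9 0 <= s' 9 0" "j \<in> set js ==> ext_ok (s 6 0) (setof s 14) j (s' 9 0)"
proof -
 have "best (s 6 0) s' & s 9 0 <= s' 9 0 & (\<forall>j\<in>set js. ext_ok (s 6 0) (setof s 14) j (s' 9 0))"
  unfolding s'_def using assms(1-4)
 proof (induction js arbitrary: s)
  case (Cons j js)
  define t where "t = den (ext_cmd j) s"
  note E = den_ext[OF Cons.prems, where j = j, folded t_def]
  have f: "t b = s b" if "b ~: {3, 9, 15, 19, 30, 31, 32, 42, 43, 44, 45, 46}" for b using that by (simp add: t_def den_frame)
  have it: "inp t" by (rule inp_cong[OF Cons.prems(1)]; rule f) auto
  have "t 6 = s 6" "setof t 14 = setof s 14" using f by (auto simp: setof_def)
  then show ?case using Cons.IH[OF it] Cons.prems E ext_ok_mono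
   by (auto simp: t_def[symmetric] intro: order_trans)
 qed simp
 then show "best (s 6 0) s'" "s 9 0 <= s' 9 0" "j \<in> set js ==> ext_ok (s 6 0) (setof s 14) j (s' 9 0)" by auto
qed

subsection \<open>One guess of the degree bound\<close>

text \<open>Array 12 holds \<open>R\<close>, which starts with the \<open>a\<close> vertices of
  largest degree; array 14 holds \<open>T\<close>, which is the large dense set in array 13 if the
  flag is up, and otherwise \<open>R\<close> completed by the vertices with most weight into
  \<open>R\<close>. \<open>T\<close> is then thinned out and extended for every
  \<open>j\<close>.\<close>

definition guess_cmd :: "nat => cmd => cmd" where
 "guess_cmd Q p = sqs [mapE 30 12 (Lit 1), mapE 30 39 (Lit 1), mapE 30 14 (Lit 0), shrink_cmd 12 14 (cell 7) (deg_cmd 39),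
   mapE 30 13 (Lit 0), St 16 (Lit 0) (Lit 0), For 17 (cell 0) (nest Q p),
   If (cell 16) (mapE 30 14 (ixE 13 30)) (Sq (mapE 30 14 (Lit 1)) (shrink_cmd 14 12 (cell 6) (deg_cmd 12))),
   mapE 30 39 (Lit 0), shrink_cmd 14 39 (cell 8) (deg_cmd 14), sqs (map ext_cmd [0..<Suc r])]"

text \<open>Each absorbed set is dense on its own and weights of disjoint sets at least add up, so
  everything added to \<open>R0\<close> keeps average degree at least
  \<open>d * M / (c * n)\<close>. The bound \<open>3 * a\<close> holds because at most
  \<open>a\<close> elements are added to fewer than \<open>2 * a\<close>.\<close>

lemma reach:
 assumes "(z0, z) \<in> (chg c d M a)^*" "z0 = (R0, {}, 0)" "z = (R, B, f)" and R0: "R0 \<subseteq> {..<n}" "card R0 = a"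
 shows "R0 \<subseteq> R & R \<subseteq> {..<n} & card R <= 3 * a & d * (M * card (R - R0)) <= c * n * wS (R - R0) & f <= 1 &
  (f = 1 --> B \<subseteq> {..<n} & a < card B & dense c d M B)"
 using assms(1-3)
proof (induction arbitrary: R B f rule: rtrancl_induct)
 case base
 then show ?case using R0 by (auto simp: wS_def)
next
 case (step y z)
 obtain R1 B1 f1 where y: "y = (R1, B1, f1)" by (cases y) blast
 note IH = step.IH[OF step.prems(1) y]
 from step(2) obtain X where 0: "f1 = 0" "card R1 < 2 * a" and X: "X \<subseteq> {..<n} - R1" "dense c d M X"
   "card X <= a & R = R1 \<union> X & B = B1 & f = 0 \<or> a < card X & R = R1 & B = X & f = 1"
  unfolding y step.prems(2) by (auto simp: chg_def)
 show ?case
 proof (cases "card X <= a")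
  case False
  then show ?thesis using X IH by auto
 next
  case True
  then have e: "R = R1 \<union> X" "f = 0" using X(3) by auto
  have fin: "finite X" "finite R1" using X IH finite_V by (auto intro: finite_subset)
  have RR: "R - R0 = (R1 - R0) \<union> X" "(R1 - R0) \<inter> X = {}" using X IH unfolding e by auto
  have "d * (M * card (R - R0)) = d * (M * card (R1 - R0)) + d * (card X * M)"
   unfolding RR(1) using RR(2) fin by (subst card_Un_disjoint) (auto simp: algebra_simps)
  also have "... <= c * n * wS (R1 - R0) + c * n * wS X"
  proof (rule add_mono)
   have "X ~= {}" using X(2) by (auto simp: dense_def wS_def)
   then have "0 < card X" using fin by (simp add: card_gt_0_iff)
   then have "M <= M + card X - 1" by linarith
   then have "d * (card X * M) <= d * (card X * (M + card X - 1))" by (intro mult_le_mono2)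
   then show "d * (card X * M) <= c * n * wS X" using X(2) unfolding dense_def by linarith
  qed (use IH in simp)
  also have "... = c * n * (wS (R1 - R0) + wS X)" by (simp add: algebra_simps)
  also have "... <= c * n * wS (R - R0)"
   unfolding RR(1) using RR(2) fin by (intro mult_le_mono2 wS_superadd) auto
  finally have "d * (M * card (R - R0)) <= c * n * wS (R - R0)" .
  moreover have "card R <= 3 * a" using card_Un_le[of R1 X] 0 True unfolding e by linarith
  ultimately show ?thesis using e X IH by auto
 qed
qed

text \<open>\<open>G z\<close> records that all attempts fail in the intermediate state
  \<open>z\<close>. Only monotonicity connects \<open>z\<close> with the final \<open>R\<close>,
  \<open>B\<close> and \<open>f\<close>, and that is enough for the density estimate.\<close>

definition outcome :: "nat => nat => nat => nat => nat => (st => bool) => nat set => bool" where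
 "outcome c d M a a' G T' \<longleftrightarrow> (\<exists>R0 z R B f T. R0 \<subseteq> {..<n} & card R0 = a &
   (\<forall>u\<in>R0. \<forall>v\<in>{..<n} - R0. dgr {..<n} v <= dgr {..<n} u) &
   ((R0, {}, 0), z) \<in> (chg c d M a)^* & (z, (R, B, f)) \<in> (chg c d M a)^* & G z &
   (if f ~= 0 then T = B else R \<subseteq> T & T \<subseteq> {..<n} & card T = M & (\<forall>u\<in>T - R. \<forall>v\<in>{..<n} - T. dgr R v <= dgr R u)) &
   T' \<subseteq> T & card T' = a' & dens_ge (wS T) (card T) T')"

lemma top_remove:
 assumes "\<forall>u\<in>X - K. \<forall>v\<in>V - X. key v <= key u" "\<And>u. u \<in> X - K ==> key v <= (key u :: nat)"
 shows "\<forall>u\<in>(X - {v}) - K. \<forall>w\<in>V - (X - {v}). key w <= key u"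
 using assms by blast

lemma writes_guess:
 "(\<And>b. b \<in> writes p ==> 12 <= b & b < 100) ==> b \<in> writes (guess_cmd Q p) ==> b \<in> {3, 9} \<or> 12 <= b & b < 100 + Q"
proof -
 assume p: "\<And>b. b \<in> writes p ==> 12 <= b & b < 100" and b: "b \<in> writes (guess_cmd Q p)"
 have "writes (sqs (map ext_cmd [0..<Suc r])) \<subseteq> {3, 9} \<union> {12..<100}" unfolding writes_sqs by auto
 then have "writes (guess_cmd Q p) \<subseteq> {3, 9} \<union> {12..<100} \<union> writes p \<union> {100..<100 + Q}"
  by (simp add: guess_cmd_def writes_nest subset_iff del: upt_Suc) blast
 then show ?thesis using p b by fastforce
qed

lemma den_guess:
 fixes Q :: nat and F :: "st => (nat => nat) => bool"
 assumes s: "inp s" "s 6 0 = M" "s 7 0 = a" "s 8 0 = a'" "s 10 0 = d" "\<And>x. Q <= x ==> digs s x = 0" "best M s"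
  and p: "searches c d M a p F" "\<And>b. b \<in> writes p ==> 12 <= b & b < 100 & b ~= 14 & b ~= 17"
  and a: "a' <= a" "3 * a < M" "M < n"
 defines "s' \<equiv> den (guess_cmd Q p) s"
 defines "G \<equiv> %z. \<forall>\<delta>. (\<forall>x<Q. \<delta> x < n + m) & (\<forall>x\<ge>Q. \<delta> x = 0) --> F z \<delta>"
 shows "best M s'" "s 9 0 <= s' 9 0" "\<exists>T'. outcome c d M a a' G T' & (\<forall>j\<le>r. ext_ok M T' j (s' 9 0))"
proof -
 define s1 where "s1 = den (mapE 30 12 (Lit 1)) s"
 define s2 where "s2 = den (mapE 30 39 (Lit 1)) s1"
 define s3 where "s3 = den (mapE 30 14 (Lit 0)) s2"
 define s4 where "s4 = den (shrink_cmd 12 14 (cell 7) (deg_cmd 39)) s3"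
 define s5 where "s5 = den (mapE 30 13 (Lit 0)) s4"
 define s6 where "s6 = den (St 16 (Lit 0) (Lit 0)) s5"
 define s7 where "s7 = den (For 17 (cell 0) (nest Q p)) s6"
 define s8' where "s8' = den (mapE 30 14 (Lit 1)) s7"
 define s8 where "s8 = (if s7 16 0 ~= 0 then den (mapE 30 14 (ixE 13 30)) s7 else den (shrink_cmd 14 12 (cell 6) (deg_cmd 12)) s8')"
 define s9 where "s9 = den (mapE 30 39 (Lit 0)) s8"
 define s10 where "s10 = den (shrink_cmd 14 39 (cell 8) (deg_cmd 14)) s9"
 have s': "s' = den (sqs (map ext_cmd [0..<Suc r])) s10"
  unfolding s'_def guess_cmd_def
  by (simp add: s1_def s2_def s3_def s4_def s5_def s6_def s7_def s8_def s8'_def s9_def s10_def del: upt_Suc den.simps(4))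
 let ?W = "{19, 30, 31, 32, 33, 38, 42, 43, 44, 45}"
 have f1: "s1 b = s b" if "b ~: {12, 30}" for b using that by (simp add: s1_def den_frame)
 have f2: "s2 b = s1 b" if "b ~: {39, 30}" for b using that by (simp add: s2_def den_frame)
 have f3: "s3 b = s2 b" if "b ~: {14, 30}" for b using that by (simp add: s3_def den_frame)
 have f4: "s4 b = s3 b" if "b ~: insert 12 ?W" for b using that by (simp add: s4_def den_frame)
 have f5: "s5 b = s4 b" if "b ~: {13, 30}" for b using that by (simp add: s5_def den_frame)
 have f6: "s6 b = s5 b" if "b ~= 16" for b using that by (simp add: s6_def)
 have f7: "s7 b = s6 b" if "b < 12 \<or> b \<ge> 100 + Q \<or> b = 14" for b
  unfolding s7_def by (rule den_frame) (use that p(2)[of b] in \<open>auto simp: writes_nest\<close>)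
 have f8': "s8' b = s7 b" if "b ~: {14, 30}" for b using that by (simp add: s8'_def den_frame)
 have f8: "s8 b = s7 b" if "b ~: insert 14 ?W" for b using that by (simp add: s8_def s8'_def den_frame)
 have f9: "s9 b = s8 b" if "b ~: {39, 30}" for b using that by (simp add: s9_def den_frame)
 have f10: "s10 b = s9 b" if "b ~: insert 14 ?W" for b using that by (simp add: s10_def den_frame)
 note fs = f1 f2 f3 f4 f5 f6 f7 f8' f8 f9 f10
 have i1: "inp s1" by (rule inp_cong[OF s(1)]; rule f1) auto
 have i2: "inp s2" by (rule inp_cong[OF i1]; rule f2) auto
 have i3: "inp s3" by (rule inp_cong[OF i2]; rule f3) auto
 have i4: "inp s4" by (rule inp_cong[OF i3]; rule f4) auto
 have i5: "inp s5" by (rule inp_cong[OF i4]; rule f5) auto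
 have i6: "inp s6" by (rule inp_cong[OF i5]; rule f6) auto
 have i7: "inp s7" by (rule inp_cong[OF i6]; rule f7) auto
 have i8': "inp s8'" by (rule inp_cong[OF i7]; rule f8') auto
 have i8: "inp s8" by (rule inp_cong[OF i7]; rule f8) auto
 have i9: "inp s9" by (rule inp_cong[OF i8]; rule f9) auto
 have i10: "inp s10" by (rule inp_cong[OF i9]; rule f10) auto
 let ?V = "{..<n}"
 define R0 where "R0 = setof s4 12"
 have R0: "\<forall>u\<in>R0 - {}. \<forall>v\<in>?V - R0. dgr ?V v <= dgr ?V u" "card R0 = a" "R0 \<subseteq> ?V"
 proof -
  have S: "setof s3 12 = ?V" "setof s3 39 = ?V" "setof s3 14 = {}"
   using setof_mapE_const[OF s(1), of 12 1] setof_mapE_const[OF i1, of 39 1] setof_mapE_const[OF i2, of 14 0] f2[of 12] f3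
   by (simp_all add: s1_def s2_def s3_def setof_def)
  have c: "12 ~: {0, 1, 2, 5, 19, 30, 42, 43, 44, 45, 14::nat}" "14 ~: {30, 42, 43, 44, 45::nat}"
   "writes (deg_cmd 39) \<inter> {0, 1, 2, 5, 42, 12, 14} = {}" by auto
  have g: "eval_expr (cell 7) t = a" if "\<And>b. b ~: {12, 30, 42, 43, 44, 45} \<union> writes (deg_cmd 39) ==> t b = s3 b" for t
   using that[of 7] fs s by simp
  have k: "setof s3 14 \<subseteq> setof s3 12" "card (setof s3 14) <= a" "a <= card (setof s3 12)"
   "\<forall>u\<in>setof s3 12 - {}. \<forall>v\<in>?V - setof s3 12. dgr ?V v <= dgr ?V u" using S a by auto
  have st: "\<forall>u\<in>(X - {v}) - {}. \<forall>w\<in>?V - (X - {v}). dgr ?V w <= dgr ?V u"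
   if "\<forall>u\<in>X - {}. \<forall>v\<in>?V - X. dgr ?V v <= dgr ?V u" "X \<subseteq> setof s3 12" "inp t"
    "\<forall>b. b ~: {12, 30, 42, 43, 44, 45} \<union> writes (deg_cmd 39) --> t b = s3 b" "v \<in> X - setof s3 14"
    "\<And>u. u \<in> X - setof s3 14 ==> den (deg_cmd 39) t 19 v <= den (deg_cmd 39) t 19 u" for X v t
  proof (rule top_remove[OF that(1)])
   fix u assume u: "u \<in> X - {}"
   have "setof t 39 = ?V" using that(4)[rule_format, of 39] S by (simp add: setof_def)
   moreover have "u < n" "v < n" using that u S by auto
   ultimately show "dgr ?V v <= dgr ?V u" using that(6)[of u] u S den_deg[OF that(3), of 39] by simp
  qed
  show "\<forall>u\<in>R0 - {}. \<forall>v\<in>?V - R0. dgr ?V v <= dgr ?V u" "card R0 = a" "R0 \<subseteq> ?V"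
  proof -
   note D = den_shrink[where P = "%X. \<forall>u\<in>X - {}. \<forall>v\<in>?V - X. dgr ?V v <= dgr ?V u", OF i3 c g k, folded s4_def, folded R0_def]
   show "\<forall>u\<in>R0 - {}. \<forall>v\<in>?V - R0. dgr ?V v <= dgr ?V u" by (rule D(1), blast, rule st, assumption+)
   show "card R0 = a" by (rule D(2), blast, rule st, assumption+)
   have "R0 \<subseteq> setof s3 12" by (rule D(4), blast, rule st, assumption+)
   then show "R0 \<subseteq> ?V" using S by simp
  qed
 qed
 have st6: "st s6 = (R0, {}, 0)"
  using setof_mapE_const[OF i4, of 13 0] f5[of 12] f6 by (simp add: st_def R0_def s5_def s6_def setof_def)
 have ok6: "ok d M a s6" using i6 s by (simp add: ok_def fs)
 have dg6: "digs s6 x = 0" if "Q <= x" for x using that s by (simp add: fs)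
 have rch: "R0 \<subseteq> R & R \<subseteq> ?V & card R <= 3 * a & d * (M * card (R - R0)) <= c * n * wS (R - R0) & f <= 1 &
   (f = 1 --> B \<subseteq> ?V & a < card B & dense c d M B)" if "((R0, {}, 0), (R, B, f)) \<in> (chg c d M a)^*" for R B f
  by (rule reach[OF that refl refl R0(3,2)])
 \<comment> \<open>\<open>reach\<close> bounds \<open>R\<close> by \<open>3 * a < M < n\<close>, so
   even with the flag raised \<open>meas\<close> stays below the number \<open>n\<close> of
   passes.\<close>
 have ms: "meas z < n" if "(st s6, z) \<in> (chg c d M a)^*" for z
  using rch[of "fst z" "fst (snd z)" "snd (snd z)"] that a unfolding st6 by (simp add: meas_def)
 obtain z where z: "((R0, {}, 0), z) \<in> (chg c d M a)^*" "(z, st s7) \<in> (chg c d M a)^*" "G z"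
 proof -
  have "\<exists>z. (st s6, z) \<in> (chg c d M a)^* & (z, st s7) \<in> (chg c d M a)^* & G z"
   unfolding s7_def G_def using p(2) ms by (intro passes[OF p(1) _ _ ok6 dg6]) auto
  then show thesis using that unfolding st6 by blast
 qed
 define R where "R = setof s7 12"
 define B where "B = setof s7 13"
 define f where "f = s7 16 0"
 have st7: "st s7 = (R, B, f)" by (simp add: st_def R_def B_def f_def)
 have RB: "R0 \<subseteq> R" "R \<subseteq> ?V" "card R <= 3 * a" "f <= 1" "f = 1 ==> B \<subseteq> ?V & a < card B"
  using rch[of R B f] z(1,2) unfolding st7 by (auto dest: rtrancl_trans)
 define T where "T = setof s8 14"
 have T: "if f ~= 0 then T = B else R \<subseteq> T & T \<subseteq> ?V & card T = M & (\<forall>u\<in>T - R. \<forall>v\<in>?V - T. dgr R v <= dgr R u)"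
 proof (cases "f = 0")
  case False
  then show ?thesis using setof_mapE_copy[OF i7, of 14 13] by (simp add: T_def s8_def f_def B_def)
 next
  case True
  have S: "setof s8' 14 = ?V" "setof s8' 12 = R"
   using setof_mapE_const[OF i7, of 14 1] f8'[of 12] by (simp_all add: s8'_def R_def setof_def)
  have c: "14 ~: {0, 1, 2, 5, 19, 30, 42, 43, 44, 45, 12::nat}" "12 ~: {30, 42, 43, 44, 45::nat}"
   "writes (deg_cmd 12) \<inter> {0, 1, 2, 5, 42, 14, 12} = {}" by auto
  have g: "eval_expr (cell 6) t = M" if "\<And>b. b ~: {14, 30, 42, 43, 44, 45} \<union> writes (deg_cmd 12) ==> t b = s8' b" for t
   using that[of 6] fs s by simp
  have k: "setof s8' 12 \<subseteq> setof s8' 14" "card (setof s8' 12) <= M" "M <= card (setof s8' 14)"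
   "\<forall>u\<in>setof s8' 14 - R. \<forall>v\<in>?V - setof s8' 14. dgr R v <= dgr R u" using S a RB by auto
  have st: "\<forall>u\<in>(X - {v}) - R. \<forall>w\<in>?V - (X - {v}). dgr R w <= dgr R u"
   if "\<forall>u\<in>X - R. \<forall>v\<in>?V - X. dgr R v <= dgr R u" "X \<subseteq> setof s8' 14" "inp t" "setof t 12 = setof s8' 12" "v \<in> X - setof s8' 12"
    "\<And>u. u \<in> X - setof s8' 12 ==> den (deg_cmd 12) t 19 v <= den (deg_cmd 12) t 19 u" for X v t
  proof (rule top_remove[OF that(1)])
   fix u assume u: "u \<in> X - R"
   have "u < n" "v < n" using that u S by auto
   then show "dgr R v <= dgr R u" using that(4) that(6)[of u] u S den_deg[OF that(3), of 12] by simp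
  qed
  show ?thesis
   using den_shrink[where P = "%X. \<forall>u\<in>X - R. \<forall>v\<in>?V - X. dgr R v <= dgr R u", OF i8' c g k st] S True
   unfolding T_def s8_def f_def by auto
 qed
 have Tn: "T \<subseteq> ?V" "a' <= card T" using T RB a by (auto split: if_splits simp: le_Suc_eq)
 define T' where "T' = setof s10 14"
 have T': "dens_ge (wS T) (card T) T'" "card T' = a'" "T' \<subseteq> T"
 proof -
  have S: "setof s9 14 = T" "setof s9 39 = {}"
   using setof_mapE_const[OF i8, of 39 0] f9[of 14] by (simp_all add: s9_def T_def setof_def)
  have c: "14 ~: {0, 1, 2, 5, 19, 30, 42, 43, 44, 45, 39::nat}" "39 ~: {30, 42, 43, 44, 45::nat}"
   "writes (deg_cmd 14) \<inter> {0, 1, 2, 5, 42, 14, 39} = {}" by auto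
  have g: "eval_expr (cell 8) t = a'" if "\<And>b. b ~: {14, 30, 42, 43, 44, 45} \<union> writes (deg_cmd 14) ==> t b = s9 b" for t
   using that[of 8] fs s by simp
  have k: "setof s9 39 \<subseteq> setof s9 14" "card (setof s9 39) <= a'" "a' <= card (setof s9 14)"
   "dens_ge (wS T) (card T) (setof s9 14)" using S Tn by (auto simp: dens_ge_def)
  have st: "dens_ge (wS T) (card T) (X - {v})"
   if "dens_ge (wS T) (card T) X" "X \<subseteq> setof s9 14" "inp t" "setof t 14 = X" "v \<in> X - setof s9 39"
    "\<And>u. u \<in> X - setof s9 39 ==> den (deg_cmd 14) t 19 v <= den (deg_cmd 14) t 19 u" for X v t
  proof (rule dens_ge_remove[OF that(1)])
   show "finite X" "v \<in> X" using that Tn S by (auto intro: finite_subset)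
   fix u assume u: "u \<in> X"
   then have "u < n" "v < n" using that Tn S by auto
   then show "dgr X v <= dgr X u" using that(4) that(6)[of u] u S den_deg[OF that(3), of 14] by simp
  qed
  show "dens_ge (wS T) (card T) T'" "card T' = a'" "T' \<subseteq> T"
   using den_shrink[where P = "dens_ge (wS T) (card T)", OF i9 c g k st] S unfolding T'_def s10_def by auto
 qed
 have "outcome c d M a a' G T'"
  unfolding outcome_def
  by (rule exI[of _ R0], rule exI[of _ z], rule exI[of _ R], rule exI[of _ B], rule exI[of _ f], rule exI[of _ T])
   (use R0 z T T' in \<open>simp add: st7\<close>)
 moreover have s10: "s10 6 0 = M" "s10 9 = s 9" "s10 3 = s 3" using s by (simp_all add: fs)
 moreover have "best (s10 6 0) s10" using s(7) s10 by (simp add: best_def setof_def)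
 moreover have "card (setof s10 14) <= s10 6 0" "s10 6 0 <= n" using T' a s10 by (auto simp: T'_def)
 ultimately have "best M s' & s 9 0 <= s' 9 0 & outcome c d M a a' G T' & (\<forall>j\<le>r. ext_ok M T' j (s' 9 0))"
  using den_exts[OF i10, where js = "[0..<Suc r]", folded s'] by (simp add: T'_def del: upt_Suc)
 then show "best M s'" "s 9 0 <= s' 9 0" "\<exists>T'. outcome c d M a a' G T' & (\<forall>j\<le>r. ext_ok M T' j (s' 9 0))"
  by blast+
qed

subsection \<open>Counting edges\<close>

lemma wS_edges:
 assumes "X \<subseteq> {..<n}"
 shows "wS X = (\<Sum>i<m. card (set (es ! i) \<inter> X) * (card (set (es ! i) \<inter> X) - 1))"
proof -
 have fin: "finite X" using assms by simp
 have "(\<Sum>u\<in>X. \<Sum>v\<in>X. if u ~= v & u \<in> set (es ! i) & v \<in> set (es ! i) then 1 else 0 :: nat)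
   = card (set (es ! i) \<inter> X) * (card (set (es ! i) \<inter> X) - 1)" for i
 proof -
  let ?A = "set (es ! i) \<inter> X"
  have "(\<Sum>u\<in>X. \<Sum>v\<in>X. if u ~= v & u \<in> set (es ! i) & v \<in> set (es ! i) then 1 else 0 :: nat)
    = (\<Sum>u\<in>?A. \<Sum>v\<in>X. if u ~= v & v \<in> set (es ! i) then 1 else 0)"
   using fin by (intro sum.mono_neutral_cong_right) auto
  also have "... = (\<Sum>u\<in>?A. card ?A - 1)"
  proof (intro sum.cong refl)
   fix u assume u: "u \<in> ?A"
   have "(\<Sum>v\<in>X. if u ~= v & v \<in> set (es ! i) then 1 else 0 :: nat) = card {v \<in> X. u ~= v & v \<in> set (es ! i)}"
    using fin by (simp flip: sum.inter_filter)
   also have "{v \<in> X. u ~= v & v \<in> set (es ! i)} = ?A - {u}" by auto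
   finally show "(\<Sum>v\<in>X. if u ~= v & v \<in> set (es ! i) then 1 else 0 :: nat) = card ?A - 1" using u by simp
  qed
  finally show ?thesis by simp
 qed
 moreover have "wS X = (\<Sum>i<m. \<Sum>u\<in>X. \<Sum>v\<in>X. if u ~= v & u \<in> set (es ! i) & v \<in> set (es ! i) then 1 else 0)"
 proof -
  have "wS X = (\<Sum>u\<in>X. \<Sum>i<m. \<Sum>v\<in>X. if u ~= v & u \<in> set (es ! i) & v \<in> set (es ! i) then 1 else 0)"
   unfolding wS_def wt_def by (rule sum.cong[OF refl]) (rule sum.swap)
  also have "... = (\<Sum>i<m. \<Sum>u\<in>X. \<Sum>v\<in>X. if u ~= v & u \<in> set (es ! i) & v \<in> set (es ! i) then 1 else 0)"
   by (rule sum.swap)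
  finally show ?thesis .
 qed
 ultimately show ?thesis by simp
qed

lemma cnt_le_wS:
 assumes "X \<subseteq> {..<n}"
 shows "r * (r - 1) * cnt X <= wS X"
proof -
 have "r * (r - 1) * cnt X = (\<Sum>i\<in>{i. i < m & set (es ! i) \<subseteq> X}. r * (r - 1))" by (simp add: cnt_def)
 also have "... = (\<Sum>i\<in>{i. i < m & set (es ! i) \<subseteq> X}. card (set (es ! i) \<inter> X) * (card (set (es ! i) \<inter> X) - 1))"
  by (intro sum.cong refl) (auto simp: card_edge Int_absorb2)
 also have "... <= wS X" unfolding wS_edges[OF assms] by (intro sum_mono2) auto
 finally show ?thesis .
qed

lemma wS_le_m:
 assumes "X \<subseteq> {..<n}"
 shows "wS X <= m * (r * r)"
proof -
 have "card (set (es ! i) \<inter> X) * (card (set (es ! i) \<inter> X) - 1) <= r * r" if "i < m" for i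
 proof -
  have "card (set (es ! i) \<inter> X) <= r" using card_edge(1)[OF that] card_mono[of "set (es ! i)" "set (es ! i) \<inter> X"] by simp
  then show ?thesis by (intro mult_mono) auto
 qed
 then have "wS X <= (\<Sum>i<m. r * r)" unfolding wS_edges[OF assms] by (intro sum_mono) auto
 then show ?thesis by simp
qed

lemma wS_profile:
 assumes "X \<subseteq> {..<n}"
 shows "wS X = (\<Sum>j\<le>r. card (ed {..<n} X j) * (j * (j - 1)))"
proof -
 let ?f = "%i. card (set (es ! i) \<inter> X)"
 have "?f i <= r" if "i < m" for i
  using card_edge(1)[OF that] card_mono[of "set (es ! i)" "set (es ! i) \<inter> X"] by simp
 then have "wS X = (\<Sum>j\<in>{..r}. \<Sum>i\<in>{i \<in> {..<m}. ?f i = j}. ?f i * (?f i - 1))"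
  unfolding wS_edges[OF assms] by (intro sum.group[symmetric]) auto
 also have "... = (\<Sum>j\<le>r. card (ed {..<n} X j) * (j * (j - 1)))"
 proof (intro sum.cong refl)
  fix j
  have "{i \<in> {..<m}. ?f i = j} = ed {..<n} X j" using card_edge(2) by (auto simp: ed_def)
  then show "(\<Sum>i\<in>{i \<in> {..<m}. ?f i = j}. ?f i * (?f i - 1)) = card (ed {..<n} X j) * (j * (j - 1))"
   by (simp add: ed_def)
 qed
 finally show ?thesis .
qed

end

section \<open>Numerical estimates for the final count\<close>

lemma geometric_sum_le:
 fixes x :: real
 assumes "0 <= x" "x <= 1/2"
 shows "(\<Sum>j<k. x ^ j) <= 2"
proof -
 have "(\<Sum>j<k. x ^ j) <= (\<Sum>j<k. (1/2) ^ j)" using assms by (intro sum_mono power_mono) auto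
 also have "... = 2 - 2 * (1/2) ^ k" by (induction k) auto
 also have "... <= 2" by simp
 finally show ?thesis .
qed

text \<open>With \<open>j\<close> shifted by 2, this absorbs the weights \<open>j * (j - 1)\<close>
  into a geometric series of ratio \<open>3 * \<mu>\<close>, which is at most 1/2.\<close>

lemma pairs_le_pow3: "(j + 2) * (j + 1) <= 2 * 3 ^ j" for j :: nat
proof (induction j)
 case (Suc j)
 have "(Suc j + 2) * (Suc j + 1) <= 3 * ((j + 2) * (j + 1))" by (simp add: algebra_simps)
 then show ?case using Suc by simp
qed simp

lemma pf_ge: "(c - k) ^ k <= pf c k"
proof -
 have "(c - k) ^ l <= pf c l" if "l <= k" for l
  using that by (induction l) (auto simp: mult.commute intro!: mult_le_mono)
 then show ?thesis by simp
qed

lemma pf_le: "pf c k <= c ^ k"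
 by (induction k) (auto simp: mult.commute intro!: mult_le_mono)

text \<open>Replaces the ratio of falling factorials by a power of \<open>M / n\<close>. Since
  \<open>a\<close> and \<open>r\<close> are small compared with \<open>M / r\<close>, Bernoulli's
  inequality bounds the loss by a factor 2.\<close>

lemma pf_ratio:
 fixes M n a k r :: nat
 assumes n: "0 < n" "M <= n" and k: "k <= r" and a: "4 * r * a <= M" and M: "4 * r * r <= M" "0 < M"
  and xy: "x * pf (M - a) k <= y * pf (n - a) k"
 shows "real x * (real M / real n) ^ k / 2 <= real y"
proof (cases "k = 0")
 case True
 then show ?thesis using xy by simp
next
 case False
 then have r: "0 < r" using k by simp
 have ak: "k * (a + k) <= r * (a + r)" using k by (intro mult_mono) auto
 have "2 * (r * (a + r)) <= M" using a M by (simp add: algebra_simps)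
 then have h: "2 * (k * (a + k)) <= M" using ak by linarith
 have "a + k <= k * (a + k)" using False by simp
 then have akM: "a + k <= M" using h by linarith
 define t where "t = real (a + k) / real M"
 have "2 * (real k * real (a + k)) <= real M" using h by (metis of_nat_le_iff of_nat_mult of_nat_numeral)
 then have "real k * t <= 1/2" using M by (simp add: t_def field_simps)
 moreover have "1 + real k * (- t) <= (1 + - t) ^ k"
  using akM M by (intro Bernoulli_inequality) (simp add: t_def field_simps)
 ultimately have b: "1/2 <= (1 - real (a + k) / real M) ^ k" unfolding t_def[symmetric] by simp
 have "real x * real M ^ k / 2 <= real x * real M ^ k * (1 - real (a + k) / real M) ^ k"
  using b mult_left_mono[OF b, of "real x * real M ^ k"] by simp
 also have "... = real x * real (M - a - k) ^ k"
  using akM M by (simp add: power_mult_distrib[symmetric] of_nat_diff right_diff_distrib)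
 also have "... <= real x * real (pf (M - a) k)"
  using pf_ge[of "M - a" k] by (intro mult_left_mono) (simp_all flip: of_nat_power)
 also have "... <= real y * real (pf (n - a) k)" using xy by (simp flip: of_nat_mult)
 also have "... <= real y * real n ^ k"
 proof (intro mult_left_mono)
  have "pf (n - a) k <= n ^ k" by (rule order_trans[OF pf_le]) (simp add: power_mono)
  then show "real (pf (n - a) k) <= real n ^ k" by (simp flip: of_nat_power)
 qed simp
 finally show ?thesis using n by (simp add: field_simps)
qed

context input
begin

text \<open>The weight of \<open>T\<close> splits according to the number \<open>j\<close> of
  vertices that a hyperedge has in \<open>T\<close>. If every level had fewer than
  \<open>\<mu> ^ (j - 2) * wS T / 8\<close> hyperedges, the levels would add up to half of
  \<open>wS T\<close> only. A rich level is extended at the cost \<open>\<mu> ^ (r - j)\<close>, and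
  the powers combine to \<open>\<mu> ^ (r - 2)\<close> whatever \<open>j\<close> is.\<close>

lemma final_count:
 assumes T: "T \<subseteq> {..<n}" "4 * r * card T <= M" and M: "4 * r * r <= M" "6 * M <= n"
  and ext: "\<And>j. j <= r ==> ext_ok M T j b"
 shows "(real M / real n) ^ (r - 2) * real (wS T) / 16 <= real (b - 1)"
proof -
 define \<mu> where "\<mu> = real M / real n"
 have "0 < 4 * r * r" using r_ge by simp
 then have n0: "0 < n" "0 < M" using r_le M by linarith+
 have mu: "0 < \<mu>" "\<mu> <= 1/6" using M n0 by (auto simp: \<mu>_def field_simps)
 have "\<exists>j\<in>{2..r}. \<mu> ^ (j - 2) * real (wS T) / 8 <= real (card (ed {..<n} T j))"
 proof (rule ccontr)
  assume "\<not> ?thesis"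
  then have lt: "real (card (ed {..<n} T j)) < \<mu> ^ (j - 2) * real (wS T) / 8" if "j \<in> {2..r}" for j
   using that by (auto simp: not_le)
  have "real (wS T) = (\<Sum>j\<in>{..r}. real (card (ed {..<n} T j)) * real (j * (j - 1)))"
   unfolding wS_profile[OF T(1)] by simp
  also have "... = (\<Sum>j\<in>{2..r}. real (card (ed {..<n} T j)) * real (j * (j - 1)))"
   by (rule sum.mono_neutral_right) (auto simp: not_le less_2_cases_iff)
  also have "... <= (\<Sum>j\<in>{2..r}. (1/2) ^ (j - 2) * (real (wS T) / 4))"
  proof (intro sum_mono)
   fix j assume j: "j \<in> {2..r}"
   obtain i where i: "j = i + 2" using j by (metis atLeastAtMost_iff le_add_diff_inverse2)
   have "real (card (ed {..<n} T j)) * real (j * (j - 1)) <= \<mu> ^ i * real (wS T) / 8 * (2 * 3 ^ i)"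
    using lt[OF j] of_nat_mono[OF pairs_le_pow3[of i], where 'a = real] mu unfolding i
    by (intro mult_mono) (auto simp: mult.commute add.commute)
   also have "... = (3 * \<mu>) ^ i * (real (wS T) / 4)" by (simp add: power_mult_distrib)
   also have "... <= (1/2) ^ i * (real (wS T) / 4)" using mu by (intro mult_right_mono power_mono) auto
   finally show "real (card (ed {..<n} T j)) * real (j * (j - 1)) <= (1/2) ^ (j - 2) * (real (wS T) / 4)" by (simp add: i)
  qed
  also have "... = (\<Sum>i<r - 1. (1/2) ^ i) * (real (wS T) / 4)"
   unfolding sum_distrib_right
   by (rule sum.reindex_bij_witness[of _ "%i. i + 2" "%j. j - 2"]) (use r_ge in auto)
  also have "... <= 2 * (real (wS T) / 4)" by (intro mult_right_mono geometric_sum_le) auto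
  finally have "wS T = 0" by simp
  then show False using lt[of 2] r_ge by simp
 qed
 then obtain j where j: "2 <= j" "j <= r" "\<mu> ^ (j - 2) * real (wS T) / 8 <= real (card (ed {..<n} T j))" by auto
 have "real (card (ed {..<n} T j)) * \<mu> ^ (r - j) / 2 <= real (b - 1)"
  unfolding \<mu>_def using ext[OF j(2)] T M n0 by (intro pf_ratio[where r = r and a = "card T"]) (auto simp: ext_ok_def)
 moreover have "\<mu> ^ (r - 2) * real (wS T) / 16 = \<mu> ^ (j - 2) * real (wS T) / 8 * \<mu> ^ (r - j) / 2"
 proof -
  have "r - 2 = (j - 2) + (r - j)" using j by simp
  then show ?thesis by (simp add: power_add)
 qed
 moreover have "\<mu> ^ (j - 2) * real (wS T) / 8 * \<mu> ^ (r - j) / 2 <= real (card (ed {..<n} T j)) * \<mu> ^ (r - j) / 2"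
  using j(3) mu by (intro divide_right_mono mult_right_mono) auto
 ultimately show ?thesis unfolding \<mu>_def[symmetric] by linarith
qed

subsection \<open>The density of the set found\<close>

lemma chg_rtrancl_mono: "(z, z') \<in> (chg c d M a)^* ==> fst z \<subseteq> fst z' & (snd (snd z) ~= 0 --> z' = z)"
proof (induction rule: rtrancl_induct)
 case (step y z')
 then show ?case by (cases y; cases z') (auto simp: chg_def)
qed simp

lemma top_cross:
 fixes f :: "nat => nat"
 assumes "finite A" "finite B" "\<And>u v. u \<in> A ==> v \<in> B ==> f v <= f u"
 shows "card A * sum f B <= card B * sum f A"
proof -
 have "card A * sum f B = (\<Sum>u\<in>A. \<Sum>v\<in>B. f v)" by simp
 also have "... <= (\<Sum>u\<in>A. \<Sum>v\<in>B. f u)" using assms by (intro sum_mono) auto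
 also have "... = card B * sum f A" by (simp add: sum_distrib_left)
 finally show ?thesis .
qed

lemma sum_dgr_swap: "(\<Sum>v\<in>X. dgr Y v) = (\<Sum>u\<in>Y. dgr X u)"
 unfolding dgr_def by (subst sum.swap) (simp add: wt_sym)

lemma sum_dgr_le_wS: "R \<subseteq> T ==> finite T ==> (\<Sum>v\<in>T. dgr R v) <= wS T"
 unfolding wS_def dgr_def by (intro sum_mono sum_mono2) auto

lemma wS_split: "finite S ==> finite R ==> wS S <= wS (S - R) + 2 * (\<Sum>v\<in>S. dgr R v)"
proof -
 assume fin: "finite S" "finite R"
 have le: "wt u v <= (if u \<in> S - R & v \<in> S - R then wt u v else 0) + (if v \<in> R then wt u v else 0) + (if u \<in> R then wt u v else 0)"
  if "u \<in> S" "v \<in> S" for u v using that by auto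
 have "wS S <= (\<Sum>u\<in>S. \<Sum>v\<in>S. (if u \<in> S - R & v \<in> S - R then wt u v else 0) + (if v \<in> R then wt u v else 0) + (if u \<in> R then wt u v else 0))"
  unfolding wS_def using le by (intro sum_mono) auto
 also have "... = (\<Sum>u\<in>S. \<Sum>v\<in>S. if u \<in> S - R & v \<in> S - R then wt u v else 0)
   + (\<Sum>u\<in>S. \<Sum>v\<in>S. if v \<in> R then wt u v else 0) + (\<Sum>u\<in>S. \<Sum>v\<in>S. if u \<in> R then wt u v else 0)"
  by (simp add: sum.distrib)
 also have "(\<Sum>u\<in>S. \<Sum>v\<in>S. if u \<in> R then wt u v else 0) = (\<Sum>u\<in>S. \<Sum>v\<in>S. if v \<in> R then wt u v else 0)"
  by (subst sum.swap) (intro sum.cong refl, simp add: wt_sym)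
 also have "(\<Sum>u\<in>S. \<Sum>v\<in>S. if u \<in> S - R & v \<in> S - R then wt u v else 0) = wS (S - R)"
 proof -
  have "(\<Sum>u\<in>S. \<Sum>v\<in>S. if u \<in> S - R & v \<in> S - R then wt u v else 0)
    = (\<Sum>u\<in>S - R. \<Sum>v\<in>S. if v \<in> S - R then wt u v else 0)"
   using fin by (intro sum.mono_neutral_cong_right) auto
  also have "... = wS (S - R)"
   unfolding wS_def using fin by (intro sum.cong refl sum.mono_neutral_cong_right) auto
  finally show ?thesis .
 qed
 also have "(\<Sum>u\<in>S. \<Sum>v\<in>S. if v \<in> R then wt u v else 0) <= (\<Sum>v\<in>S. dgr R v)"
 proof (intro sum_mono)
  fix u
  have "(\<Sum>v\<in>S. if v \<in> R then wt u v else 0) = (\<Sum>v\<in>S \<inter> R. wt u v)" using fin by (simp add: sum.inter_restrict)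
  also have "... <= dgr R u" unfolding dgr_def using fin by (intro sum_mono2) auto
  finally show "(\<Sum>v\<in>S. if v \<in> R then wt u v else 0) <= dgr R u" .
 qed
 finally show ?thesis by simp
qed

text \<open>\<open>H\<close> is applied to the state that withstood the search. If \<open>R\<close>
  has reached \<open>2 * a\<close> there, it is dense by itself. If some outside vertex has degree
  at least \<open>K\<close>, so have all of \<open>R0\<close>; then much weight runs between
  \<open>R\<close> and all vertices, and the vertices preferred for \<open>T\<close> catch a fair
  share. If \<open>S\<close> loses more than half of its weight without \<open>R\<close>, then the
  weight between \<open>S\<close> and \<open>R\<close> is large, and again \<open>T\<close> catches
  a share of it. In the case \<open>f \<noteq> 0\<close> the stored set is dense directly.\<close>

lemma outcome_dense:
 fixes K :: real
 assumes out: "outcome c d M a a' G T'" and a: "a = M div 4" "6 <= M" and c: "4 <= c"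
  and K: "0 <= K" "K <= real d" "K * real M * real M <= real n * real (wS S)"
  and S: "S \<subseteq> {..<n}" "card S <= M"
  and H: "\<And>R B. R \<subseteq> {..<n} ==> card R < 2 * a ==> G (R, B, 0) ==>
   (\<exists>v\<in>{..<n} - R. K <= real (dgr {..<n} v)) \<or> 2 * wS (S - R) < wS S"
 shows "K * real (a' * (a' - 1)) <= 8 * real c * real n * real (wS T')" "card T' = a'" "T' \<subseteq> {..<n}"
proof -
 let ?V = "{..<n}"
 obtain R0 z R B f T where R0: "R0 \<subseteq> ?V" "card R0 = a" "\<forall>u\<in>R0. \<forall>v\<in>?V - R0. dgr ?V v <= dgr ?V u"
  and z: "((R0, {}, 0), z) \<in> (chg c d M a)^*" "(z, (R, B, f)) \<in> (chg c d M a)^*" "G z"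
  and T: "if f ~= 0 then T = B else R \<subseteq> T & T \<subseteq> ?V & card T = M & (\<forall>u\<in>T - R. \<forall>v\<in>?V - T. dgr R v <= dgr R u)"
  and T': "T' \<subseteq> T" "card T' = a'" "dens_ge (wS T) (card T) T'"
  using out unfolding outcome_def by auto
 have "((R0, {}, 0), (R, B, f)) \<in> (chg c d M a)^*" using z by (meson rtrancl_trans)
 note rR = reach[OF this refl refl R0(1,2)]
 have TV: "T \<subseteq> ?V" using T rR by (auto split: if_splits simp: le_Suc_eq)
 then show "T' \<subseteq> ?V" "card T' = a'" using T' by auto
 have finT: "finite T" using TV by simp
 have a8: "M <= 8 * a" "4 * a <= M" using a by auto
 have main: "K * real (card T * (card T - 1)) <= 8 * real c * real n * real (wS T)"
 proof (cases "f = 0")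
  case False
  then have B: "T = B" "dense c d M B" using T rR by (auto simp: le_Suc_eq)
  have "d * (card T * (card T - 1)) <= c * n * wS T"
  proof -
   have "d * (card T * (card T - 1)) <= d * (card T * (M + card T - 1))" by (intro mult_le_mono2) simp
   then show ?thesis using B(2) unfolding dense_def B(1)[symmetric] by (meson le_less_trans less_imp_le)
  qed
  then have "real d * real (card T * (card T - 1)) <= real c * real n * real (wS T)" by (metis of_nat_le_iff of_nat_mult)
  moreover have "K * real (card T * (card T - 1)) <= real d * real (card T * (card T - 1))"
   using K by (intro mult_right_mono) auto
  moreover have "0 <= real c * real n * real (wS T)" by simp
  ultimately show ?thesis by linarith
 next
  case f0: True
  then have R: "R \<subseteq> T" "card T = M" "\<And>u v. u \<in> T - R ==> v \<in> ?V - T ==> dgr R v <= dgr R u" using T by auto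
  have finR: "finite R" using rR by simp
  obtain Rp Bp fp where zz: "z = (Rp, Bp, fp)" by (cases z) blast
  have Rp: "Rp \<subseteq> R" "fp = 0" using chg_rtrancl_mono[OF z(2)] f0 by (auto simp: zz)
  have rp: "R0 \<subseteq> Rp" "Rp \<subseteq> ?V" using reach[OF z(1) refl zz R0(1,2)] by auto
  have cTR: "M <= 4 * card (T - R)" "card (T - R) <= M"
   using R(1,2) finR rR a8 by (auto simp: card_Diff_subset)
  let ?s = "\<Sum>v\<in>T. dgr R v"
  have sT: "?s <= wS T" by (rule sum_dgr_le_wS[OF R(1) finT])
  have sTR: "(\<Sum>v\<in>T - R. dgr R v) <= ?s" using finT by (intro sum_mono2) auto
  have MM: "K * real (card T * (card T - 1)) <= K * (real M * real M)"
   unfolding R(2) using K by (intro mult_left_mono) (auto simp flip: of_nat_mult)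
  have "2 * a <= card Rp \<or> (\<exists>v\<in>?V - Rp. K <= real (dgr ?V v)) \<or> 2 * wS (S - Rp) < wS S"
   using H[of Rp Bp] z(3) rp unfolding zz Rp(2) by (meson not_le)
  then consider "2 * a <= card Rp" | v where "v \<in> ?V - Rp" "K <= real (dgr ?V v)" | "2 * wS (S - Rp) < wS S"
   by blast
  then show ?thesis
  proof cases
   case 1
   then have "2 * a <= card R" using card_mono[OF finR Rp(1)] by simp
   then have "a <= card (R - R0)" using R0 rR finite_V[OF R0(1)] by (simp add: card_Diff_subset)
   then have "d * (M * a) <= d * (M * card (R - R0))" by simp
   also have "... <= c * n * wS (R - R0)" using rR by simp
   also have "... <= c * n * wS T" using R(1) finT by (intro mult_le_mono2 wS_mono) auto
   finally have "real d * (real M * real a) <= real c * real n * real (wS T)" by (metis of_nat_le_iff of_nat_mult)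
   moreover have "K * (real M * real M) <= 8 * (real d * (real M * real a))"
   proof -
    have "real M <= 8 * real a" using a8 by (metis of_nat_le_iff of_nat_mult of_nat_numeral)
    then have "K * (real M * real M) <= real d * (real M * (8 * real a))" using K by (intro mult_mono) auto
    then show ?thesis by simp
   qed
   ultimately show ?thesis using MM by linarith
  next
   case 2
   have tot: "K * real a <= real (\<Sum>v\<in>?V. dgr R v)"
   proof -
    have "K <= real (dgr ?V u)" if "u \<in> R0" for u
    proof -
     have "v \<in> ?V - R0" using 2 rp by auto
     then have "dgr ?V v <= dgr ?V u" using R0(3) that by blast
     then show ?thesis using 2(2) by linarith
    qed
    then have "(\<Sum>u\<in>R0. K) <= (\<Sum>u\<in>R0. real (dgr ?V u))" by (intro sum_mono) auto
    also have "... <= (\<Sum>u\<in>R. real (dgr ?V u))" using rR finR by (intro sum_mono2) auto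
    also have "... = real (\<Sum>v\<in>?V. dgr R v)" by (subst sum_dgr_swap) simp
    finally show ?thesis using R0(2) by (simp add: mult.commute)
   qed
   have "card (T - R) * (\<Sum>v\<in>?V - T. dgr R v) <= card (?V - T) * (\<Sum>v\<in>T - R. dgr R v)"
    using R(3) finT by (intro top_cross) auto
   also have "... <= card (?V - T) * ?s" using sTR by simp
   finally have "card (T - R) * (\<Sum>v\<in>?V - T. dgr R v) + card (T - R) * ?s <= card (?V - T) * ?s + M * ?s"
    using cTR(2) by (intro add_mono mult_le_mono1)
   also have "card (?V - T) * ?s + M * ?s = n * ?s"
    using TV R(2) finT card_mono[OF _ TV] by (simp add: card_Diff_subset flip: add_mult_distrib)
   finally have "card (T - R) * ((\<Sum>v\<in>?V - T. dgr R v) + ?s) <= n * ?s" by (simp add: algebra_simps)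
   then have "card (T - R) * (\<Sum>v\<in>?V. dgr R v) <= n * ?s" using sum.subset_diff[OF TV, of "dgr R"] by simp
   also have "... <= n * wS T" using sT by simp
   finally have "real (card (T - R)) * real (\<Sum>v\<in>?V. dgr R v) <= real n * real (wS T)" by (metis of_nat_le_iff of_nat_mult)
   moreover have "real M / 4 * (K * (real M / 8)) <= real (card (T - R)) * real (\<Sum>v\<in>?V. dgr R v)"
   proof (intro mult_mono)
    show "real M / 4 <= real (card (T - R))" using cTR(1) by linarith
    have "real M / 8 <= real a" using a8 by linarith
    then have "K * (real M / 8) <= K * real a" using K by (intro mult_left_mono) auto
    then show "K * (real M / 8) <= real (\<Sum>v\<in>?V. dgr R v)" using tot by linarith
   qed (use K in auto)
   moreover have "32 * (real n * real (wS T)) <= 8 * real c * (real n * real (wS T))"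
    using c by (intro mult_right_mono) auto
   ultimately show ?thesis using MM by (simp add: algebra_simps)
  next
   case 3
   have finS: "finite S" using S by simp
   have "wS (S - R) <= wS (S - Rp)" using Rp(1) finS by (intro wS_mono) auto
   then have g: "wS S <= 4 * (\<Sum>v\<in>S. dgr R v)" using wS_split[OF finS finR] 3 by linarith
   have "card (T - R) * (\<Sum>v\<in>S - T. dgr R v) <= card (S - T) * (\<Sum>v\<in>T - R. dgr R v)"
    using R(3) finT finS S by (intro top_cross) auto
   also have "... <= M * ?s"
    using sTR card_mono[of S "S - T"] finS S(2) by (intro mult_le_mono) auto
   finally have "M * (\<Sum>v\<in>S - T. dgr R v) <= M * (4 * ?s)"
    using mult_le_mono1[OF cTR(1), of "\<Sum>v\<in>S - T. dgr R v"] by linarith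
   then have "(\<Sum>v\<in>S - T. dgr R v) <= 4 * ?s" using a(2) by simp
   moreover have "(\<Sum>v\<in>S \<inter> T. dgr R v) <= ?s" using finT by (intro sum_mono2) auto
   moreover have "(\<Sum>v\<in>S. dgr R v) = (\<Sum>v\<in>S \<inter> T. dgr R v) + (\<Sum>v\<in>S - T. dgr R v)"
    by (rule sum.Int_Diff[OF finS])
   ultimately have "wS S <= 20 * wS T" using g sT by linarith
   then have "real n * real (wS S) <= real n * (20 * real (wS T))"
    by (intro mult_left_mono) (metis of_nat_le_iff of_nat_mult of_nat_numeral, simp)
   moreover have "20 * (real n * real (wS T)) <= 8 * real c * (real n * real (wS T))"
    using c by (intro mult_right_mono) auto
   ultimately show ?thesis using MM K(3) by (simp add: algebra_simps)
  qed
 qed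
 show "K * real (a' * (a' - 1)) <= 8 * real c * real n * real (wS T')"
 proof (cases "a' <= 1")
  case True
  then have z: "a' * (a' - 1) = 0" by auto
  show ?thesis unfolding z by simp
 next
  case False
  have "a' <= card T" using T' card_mono[OF finT T'(1)] by simp
  then have pos: "0 < real (card T * (card T - 1))" using False by simp
  have "K * real (a' * (a' - 1)) * real (card T * (card T - 1)) <= 8 * real c * real n * real (wS T) * real (a' * (a' - 1))"
   using mult_right_mono[OF main, of "real (a' * (a' - 1))"] by (simp add: mult_ac)
  also have "... = 8 * real c * real n * real (wS T * (a' * (a' - 1)))" by simp
  also have "... <= 8 * real c * real n * real (wS T' * (card T * (card T - 1)))"
   using T'(2,3) by (intro mult_left_mono) (auto simp: dens_ge_def simp flip: of_nat_mult)
  finally have "K * real (a' * (a' - 1)) * real (card T * (card T - 1))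
    <= 8 * real c * real n * real (wS T') * real (card T * (card T - 1))" by simp
  then show ?thesis using pos by (simp only: mult_le_cancel_right_pos)
 qed
qed

subsection \<open>Vectors realised by digits\<close>

lemma horner_cong:
 assumes "\<And>t. t < D ==> pos t = pos' t" "\<And>j t. j < E ==> t < D ==> dig j t = dig' j t"
 shows "horner pos dig D E = horner pos' dig' D E"
 using assms(2)
proof (induction E)
 case (Suc E)
 have "(\<Sum>t<D. if pos t = v then dig E t else 0) = (\<Sum>t<D. if pos' t = v then dig' E t else 0)" for v
  using Suc.prems[of E] assms(1) by (intro sum.cong) auto
 then show ?case using Suc by (auto simp: fun_eq_iff)
qed (auto simp: fun_eq_iff)

text \<open>After \<open>j\<close> rounds the accumulator holds the number without its last
  \<open>E - j\<close> digits; this is the invariant of the inner induction.\<close>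

lemma horner_digits:
 assumes ts: "distinct ts" "length ts <= D" and X: "\<And>v. v \<in> set ts ==> X v < (n + m) ^ E" "\<And>v. v ~: set ts ==> X v = 0"
 defines "pos \<equiv> %t. if t < length ts then ts ! t else 0"
  and "dig \<equiv> %j t. if t < length ts then X (ts ! t) div (n + m) ^ (E - 1 - j) mod (n + m) else 0"
 shows "horner pos dig D E v = X v"
proof -
 have dsum: "(\<Sum>t<D. if pos t = v then dig j t else 0) = X v div (n + m) ^ (E - 1 - j) mod (n + m)" for j
 proof -
  have "(\<Sum>t<D. if pos t = v then dig j t else 0)
    = (\<Sum>t<length ts. if ts ! t = v then X (ts ! t) div (n + m) ^ (E - 1 - j) mod (n + m) else 0)"
   using ts(2) by (intro sum.mono_neutral_cong_right) (auto simp: pos_def dig_def)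
  also have "... = (\<Sum>u\<in>set ts. if u = v then X u div (n + m) ^ (E - 1 - j) mod (n + m) else 0)"
   using bij_betw_nth[OF ts(1), of "{..<length ts}" "set ts"]
   by (intro sum.reindex_bij_betw[of "%t. ts ! t" "{..<length ts}" "set ts" "%u. if u = v then X u div (n + m) ^ (E - 1 - j) mod (n + m) else 0"]) auto
  also have "... = X v div (n + m) ^ (E - 1 - j) mod (n + m)" using X(2)[of v] by auto
  finally show ?thesis .
 qed
 have "horner pos dig D j v = X v div (n + m) ^ (E - j)" if "j <= E" for j
  using that
 proof (induction j)
  case 0
  then show ?case using X[of v] by (cases "v \<in> set ts") auto
 next
  case (Suc j)
  define w where "w = X v div (n + m) ^ (E - 1 - j)"
  have "E - j = Suc (E - 1 - j)" using Suc.prems by simp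
  then have "X v div (n + m) ^ (E - j) = w div (n + m)" by (simp only: w_def power_Suc2 div_mult2_eq)
  then have "horner pos dig D (Suc j) v = (n + m) * (w div (n + m)) + w mod (n + m)"
   using Suc dsum[of j] by (simp add: w_def)
  also have "... = w" by simp
  finally show ?case by (simp add: w_def)
 qed
 from this[of E] show ?thesis by simp
qed

definition bsize :: "nat => nat => nat" where
 "bsize D E = 3 + D + 2 * (E * D)"

text \<open>What one block of digits can describe, up to a positive factor. The factor is harmless
  because only the order of the entries enters \<open>upper\<close>.\<close>

definition realised :: "nat => nat => nat set => nat => (nat => real) set" where
 "realised D E R d = {y. \<exists>dg c. (\<forall>x. dg x < n + m) & 0 < c &
   (\<forall>i. y i = c * (real (vecd D E R d dg 0 0 i) - real (vecd D E R d dg 1 0 i)))}"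

lemma digits_exist:
 assumes T: "T \<subseteq> {..<n}" "card T <= D" and kw: "k < n + m" "w < n + m"
  and X: "\<And>\<sigma> v. \<sigma> < 2 ==> X \<sigma> v < (n + m) ^ E" "\<And>\<sigma> v. v ~: T ==> X \<sigma> v = 0"
 obtains dg where "\<And>x. dg x < n + m"
  "\<And>\<sigma>. \<sigma> < 2 ==> vecd D E R d dg \<sigma> 0 = (stepv R 0 ^^ w) ((stepv R d ^^ k) (X \<sigma>))"
proof -
 have N: "0 < n + m" using r_le by simp
 obtain ts where ts: "distinct ts" "set ts = T" using finite_distinct_list finite_V[OF T(1)] by blast
 then have len: "length ts <= D" using T distinct_card by fastforce
 define pos where "pos = (%t. if t < length ts then ts ! t else 0)"
 define dig where "dig = (%\<sigma> j t. if t < length ts then X \<sigma> (ts ! t) div (n + m) ^ (E - 1 - j) mod (n + m) else 0)"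
 define dg where "dg x = (if x = 0 then k else if x = 1 then w else if x = 2 then 0 else if x < 3 + D then pos (x - 3)
  else let y = x - (3 + D) in if y < E * D then dig 0 (y div D) (y mod D) else dig 1 ((y - E * D) div D) ((y - E * D) mod D))" for x
 have pos: "pos t < n + m" for t
 proof (cases "t < length ts")
  case True
  then have "ts ! t \<in> {..<n}" using nth_mem ts(2) T(1) by blast
  then show ?thesis using True by (simp add: pos_def)
 qed (use N in \<open>simp add: pos_def\<close>)
 have dig: "dig \<sigma> j t < n + m" for \<sigma> j t using N by (auto simp: dig_def)
 have "dg x < n + m" for x using kw N pos dig by (auto simp: dg_def Let_def)
 moreover have "vecd D E R d dg \<sigma> 0 = (stepv R 0 ^^ w) ((stepv R d ^^ k) (X \<sigma>))" if s: "\<sigma> < 2" for \<sigma>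
 proof -
  have "horner (%t. dg (3 + t)) (%j t. dg (3 + D + \<sigma> * (E * D) + (j * D + t))) D E = horner pos (dig \<sigma>) D E"
  proof (rule horner_cong)
   show "dg (3 + t) = pos t" if "t < D" for t using that by (simp add: dg_def)
   show "dg (3 + D + \<sigma> * (E * D) + (j * D + t)) = dig \<sigma> j t" if jt: "j < E" "t < D" for j t
   proof -
    have "j * D + t < Suc j * D" using jt by simp
    also have "... <= E * D" using jt by (intro mult_le_mono1) simp
    finally have "j * D + t < E * D" .
    moreover have "\<sigma> = 0 \<or> \<sigma> = 1" using s by auto
    ultimately show ?thesis using jt by (auto simp: dg_def Let_def)
   qed
  qed
  also have "... = X \<sigma>"
   unfolding pos_def dig_def using horner_digits[OF ts(1) len, of "X \<sigma>" E] X s ts(2) by (auto simp: fun_eq_iff)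
  finally show ?thesis by (simp add: vecd_def blk_def dg_def)
 qed
 ultimately show thesis by (rule that)
qed

end

text \<open>The situation in which the linear algebra applies: outside \<open>R\<close> all degrees
  are at most \<open>d\<close>, so the pair weights over \<open>d\<close> are substochastic
  there.\<close>

locale sparse_part = input +
 fixes R :: "nat set" and d :: nat
 assumes R: "R \<subseteq> {..<n}" and d: "0 < d" and dgr_le: "\<And>v. v \<in> {..<n} - R ==> dgr {..<n} v <= d"
begin

definition U :: "nat set" where "U = {..<n} - R"

definition A :: "nat => nat => real" where "A u v = real (wt u v) / real d"

sublocale W: substochastic U A
proof
 show "finite U" by (simp add: U_def)
 show "0 <= A i j" for i j by (simp add: A_def)
 show "A i j = A j i" for i j by (simp add: A_def wt_sym)
 fix i assume i: "i \<in> U"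
 have "(\<Sum>v\<in>U. wt i v) <= dgr {..<n} i" unfolding dgr_def by (intro sum_mono2) (auto simp: U_def)
 also have "... <= d" using dgr_le i by (simp add: U_def)
 finally have "(\<Sum>v\<in>U. wt i v) <= d" .
 then show "(\<Sum>j\<in>U. A i j) <= 1"
  using d by (simp add: A_def flip: sum_divide_distrib of_nat_sum)
qed

lemma Wy_ap:
 assumes "\<And>i. i \<in> R ==> y i = 0" and i: "i \<in> U"
 shows "real (Wy y i) = real d * W.ap (%i. real (y i)) i"
proof -
 have "Wy y i = (\<Sum>v\<in>U. wt i v * y v)"
  unfolding Wy_def using assms by (intro sum.mono_neutral_right) (auto simp: U_def)
 then have "real (Wy y i) = (\<Sum>v\<in>U. real (wt i v) * real (y v))" by simp
 also have "... = (\<Sum>v\<in>U. real d * (A i v * real (y v)))" using d by (intro sum.cong) (auto simp: A_def)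
 also have "... = real d * W.ap (%i. real (y i)) i" using i by (simp add: W.ap_def sum_distrib_left)
 finally show ?thesis .
qed

lemma stepv_B_pow:
 assumes x: "\<And>i. i \<in> R ==> x i = 0"
 shows "(i \<in> R --> (stepv R d ^^ k) x i = 0) & (i \<in> U --> real ((stepv R d ^^ k) x i) = real d ^ k * (W.B ^^ k) (%i. real (x i)) i)"
proof (induction k arbitrary: i)
 case (Suc k)
 let ?y = "(stepv R d ^^ k) x"
 have "real (stepv R d ?y i) = real d ^ Suc k * (W.B ^^ Suc k) (%i. real (x i)) i" if i: "i \<in> U"
 proof -
  have "real (stepv R d ?y i) = real d * W.ap (%i. real (?y i)) i + real d * real (?y i)"
   using Wy_ap[OF _ i, of ?y] Suc.IH i by (simp add: stepv_def U_def)
  also have "W.ap (%i. real (?y i)) = W.ap (%i. real d ^ k * (W.B ^^ k) (%i. real (x i)) i)"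
   using Suc.IH by (intro W.ap_cong) auto
  also have "W.ap (%i. real d ^ k * (W.B ^^ k) (%i. real (x i)) i) i = real d ^ k * W.ap ((W.B ^^ k) (%i. real (x i))) i"
   by (simp add: W.ap_def sum_distrib_left mult_ac)
  finally show ?thesis using Suc.IH[of i] i unfolding W.B_pow_Suc by (simp add: algebra_simps)
 qed
 moreover have "stepv R d ?y i = 0" if "i \<in> R" using that by (simp add: stepv_def)
 ultimately show ?case by simp
qed (use x in simp)

text \<open>Positive and negative part of \<open>\<sigma> * x\<close> are rounded down to integers
  and written with \<open>E\<close> digits. This changes the entries of \<open>x\<close> by at most
  \<open>1 / \<sigma>\<close>, and \<open>k\<close> applications of \<open>B\<close> magnify the
  error by at most \<open>2 ^ k\<close>.\<close>

lemma realised_approximable: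
 fixes \<sigma> :: real and b :: real
 assumes k: "k < n + m" and \<sigma>: "0 < \<sigma>" "2 ^ k / \<sigma> <= \<epsilon>" and b: "\<sigma> * b < real (n + m) ^ E"
 shows "W.approximable (realised D E R d) k D b \<epsilon>"
 unfolding W.approximable_def
proof (intro allI impI)
 fix x :: "nat => real" and T assume T: "T \<subseteq> U" "card T <= D" and x: "\<forall>i. i ~: T --> x i = 0" "\<forall>i. \<bar>x i\<bar> <= b"
 define X where "X s i = nat \<lfloor>\<sigma> * (if s = 0 then max (x i) 0 else max (- x i) 0)\<rfloor>" for s i :: nat
 let ?x = "%i. (real (X 0 i) - real (X 1 i)) / \<sigma>"
 have Xlt: "X s i < (n + m) ^ E" for s i
 proof -
  have "\<sigma> * (if s = 0 then max (x i) 0 else max (- x i) 0) <= \<sigma> * b"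
   using x(2)[rule_format, of i] \<sigma> by (intro mult_left_mono) auto
  then have "real (X s i) <= \<sigma> * b" unfolding X_def using \<sigma>
   by (smt (verit) mult_nonneg_nonneg of_nat_nat of_int_floor_le zero_le_floor max.cobounded2)
  then have "real (X s i) < real ((n + m) ^ E)" using b by simp
  then show ?thesis by (simp only: of_nat_less_iff)
 qed
 have X0: "X s i = 0" if "i ~: T" for s i using x(1) that by (simp add: X_def)
 have err: "\<bar>?x i - x i\<bar> <= 1 / \<sigma>" for i
 proof -
  have "\<bar>real (X 0 i) - real (X 1 i) - \<sigma> * x i\<bar> <= 1"
  proof (cases "0 <= x i")
   case True
   then have "0 <= \<lfloor>\<sigma> * x i\<rfloor>" using \<sigma> by simp
   then have "real (X 0 i) = of_int \<lfloor>\<sigma> * x i\<rfloor>" "X 1 i = 0" using True by (simp_all add: X_def max_def)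
   then show ?thesis using of_int_floor_le[of "\<sigma> * x i"] real_of_int_floor_add_one_ge[of "\<sigma> * x i"]
    unfolding abs_le_iff by linarith
  next
   case False
   then have "0 <= \<sigma> * - x i" using \<sigma> by (intro mult_nonneg_nonneg) auto
   then have "0 <= \<lfloor>\<sigma> * - x i\<rfloor>" by (simp only: zero_le_floor)
   then have "real (X 1 i) = of_int \<lfloor>\<sigma> * - x i\<rfloor>" "X 0 i = 0" using False by (simp_all add: X_def max_def)
   then show ?thesis using of_int_floor_le[of "\<sigma> * - x i"] real_of_int_floor_add_one_ge[of "\<sigma> * - x i"]
    unfolding abs_le_iff mult_minus_right by linarith
  qed
  moreover have "?x i - x i = (real (X 0 i) - real (X 1 i) - \<sigma> * x i) / \<sigma>" using \<sigma> by (simp add: field_simps)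
  ultimately show ?thesis using \<sigma> by (simp add: divide_right_mono)
 qed
 have Bdiff: "(W.B ^^ k) ?x i - (W.B ^^ k) x i = (W.B ^^ k) (%i. ?x i - x i) i" for i
  using W.B_pow_add[of k ?x "-1" x] by simp
 have e1: "\<bar>(W.B ^^ k) ?x i - (W.B ^^ k) x i\<bar> <= \<epsilon>" if "i \<in> U" for i
  unfolding Bdiff using W.B_pow_sup_le[of "%i. ?x i - x i" "1 / \<sigma>" i k] err that \<sigma>(2) by simp
 have e2: "\<bar>W.ap ((W.B ^^ k) ?x) i - W.ap ((W.B ^^ k) x) i\<bar> <= \<epsilon>" if "i \<in> U" for i
 proof -
  have "W.ap ((W.B ^^ k) ?x) i - W.ap ((W.B ^^ k) x) i = W.ap (%i. (W.B ^^ k) ?x i - (W.B ^^ k) x i) i"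
   using that by (simp add: W.ap_def right_diff_distrib sum_subtractf)
  then show ?thesis using W.B_sup_le[OF e1 that] by simp
 qed
 have TV: "T \<subseteq> {..<n}" using T by (auto simp: U_def)
 have XR: "X s i = 0" if "i \<in> R" for s i using X0 that T(1) by (auto simp: U_def)
 have Bx: "real ((stepv R d ^^ k) (X 0) i) - real ((stepv R d ^^ k) (X 1) i) = real d ^ k * (\<sigma> * (W.B ^^ k) ?x i)" if "i \<in> U" for i
 proof -
  have "(W.B ^^ k) (%i. real (X 0 i) + (-1) * real (X 1 i)) i = (W.B ^^ k) (%i. \<sigma> * ?x i) i"
   using \<sigma> by (intro W.B_pow_cong that) simp
  then have "(W.B ^^ k) (%i. real (X 0 i)) i - (W.B ^^ k) (%i. real (X 1 i)) i = \<sigma> * (W.B ^^ k) ?x i"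
   unfolding W.B_pow_add W.B_pow_scale by simp
  then show ?thesis using stepv_B_pow[of "X 0" i k] stepv_B_pow[of "X 1" i k] XR that
   by (simp flip: right_diff_distrib)
 qed
 have n0: "0 < n + m" "1 < n + m" using r_le r_ge by auto
 have R1: "\<exists>y\<in>realised D E R d. \<forall>i\<in>U. y i = (W.B ^^ k) ?x i"
 proof -
  obtain dg where dg: "\<And>x. dg x < n + m" "\<And>s. s < 2 ==> vecd D E R d dg s 0 = (stepv R 0 ^^ 0) ((stepv R d ^^ k) (X s))"
   using digits_exist[OF TV T(2) k n0(1), of X E R d] Xlt X0 by blast
  define y where "y i = 1 / (real d ^ k * \<sigma>) * (real (vecd D E R d dg 0 0 i) - real (vecd D E R d dg 1 0 i))" for i
  have "y \<in> realised D E R d" unfolding realised_def using dg(1) d \<sigma> y_def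
   by (intro CollectI exI[of _ dg] exI[of _ "1 / (real d ^ k * \<sigma>)"]) auto
  moreover have "y i = (W.B ^^ k) ?x i" if "i \<in> U" for i
   using Bx[OF that] dg(2)[of 0] dg(2)[of 1] d \<sigma> by (simp add: y_def)
  ultimately show ?thesis by blast
 qed
 \<comment> \<open>The image under \<open>ap\<close> takes one further step with 0 in place of
   \<open>d\<close>, which is what the second digit of a block is for.\<close>
 have R2: "\<exists>y\<in>realised D E R d. \<forall>i\<in>U. y i = W.ap ((W.B ^^ k) ?x) i"
 proof -
  obtain dg where dg: "\<And>x. dg x < n + m" "\<And>s. s < 2 ==> vecd D E R d dg s 0 = (stepv R 0 ^^ 1) ((stepv R d ^^ k) (X s))"
   using digits_exist[OF TV T(2) k n0(2), of X E R d] Xlt X0 by blast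
  define y where "y i = 1 / (real d ^ Suc k * \<sigma>) * (real (vecd D E R d dg 0 0 i) - real (vecd D E R d dg 1 0 i))" for i
  have "y \<in> realised D E R d" unfolding realised_def using dg(1) d \<sigma> y_def
   by (intro CollectI exI[of _ dg] exI[of _ "1 / (real d ^ Suc k * \<sigma>)"]) auto
  moreover have "y i = W.ap ((W.B ^^ k) ?x) i" if i: "i \<in> U" for i
  proof -
   let ?v = "%s. (stepv R d ^^ k) (X s)"
   have v: "real (vecd D E R d dg s 0 i) = real d * W.ap (%i. real (?v s i)) i" if "s < 2" for s
    using Wy_ap[OF _ i, of "?v s"] stepv_B_pow[of "X s" _ k] XR dg(2)[OF that] i by (simp add: stepv_def U_def)
   have "W.ap (%i. real (?v 0 i)) i - W.ap (%i. real (?v 1 i)) i = W.ap (%i. real (?v 0 i) - real (?v 1 i)) i"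
    using i by (simp add: W.ap_def right_diff_distrib sum_subtractf)
   also have "W.ap (%i. real (?v 0 i) - real (?v 1 i)) = W.ap (%i. real d ^ k * (\<sigma> * (W.B ^^ k) ?x i))"
    by (rule W.ap_cong) (rule Bx)
   also have "... i = real d ^ k * \<sigma> * W.ap ((W.B ^^ k) ?x) i"
    by (simp add: W.ap_def sum_distrib_left mult_ac)
   finally have "real (vecd D E R d dg 0 0 i) - real (vecd D E R d dg 1 0 i) = real d * (real d ^ k * \<sigma> * W.ap ((W.B ^^ k) ?x) i)"
    using v[of 0] v[of 1] by (simp flip: right_diff_distrib)
   then show ?thesis using d \<sigma> by (simp add: y_def)
  qed
  ultimately show ?thesis by blast
 qed
 show "(\<exists>y\<in>realised D E R d. \<forall>i\<in>U. \<bar>y i - (W.B ^^ k) x i\<bar> <= \<epsilon>) & (\<exists>y\<in>realised D E R d. \<forall>i\<in>U. \<bar>y i - W.ap ((W.B ^^ k) x) i\<bar> <= \<epsilon>)"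
  using R1 R2 e1 e2 by (metis (no_types, lifting))
qed

lemma vecd_block:
 assumes "\<And>x. x < bsize D E ==> dg (blk D E b + x) = dg' x" "\<sigma> < 2"
 shows "vecd D E R d dg \<sigma> b = vecd D E R d dg' \<sigma> 0"
proof -
 have b0: "blk D E 0 = 0" by (simp add: blk_def)
 have "horner (%t. dg (blk D E b + 3 + t)) (%j t. dg (blk D E b + 3 + D + \<sigma> * (E * D) + (j * D + t))) D E
   = horner (%t. dg' (3 + t)) (%j t. dg' (3 + D + \<sigma> * (E * D) + (j * D + t))) D E"
 proof (rule horner_cong)
  show "dg (blk D E b + 3 + t) = dg' (3 + t)" if "t < D" for t
   using assms(1)[of "3 + t"] that by (simp add: bsize_def add.assoc)
  show "dg (blk D E b + 3 + D + \<sigma> * (E * D) + (j * D + t)) = dg' (3 + D + \<sigma> * (E * D) + (j * D + t))" if jt: "j < E" "t < D" for j t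
  proof -
   have "j * D + t < Suc j * D" using jt by simp
   also have "... <= E * D" using jt by (intro mult_le_mono1) simp
   finally have "j * D + t < E * D" .
   moreover have "\<sigma> * (E * D) <= 1 * (E * D)" using assms(2) by (intro mult_le_mono1) simp
   ultimately have "\<sigma> * (E * D) + (j * D + t) < 2 * (E * D)" by linarith
   then show ?thesis using assms(1)[of "3 + D + \<sigma> * (E * D) + (j * D + t)"] by (simp add: bsize_def add.assoc)
  qed
 qed
 then show ?thesis using assms(1)[of 0] assms(1)[of 1] by (simp add: vecd_def b0 bsize_def)
qed

text \<open>A nonempty up-set is cut out by comparison with its least element, so its threshold can
  be named by a vertex. The blocks of the \<open>ms\<close> threshold sets are concatenated, and the
  table \<open>\<phi>\<close> reads the value of \<open>P\<close> off any vertex of each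
  type.\<close>

lemma candidate_trial:
 assumes cand: "W.dense_candidate (realised D E R d) ms q (real M / real n) (real n)" and q: "0 < q"
  and Ra: "card R < 2 * a" "U ~= {}"
 obtains \<delta> \<phi> where "\<And>x. x < ms * bsize D E ==> \<delta> x < n + m" "\<And>x. x \<ge> ms * bsize D E ==> \<delta> x = 0"
  "length \<phi> = 2 ^ ms" "\<forall>x\<in>set \<phi>. x <= q" "trial 30000 d M a q D E ms \<phi> (R, Z, 0) \<delta>"
proof -
 obtain Xs P where Xs: "\<And>b. b < ms ==> \<exists>y\<in>realised D E R d. W.upper y (Xs b)"
  and P: "\<And>i. P i <= q" "\<And>i. i ~: U ==> P i = 0"
  and resp: "\<And>i k. i \<in> U ==> k \<in> U ==> (\<forall>b<ms. i \<in> Xs b \<longleftrightarrow> k \<in> Xs b) ==> P i = P k"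
  and big: "W.ip (%i. real (P i) / real q) (W.ap (%i. real (P i) / real q))
    > 1 / 30000 * (real M / real n * (\<Sum>i\<in>U. real (P i) / real q) + (\<Sum>i\<in>U. real (P i) / real q)\<^sup>2 / real n)"
  using cand unfolding W.dense_candidate_def by blast
 have n0: "0 < n" "0 < n + m" using r_le by auto
 \<comment> \<open>An empty up-set has no least element; its block may be arbitrary, since this can
   only make the types finer.\<close>
 have "\<exists>dg h. (\<forall>x. dg x < n + m) & h \<in> U & (Xs b ~= {} -->
   (\<forall>i\<in>U. i \<in> Xs b \<longleftrightarrow> real (vecd D E R d dg 0 0 h) - real (vecd D E R d dg 1 0 h) <= real (vecd D E R d dg 0 0 i) - real (vecd D E R d dg 1 0 i)))"
  if b: "b < ms" for b
 proof -
  obtain y where y: "y \<in> realised D E R d" "W.upper y (Xs b)" using Xs[OF b] by blast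
  then obtain dg c where dg: "\<forall>x. dg x < n + m" "0 < c"
   "\<And>i. y i = c * (real (vecd D E R d dg 0 0 i) - real (vecd D E R d dg 1 0 i))" unfolding realised_def by blast
  have XU: "Xs b \<subseteq> U" using y(2) by (simp add: W.upper_def)
  show ?thesis
  proof (cases "Xs b = {}")
   case True
   then show ?thesis using dg(1) Ra(2) by blast
  next
   case False
   have "finite (Xs b)" using XU W.finU by (rule finite_subset)
   then obtain h where h: "h \<in> Xs b" "\<And>i. i \<in> Xs b ==> y h <= y i"
    using False by (metis arg_min_if_finite(1) arg_min_least)
   have "i \<in> Xs b \<longleftrightarrow> y h <= y i" if "i \<in> U" for i using h y(2) that unfolding W.upper_def by blast
   moreover have "h \<in> U" using h XU by blast
   ultimately show ?thesis using dg unfolding dg(3) by (intro exI[of _ dg] exI[of _ h]) (auto simp: mult_le_cancel_left_pos)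
  qed
 qed
 then obtain dgs h where dgs: "\<And>b x. b < ms ==> dgs b x < n + m" and h: "\<And>b. b < ms ==> h b \<in> U"
  and cuts: "\<And>b i. b < ms ==> Xs b ~= {} ==> i \<in> U ==> i \<in> Xs b \<longleftrightarrow>
   real (vecd D E R d (dgs b) 0 0 (h b)) - real (vecd D E R d (dgs b) 1 0 (h b)) <= real (vecd D E R d (dgs b) 0 0 i) - real (vecd D E R d (dgs b) 1 0 i)"
  by metis
 define bs where "bs = bsize D E"
 have bs: "3 <= bs" by (simp add: bs_def bsize_def)
 define \<delta> where "\<delta> x = (if x < ms * bs then if x mod bs = 2 then h (x div bs) else dgs (x div bs) (x mod bs) else 0)" for x
 have blk: "blk D E b = b * bs" for b by (simp add: blk_def bs_def bsize_def)
 have hlt: "h b < n" if "b < ms" for b using h[OF that] by (simp add: U_def)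
 have dlt: "\<delta> x < n + m" for x
 proof (cases "x < ms * bs")
  case True
  then have "x div bs < ms" by (simp add: less_mult_imp_div_less)
  then show ?thesis using dgs hlt[of "x div bs"] by (auto simp: \<delta>_def)
 qed (use n0 in \<open>simp add: \<delta>_def\<close>)
 have dblk: "\<delta> (b * bs + x) = (if x = 2 then h b else dgs b x)" if "b < ms" "x < bs" for b x
 proof -
  have "b * bs + x < Suc b * bs" using that by simp
  also have "... <= ms * bs" using that by (intro mult_le_mono1) simp
  finally have lt: "b * bs + x < ms * bs" .
  have dm: "(b * bs + x) div bs = b" "(b * bs + x) mod bs = x" using that by simp_all
  show ?thesis unfolding \<delta>_def dm using lt by simp
 qed
 have vd: "vecd D E R d \<delta> \<sigma> b = vecd D E R d (dgs b) \<sigma> 0" if b: "b < ms" "\<sigma> < 2" for b \<sigma>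
 proof -
  have "vecd D E R d \<delta> \<sigma> b = vecd D E R d (%x. if x = 2 then h b else dgs b x) \<sigma> 0"
   using dblk[OF b(1)] b(2) by (intro vecd_block) (simp_all add: blk bs_def)
  also have "... = vecd D E R d (dgs b) \<sigma> 0" by (simp add: vecd_def blk_def)
  finally show ?thesis .
 qed
 have h2: "\<delta> (blk D E b + 2) = h b" if "b < ms" for b using dblk[OF that, of 2] bs by (simp add: blk)
 have cut: "cut D E R d \<delta> b i \<longleftrightarrow> i \<in> Xs b" if "b < ms" "Xs b ~= {}" "i \<in> U" for b i
  unfolding cut_def Let_def h2[OF that(1)] cuts[OF that] using vd[OF that(1)] by (simp, linarith)
 let ?ty = "vtype D E ms R d \<delta>"
 have tyP: "P i = P k" if ik: "i \<in> U" "k \<in> U" "?ty i = ?ty k" for i k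
 proof (rule resp[OF ik(1,2)], intro allI impI)
  fix b assume b: "b < ms"
  have "cut D E R d \<delta> b i \<longleftrightarrow> cut D E R d \<delta> b k" using bits_inj[OF ik(3)[unfolded vtype_def] b] .
  then show "i \<in> Xs b \<longleftrightarrow> k \<in> Xs b" using cut[OF b] ik by (cases "Xs b = {}") auto
 qed
 define \<phi> where "\<phi> = map (%\<tau>. if \<exists>i\<in>U. ?ty i = \<tau> then P (SOME i. i \<in> U & ?ty i = \<tau>) else 0) [0..<2 ^ ms]"
 have phi: "\<phi> ! ?ty i = P i" if i: "i \<in> U" for i
 proof -
  have "(SOME k. k \<in> U & ?ty k = ?ty i) \<in> U & ?ty (SOME k. k \<in> U & ?ty k = ?ty i) = ?ty i"
   by (rule someI[of "%k. k \<in> U & ?ty k = ?ty i" i]) (use i in simp)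
  then have "P (SOME k. k \<in> U & ?ty k = ?ty i) = P i" using tyP i by blast
  then show ?thesis using i vtype_less by (auto simp: \<phi>_def)
 qed
 have qle: "\<forall>x\<in>set \<phi>. x <= q" using P(1) by (auto simp: \<phi>_def)
 have "gain 30000 d M q (%i. if i \<in> R then 0 else \<phi> ! ?ty i) = gain 30000 d M q P"
  using phi P(2) by (intro gain_cong) (auto simp: U_def)
 also have "0 < gain 30000 d M q P"
 proof -
  have Usum: "(\<Sum>i\<in>U. f i) = (\<Sum>i<n. f i)" if "\<And>i. i \<in> R ==> f i = (0::real)" for f
   using that by (intro sum.mono_neutral_left) (auto simp: U_def)
  have PR: "P i = 0" if "i \<in> R" for i using P(2) that by (simp add: U_def)
  define s where "s = (\<Sum>i<n. real (P i))"
  have s: "(\<Sum>i\<in>U. real (P i) / real q) = s / real q"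
   using Usum[of "%i. real (P i)"] PR by (simp add: s_def flip: sum_divide_distrib)
  have "W.ip (%i. real (P i) / real q) (W.ap (%i. real (P i) / real q))
    = (\<Sum>i\<in>U. \<Sum>k\<in>U. real (wt i k) * (real (P i) * real (P k)) / (real d * (real q)\<^sup>2))"
   unfolding W.ip_def W.ap_def sum_distrib_left
   by (intro sum.cong refl) (simp add: A_def power2_eq_square sum_distrib_left field_simps)
  also have "... = (\<Sum>i\<in>U. \<Sum>k<n. real (wt i k) * (real (P i) * real (P k)) / (real d * (real q)\<^sup>2))"
   using PR by (intro sum.cong refl Usum) simp
  also have "... = (\<Sum>i<n. \<Sum>k<n. real (wt i k) * (real (P i) * real (P k)) / (real d * (real q)\<^sup>2))"
   using PR by (intro Usum) simp
  also have "... = real (quad P) / (real d * (real q)\<^sup>2)"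
   by (simp add: quad_def flip: sum_divide_distrib)
  finally have "1 / 30000 * (real M / real n * (s / real q) + (s / real q)\<^sup>2 / real n) < real (quad P) / (real d * (real q)\<^sup>2)"
   using big s by simp
  moreover have "1 / 30000 * (real M / real n * (s / real q) + (s / real q)\<^sup>2 / real n)
    = (real M * real q * s + s\<^sup>2) / (30000 * real n) / (real q)\<^sup>2"
   using n0 q by (simp add: field_simps power2_eq_square)
  ultimately have "(real M * real q * s + s\<^sup>2) / (30000 * real n) / (real q)\<^sup>2 < real (quad P) / real d / (real q)\<^sup>2"
   by (simp only: divide_divide_eq_left)
  then have "(real M * real q * s + s\<^sup>2) / (30000 * real n) < real (quad P) / real d"
   using q by (simp only: divide_less_cancel) auto
  then have "real d * (real M * real q * s + s\<^sup>2) < 30000 * real n * real (quad P)"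
   using n0 d by (simp add: field_simps)
  moreover have "real (pairs P) <= s\<^sup>2"
  proof -
   have "pairs P <= (\<Sum>i<n. \<Sum>k<n. P i * P k)" unfolding pairs_def by (intro sum_mono) auto
   also have "... = (\<Sum>i<n. P i)\<^sup>2" by (simp add: power2_eq_square sum_product)
   finally have "real (pairs P) <= real ((\<Sum>i<n. P i)\<^sup>2)" by (simp only: of_nat_le_iff)
   then show ?thesis by (simp add: s_def)
  qed
  then have "real d * (real M * real q * s + real (pairs P)) <= real d * (real M * real q * s + s\<^sup>2)"
   by (intro mult_left_mono) auto
  ultimately have "real (d * (M * q * (\<Sum>i<n. P i) + pairs P)) < real (30000 * n * quad P)"
   by (simp add: s_def)
  then have "d * (M * q * (\<Sum>i<n. P i) + pairs P) < 30000 * n * quad P" by (simp only: of_nat_less_iff)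
  then show ?thesis unfolding gain_def by (simp only: diff_gt_0_iff_gt of_nat_less_iff)
 qed
 finally have "trial 30000 d M a q D E ms \<phi> (R, Z, 0) \<delta>"
  using Ra hlt h2 less_imp_le[OF dlt] by (simp add: trial_def)
 moreover have "length \<phi> = 2 ^ ms" by (simp add: \<phi>_def)
 moreover have "\<delta> x = 0" if "x \<ge> ms * bsize D E" for x using that by (simp add: \<delta>_def bs_def)
 ultimately show thesis using that[of \<delta> \<phi>] dlt qle by blast
qed

end

context input
begin

subsection \<open>Correctness of the main program\<close>

text \<open>\<open>k / l\<close> represents \<open>\<mu>\<close>. All \<open>d\<close> up to
  \<open>n + m\<close> are tried because the right one depends on the unknown optimum. The size
  \<open>M div (4 * r)\<close> to which \<open>T\<close> is thinned is what keeps the loss in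
  \<open>pf_ratio\<close> bounded.\<close>

definition main_cmd :: "nat => nat => nat => cmd => cmd" where
 "main_cmd k l Q p = sqs [div_cmd 6 l (mulc k (cell 0)), div_cmd 7 4 (cell 6), div_cmd 8 (4 * r) (cell 6),
   For 11 (cell 5) (Sq (St 10 (Lit 0) (Add (cell 11) (Lit 1))) (guess_cmd Q p))]"

lemma den_main:
 fixes Q :: nat and F :: "nat => st => (nat => nat) => bool"
 assumes s: "inp s" "\<And>x. digs s x = 0" "s 9 0 = 0" and M: "k * n = M * l" "0 < l" "0 < M" "M < n"
  and p: "\<And>d. d <= n + m ==> searches c d M (M div 4) p (F d)"
   "\<And>b. b \<in> writes p ==> 12 <= b & b < 100 & b ~= 14 & b ~= 17"
 defines "s' \<equiv> den (main_cmd k l Q p) s"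
 defines "G \<equiv> %d z. \<forall>\<delta>. (\<forall>x<Q. \<delta> x < n + m) & (\<forall>x\<ge>Q. \<delta> x = 0) --> F d z \<delta>"
 shows "best M s'" "d \<in> {1..n + m} ==> \<exists>T'. outcome c d M (M div 4) (M div (4 * r)) (G d) T' & (\<forall>j\<le>r. ext_ok M T' j (s' 9 0))"
proof -
 define a where "a = M div 4"
 define a' where "a' = M div (4 * r)"
 have r0: "0 < r" using r_ge by simp
 define s1 where "s1 = den (div_cmd 6 l (mulc k (cell 0))) s"
 define s2 where "s2 = den (div_cmd 7 4 (cell 6)) s1"
 define s3 where "s3 = den (div_cmd 8 (4 * r) (cell 6)) s2"
 have f1: "s1 b = s b" if "b ~: {30, 6}" for b using that by (simp add: s1_def den_frame)
 have f2: "s2 b = s1 b" if "b ~: {30, 7}" for b using that by (simp add: s2_def den_frame)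
 have f3: "s3 b = s2 b" if "b ~: {30, 8}" for b using that by (simp add: s3_def den_frame)
 have i1: "inp s1" by (rule inp_cong[OF s(1)]; rule f1) auto
 have i2: "inp s2" by (rule inp_cong[OF i1]; rule f2) auto
 have i3: "inp s3" by (rule inp_cong[OF i2]; rule f3) auto
 have "s1 6 0 = (M * l) div l"
  unfolding s1_def
 by (rule den_div[OF s(1)]) (use s(1) M(1) M in \<open>auto simp: inp_def\<close>)
 then have v1: "s1 6 0 = M" using M by simp
 have "M div 4 <= n" "M div (4 * r) <= n" using M(4) div_le_dividend[of M] by (meson less_imp_le order_trans)+
 moreover have "s2 7 0 = a" unfolding s2_def a_def by (rule den_div[OF i1]) (use calculation v1 in auto)
 moreover have "s3 8 0 = a'" unfolding s3_def a'_def by (rule den_div[OF i2]) (use calculation v1 r0 f2[of 6] in auto)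
 ultimately have v: "s3 6 0 = M" "s3 7 0 = a" "s3 8 0 = a'" "s3 9 0 = 0" "\<And>x. digs s3 x = 0"
  using v1 s f1 f2 f3 by auto
 have aa: "a' <= a" "3 * a < M" unfolding a_def a'_def using M(3) r0 by (auto intro!: div_le_mono2)
 let ?b = "Sq (St 10 (Lit 0) (Add (cell 11) (Lit 1))) (guess_cmd Q p)"
 let ?O = "%d b. \<exists>T'. outcome c d M a a' (G d) T' & (\<forall>j\<le>r. ext_ok M T' j b)"
 let ?I = "%j s1. best M s1 & (\<forall>d\<in>{1..j}. ?O d (s1 9 0))"
 have wg: "b \<in> {3, 9} \<or> 12 <= b & b < 100 + Q" if "b \<in> writes (guess_cmd Q p)" for b
  using writes_guess[OF _ that] p(2) by blast
 have "?I (n + m) (den (For 11 (cell 5) ?b) s3)"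
 proof (rule For_rule[where s = s3 and I = ?I and N = "n + m"])
  show "11 ~: writes ?b" using wg[of 11] by auto
  show "n + m = min (eval_expr (cell 5) s3) (s3 5 0)" using i3 by (simp add: inp_def)
  show "?I 0 s3" using v by (simp add: best_def)
  show "?I j (t(11 := x))" if "?I j t" for j t x using that by (simp add: best_def setof_def)
  fix j t assume j: "j < n + m" "?I j t" "t 11 0 = j" and fr: "\<And>b. b ~: insert 11 (writes ?b) ==> t b = s3 b"
  define t1 where "t1 = upd t 10 0 (Suc j)"
  have f: "t b = s3 b" if "b \<in> {0, 1, 2, 5, 6, 7, 8} \<or> b \<ge> 100 + Q" for b
  proof -
   have "b ~: insert 11 (writes ?b)" using wg[of b] that by auto
   then show ?thesis by (rule fr)
  qed
  have f1: "t1 b = s3 b" if "b \<in> {0, 1, 2, 5, 6, 7, 8} \<or> b \<ge> 100 + Q" for b using f[OF that] that by (auto simp: t1_def)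
  have it: "inp t1" by (rule inp_cong[OF i3]; rule f1) auto
  have t: "t1 6 0 = M" "t1 7 0 = a" "t1 8 0 = a'" "t1 10 0 = Suc j"
   using v f1[of 6] f1[of 7] f1[of 8] t1_def by simp_all
  have tx: "digs t1 x = 0" if "Q <= x" for x using f1[of "100 + x"] v(5) that by simp
  have tb: "best M t1" using j(2) by (simp add: best_def setof_def t1_def)
  have sj: "searches c (Suc j) M a p (F (Suc j))" using p(1) j(1) by (simp add: a_def)
  note D = den_guess[where Q = Q, OF it t tx tb sj p(2) aa M(4)]
  have den: "den ?b t = den (guess_cmd Q p) t1" using j(3) by (simp add: t1_def)
  have le: "t 9 0 <= den (guess_cmd Q p) t1 9 0" using D(2) by (simp add: t1_def)
  have O: "?O d (den (guess_cmd Q p) t1 9 0)" if "d \<in> {1..Suc j}" for d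
  proof (cases "d = Suc j")
   case True
   show ?thesis unfolding True G_def by (rule D(3))
  next
   case False
   then have "?O d (t 9 0)" using j(2) that by simp
   then show ?thesis using ext_ok_mono[OF _ le] by blast
  qed
  show "?I (Suc j) (den ?b t)" unfolding den using D(1) O by blast
 qed
 moreover have "s' = den (For 11 (cell 5) ?b) s3"
  unfolding s'_def main_cmd_def by (simp add: s1_def s2_def s3_def del: den.simps(4))
 ultimately show "best M s'" "d \<in> {1..n + m} ==> \<exists>T'. outcome c d M (M div 4) (M div (4 * r)) (G d) T' & (\<forall>j\<le>r. ext_ok M T' j (s' 9 0))"
  by (auto simp: a_def a'_def)
qed

definition phis :: "nat => nat => nat list list" where
 "phis q ms = List.n_lists (2 ^ ms) [0..<Suc q]"

lemma set_phis: "\<phi> \<in> set (phis q ms) \<longleftrightarrow> length \<phi> = 2 ^ ms & (\<forall>x\<in>set \<phi>. x <= q)"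
 unfolding phis_def set_n_lists by (auto simp: less_Suc_eq_le subset_iff)

definition prog_cmd :: "nat => nat => nat => nat => nat => nat => cmd" where
 "prog_cmd k l q D E ms = main_cmd k l (ms * bsize D E) (body_cmd 30000 q D E ms (phis q ms))"

text \<open>The requirements that hold only for large \<open>N\<close>. The power
  \<open>N powr (-3/2)\<close> is \<open>\<epsilon> * sqrt N\<close> for the approximation error
  \<open>\<epsilon> = 1 / N\<^sup>2\<close>.\<close>

definition large_enough :: "real => real => nat => nat => real => bool" where
 "large_enough \<rho> \<gamma> D E N \<longleftrightarrow> N powr (-3/2) <= \<rho> / 2 ^ 10 & N powr (-3/2) <= \<gamma> &
   (\<exists>k\<ge>1. real k < N & N * (1 + \<rho> / 3) ^ k < (1 + \<rho> / 2) ^ k &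
    (1 + \<rho> / 4) ^ k * (real D * 2 ^ D) <= (1 + \<rho> / 3) ^ k & 2 ^ k * N\<^sup>2 * (real D * N * 2 ^ D) < N ^ E)"

text \<open>The right guess is \<open>d\<close> just above \<open>K = L * wS S / M\<close>, which is
  \<open>L\<close> times the average degree inside \<open>S\<close>. If the search failed at some
  \<open>R\<close> with all outer degrees below \<open>K\<close> and at least half the weight of
  \<open>S\<close> left, the weights over \<open>d\<close> would give \<open>S - R\<close> a form of
  at least \<open>\<rho> * M\<close>; then a dense candidate exists, and its digits contradict the
  failure.\<close>

lemma prog_correct:
 assumes s: "inp s" "\<And>x. digs s x = 0" "s 9 0 = 0"
  and M: "k * n = M * l" "0 < l" "real M = exp (- L) * real n"
  and par: "substochastic.good_params L \<rho> h \<gamma> D G ms q"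
  and large: "large_enough \<rho> \<gamma> D E (real n)"
  and big: "16 * r * r <= M" "L * real (r * r) <= real M" "L * real M <= real n" "6 * M <= n"
 defines "s' \<equiv> den (prog_cmd k l q D E ms) s"
 shows "card (setof s' 3) = M"
  and "S \<subseteq> {..<n} ==> card S = M ==> 1 / 10 ^ 9 * exp (- L) ^ (r - 1) * L * real (cnt S) <= real (cnt (setof s' 3))"
proof -
 interpret T: substochastic "{}" "%_ _. 0" by unfold_locales auto
 have par': "substochastic.good_params L \<rho> h \<gamma> D G ms q" by (rule par)
 note P = par[unfolded T.good_params_def]
 have L: "0 < L" and rho: "\<rho> = 1 / (4 * L)" and q: "0 < q" using P by auto
 have r2: "0 < 16 * r * r" "16 * r <= 16 * r * r" using r_ge by auto
 have n0: "0 < n" using r_le by simp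
 have M0: "0 < M" "M < n" using big r2 n0 by linarith+
 define \<mu> where "\<mu> = exp (- L)"
 have mu: "\<mu> = real M / real n" using M n0 by (simp add: \<mu>_def)
 let ?a = "M div 4" and ?a' = "M div (4 * r)"
 let ?b = "body_cmd 30000 q D E ms (phis q ms)"
 let ?F = "%d z dg. \<forall>\<phi>\<in>set (phis q ms). \<not> trial 30000 d M ?a q D E ms \<phi> z dg"
 let ?G = "%d z. \<forall>\<delta>. (\<forall>x<ms * bsize D E. \<delta> x < n + m) & (\<forall>x\<ge>ms * bsize D E. \<delta> x = 0) --> ?F d z \<delta>"
 have "searches 30000 d M ?a ?b (?F d)" if "d <= n + m" for d
  using that q by (intro body_searches) (auto simp: set_phis)
 moreover have "12 <= b & b < 100 & b ~= 14 & b ~= 17" if "b \<in> writes ?b" for b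
  using subsetD[OF writes_body that] by auto
 ultimately have D: "best M s'" "\<And>d. d \<in> {1..n + m} ==> \<exists>T'. outcome 30000 d M ?a ?a' (?G d) T' & (\<forall>j\<le>r. ext_ok M T' j (s' 9 0))"
  unfolding s'_def prog_cmd_def by (intro den_main[where F = ?F, OF s M(1,2) M0]; blast)+
 have "0 < s' 9 0" using D(2)[of 1] n0 by (auto simp: ext_ok_def)
 then have out: "card (setof s' 3) = M" "s' 9 0 - 1 = cnt (setof s' 3)" using D(1) by (auto simp: best_def)
 show "card (setof s' 3) = M" by (rule out)
 assume S: "S \<subseteq> {..<n}" "card S = M"
 define g where "g = wS S"
 have gS: "real r * real r / 2 * real (cnt S) <= real g"
 proof -
  have "real (r * (r - 1) * cnt S) <= real g" using cnt_le_wS[OF S(1)] by (simp only: of_nat_le_iff g_def)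
  moreover have "real r * real r / 2 <= real (r * (r - 1))" using r_ge by (simp add: of_nat_diff) 
  ultimately show ?thesis by (smt (verit) mult_right_mono of_nat_0_le_iff of_nat_mult)
 qed
 show "1 / 10 ^ 9 * exp (- L) ^ (r - 1) * L * real (cnt S) <= real (cnt (setof s' 3))"
 proof (cases "g = 0")
  case True
  then have "cnt S = 0" using gS r_ge by (auto simp: mult_le_0_iff)
  then show ?thesis by simp
 next
  case False
  define K where "K = L * real g / real M"
  have K0: "0 < K" using L False M0 by (simp add: K_def)
  define d where "d = nat \<lceil>K\<rceil>"
  have d: "0 < d" "K <= real d" "real d < K + 1" using K0 unfolding d_def by linarith+
  \<comment> \<open>Ensures that the loop over the guesses reaches \<open>d\<close>.\<close>
  have "K <= real m"
  proof -
   have "L * real g <= L * real (m * (r * r))" using L wS_le_m[OF S(1)] by (intro mult_left_mono) (simp_all only: g_def of_nat_le_iff)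
   also have "... = real m * (L * real (r * r))" by simp
   also have "... <= real m * real M" using big(2) by (intro mult_left_mono) auto
   finally show ?thesis using M0 by (simp add: K_def divide_le_eq)
  qed
  then have "d <= m" using d(3) by linarith
  then have "d \<in> {1..n + m}" using d(1) by simp
  then obtain T' where T': "outcome 30000 d M ?a ?a' (?G d) T'" "\<And>j. j <= r ==> ext_ok M T' j (s' 9 0)" using D(2) by blast
  have H: "(\<exists>v\<in>{..<n} - R. K <= real (dgr {..<n} v)) \<or> 2 * wS (S - R) < wS S"
   if R: "R \<subseteq> {..<n}" "card R < 2 * ?a" and GR: "?G d (R, Z, 0)" for R Z
  proof (rule ccontr)
   assume "\<not> ?thesis"
   then have dl: "\<And>v. v \<in> {..<n} - R ==> real (dgr {..<n} v) < K" and w: "g <= 2 * wS (S - R)" by (auto simp: g_def not_le)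
   have ne: "S - R ~= {}"
   proof
    assume e: "S - R = {}"
    show False using w False unfolding e by (simp add: wS_def)
   qed
   \<comment> \<open>Degrees are integers, so for \<open>K < 1\<close> all degrees outside
     \<open>R\<close> would vanish and with them the weight of \<open>S - R\<close>. Hence rounding
     \<open>K\<close> up to \<open>d\<close> at most doubles it.\<close>
   have K1: "1 <= K"
   proof (rule ccontr)
    assume "\<not> 1 <= K"
    then have "dgr {..<n} v = 0" if "v \<in> {..<n} - R" for v using dl[OF that] by simp
    moreover have "wS (S - R) <= (\<Sum>v\<in>S - R. dgr {..<n} v)"
     unfolding wS_def dgr_def using S(1) by (intro sum_mono sum_mono2) auto
    ultimately have "wS (S - R) = 0" using S(1) by (simp add: subset_iff)
    then show False using w False by simp
   qed
   interpret A: sparse_part n r es R d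
   proof
    show "dgr {..<n} v <= d" if "v \<in> {..<n} - R" for v using dl[OF that] d(2) by linarith
   qed (use R d in auto)
   have U: "A.U ~= {}" "real (card A.U) <= real n" "card A.U <= n"
    using ne S(1) card_mono[of "{..<n}" A.U] by (auto simp: A.U_def)
   obtain k where k: "1 <= k" "real k < real n" "real n * (1 + \<rho> / 3) ^ k < (1 + \<rho> / 2) ^ k"
     "(1 + \<rho> / 4) ^ k * (real D * 2 ^ D) <= (1 + \<rho> / 3) ^ k" "2 ^ k * (real n)\<^sup>2 * (real D * real n * 2 ^ D) < real n ^ E"
    using large unfolding large_enough_def by blast
   define \<epsilon> where "\<epsilon> = 1 / (real n)\<^sup>2"
   have ap: "A.W.approximable (realised D E R d) k D (real D * real (card A.U) * 2 ^ D) \<epsilon>"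
   proof (rule A.realised_approximable[where \<sigma> = "2 ^ k * (real n)\<^sup>2"])
    have "2 ^ k * (real n)\<^sup>2 * (real D * real (card A.U) * 2 ^ D) <= 2 ^ k * (real n)\<^sup>2 * (real D * real n * 2 ^ D)"
     using U(2) by (intro mult_left_mono mult_right_mono) auto
    also have "... < real n ^ E" by (rule k(5))
    also have "... <= real (n + m) ^ E" by (intro power_mono) auto
    finally show "2 ^ k * (real n)\<^sup>2 * (real D * real (card A.U) * 2 ^ D) < real (n + m) ^ E" .
   qed (use k(2) n0 in \<open>auto simp: \<epsilon>_def\<close>)
   have e: "\<epsilon> * sqrt (real n) = real n powr (-3/2)"
   proof -
    have "\<epsilon> * sqrt (real n) = real n powr (-2) * real n powr (1/2)"
     using n0 by (simp add: \<epsilon>_def powr_half_sqrt powr_minus_divide)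
    also have "... = real n powr (-2 + 1/2)" by (rule powr_add[symmetric])
    finally show ?thesis by simp
   qed
   have iw: "inner_weight A.A (S - R) = real (wS (S - R)) / real d"
    by (simp add: inner_weight_def A.A_def wS_def flip: sum_divide_distrib)
   have "\<rho> * (\<mu> * real n) <= inner_weight A.A (S - R)"
   proof -
    have "real d <= 2 * K" using d(3) K1 by linarith
    then have "real d * real M <= 2 * L * real g" using M0 mult_right_mono[of "real d" "2 * K" "real M"] by (simp add: K_def)
    also have "... <= 2 * L * (2 * real (wS (S - R)))" using w L by (intro mult_left_mono) linarith+
    finally have "real M / (4 * L) <= real (wS (S - R)) / real d" using L d by (simp add: field_simps)
    then show ?thesis unfolding iw rho mu using n0 by simp
   qed
   moreover have "real (card (S - R)) <= \<mu> * real n"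
    using card_mono[of S "S - R"] S finite_V[OF S(1)] n0 by (simp add: mu)
   moreover have "S - R \<subseteq> A.U" using S(1) by (auto simp: A.U_def)
   ultimately have "A.W.dense_candidate (realised D E R d) ms q \<mu> (real n)"
    using A.W.dense_candidate_exists[OF par' \<mu>_def U(1,2) k(1,3,4) _ _ _ ap] large unfolding large_enough_def e
    by (simp add: \<epsilon>_def)
   then obtain \<delta> \<phi> where "\<And>x. x < ms * bsize D E ==> \<delta> x < n + m" "\<And>x. x \<ge> ms * bsize D E ==> \<delta> x = 0"
     "length \<phi> = 2 ^ ms" "\<forall>x\<in>set \<phi>. x <= q" "trial 30000 d M ?a q D E ms \<phi> (R, Z, 0) \<delta>"
    unfolding mu using A.candidate_trial[OF _ q R(2) U(1)] by metis
   then show False using GR set_phis by blast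
  qed
  have KM: "K * real M * real M <= real n * real (wS S)"
  proof -
   have "K * real M * real M = L * real M * real g" using M0 by (simp add: K_def)
   also have "... <= real n * real g" using big(3) by (intro mult_right_mono) auto
   finally show ?thesis by (simp add: g_def)
  qed
  have "6 <= M" using big(1) r2 r_ge by linarith
  then have od: "K * real (?a' * (?a' - 1)) <= 8 * real (30000::nat) * real n * real (wS T')" "card T' = ?a'" "T' \<subseteq> {..<n}"
   using outcome_dense[OF T'(1) refl _ _ less_imp_le[OF K0] d(2) KM S(1) _ H] S(2) by auto
  have fc: "(real M / real n) ^ (r - 2) * real (wS T') / 16 <= real (cnt (setof s' 3))"
   using final_count[OF od(3) _ _ big(4) T'(2)] od(2) big(1) out(2) times_div_less_eq_dividend[of "4 * r" M] by auto
  have aa: "(real M)\<^sup>2 / (128 * (real r)\<^sup>2) <= real (?a' * (?a' - 1))"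
  proof -
   define x where "x = real M / (8 * real r)"
   have r0: "0 < real r" using r_ge by simp
   have "M < 4 * r * (?a' + 1)" using r_ge dividend_less_div_times[of "4 * r" M] by (simp add: mult.commute)
   then have "real M < real (4 * r * (?a' + 1))" by (simp only: of_nat_less_iff)
   then have "2 * x < real ?a' + 1" using r0 by (simp add: x_def field_simps)
   moreover have "2 <= x"
   proof -
    have "real (16 * r) <= real M" using big(1) r2 by (simp only: of_nat_le_iff)
    then show ?thesis using r0 by (simp add: x_def field_simps)
   qed
   ultimately have "x * (x / 2) <= real ?a' * (real ?a' - 1)" by (intro mult_mono) auto
   moreover have "1 <= ?a'" using \<open>2 * x < real ?a' + 1\<close> \<open>2 <= x\<close> by linarith
   ultimately show ?thesis by (simp add: x_def of_nat_diff power2_eq_square field_simps)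
  qed
  have "L * real (cnt S) * real M / 256 <= K * ((real M)\<^sup>2 / (128 * (real r)\<^sup>2))"
  proof -
   have "L * real (cnt S) * real M / 256 = L * (real r * real r / 2 * real (cnt S)) / real M * ((real M)\<^sup>2 / (128 * (real r)\<^sup>2))"
    using M0 r_ge by (simp add: field_simps power2_eq_square)
   also have "... <= K * ((real M)\<^sup>2 / (128 * (real r)\<^sup>2))"
    unfolding K_def using gS L by (intro mult_right_mono divide_right_mono mult_left_mono) auto
   finally show ?thesis .
  qed
  also have "... <= K * real (?a' * (?a' - 1))" using aa K0 by (intro mult_left_mono) auto
  also have "... <= 240000 * real n * real (wS T')" using od(1) by simp
  \<comment> \<open>\<open>61440000\<close> is \<open>256 * 240000\<close>. With the 16 of
    \<open>final_count\<close> the total constant is 983040000, just below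
    \<open>10 ^ 9\<close>.\<close>
  finally have "L * real (cnt S) * \<mu> / 61440000 <= real (wS T')" using n0 by (simp add: mu field_simps)
  then have "\<mu> ^ (r - 2) * (L * real (cnt S) * \<mu> / 61440000) / 16 <= \<mu> ^ (r - 2) * real (wS T') / 16"
   by (intro divide_right_mono mult_left_mono) (auto simp: \<mu>_def)
  also have "... <= real (cnt (setof s' 3))" using fc by (simp add: mu)
  finally have *: "\<mu> ^ (r - 2) * (L * real (cnt S) * \<mu> / 61440000) / 16 <= real (cnt (setof s' 3))" .
  define y where "y = \<mu> ^ (r - 1) * (L * real (cnt S))"
  have "r - 1 = Suc (r - 2)" using r_ge by simp
  then have "\<mu> ^ (r - 2) * (L * real (cnt S) * \<mu> / 61440000) / 16 = y / 983040000" by (simp add: y_def)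
  moreover have "0 <= y" using L by (simp add: y_def \<mu>_def)
  ultimately have "1 / 10 ^ 9 * y <= real (cnt (setof s' 3))" using * by simp
  then show ?thesis unfolding \<mu>_def[symmetric] by (simp add: y_def mult.assoc)
 qed
qed

text \<open>Extension of the empty set: averaging alone secures the fraction
  \<open>\<mu> ^ r / 2\<close> of all hyperedges, which suffices where \<open>\<mu>\<close> is
  bounded away from 0.\<close>

definition simple_cmd :: "nat => nat => cmd" where
 "simple_cmd k l = sqs [div_cmd 6 l (mulc k (cell 0)), mapE 30 14 (Lit 0), ext_cmd 0]"

lemma simple_correct:
 assumes s: "inp s" "s 9 0 = 0" and M: "k * n = M * l" "0 < l" "4 * r * r <= M" "M <= n"
 defines "s' \<equiv> den (simple_cmd k l) s"
 shows "card (setof s' 3) = M" "(real M / real n) ^ r / 2 * real m <= real (cnt (setof s' 3))"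
proof -
 define s1 where "s1 = den (div_cmd 6 l (mulc k (cell 0))) s"
 define s2 where "s2 = den (mapE 30 14 (Lit 0)) s1"
 have f1: "s1 b = s b" if "b ~: {30, 6}" for b using that by (simp add: s1_def den_frame)
 have f2: "s2 b = s1 b" if "b ~: {30, 14}" for b using that by (simp add: s2_def den_frame)
 have i1: "inp s1" by (rule inp_cong[OF s(1)]; rule f1) auto
 have i2: "inp s2" by (rule inp_cong[OF i1]; rule f2) auto
 have "s1 6 0 = (M * l) div l"
  unfolding s1_def
 by (rule den_div[OF s(1)]) (use s(1) M(1) M in \<open>auto simp: inp_def\<close>)
 then have v: "s2 6 0 = M" "s2 9 0 = 0" "setof s2 14 = {}"
  using M f1 f2 s setof_mapE_const[OF i1, of 14 0] by (auto simp: s2_def)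
 have "s' = den (ext_cmd 0) s2" by (simp add: s'_def simple_cmd_def s1_def s2_def)
 then have e: "best M s'" "ext_ok M {} 0 (s' 9 0)" using den_ext[OF i2, where j = 0] v M by (auto simp: best_def)
 then have o: "card (setof s' 3) = M" "s' 9 0 - 1 = cnt (setof s' 3)" by (auto simp: best_def ext_ok_def)
 show "card (setof s' 3) = M" by (rule o)
 have "ed {..<n} {} 0 = {..<m}" using card_edge(2) by (auto simp: ed_def)
 then have "m * pf (M - 0) r <= cnt (setof s' 3) * pf (n - 0) r" using e(2) o by (simp add: ext_ok_def)
 moreover have "0 < 4 * r * r" using r_ge by simp
 then have "0 < M" using M(3) by linarith
 ultimately have "real m * (real M / real n) ^ r / 2 <= real (cnt (setof s' 3))"
  using M r_le by (intro pf_ratio[where a = 0 and r = r]) auto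
 then show "(real M / real n) ^ r / 2 * real m <= real (cnt (setof s' 3))" by (simp add: mult.commute)
qed

end

subsection \<open>Running time of the main program\<close>

text \<open>The loop depth becomes the exponent of the running time in \<open>exec_tame\<close>; in
  \<open>prog_cmd\<close> all but 6 levels come from the digits.\<close>

definition tame :: "cmd => nat => bool" where
 "tame c k \<longleftrightarrow> wf_cmd c & depth c <= k"

lemma tame_mono: "tame c k ==> k <= l ==> tame c l"
 by (auto simp: tame_def)

lemma tame_simps [simp]:
 "tame (St a i e) k \<longleftrightarrow> a ~= 5" "tame (Sq c d) k \<longleftrightarrow> tame c k & tame d k" "tame (If e c d) k \<longleftrightarrow> tame c k & tame d k"
 "tame Nop k" "tame (For a e c) (Suc k) \<longleftrightarrow> tame c k & a ~= 5 & a ~: writes c"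
 by (auto simp: tame_def)

lemma tame_sqs: "tame (sqs cs) k \<longleftrightarrow> (\<forall>c\<in>set cs. tame c k)"
 by (induction cs) auto

lemma tame_macros [simp]:
 "tame (mapE iv dst e) (Suc k) \<longleftrightarrow> iv ~= dst & iv ~= 5 & dst ~= 5"
 "tame (mapIf iv dst t e f) (Suc k) \<longleftrightarrow> iv ~= dst & iv ~= 5 & dst ~= 5"
 "tame (sumE iv dst e) (Suc k) \<longleftrightarrow> iv ~= dst & iv ~= 5 & dst ~= 5"
 "tame (mulE iv dst e f) (Suc k) \<longleftrightarrow> iv ~= dst & iv ~= 5 & dst ~= 5"
 by (auto simp: tame_def)

context input
begin

lemma tame_wapp [simp]: "tame (wapp y z) (Suc (Suc (Suc k)))" if "z ~: {5, 30, 31, 32, 33}"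
 using that by (auto simp: wapp_def)

lemma tame_scale: "tame (scale y e) (Suc (Suc k))" if "y ~: {5, 30, 31, 34}"
 using that by (auto simp: scale_def)

lemma tame_iter: "tame (iter_cmd y l e) (Suc (Suc (Suc (Suc k))))" if "y ~: {5, 18, 30, 31, 32, 33, 34, 35}"
 using that by (auto simp: iter_cmd_def step_cmd_def intro!: tame_scale)

lemma tame_horner: "tame (horner_cmd y pos dig D E) (Suc (Suc k))" if "y ~: {5, 30, 31, 34}"
 using that tame_scale by (auto simp: horner_cmd_def tame_sqs add_digits_def)

lemma tame_types: "tame (types_cmd D E l) (Suc (Suc (Suc (Suc k))))"
 by (auto simp: types_cmd_def tame_sqs block_cmd_def vec_cmd_def Let_def intro!: tame_iter tame_horner)

lemma tame_cand: "tame (cand_cmd c q \<phi>) (Suc (Suc (Suc (Suc k))))"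
 by (auto simp: cand_cmd_def table_cmd_def tame_sqs round_cmd_def test_cmd_def upd_cmd_def)

lemma tame_body: "tame (body_cmd c q D E l \<Phi>) 4"
 using tame_types[of D E l 0] tame_cand[of c q _ 0] by (auto simp: body_cmd_def tame_sqs eval_nat_numeral)

lemma tame_nest: "tame p k ==> (\<And>b. b \<in> writes p ==> b < 100) ==> tame (nest l p) (l + k)"
proof (induction l)
 case (Suc l)
 have "100 + l ~: writes (nest l p)" using Suc.prems(2)[of "100 + l"] by (auto simp: writes_nest)
 then show ?case using Suc by simp
qed simp

lemma tame_shrink: "tame zc (Suc (Suc (Suc k))) ==> C ~: {5, 30, 42} ==> 42 ~: writes zc ==> tame (shrink_cmd C K g zc) (Suc (Suc (Suc (Suc k))))"
 by (auto simp: shrink_cmd_def argmin_cmd_def Let_def)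

lemma tame_ext: "tame (ext_cmd j) (Suc (Suc (Suc (Suc k))))"
 by (auto simp: ext_cmd_def key_cmd_def count_cmd_def intro!: tame_shrink)

lemma tame_prog: "tame (prog_cmd k l q D E ms) (ms * bsize D E + 6)"
proof -
 let ?Q = "ms * bsize D E" and ?b = "body_cmd 30000 q D E ms (phis q ms)"
 have w: "12 <= b & b < 100 & b ~= 14 & b ~= 17" if "b \<in> writes ?b" for b
  using subsetD[OF writes_body that] by auto
 define W where "W = ?Q + 4"
 have "tame (nest ?Q ?b) W" unfolding W_def by (rule tame_nest) (use tame_body w in auto)
 moreover have "17 ~: writes (nest ?Q ?b)" using w by (auto simp: writes_nest)
 moreover have s: "tame (shrink_cmd C K g (deg_cmd a)) (Suc W)" if "C ~: {5, 30, 42}" for C K g a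
  by (rule tame_mono[OF tame_shrink[where k = 0]]) (use that in \<open>auto simp: deg_cmd_def W_def\<close>)
 moreover have "tame (ext_cmd j) (Suc W)" for j by (rule tame_mono[OF tame_ext[where k = 0]]) (simp add: W_def)
 ultimately have g: "tame (guess_cmd ?Q ?b) (Suc W)" by (simp add: guess_cmd_def tame_sqs del: upt_Suc)
 have "11 ~: writes (guess_cmd ?Q ?b)" using writes_guess[of ?b 11 ?Q] w by auto
 moreover have e: "?Q + 6 = Suc (Suc W)" by (simp add: W_def)
 ultimately show ?thesis using g r_ge unfolding e prog_cmd_def main_cmd_def div_cmd_def by simp
qed

lemma tame_simple: "tame (simple_cmd k l) 4"
 using tame_ext[of 0 0] by (auto simp: simple_cmd_def div_cmd_def eval_nat_numeral)

lemma exec_tame: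
 assumes "tame c k" "s 0 0 = n" "s 1 0 = m"
 obtains t where "t <= weight c * (n + m + 1) ^ k + 2"
  "exec (Seq (Store 5 (Lit 0) (Add (cell 0) (cell 1))) (compile c)) s t (den c (upd s 5 0 (n + m)))"
proof -
 let ?s = "upd s 5 0 (n + m)"
 obtain t where t: "t <= weight c * (n + m + 1) ^ depth c" "exec (compile c) ?s t (den c ?s)"
  using exec_compile[of c ?s] assms(1) by (auto simp: tame_def)
 have "exec (Store 5 (Lit 0) (Add (cell 0) (cell 1))) s 1 ?s"
  using exec_Store[of 5 "Lit 0" "Add (cell 0) (cell 1)" s] assms by simp
 then have "exec (Seq (Store 5 (Lit 0) (Add (cell 0) (cell 1))) (compile c)) s (1 + 1 + t) (den c ?s)"
  by (rule exec_Seq[OF _ t(2)])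
 moreover have "weight c * (n + m + 1) ^ depth c <= weight c * (n + m + 1) ^ k"
  using assms(1) by (intro mult_le_mono2 power_increasing) (auto simp: tame_def)
 then have "1 + 1 + t <= weight c * (n + m + 1) ^ k + 2" using t(1) by linarith
 ultimately show thesis using that by blast
qed

end

subsection \<open>A decision tree for small inputs\<close>

text \<open>Case distinction on the value of \<open>e\<close> by trying \<open>j\<close>,
  \<open>j + 1\<close> and so on. Testing \<open>Sub e (Lit j)\<close> for zero is sound because
  smaller values have been excluded before.\<close>

fun sel :: "expr => nat => (nat => prog) => nat => prog" where
 "sel e 0 F j = Skip"
| "sel e (Suc k) F j = Cond (Sub e (Lit j)) (sel e k F (Suc j)) (F j)"

lemma exec_sel:
 "eval_expr e s = v ==> j <= v ==> v < j + k ==> exec (F v) s t s' ==> exec (sel e k F j) s (Suc (v - j) + t) s'"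
proof (induction k arbitrary: j)
 case (Suc k)
 show ?case
 proof (cases "v = j")
  case True
  then show ?thesis using exec_CondF[of "Sub e (Lit j)" s "F j" t s'] Suc.prems by simp
 next
  case False
  then have "exec (sel e k F (Suc j)) s (Suc (v - Suc j) + t) s'" using Suc by simp
  moreover have "eval_expr (Sub e (Lit j)) s ~= 0" using False Suc.prems by simp
  ultimately have "exec (sel e (Suc k) F j) s (1 + (Suc (v - Suc j) + t)) s'" unfolding sel.simps by (intro exec_CondT)
  moreover have "1 + (Suc (v - Suc j) + t) = Suc (v - j) + t" using False Suc.prems by simp
  ultimately show ?thesis by metis
 qed
qed simp

fun tree :: "nat => nat => nat list => (nat list => prog) => prog" where
 "tree b 0 xs F = F xs"
| "tree b (Suc k) xs F = sel (Arr 2 (Lit (length xs))) b (%v. tree b k (xs @ [v]) F) 0"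

lemma exec_tree:
 assumes "\<And>i. i < length xs + k ==> s 2 i < b" "exec (F (xs @ map (s 2) [length xs..<length xs + k])) s t s'"
 shows "\<exists>u \<le> k * b + t. exec (tree b k xs F) s u s'"
 using assms
proof (induction k arbitrary: xs)
 case (Suc k)
 define v where "v = s 2 (length xs)"
 have v: "v < b" using Suc.prems(1)[of "length xs"] by (simp add: v_def)
 have "map (s 2) [length xs..<length xs + Suc k] = v # map (s 2) [Suc (length xs)..<Suc (length xs) + k]"
  by (simp add: v_def upt_conv_Cons del: upt_Suc)
 then obtain u where u: "u <= k * b + t" "exec (tree b k (xs @ [v]) F) s u s'"
  using Suc.IH[of "xs @ [v]"] Suc.prems by auto
 have "exec (sel (Arr 2 (Lit (length xs))) b (%v. tree b k (xs @ [v]) F) 0) s (Suc (v - 0) + u) s'"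
  by (rule exec_sel) (use v u in \<open>auto simp: v_def\<close>)
 moreover have "Suc (v - 0) + u <= Suc k * b + t" using v u by simp
 ultimately show ?case unfolding tree.simps by blast
qed auto

fun out :: "nat list => prog" where
 "out [] = Skip"
| "out (x # xs) = Seq (Store 3 (Lit x) (Lit 1)) (out xs)"

lemma exec_out: "\<exists>s'. exec (out xs) s (2 * length xs) s' & (\<forall>i. s' 3 i = (if i \<in> set xs then 1 else s 3 i))"
proof (induction xs arbitrary: s)
 case Nil
 then show ?case using exec_Skip by auto
next
 case (Cons x xs)
 obtain s' where s': "exec (out xs) (upd s 3 x 1) (2 * length xs) s'" "\<forall>i. s' 3 i = (if i \<in> set xs then 1 else upd s 3 x 1 3 i)"
  using Cons by blast
 have "exec (out (x # xs)) s (1 + 1 + 2 * length xs) s'"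
  unfolding out.simps using exec_Seq[OF exec_Store[of 3 "Lit x" "Lit 1" s], of "out xs"] s'(1) by simp
 then show ?case using s'(2) by auto
qed

section \<open>Optimal answers for small inputs\<close>

definition valid :: "nat => nat => nat list list => bool" where
 "valid n r es \<longleftrightarrow> (\<forall>e\<in>set es. length e = r & distinct e & set e \<subseteq> {..<n}) & distinct (map set es)"

definition ecnt :: "nat list list => nat set => nat" where
 "ecnt es X = card {i. i < length es & set (es ! i) \<subseteq> X}"

definition result :: "real => nat => nat list list => mem => nat => real => bool" where
 "result \<mu> n es s M c \<longleftrightarrow> (let X = {i. i < n & s 3 i ~= 0} in card X = M &
   (\<forall>S. S \<subseteq> {..<n} & card S = M --> c * real (ecnt es S) <= real (ecnt es X)))"

lemma valid_length_le: "valid n r es ==> length es <= n ^ r"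
proof -
 assume v: "valid n r es"
 have "length es = card (set es)" using v by (simp add: valid_def distinct_map distinct_card)
 also have "... <= card {xs. set xs \<subseteq> {..<n} & length xs = r}"
  using v by (intro card_mono finite_lists_length_eq) (auto simp: valid_def)
 finally show ?thesis by (simp add: card_lists_length_eq)
qed

text \<open>The nonconstructive choice is harmless: the answers are built into the program as
  constants, for finitely many inputs.\<close>

definition pick :: "nat => nat => real => nat list => nat list" where
 "pick n r M xs = (SOME ys. distinct ys & set ys \<subseteq> {..<n} & real (length ys) = M &
   (\<forall>es. valid n r es & concat es = xs --> (\<forall>S. S \<subseteq> {..<n} & card S = length ys --> ecnt es S <= ecnt es (set ys))))"

text \<open>The memory holds only the concatenation of the hyperedges. Their common length
  \<open>r\<close> makes them recoverable, so one answer per concatenation is well defined.\<close>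

lemma valid_concat_inj: "valid n r es ==> valid n r es' ==> concat es = concat es' ==> 0 < r ==> es = es'"
proof -
 assume v: "valid n r es" "valid n r es'" and c: "concat es = concat es'" and r: "0 < r"
 have "length (concat es) = r * length es" if "valid n r es" for es
  using that by (induction es) (auto simp: valid_def)
 then have "length es = length es'" using v c r by (metis mult_cancel1 neq0_conv)
 then show ?thesis using c v by (intro concat_injective) (auto simp: valid_def, metis set_zip_leftD set_zip_rightD)
qed

lemma pick_correct:
 assumes v: "valid n r es" and r: "0 < r" and M: "M <= n"
 defines "ys \<equiv> pick n r (real M) (concat es)"
 shows "distinct ys" "set ys \<subseteq> {..<n}" "length ys = M" "S \<subseteq> {..<n} ==> card S = M ==> ecnt es S <= ecnt es (set ys)"
proof -
 let ?A = "{S. S \<subseteq> {..<n} & card S = M}"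
 have "finite ?A" by simp
 moreover have "{..<M} \<in> ?A" using M by auto
 ultimately have "Max (ecnt es ` ?A) \<in> ecnt es ` ?A" by (intro Max_in finite_imageI) blast+
 then obtain S0 where S0': "S0 \<in> ?A" "Max (ecnt es ` ?A) = ecnt es S0" by blast
 have S0: "S0 \<in> ?A" "\<And>S. S \<in> ?A ==> ecnt es S <= ecnt es S0"
  using S0'(1) Max_ge[OF finite_imageI[OF \<open>finite ?A\<close>], of _ "ecnt es"] unfolding S0'(2) by blast+
 obtain zs where zs: "distinct zs" "set zs = S0"
  using S0(1) finite_distinct_list finite_subset[of S0 "{..<n}"] by auto
 have "distinct ys & set ys \<subseteq> {..<n} & real (length ys) = real M &
   (\<forall>es'. valid n r es' & concat es' = concat es --> (\<forall>S. S \<subseteq> {..<n} & card S = length ys --> ecnt es' S <= ecnt es' (set ys)))"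
  unfolding ys_def pick_def
 proof (rule someI[of _ zs], intro conjI allI impI)
  show "distinct zs" "set zs \<subseteq> {..<n}" "real (length zs) = real M" using zs S0(1) by (auto simp: distinct_card[symmetric])
  fix es' S assume "valid n r es' & concat es' = concat es" and S: "S \<subseteq> {..<n} & card S = length zs"
  then have "es' = es" using valid_concat_inj v r by blast
  then show "ecnt es' S <= ecnt es' (set zs)" using S0 S zs by (auto simp: distinct_card[symmetric])
 qed
 then show "distinct ys" "set ys \<subseteq> {..<n}" "length ys = M" "S \<subseteq> {..<n} ==> card S = M ==> ecnt es S <= ecnt es (set ys)"
  using v by auto
qed

definition lookup :: "nat => nat => real => prog" where
 "lookup N r \<mu> = sel (cell 0) N (%n. sel (cell 1) (Suc (n ^ r)) (%m. tree n (r * m) [] (%xs. out (pick n r (\<mu> * real n) xs))) 0) 0"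

lemma exec_lookup:
 assumes v: "valid n r es" and r: "0 < r" and M: "M <= n" "real M = \<mu> * real n" and n: "n < N"
 obtains t s' where "t <= 3 * n + n ^ r + r * n ^ r * n + 2" "exec (lookup N r \<mu>) (input_mem n es) t s'" "result \<mu> n es s' M 1"
proof -
 let ?s = "input_mem n es" and ?m = "length es"
 define ys where "ys = pick n r (real M) (concat es)"
 note P = pick_correct[OF v r M(1), folded ys_def]
 have len: "length (concat es) = r * ?m" using v by (induction es) (auto simp: valid_def)
 have s2: "?s 2 i = concat es ! i" if "i < r * ?m" for i using that len by (simp add: input_mem_def)
 then have rd: "map (?s 2) [0..<r * ?m] = concat es" using len by (intro nth_equalityI) auto
 have lt: "?s 2 i < n" if "i < r * ?m" for i
 proof -
  have "concat es ! i \<in> set (concat es)" using that len by (intro nth_mem) simp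
  then have "concat es ! i < n" using v by (auto simp: valid_def)
  then show ?thesis using s2[OF that] by simp
 qed
 obtain s' where s': "exec (out ys) ?s (2 * length ys) s'" "\<forall>i. s' 3 i = (if i \<in> set ys then 1 else ?s 3 i)"
  using exec_out by blast
 let ?f = "%n m. tree n (r * m) [] (%xs. out (pick n r (\<mu> * real n) xs))"
 let ?g = "%n. sel (cell 1) (Suc (n ^ r)) (?f n) 0"
 have "\<exists>u \<le> r * ?m * n + 2 * length ys. exec (?f n ?m) ?s u s'"
  by (rule exec_tree) (use lt s'(1) rd M(2) in \<open>simp_all add: ys_def\<close>)
 then obtain u where u: "u <= r * ?m * n + 2 * length ys" "exec (?f n ?m) ?s u s'" by blast
 have "exec (?g n) ?s (Suc (?m - 0) + u) s'"
  by (rule exec_sel[where F = "?f n"]) (use valid_length_le[OF v] u in \<open>auto simp: input_mem_def\<close>)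
 then have "exec (lookup N r \<mu>) ?s (Suc (n - 0) + (Suc (?m - 0) + u)) s'"
  unfolding lookup_def by (rule exec_sel[where F = ?g, rotated 3]) (use n in \<open>auto simp: input_mem_def\<close>)
 moreover have "Suc (n - 0) + (Suc (?m - 0) + u) <= 3 * n + n ^ r + r * n ^ r * n + 2"
 proof -
  have "r * ?m * n <= r * n ^ r * n" using valid_length_le[OF v] by (intro mult_le_mono) auto
  then show ?thesis using u(1) valid_length_le[OF v] P(3) M(1) by linarith
 qed
 moreover have "result \<mu> n es s' M 1"
 proof -
  have X: "{i. i < n & s' 3 i ~= 0} = set ys" using s'(2) P(2) by (auto simp: input_mem_def)
  show ?thesis unfolding result_def Let_def X using P distinct_card[OF P(1)] by auto
 qed
 ultimately show thesis using that by blast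
qed

subsection \<open>Choice of the parameters\<close>

text \<open>Let \<open>l\<close> be the binary length of \<open>n\<close> and
  \<open>k = \<kappa> * l\<close>. Bernoulli's inequality gives
  \<open>(1 + x) ^ \<kappa> \<ge> 2\<close> for \<open>x\<close> down to \<open>\<rho> / 16\<close>,
  so \<open>(1 + x) ^ k\<close> exceeds \<open>n\<close>; the gaps between
  \<open>1 + \<rho> / 4\<close>, \<open>1 + \<rho> / 3\<close> and \<open>1 + \<rho> / 2\<close>
  contain such factors. As \<open>2 ^ k\<close> is at most \<open>n ^ (2 * \<kappa>)\<close>,
  \<open>2 * \<kappa> + 4\<close> digits are enough.\<close>

lemma large_enough_eventually:
 assumes \<rho>: "0 < \<rho>" "\<rho> <= 1" and \<gamma>: "0 < \<gamma>" and \<kappa>: "16 <= real \<kappa> * \<rho>"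
 shows "\<exists>N0. \<forall>n\<ge>N0. input.large_enough \<rho> \<gamma> D (2 * \<kappa> + 4) (real n)"
proof -
 have "\<exists>l0. \<forall>l\<ge>l0. real (2 * \<kappa>) * real l < 2 ^ l"
  unfolding eventually_sequentially[symmetric] by real_asymp
 then obtain l0 where l0: "\<And>l. l0 <= l ==> real (2 * \<kappa>) * real l < 2 ^ l" by blast
 have "\<exists>N1. \<forall>n\<ge>N1. real n powr (-3/2) <= min (\<rho> / 2 ^ 10) \<gamma>"
 proof -
  have "((%n. real n powr (-3/2)) \<longlongrightarrow> 0) sequentially" by real_asymp
  then have "\<forall>\<^sub>F n in sequentially. real n powr (-3/2) < min (\<rho> / 2 ^ 10) \<gamma>"
   by (rule order_tendstoD) (use \<rho> \<gamma> in auto)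
  then show ?thesis unfolding eventually_sequentially by (meson less_imp_le)
 qed
 then obtain N1 where N1: "\<And>n. N1 <= n ==> real n powr (-3/2) <= min (\<rho> / 2 ^ 10) \<gamma>" by blast
 have "input.large_enough \<rho> \<gamma> D (2 * \<kappa> + 4) (real n)" if n: "2 ^ l0 <= n" "N1 <= n" "D * 2 ^ D < n" "2 <= n" for n
 proof -
  interpret input 3 2 "[]" by unfold_locales auto
  define l where "l = (LEAST l. n < 2 ^ l)"
  have nl: "n < 2 ^ l" unfolding l_def by (rule LeastI[of _ n]) simp
  have "l ~= 0" using nl n by (cases l) auto
  then have "\<not> n < 2 ^ (l - 1)" unfolding l_def by (intro not_less_Least) simp
  then have nl2: "2 ^ l <= 2 * n" using \<open>l ~= 0\<close> by (cases l) auto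
  have "(2::nat) ^ l0 < 2 ^ l" using n(1) nl by linarith
  then have ll: "l0 <= l" by (simp add: power_strict_increasing_iff)
  define k where "k = \<kappa> * l"
  have \<kappa>0: "0 < \<kappa>" using \<kappa> by (cases \<kappa>) auto
  have "real (2 * \<kappa>) * real l < real (2 * n)" using l0[OF ll] nl2 by (metis less_le_trans of_nat_le_iff of_nat_numeral of_nat_power)
  then have kn: "real k < real n" by (simp add: k_def)
  have grow: "real n < (1 + x) ^ k" if "0 <= x" "1 <= real \<kappa> * x" for x :: real
  proof -
   have "1 + real \<kappa> * x <= (1 + x) ^ \<kappa>" using that by (intro Bernoulli_inequality) auto
   then have "2 <= (1 + x) ^ \<kappa>" using that by linarith
   then have "2 ^ l <= ((1 + x) ^ \<kappa>) ^ l" by (intro power_mono) auto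
   moreover have "real n < 2 ^ l" using nl by (metis of_nat_less_iff of_nat_numeral of_nat_power)
   ultimately have "real n < ((1 + x) ^ \<kappa>) ^ l" by linarith
   then show ?thesis by (simp only: k_def power_mult)
  qed
  have rr: "\<rho> * \<rho> <= \<rho>" using \<rho> by (simp add: mult_left_le)
  have g1: "real n * (1 + \<rho> / 3) ^ k < (1 + \<rho> / 2) ^ k"
  proof -
   have "real n * (1 + \<rho> / 3) ^ k < (1 + \<rho> / 8) ^ k * (1 + \<rho> / 3) ^ k"
    using grow[of "\<rho> / 8"] \<rho> \<kappa> by (intro mult_strict_right_mono) auto
   also have "... = ((1 + \<rho> / 8) * (1 + \<rho> / 3)) ^ k" by (rule power_mult_distrib[symmetric])
   also have "(1 + \<rho> / 8) * (1 + \<rho> / 3) = 1 + \<rho> * (11 / 24) + \<rho> * \<rho> / 24" by (simp add: field_simps)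
   also have "... ^ k <= (1 + \<rho> / 2) ^ k" by (rule power_mono) (use \<rho> rr in linarith, use \<rho> in simp)
   finally show ?thesis .
  qed
  have "real (D * 2 ^ D) < real n" using n(3) by (simp only: of_nat_less_iff)
  then have Dn: "real D * 2 ^ D < real n" by simp
  have g2: "(1 + \<rho> / 4) ^ k * (real D * 2 ^ D) <= (1 + \<rho> / 3) ^ k"
  proof -
   have "(1 + \<rho> / 4) ^ k * (real D * 2 ^ D) <= (1 + \<rho> / 4) ^ k * (1 + \<rho> / 16) ^ k"
    using grow[of "\<rho> / 16"] \<rho> \<kappa> Dn by (intro mult_left_mono) auto
   also have "... = ((1 + \<rho> / 4) * (1 + \<rho> / 16)) ^ k" by (rule power_mult_distrib[symmetric])
   also have "(1 + \<rho> / 4) * (1 + \<rho> / 16) = 1 + \<rho> * (5 / 16) + \<rho> * \<rho> / 64" by (simp add: field_simps)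
   also have "... ^ k <= (1 + \<rho> / 3) ^ k" by (rule power_mono) (use \<rho> rr in linarith, use \<rho> in simp)
   finally show ?thesis .
  qed
  have "(2::real) ^ k <= (real n ^ 2) ^ \<kappa>"
  proof -
   have "(2::nat) ^ l <= n\<^sup>2" using nl2 mult_le_mono1[OF n(4), of n] unfolding power2_eq_square by linarith
   then have "(2::real) ^ l <= real n ^ 2" by (metis of_nat_le_iff of_nat_numeral of_nat_power)
   then have "(2 ^ l) ^ \<kappa> <= (real n ^ 2) ^ \<kappa>" by (intro power_mono) auto
   then show ?thesis by (simp add: k_def power_mult[symmetric] mult.commute)
  qed
  then have "2 ^ k * (real n)\<^sup>2 * (real D * real n * 2 ^ D) <= (real n ^ 2) ^ \<kappa> * (real n)\<^sup>2 * (real D * real n * 2 ^ D)"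
   by (intro mult_right_mono) auto
  also have "... = (real n ^ 2) ^ \<kappa> * (real n)\<^sup>2 * real n * (real D * 2 ^ D)" by simp
  also have "... < (real n ^ 2) ^ \<kappa> * (real n)\<^sup>2 * real n * real n" using Dn n(4) by (intro mult_strict_left_mono) auto
  also have "... = real n ^ (2 * \<kappa> + 4)" by (simp add: power_add power_mult power2_eq_square power4_eq_xxxx)
  finally have g3: "2 ^ k * (real n)\<^sup>2 * (real D * real n * 2 ^ D) < real n ^ (2 * \<kappa> + 4)" .
  have "1 <= k" using \<kappa>0 \<open>l ~= 0\<close> by (simp add: k_def)
  then show ?thesis unfolding large_enough_def using N1[OF n(2)] kn g1 g2 g3 by auto
 qed
 then show ?thesis
  by (intro exI[of _ "2 ^ l0 + N1 + D * 2 ^ D + 2"] allI impI) auto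
qed

text \<open>All parameters are bounded by polynomials in \<open>exp L\<close>, which is
  \<open>1 / \<mu>\<close>, using \<open>L \<le> exp L\<close> crudely. The exponent 18 consists of
  16 for the number \<open>ms\<close> of threshold sets and 2 for the size of a block.\<close>

lemma params_exist:
 "\<exists>L0\<ge>2. \<forall>L\<ge>L0. 6 * exp (- L) <= 1 & (\<exists>\<rho> h \<gamma> D G ms q \<kappa>. substochastic.good_params L \<rho> h \<gamma> D G ms q &
   16 <= real \<kappa> * \<rho> & real (ms * input.bsize D (2 * \<kappa> + 4)) <= 2 ^ 200 * exp L ^ 18)"
proof -
 let ?h = "%L::real. 2 ^ 70 * (4 * L) ^ 6"
 let ?Q = "%L. 2 <= L & 6 * exp (- L) <= (1::real) & L / 5 * ?h L * exp (L / 10) <= exp (L / 2) &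
   2 * (?h L) ^ 3 * exp (- L) * exp (3 * (L / 10)) <= 1 / 1280 - 1 / 2000 &
   1 / 30000 * (exp (- L) + (1 / (4 * L))\<^sup>2 / 2 ^ 26) < (1 / (4 * L))\<^sup>2 / 2 ^ 22 &
   1 / 30000 * (exp (- L) * 2 ^ 13 / (1 / (4 * L))\<^sup>2 + exp (- L) * 2 ^ 26 / (1 / (4 * L)) ^ 4) < (1 / (4 * L)) ^ 6 / 2 ^ 26"
 have "\<forall>\<^sub>F L in at_top. ?Q L"
  by (intro eventually_conj; real_asymp)
 then obtain L0 where L0: "\<And>L. L0 <= L ==> ?Q L"
  unfolding eventually_at_top_linorder by blast
 have "\<exists>\<rho> h \<gamma> D G ms q \<kappa>. substochastic.good_params L \<rho> h \<gamma> D G ms q &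
   16 <= real \<kappa> * \<rho> & real (ms * input.bsize D (2 * \<kappa> + 4)) <= 2 ^ 200 * exp L ^ 18" if "L0 <= L" for L
 proof -
  interpret T: substochastic "{}" "%_ _. 0" by unfold_locales auto
  interpret input 3 2 "[]" by unfold_locales auto
  note P = L0[OF that]
  have L: "2 <= L" using P by simp
  define x where "x = exp L"
  have x: "1 <= x" "L <= x" using L exp_ge_add_one_self[of L] unfolding x_def by linarith+
  define \<rho> where "\<rho> = 1 / (4 * L)"
  have rho: "0 < \<rho>" "\<rho> <= 1" "1 / \<rho> <= 4 * x" using L x by (auto simp: \<rho>_def)
  define h where "h = 2 ^ 70 / \<rho> ^ 6"
  have h: "h = ?h L" by (simp add: h_def \<rho>_def power_divide power_mult_distrib)
  have h1: "1 <= h" unfolding h_def using rho power_le_one[of \<rho> 6] by (simp add: divide_simps)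
  have hx: "h <= 2 ^ 82 * x ^ 6"
  proof -
   have "(4 * L) ^ 6 <= (4 * x) ^ 6" using x L by (intro power_mono) auto
   then show ?thesis by (simp add: h power_mult_distrib)
  qed
  define D where "D = nat \<lceil>x\<rceil>"
  have D: "x <= real D" "real D <= 2 * x" using x unfolding D_def by linarith+
  have D1: "1 <= real D" using D x by linarith
  \<comment> \<open>An inner product sums \<open>D\<close> terms whose factors are of size up to
    \<open>sqrt h\<close>; dividing by \<open>(real D)\<^sup>2 * h\<close> brings its grid error
    down to \<open>\<rho> / real D / 32\<close>, which serves both the form and the
    correlations.\<close>
  define \<gamma> where "\<gamma> = \<rho> / (2 ^ 10 * (real D)\<^sup>2 * h)"
  have g0: "0 < \<gamma>" using rho D1 h1 by (simp add: \<gamma>_def)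
  have sh: "1 <= sqrt h" "sqrt h * sqrt h = h" "sqrt h <= h" using h1 by (auto simp: sqrt_le_D real_le_lsqrt power2_eq_square)
  have DD: "real D <= (real D)\<^sup>2" "1 <= (real D)\<^sup>2"
   using mult_left_mono[OF D1, of "real D"] D1 one_le_power[OF D1, of 2] by (simp_all add: power2_eq_square)
  have gD: "\<gamma> * real D * h * 2 ^ 10 <= \<rho> / real D" using D1 h1 by (simp add: \<gamma>_def power2_eq_square)
  have gle: "\<gamma> <= \<rho> / 2 ^ 10"
  proof -
   have "1 <= (real D)\<^sup>2 * h" using mult_mono[OF DD(2) h1] by simp
   then show ?thesis unfolding \<gamma>_def using rho D1 h1 by (intro divide_left_mono) auto
  qed
  have key: "2 * \<gamma> * real D * (2 * sqrt h + 2 * \<gamma>) <= \<rho> / real D / 32"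
  proof -
   have "\<gamma> <= 1" by (rule order_trans[OF gle]) (use rho in simp)
   then have "2 * sqrt h + 2 * \<gamma> <= 4 * h" using sh(3) h1 by linarith
   then have "2 * \<gamma> * real D * (2 * sqrt h + 2 * \<gamma>) <= 2 * \<gamma> * real D * (4 * h)" using g0 D1 by (intro mult_left_mono) auto
   also have "... = 8 * (\<gamma> * real D * h)" by simp
   also have "... <= \<rho> / real D / 32"
   proof -
    have "0 <= \<rho> / real D" using rho by simp
    moreover have "\<gamma> * real D * h * 1024 <= \<rho> / real D" using gD by simp
    moreover have "8 * y <= w / 32" if "0 <= w" "y * 1024 <= w" for y w :: real using that by linarith
    ultimately show ?thesis by blast
   qed
   finally show ?thesis .
  qed
  have k1: "\<rho> / real D / 32 <= \<rho> / 32" using rho D1 by (simp add: divide_simps)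
  have k2: "\<rho> / real D / 32 <= 1 / sqrt (real D)"
  proof -
   have "sqrt (real D) <= real D" using D1 by (simp add: real_le_lsqrt power2_eq_square)
   then have "1 / real D <= 1 / sqrt (real D)" using D1 by (intro divide_left_mono) auto
   moreover have "\<rho> / real D / 32 <= 1 / real D" using rho D1 by (simp add: divide_simps)
   ultimately show ?thesis by linarith
  qed
  have k3: "8 * \<gamma>\<^sup>2 * real D <= h / 2"
  proof -
   have "\<gamma> * real D <= 1 / 2 ^ 10"
   proof -
    have "\<gamma> * real D * 1 * 2 ^ 10 <= \<gamma> * real D * h * 2 ^ 10" using h1 g0 D1 by (intro mult_right_mono mult_left_mono) auto
    moreover have "\<rho> / real D <= 1" using rho D1 by (simp add: divide_simps)
    ultimately show ?thesis using gD by simp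
   qed
   then have "\<gamma> * (\<gamma> * real D) <= 1 * (1 / 2 ^ 10)" using gle rho g0 D1 by (intro mult_mono) auto
   then show ?thesis using h1 by (simp add: power2_eq_square)
  qed
  define G where "G = nat \<lfloor>sqrt h / \<gamma>\<rfloor> + 1"
  have G1: "sqrt h < real G * \<gamma>"
  proof -
   have "sqrt h / \<gamma> < real G" using g0 sh unfolding G_def by (simp add: of_nat_nat floor_le_iff) linarith
   then show ?thesis using g0 by (simp add: divide_less_eq)
  qed
  have G2: "real G <= 2 ^ 180 * x ^ 15"
  proof -
   have "0 <= sqrt h / \<gamma>" using sh g0 by simp
   then have "real G <= sqrt h / \<gamma> + 1" unfolding G_def by (simp add: of_nat_nat)
   moreover have "sqrt h / \<gamma> <= h / \<gamma>" using sh g0 by (intro divide_right_mono) auto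
   moreover have "h / \<gamma> = 2 ^ 10 * (real D)\<^sup>2 * (h * h) * (1 / \<rho>)" using rho by (simp add: \<gamma>_def)
   moreover have "... <= 2 ^ 10 * (2 * x)\<^sup>2 * (2 ^ 82 * x ^ 6 * (2 ^ 82 * x ^ 6)) * (4 * x)"
    using D D1 hx h1 rho x by (intro mult_mono power_mono) auto
   moreover have "... = 2 ^ 178 * x ^ 15" by (simp add: power_mult_distrib flip: power_add) (simp add: eval_nat_numeral)
   moreover have "1 <= x ^ 15" by (rule one_le_power[OF x(1)])
   ultimately show ?thesis by simp
  qed
  define ms where "ms = D * (2 * G + 1)"
  have msx: "real ms <= 2 ^ 183 * x ^ 16"
  proof -
   have "1 <= x ^ 15" using x by (intro one_le_power)
   then have "2 * real G + 1 <= 2 ^ 182 * x ^ 15" using G2 by simp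
   then have "real D * (2 * real G + 1) <= (2 * x) * (2 ^ 182 * x ^ 15)" using D x by (intro mult_mono) auto
   also have "... = 2 ^ 183 * x ^ 16" by (simp add: power_Suc[symmetric] eval_nat_numeral)
   finally show ?thesis by (simp add: ms_def algebra_simps)
  qed
  define q where "q = nat \<lceil>40000 * x\<^sup>2\<rceil> + 1"
  have qx: "40000 * x\<^sup>2 < real q" unfolding q_def using x by (simp add: of_nat_nat) linarith
  have "2 / real q < (exp (- L))\<^sup>2 / 20000"
   using qx x by (simp add: exp_minus x_def[symmetric] power_inverse divide_simps mult.commute)
  moreover have "L / 5 * h * exp (L / 10) <= sqrt (real D)"
  proof -
   have "L / 5 * h * exp (L / 10) <= exp (L / 2)" using P unfolding h by blast
   also have "exp (L / 2) = sqrt x" by (rule real_sqrt_unique[symmetric]) (auto simp: x_def power2_eq_square simp flip: exp_add)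
   also have "... <= sqrt (real D)" using D by simp
   finally show ?thesis .
  qed
  \<comment> \<open>This identity explains the value \<open>2 ^ 70 / \<rho> ^ 6\<close> of
    \<open>h\<close>: level sets found through long vectors become small enough compared with their
    guaranteed density \<open>\<rho>\<^sup>2 / 2 ^ 22\<close>.\<close>
  moreover have "2 ^ 44 / (h * \<rho> ^ 4) = \<rho>\<^sup>2 / 2 ^ 26"
   using rho unfolding h_def by (simp add: field_simps flip: power_add)
  moreover have "0 < D" "0 < q" "2 <= ms" using D1 unfolding ms_def q_def G_def by (auto simp: Suc_le_eq)
  ultimately have "substochastic.good_params L \<rho> h \<gamma> D G ms q"
   unfolding T.good_params_def using P L rho g0 key k1 k2 k3 G1 h h_def \<rho>_def by (auto simp: ms_def)
  moreover define \<kappa> where "\<kappa> = nat \<lceil>64 * L\<rceil>"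
  have kx: "64 * L <= real \<kappa>" "real \<kappa> <= 65 * x" using L x unfolding \<kappa>_def by linarith+
  moreover have "16 <= real \<kappa> * \<rho>" using kx(1) L by (simp add: \<rho>_def field_simps)
  moreover have "real (ms * bsize D (2 * \<kappa> + 4)) <= 2 ^ 200 * x ^ 18"
  proof -
   have xx: "x <= x\<^sup>2" "1 <= x\<^sup>2"
    using mult_left_mono[OF x(1), of x] x one_le_power[OF x(1), of 2] by (simp_all add: power2_eq_square)
   have "2 * real \<kappa> + 4 <= 134 * x" using kx(2) x by linarith
   then have "(2 * real \<kappa> + 4) * real D <= (134 * x) * (2 * x)" using D x by (intro mult_mono) auto
   then have "real (bsize D (2 * \<kappa> + 4)) <= 2 ^ 10 * x\<^sup>2" using D xx by (simp add: bsize_def power2_eq_square)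
   then have "real ms * real (bsize D (2 * \<kappa> + 4)) <= (2 ^ 183 * x ^ 16) * (2 ^ 10 * x\<^sup>2)"
    using msx x by (intro mult_mono) auto
   also have "... = 2 ^ 193 * x ^ 18" by (simp flip: power_add)
   also have "... <= 2 ^ 200 * x ^ 18" using x by (intro mult_right_mono) auto
   finally show ?thesis by simp
  qed
  ultimately show ?thesis unfolding x_def by blast
 qed
 then show ?thesis using L0 by (intro exI[of _ "max L0 2"]) auto
qed

subsection \<open>Running time and transfer to the given hypergraph\<close>

lemma valid_input: "valid n r es ==> r < n ==> 2 <= r ==> input n r es"
 by unfold_locales (auto simp: valid_def)

lemma inp_input_mem:
 assumes "valid n r es" "input n r es"
 shows "input.inp n r es (upd (input_mem n es) 5 0 (n + length es))"
proof -
 have nth: "concat es ! (r * j + l) = es ! j ! l & r * j + l < length (concat es)"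
  if "j < length es" "l < r" "\<forall>e\<in>set es. length e = r" for es :: "nat list list" and j l
  using that
 proof (induction es arbitrary: j)
  case (Cons e es)
  show ?case
  proof (cases j)
   case (Suc i)
   have "r * j + l = length e + (r * i + l)" using Cons.prems Suc by simp
   then show ?thesis using Cons.IH[of i] Cons.prems Suc by (simp add: nth_append)
  qed (use Cons.prems in \<open>simp add: nth_append\<close>)
 qed simp
 show ?thesis
  unfolding input.inp_def[OF assms(2)] using nth[of _ es] assms(1) by (auto simp: input_mem_def valid_def)
qed

lemma result_mono: "result \<mu> n es s M c ==> c' <= c ==> result \<mu> n es s M c'"
 unfolding result_def Let_def by (meson mult_right_mono of_nat_0_le_iff order_trans)

text \<open>Below a threshold \<open>N\<close> the program consults the table. Above it,
  \<open>n\<close> exceeds the constant factors of the running time, and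
  \<open>n + length es + 1\<close> is at most \<open>n ^ (r + 1)\<close>. Since
  \<open>0 < M < n\<close> forces \<open>n \<ge> 2\<close>, the cost of the table lookup is a power
  of \<open>n\<close> as well.\<close>

lemma program_exists:
 assumes r: "2 <= r" and c: "c <= 1"
  and large: "\<And>n es M. [|N0 <= n; valid n r es; input n r es; real M = \<mu> * real n; 0 < M; M < n|] ==>
   tame cm K & result \<mu> n es (den cm (upd (input_mem n es) 5 0 (n + length es))) M c"
 shows "\<exists>P. \<forall>n es M. valid n r es & real M = \<mu> * real n & 0 < M & M < n -->
  (\<exists>t s'. t <= n ^ ((r + 1) * K + 2 * r + 8) & exec P (input_mem n es) t s' & result \<mu> n es s' M c)"
proof -
 define N where "N = N0 + r + weight cm + 4"
 define P where "P = Cond (Sub (Lit N) (cell 0)) (lookup N r \<mu>) (Seq (Store 5 (Lit 0) (Add (cell 0) (cell 1))) (compile cm))"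
 have "\<exists>t s'. t <= n ^ ((r + 1) * K + 2 * r + 8) & exec P (input_mem n es) t s' & result \<mu> n es s' M c"
  if v: "valid n r es" and M: "real M = \<mu> * real n" "0 < M" "M < n" for n es M
 proof -
  let ?s = "input_mem n es" and ?m = "length es"
  have n2: "2 <= n" using M by simp
  have s0: "?s 0 0 = n" "?s 1 0 = ?m" by (auto simp: input_mem_def)
  show ?thesis
  proof (cases "n < N")
   case True
   obtain t s' where t: "t <= 3 * n + n ^ r + r * n ^ r * n + 2" "exec (lookup N r \<mu>) ?s t s'" "result \<mu> n es s' M 1"
    using exec_lookup[OF v _ _ M(1) True] M r by auto
   have "exec P ?s (1 + t) s'" unfolding P_def by (rule exec_CondT) (use True s0 t in auto)
   moreover have "1 + t <= n ^ ((r + 1) * K + 2 * r + 8)"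
   proof -
    define X where "X = n ^ (r + 1)"
    have X: "n <= X" "n ^ r <= X" "1 <= X" unfolding X_def using n2 self_le_power[of n "r + 1"] by (auto intro: power_increasing)
    have "r * n ^ r * n = r * X" "(r + 7) * X = r * X + 7 * X" by (simp_all add: X_def algebra_simps)
    then have "1 + t <= (r + 7) * X" using t(1) X by linarith
    also have "... <= n ^ (r + 7) * X"
    proof (rule mult_le_mono1)
     have "r + 7 <= 2 ^ (r + 7)" by (rule less_imp_le, rule less_exp)
     also have "... <= n ^ (r + 7)" using n2 by (rule power_mono) simp
     finally show "r + 7 <= n ^ (r + 7)" .
    qed
    also have "... = n ^ (2 * r + 8)"
    proof -
     have e: "2 * r + 8 = (r + 7) + (r + 1)" by simp
     show ?thesis unfolding e X_def by (rule power_add[symmetric])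
    qed
    also have "... <= n ^ ((r + 1) * K + 2 * r + 8)" using n2 by (intro power_increasing) auto
    finally show ?thesis .
   qed
   ultimately show ?thesis using result_mono[OF t(3) c] by blast
  next
   case False
   then have n: "N0 <= n" "r < n" "weight cm + 3 <= n" by (auto simp: N_def)
   have inp: "input n r es" by (rule valid_input[OF v n(2) r])
   note L = large[OF n(1) v inp M]
   obtain t where t: "t <= weight cm * (n + ?m + 1) ^ K + 2"
     "exec (Seq (Store 5 (Lit 0) (Add (cell 0) (cell 1))) (compile cm)) ?s t (den cm (upd ?s 5 0 (n + ?m)))"
    using input.exec_tame[OF inp, of cm K ?s] s0 L by blast
   have "exec P ?s (1 + t) (den cm (upd ?s 5 0 (n + ?m)))" unfolding P_def by (rule exec_CondF) (use False s0 t in auto)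
   moreover have "1 + t <= n ^ ((r + 1) * K + 2 * r + 8)"
   proof -
    define X where "X = n ^ ((r + 1) * K)"
    have "n + 1 <= n * n" using n2 mult_le_mono1[OF n2, of n] by linarith
    also have "... = n ^ 2" by (simp add: power2_eq_square)
    also have "... <= n ^ r" using n2 r by (intro power_increasing) auto
    finally have "n + ?m + 1 <= 2 * n ^ r" using valid_length_le[OF v] by linarith
    also have "... <= n ^ (r + 1)" using n2 by simp
    finally have "(n + ?m + 1) ^ K <= X" unfolding X_def power_mult by (intro power_mono) auto
    then have "weight cm * (n + ?m + 1) ^ K <= weight cm * X" by (rule mult_le_mono2)
    moreover have "1 <= X" using n2 by (simp add: X_def)
    moreover have "(weight cm + 3) * X = weight cm * X + 3 * X" by (rule add_mult_distrib)
    ultimately have "1 + t <= (weight cm + 3) * X" using t(1) by linarith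
    also have "... <= n * X" using n(3) by (rule mult_le_mono1)
    also have "... = n ^ ((r + 1) * K + 1)" by (simp add: X_def)
    also have "... <= n ^ ((r + 1) * K + 2 * r + 8)" using n2 by (intro power_increasing) auto
    finally show ?thesis .
   qed
   ultimately show ?thesis using L by blast
  qed
 qed
 then show ?thesis by blast
qed

text \<open>\<open>(!) vs\<close> is a bijection between indices and vertices that preserves counts.
  Dividing by \<open>card E\<close> turns counts into fractions, and the convention for division by
  zero covers the case without hyperedges.\<close>

lemma transfer:
 assumes u: "uniform_hypergraph r V E" and p: "presents vs es V E" and n: "n = card V"
 shows "valid n r es"
  and "[|result \<mu> n es s M c; real M = \<mu> * real n; M <= n|] ==> card (output_set vs s) = M &
   c * max_edge_fraction (\<mu> * real n) V E <= edge_fraction E (output_set vs s)"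
proof -
 let ?f = "%X. (!) vs ` X"
 have vs: "distinct vs" "set vs = V" "length vs = n" using p n by (auto simp: presents_def distinct_card)
 have inj: "inj_on ((!) vs) {..<n}" using vs by (simp add: inj_on_nth)
 have im: "?f {..<n} = V" using vs by (auto simp: set_conv_nth image_def)
 have es: "\<forall>e\<in>set es. distinct e & set e \<subseteq> {..<n}" "distinct (map set es)" and E: "E = (%e. ?f (set e)) ` set es"
  using p vs(3) by (auto simp: presents_def)
 have "length e = r" if "e \<in> set es" for e
 proof -
  have "card (?f (set e)) = r" using u E that by (auto simp: uniform_hypergraph_def)
  moreover have "card (?f (set e)) = card (set e)" using es that by (intro card_image inj_on_subset[OF inj]) auto
  ultimately show ?thesis using es that by (simp add: distinct_card)
 qed
 then show "valid n r es" using es by (auto simp: valid_def)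
 have sub: "set (es ! i) \<subseteq> {..<n}" if "i < length es" for i using es that by auto
 have cnt: "card (induced_edges E (?f X)) = ecnt es X" if X: "X \<subseteq> {..<n}" for X
 proof -
  let ?A = "{i. i < length es & set (es ! i) \<subseteq> X}"
  have "induced_edges E (?f X) = (%i. ?f (set (es ! i))) ` ?A"
  proof -
   have "?f (set (es ! i)) \<subseteq> ?f X \<longleftrightarrow> set (es ! i) \<subseteq> X" if "i < length es" for i
    using inj_on_image_subset_iff[OF inj sub[OF that] X] .
   moreover have "E = (%i. ?f (set (es ! i))) ` {..<length es}" unfolding E by (auto simp: set_conv_nth image_def)
   ultimately show ?thesis unfolding induced_edges_def by auto
  qed
  moreover have "inj_on (%i. ?f (set (es ! i))) ?A"
  proof (rule inj_onI)
   fix i j assume ij: "i \<in> ?A" "j \<in> ?A" "?f (set (es ! i)) = ?f (set (es ! j))"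
   then have "map set es ! i = map set es ! j" using inj_on_image_eq_iff[OF inj sub sub, of i j] by auto
   then show "i = j" using es(2) ij by (metis (no_types, lifting) length_map mem_Collect_eq nth_eq_iff_index_eq)
  qed
  ultimately show ?thesis by (simp add: ecnt_def card_image)
 qed
 assume R: "result \<mu> n es s M c" and M: "real M = \<mu> * real n" "M <= n"
 define X where "X = {i. i < n & s 3 i ~= 0}"
 have X: "X \<subseteq> {..<n}" "card X = M" and best: "\<And>S. S \<subseteq> {..<n} ==> card S = M ==> c * real (ecnt es S) <= real (ecnt es X)"
  using R by (auto simp: result_def Let_def X_def)
 have out: "output_set vs s = ?f X" using vs by (auto simp: output_set_def X_def)
 let ?\<S> = "{S. S \<subseteq> V & real (card S) = \<mu> * real n}"
 have "finite ?\<S>" using u by (simp add: uniform_hypergraph_def)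
 moreover have "?f X \<in> ?\<S>" using X M im card_image[OF inj_on_subset[OF inj X(1)]] by auto
 ultimately have "max_edge_fraction (\<mu> * real n) V E \<in> edge_fraction E ` ?\<S>"
  unfolding max_edge_fraction_def by (intro Max_in finite_imageI) blast+
 then obtain S where S: "S \<subseteq> V" "real (card S) = \<mu> * real n" "max_edge_fraction (\<mu> * real n) V E = edge_fraction E S" by blast
 obtain S' where S': "S' \<subseteq> {..<n}" "S = ?f S'" using S(1) im by (metis subset_image_iff)
 have "card S' = M" using S(2) M(1) card_image[OF inj_on_subset[OF inj S'(1)]] S'(2) by simp
 then have "c * real (ecnt es S') / real (card E) <= real (ecnt es X) / real (card E)"
  using best[OF S'(1)] by (intro divide_right_mono) auto
 then have "c * max_edge_fraction (\<mu> * real n) V E <= edge_fraction E (output_set vs s)"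
  unfolding S(3) S'(2) out edge_fraction_def cnt[OF S'(1)] cnt[OF X(1)] by simp
 moreover have "card (output_set vs s) = M" unfolding out using card_image[OF inj_on_subset[OF inj X(1)]] X by simp
 ultimately show "card (output_set vs s) = M & c * max_edge_fraction (\<mu> * real n) V E <= edge_fraction E (output_set vs s)" by blast
qed

lemma ecnt_le_length: "ecnt es S <= length es"
 unfolding ecnt_def using card_mono[of "{..<length es}" "{i. i < length es & set (es ! i) \<subseteq> S}"] by auto

text \<open>The constant is the smaller one of two regimes: \<open>1 / 10 ^ 9\<close> for
  \<open>L \<ge> L0\<close>, and for smaller \<open>L\<close> a value that makes
  \<open>C * L\<close> at most \<open>\<mu> / 2\<close>, as the guarantee of
  \<open>simple_correct\<close> requires.\<close>

lemma algorithm_exists: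
 "\<exists>C>0. \<forall>r\<ge>2. \<forall>\<mu>. 0 < \<mu> & \<mu> < 1 --> (\<exists>P K. real K <= 2 ^ 200 * (1 / \<mu>) ^ 18 + 6 &
  (\<forall>n es M. valid n r es & real M = \<mu> * real n & 0 < M & M < n -->
   (\<exists>t s'. t <= n ^ ((r + 1) * K + 2 * r + 8) & exec P (input_mem n es) t s' &
    result \<mu> n es s' M (C * \<mu> ^ (r - 1) * ln (1 / \<mu>)))))"
proof -
 let ?Q = "%r \<mu> c. \<exists>P K. real K <= 2 ^ 200 * (1 / \<mu>) ^ 18 + 6 &
  (\<forall>n es M. valid n r es & real M = \<mu> * real n & 0 < M & M < n -->
   (\<exists>t s'. t <= n ^ ((r + 1) * K + 2 * r + 8) & exec P (input_mem n es) t s' & result \<mu> n es s' M c))"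
 obtain L0 where L0: "2 <= L0" and par: "\<And>L. L0 <= L ==> 6 * exp (- L) <= 1 &
   (\<exists>\<rho> h \<gamma> D G ms q \<kappa>. substochastic.good_params L \<rho> h \<gamma> D G ms q &
    16 <= real \<kappa> * \<rho> & real (ms * input.bsize D (2 * \<kappa> + 4)) <= 2 ^ 200 * exp L ^ 18)"
  using params_exist by blast
 define C where "C = min (1 / 10 ^ 9) (exp (- L0) / (2 * L0))"
 have C: "0 < C" "C <= 1 / 10 ^ 9" "2 * L0 * C <= exp (- L0)"
 proof -
  have "C <= exp (- L0) / (2 * L0)" by (simp add: C_def)
  then show "2 * L0 * C <= exp (- L0)" using L0 by (simp add: pos_le_divide_eq mult.commute)
 qed (use L0 in \<open>auto simp: C_def\<close>)
 have "?Q r \<mu> (C * \<mu> ^ (r - 1) * ln (1 / \<mu>))" if r: "2 <= r" and mu: "0 < \<mu>" "\<mu> < 1" for r \<mu>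
 \<comment> \<open>If \<open>\<mu>\<close> is not a ratio of naturals, \<open>\<mu> * n\<close> is
   never a natural number for positive \<open>n\<close> and any program will do. Otherwise numerator
   and denominator can be written into the program.\<close>
 proof (cases "\<exists>k l. 0 < l & real k = \<mu> * real l")
  case False
  then have "\<not> (real M = \<mu> * real n & 0 < M & M < n)" for M n by (metis gr_implies_not0 neq0_conv)
  then show ?thesis using mu by (intro exI[of _ Skip] exI[of _ 0]) auto
 next
  case True
  then obtain k l where kl: "0 < l" "real k = \<mu> * real l" by blast
  have km: "k * n = M * l" if "real M = \<mu> * real n" for M n
  proof -
   have "real (k * n) = real (M * l)" using kl(2) that by simp
   then show ?thesis by (simp only: of_nat_eq_iff)
  qed
  define L where "L = ln (1 / \<mu>)"
  have L: "0 < L" "exp (- L) = \<mu>" "exp L = 1 / \<mu>" using mu by (auto simp: L_def ln_div exp_minus inverse_eq_divide)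
  define c where "c = C * \<mu> ^ (r - 1) * L"
  have c1: "c <= 1"
  proof -
   have "\<mu> ^ (r - 1) * L <= 1"
   proof -
    have "\<mu> ^ (r - 1) <= \<mu> ^ 1" using mu r by (intro power_decreasing) auto
    then have "\<mu> ^ (r - 1) * L <= \<mu> * L" using L by (intro mult_right_mono) auto
    also have "\<mu> * L <= \<mu> * (1 / \<mu>)" using exp_ge_add_one_self[of L] L mu by (intro mult_left_mono) auto
    finally show ?thesis using mu by simp
   qed
   moreover have "C <= 1" using C(2) by simp
   moreover have "0 <= \<mu> ^ (r - 1) * L" using mu L by simp
   ultimately have "C * (\<mu> ^ (r - 1) * L) <= 1 * 1" using C(1) by (intro mult_mono) auto
   then show ?thesis by (simp add: c_def mult.assoc)
  qed
  have K: "?Q r \<mu> c"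
   if "\<And>n es M. [|N0 <= n; valid n r es; input n r es; real M = \<mu> * real n; 0 < M; M < n|] ==>
    tame cm K & result \<mu> n es (den cm (upd (input_mem n es) 5 0 (n + length es))) M c"
    "real K <= 2 ^ 200 * (1 / \<mu>) ^ 18 + 6" for N0 cm K
   using program_exists[OF r c1 that(1)] that(2) by blast
  have big: "x <= real M" if "real M = \<mu> * real n" "nat \<lceil>x / \<mu>\<rceil> <= n" for x M n
  proof -
   have "x / \<mu> <= real n" using that(2) by linarith
   then show ?thesis using that(1) mu by (simp add: divide_le_eq mult.commute)
  qed
  have cell9: "upd (input_mem n es) 5 0 y 9 0 = 0" "upd (input_mem n es) 5 0 y (100 + x) 0 = 0" for n es y x
   by (auto simp: input_mem_def)
  have res: "result \<mu> n es s M c" if "input n r es" "card (input.setof n s 3) = M"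
    "\<And>S. S \<subseteq> {..<n} ==> card S = M ==> c * real (input.cnt es S) <= real (input.cnt es (input.setof n s 3))" for n es s M
   using that unfolding result_def Let_def input.setof_def[OF that(1)] input.cnt_def[OF that(1)] ecnt_def by auto
  show ?thesis
  proof (cases "L0 <= L")
   case True
   obtain \<rho> h \<gamma> D G ms q \<kappa> where P: "substochastic.good_params L \<rho> h \<gamma> D G ms q" "16 <= real \<kappa> * \<rho>"
     "real (ms * input.bsize D (2 * \<kappa> + 4)) <= 2 ^ 200 * exp L ^ 18" and mu6: "6 * \<mu> <= 1"
    using par[OF True] L by auto
   interpret T: substochastic "{}" "%_ _. 0" by unfold_locales auto
   have "0 < \<rho>" "\<rho> <= 1" "0 < \<gamma>" using P(1) by (auto simp: T.good_params_def)
   then obtain N1 where N1: "\<And>n. N1 <= n ==> input.large_enough \<rho> \<gamma> D (2 * \<kappa> + 4) (real n)"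
    using large_enough_eventually[OF _ _ _ P(2)] by blast
   define cm where "cm = input.prog_cmd r k l q D (2 * \<kappa> + 4) ms"
   define N0 where "N0 = N1 + nat \<lceil>(16 * real r * real r + L * real (r * r)) / \<mu>\<rceil>"
   have "tame cm (ms * input.bsize D (2 * \<kappa> + 4) + 6) & result \<mu> n es (den cm (upd (input_mem n es) 5 0 (n + length es))) M c"
    if n: "N0 <= n" and v: "valid n r es" and i: "input n r es" and M: "real M = \<mu> * real n" "0 < M" "M < n" for n es M
   proof
    interpret input n r es by (rule i)
    show "tame cm (ms * bsize D (2 * \<kappa> + 4) + 6)" unfolding cm_def by (rule tame_prog)
    have "16 * real r * real r + L * real (r * r) <= real M" by (rule big[OF M(1)]) (use n in \<open>unfold N0_def, linarith\<close>)
    moreover have "0 <= L * real (r * r)" "0 <= 16 * real r * real r" using L by auto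
    ultimately have "real (16 * r * r) <= real M" and b2: "L * real (r * r) <= real M"
     unfolding of_nat_mult of_nat_numeral by linarith+
    then have b1: "16 * r * r <= M" by (simp only: of_nat_le_iff)
    have b3: "L * real M <= real n"
    proof -
     have "L * \<mu> <= 1 / \<mu> * \<mu>" using exp_ge_add_one_self[of L] L mu by (intro mult_right_mono) auto
     then have "L * \<mu> * real n <= 1 * real n" using mu by (intro mult_right_mono) auto
     then show ?thesis using M(1) by (simp add: mult.assoc)
    qed
    have "real (6 * M) <= real n" using mult_right_mono[OF mu6, of "real n"] M(1) by simp
    then have b4: "6 * M <= n" by (simp only: of_nat_le_iff)
    have M': "real M = exp (- L) * real n" using M(1) L by simp
    have le: "large_enough \<rho> \<gamma> D (2 * \<kappa> + 4) (real n)" using N1 n by (simp add: N0_def)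
    note R = prog_correct[OF inp_input_mem[OF v i] cell9(2,1) km[OF M(1)] kl(1) M' P(1) le b1 b2 b3 b4, folded cm_def]
    show "result \<mu> n es (den cm (upd (input_mem n es) 5 0 (n + m))) M c"
    proof (rule res[OF i R(1)])
     fix S assume S: "S \<subseteq> {..<n}" "card S = M"
     have "c * real (cnt S) <= 1 / 10 ^ 9 * exp (- L) ^ (r - 1) * L * real (cnt S)"
      unfolding c_def using C L mu by (intro mult_right_mono) auto
     also note R(2)[OF S]
     finally show "c * real (cnt S) <= real (cnt (setof (den cm (upd (input_mem n es) 5 0 (n + m))) 3))" .
    qed
   qed
   moreover have "real (ms * input.bsize D (2 * \<kappa> + 4) + 6) <= 2 ^ 200 * (1 / \<mu>) ^ 18 + 6" using P(3) L by simp
   ultimately show ?thesis using K[of N0 cm] unfolding c_def L_def by blast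
  next
   case False
   define cm where "cm = input.simple_cmd r k l"
   define N0 where "N0 = nat \<lceil>4 * real r * real r / \<mu>\<rceil>"
   have "tame cm 4 & result \<mu> n es (den cm (upd (input_mem n es) 5 0 (n + length es))) M c"
    if n: "N0 <= n" and v: "valid n r es" and i: "input n r es" and M: "real M = \<mu> * real n" "0 < M" "M < n" for n es M
   proof
    interpret input n r es by (rule i)
    show "tame cm 4" unfolding cm_def by (rule tame_simple)
    have "real (4 * r * r) <= real M" using big[OF M(1), of "4 * real r * real r"] n by (simp add: N0_def)
    then have b1: "4 * r * r <= M" by (simp only: of_nat_le_iff)
    note R = simple_correct[OF inp_input_mem[OF v i] cell9(1) km[OF M(1)] kl(1) b1 less_imp_le[OF M(3)], folded cm_def]
    have "real M / real n = \<mu>" using M by simp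
    note R = R[unfolded this]
    have "c <= \<mu> ^ r / 2"
    proof -
     have "exp (- L0) <= \<mu>" using False L by (metis exp_le_cancel_iff neg_le_iff_le nle_le)
     moreover have "C * L <= C * L0" using False C by (intro mult_left_mono) auto
     moreover have "2 * (C * L0) <= exp (- L0)" using C(3) by (simp add: mult_ac)
     ultimately have "C * L <= \<mu> / 2" by linarith
     then have "\<mu> ^ (r - 1) * (C * L) <= \<mu> ^ (r - 1) * (\<mu> / 2)" using mu by (intro mult_left_mono) auto
     moreover have "\<mu> ^ (r - 1) * \<mu> = \<mu> ^ r" using r by (metis One_nat_def Suc_pred less_le_trans pos2 power_Suc2)
     ultimately show ?thesis by (simp add: c_def mult_ac)
    qed
    moreover have "cnt S <= m" for S using ecnt_le_length[of es S] by (simp add: cnt_def ecnt_def)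
    ultimately have "c * real (cnt S) <= \<mu> ^ r / 2 * real m" for S using mu by (intro mult_mono) auto
    then show "result \<mu> n es (den cm (upd (input_mem n es) 5 0 (n + m))) M c"
     using R(2) by (intro res[OF i R(1)]) (meson order_trans)
   qed
   moreover have "real 4 <= 2 ^ 200 * (1 / \<mu>) ^ 18 + 6" using mu by (simp add: add_increasing)
   ultimately show ?thesis using K[of N0 cm 4] unfolding c_def L_def by blast
  qed
 qed
 then show ?thesis using C(1) by blast
qed

theorem theorem1p4:
 "\<exists>C::real. C > 0 \<and>
  (\<forall>r::nat. r \<ge> 2 \<longrightarrow>
   (\<exists>p::real poly. \<forall>\<mu>::real. 0 < \<mu> \<and> \<mu> < 1 \<longrightarrow>
    (\<exists>P::prog. \<forall>(V::nat set) (E::nat set set) (vs::nat list) (es::nat list list).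
     uniform_hypergraph r V E \<and> V \<noteq> {} \<and> \<mu> * real (card V) \<in> \<nat> \<and>
     presents vs es V E \<longrightarrow>
     (\<exists>t::nat.
      real t \<le> real (card V) powr poly p (1 / \<mu>) \<and>
      halts_within t P (input_mem (card V) es) \<and>
      measure_pmf.prob (run t P (input_mem (card V) es))
       {(P', s). real (card (output_set vs s)) = \<mu> * real (card V) \<and>
         edge_fraction E (output_set vs s)
          \<ge> C * \<mu> ^ (r - 1) * ln (1 / \<mu>)
            * max_edge_fraction (\<mu> * real (card V)) V E} \<ge> 2 / 3))))"
proof -
 obtain C P K where C: "0 < C"
  and K: "\<And>r \<mu>. 2 <= r ==> 0 < \<mu> ==> \<mu> < 1 ==> real (K r \<mu>) <= 2 ^ 200 * (1 / \<mu>) ^ 18 + 6"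
  and P: "\<And>r \<mu> n es M. [|2 <= r; 0 < \<mu>; \<mu> < 1; valid n r es; real M = \<mu> * real n; 0 < M; M < n|] ==>
   \<exists>t s'. t <= n ^ ((r + 1) * K r \<mu> + 2 * r + 8) & exec (P r \<mu>) (input_mem n es) t s' &
    result \<mu> n es s' M (C * \<mu> ^ (r - 1) * ln (1 / \<mu>))"
  using algorithm_exists by metis
 \<comment> \<open>The exponent \<open>(r + 1) * K + 2 * r + 8\<close> with the bound on
   \<open>K\<close> inserted: a polynomial of degree 18 in \<open>1 / \<mu>\<close> with
   coefficients depending on \<open>r\<close>.\<close>
 define p where "p r = monom ((real r + 1) * 2 ^ 200) 18 + [:(real r + 1) * 6 + 2 * real r + 8:]" for r :: nat
 show ?thesis
 proof (intro exI[of _ C] conjI allI impI C, rule_tac x = "p r" in exI, intro allI impI, rule_tac x = "P r \<mu>" in exI,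
   intro allI impI, elim conjE)
  fix r :: nat and \<mu> :: real and V :: "nat set" and E :: "nat set set" and vs es
  assume r: "2 <= r" and mu: "0 < \<mu>" "\<mu> < 1"
   and H: "uniform_hypergraph r V E" "V ~= {}" "\<mu> * real (card V) \<in> \<nat>" "presents vs es V E"
  define n where "n = card V"
  have n0: "0 < n" using H(1,2) by (simp add: n_def uniform_hypergraph_def card_gt_0_iff)
  obtain M where M: "real M = \<mu> * real n" using H(3) by (auto simp: n_def Nats_def)
  have "0 < real M" "real M < real n" using M mu n0 by (auto simp: mult_less_cancel_right2)
  then have M0: "0 < M" "M < n" by simp_all
  note T = transfer[OF H(1,4) n_def]
  obtain t s' where t: "t <= n ^ ((r + 1) * K r \<mu> + 2 * r + 8)" "exec (P r \<mu>) (input_mem n es) t s'"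
    "result \<mu> n es s' M (C * \<mu> ^ (r - 1) * ln (1 / \<mu>))"
   using P[OF r mu T(1) M M0] by blast
  \<comment> \<open>Executions described by \<open>exec\<close> flip no coins, so the final
    configuration is a point mass and the success probability is 1.\<close>
  have run: "run t (P r \<mu>) (input_mem n es) = return_pmf (Skip, s')" by (rule exec_run[OF t(2)])
  have "real t <= real n powr poly (p r) (1 / \<mu>)"
  proof -
   have "real t <= real (n ^ ((r + 1) * K r \<mu> + 2 * r + 8))" using t(1) by (simp only: of_nat_le_iff)
   also have "... = real n powr real ((r + 1) * K r \<mu> + 2 * r + 8)" using n0 by (simp add: powr_realpow[symmetric])
   also have "... <= real n powr poly (p r) (1 / \<mu>)"
   proof (rule powr_mono)
    have "(real r + 1) * real (K r \<mu>) <= (real r + 1) * (2 ^ 200 * (1 / \<mu>) ^ 18 + 6)" using K[OF r mu] by (intro mult_left_mono) auto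
    then show "real ((r + 1) * K r \<mu> + 2 * r + 8) <= poly (p r) (1 / \<mu>)" by (simp add: p_def poly_monom algebra_simps)
   qed (use n0 in simp)
   finally show ?thesis .
  qed
  moreover have "halts_within t (P r \<mu>) (input_mem n es)" by (simp add: halts_within_def run)
  moreover have "real (card (output_set vs s')) = \<mu> * real n & edge_fraction E (output_set vs s')
    \<ge> C * \<mu> ^ (r - 1) * ln (1 / \<mu>) * max_edge_fraction (\<mu> * real n) V E"
   using T(2)[OF t(3) M less_imp_le[OF M0(2)]] M by simp
  then have "measure_pmf.prob (run t (P r \<mu>) (input_mem n es))
     {(P', s). real (card (output_set vs s)) = \<mu> * real n &
       edge_fraction E (output_set vs s) \<ge> C * \<mu> ^ (r - 1) * ln (1 / \<mu>) * max_edge_fraction (\<mu> * real n) V E} \<ge> 2 / 3"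
   unfolding run by simp
  ultimately show "\<exists>t::nat.
    real t <= real (card V) powr poly (p r) (1 / \<mu>) &
    halts_within t (P r \<mu>) (input_mem (card V) es) &
    measure_pmf.prob (run t (P r \<mu>) (input_mem (card V) es))
     {(P', s). real (card (output_set vs s)) = \<mu> * real (card V) &
       edge_fraction E (output_set vs s)
        \<ge> C * \<mu> ^ (r - 1) * ln (1 / \<mu>)
          * max_edge_fraction (\<mu> * real (card V)) V E} \<ge> 2 / 3"
   unfolding n_def by blast
 qed
qed

end
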